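(* Let $G$ be an abelian group and $\mathbb{F}$ a field. (1) If $\mathcal{B}$ is a $G$-graded-central-simple algebra over $\mathbb{F}$, then there exist a subgroup $H$ of $G$, an algebra $\mathcal{A}$ graded by $\overline{G}=G/H$ which is central simple as an ungraded algebra, and $\tau\in\mathrm{Z}^2_{\mathrm{sym}}(G,\mathbb{F}^\times)$ such that $\mathcal{B}\simeq_G L^\tau_\pi(\mathcal{A})$, where $\pi:G\to\overline{G}$ is the canonical projection. (2) Conversely, if $H\le G$, $\mathcal{A}$ is a central simple $\overline{G}=G/H$-graded algebra and $\tau\in\mathrm{Z}^2_{\mathrm{sym}}(G,\mathbb{F}^\times)$, then $L^\tau_\pi(\mathcal{A})$ is $G$-graded-central-simple and $C(L^\tau_\pi(\mathcal{A}))\simeq_G\mathbb{F}^{\tau'}H$, where $\tau'=\tau|_{H\times H}$. (3) For $i=1,2$ let $H_i\le G$, $\pi_i:G\to G/H_i$ the canonical projection, $\mathcal{A}_i$ a central simple $G/H_i$-graded algebra, and $\tau_i\in\mathrm{Z}^2_{\mathrm{sym}}(G,\mathbb{F}^\times)$. Then $L^{\tau_1}_{\pi_1}(\mathcal{A}_1)\simeq_G L^{\tau_2}_{\pi_2}(\mathcal{A}_2)$ if and only if $H_1=H_2=:H$ (so $\pi_1=\pi_2=:\pi:G\to\overline{G}=G/H$) and there exists $\mu\in\mathrm{Z}^2_{\mathrm{sym}}(\overline{G},\mathbb{F}^\times)$ such that $[\tau_1]=\pi^*([\mu])[\tau_2]$ in $\mathrm{H}^2_{\mathrm{sym}}(G,\mathbb{F}^\times)$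 and $\mathcal{A}_1^\mu\simeq_{\overline{G}}\mathcal{A}_2$.
   Context: Algebras are arbitrary (nonassociative, possibly infinite-dimensional) algebras over $\mathbb{F}$. A $G$-grading is a decomposition $\mathcal{A}=\bigoplus_g\mathcal{A}_g$ with $\mathcal{A}_g\mathcal{A}_h\subseteq\mathcal{A}_{gh}$; $\simeq_G$ denotes graded isomorphism. Centroid: $C(\mathcal{A})=\{c\in\mathrm{End}_{\mathbb{F}}(\mathcal{A})\mid c(xy)=c(x)y=xc(y)\}$, $C(\mathcal{A})_g=\{c\in C(\mathcal{A}): c\mathcal{A}_{g'}\subseteq\mathcal{A}_{gg'}\ \forall g'\}$. An algebra is central simple if it is simple and its centroid is $\mathbb{F}1$. A $G$-graded algebra is graded-simple if $\mathcal{A}^2=\mathcal{A}$ and there are no proper nonzero graded ideals, graded-central if $C(\mathcal{A})_e=\mathbb{F}1$, graded-central-simple if both; for such algebras $C(\mathcal{A})=\bigoplus_gC(\mathcal{A})_g$ is $G$-graded. Symmetric $2$-cocycles $\mathrm{Z}^2_{\mathrm{sym}}(A,\mathbb{F}^\times)$: maps $\tau:A\times A\to\mathbb{F}^\times$ with $\tau(a_1,a_2)\tau(a_1a_2,a_3)=\tau(a_1,a_2a_3)\tau(a_2,a_3)$ and $\tau(a_1,a_2)=\tau(a_2,a_1)$; coboundaries $\mathrm{d}\gamma(a_1,a_2)=\gamma(a_1)\gamma(a_2)\gamma(a_1a_2)^{-1}$; $\mathrm{H}^2_{\mathrm{sym}}=\mathrm{Z}^2_{\mathrm{sym}}/\mathrm{B}^2$.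 For $\pi:G\to\overline{G}$, $\pi^*:\mathrm{H}^2_{\mathrm{sym}}(\overline{G},\mathbb{F}^\times)\to\mathrm{H}^2_{\mathrm{sym}}(G,\mathbb{F}^\times)$, $[\mu]\mapsto[\mu\circ(\pi\times\pi)]$. The $\tau$-twist $\mathcal{A}^\tau$ of a graded algebra is the same graded space with multiplication $x*y=\tau(g_1,g_2)xy$ for $x\in\mathcal{A}_{g_1},y\in\mathcal{A}_{g_2}$. The twisted group algebra $\mathbb{F}^{\tau'}H$ is the $\tau'$-twist of the group algebra $\mathbb{F}H$ with its natural grading (viewed as $G$-graded with support $H$). For $H\le G$, $\pi:G\to\overline{G}=G/H$, $g\mapsto\bar g$, and a $\overline{G}$-graded algebra $\mathcal{A}$, the loop algebra is the $G$-graded subalgebra $L_\pi(\mathcal{A})=\bigoplus_{g\in G}\mathcal{A}_{\bar g}\otimes g$ of $\mathcal{A}\otimes_{\mathbb{F}}\mathbb{F}G$ (degree of $\mathcal{A}_{\bar g}\otimes g$ is $g$), and $L^\tau_\pi(\mathcal{A}):=(L_\pi(\mathcal{A}))^\tau$ for $\tau\in\mathrm{Z}^2_{\mathrm{sym}}(G,\mathbb{F}^\times)$. *)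

theory Defs
  imports "HOL-Algebra.Coset" "HOL-Library.Function_Algebras"
begin

text \<open>An algebra over the field 'f is represented by an ambient additive abelian group
type 'a, a carrier subspace asp, a scalar multiplication ascal and a bilinear product
amul (no associativity).  The field acomp gives the homogeneous components, indexed
by the elements of a grading group (an HOL-Algebra group).  For ungraded notions
acomp is ignored.\<close>

record ('a, 'f, 'i) galg =
  asp   :: "'a set"
  ascal :: "'f \<Rightarrow> 'a \<Rightarrow> 'a"
  amul  :: "'a \<Rightarrow> 'a \<Rightarrow> 'a"
  acomp :: "'i \<Rightarrow> 'a set"

definition is_algebra :: "('a::ab_group_add, 'f::field, 'i, 'z) galg_scheme \<Rightarrow> bool" where
  "is_algebra A \<longleftrightarrow>
     0 \<in> asp A \<and>
     (\<forall>x\<in>asp A. \<forall>y\<in>asp A. x + y \<in> asp A) \<and>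
     (\<forall>a. \<forall>x\<in>asp A. ascal A a x \<in> asp A) \<and>
     (\<forall>x\<in>asp A. \<forall>y\<in>asp A. amul A x y \<in> asp A) \<and>
     (\<forall>a. \<forall>x\<in>asp A. \<forall>y\<in>asp A. ascal A a (x + y) = ascal A a x + ascal A a y) \<and>
     (\<forall>a b. \<forall>x\<in>asp A. ascal A (a + b) x = ascal A a x + ascal A b x) \<and>
     (\<forall>a b. \<forall>x\<in>asp A. ascal A a (ascal A b x) = ascal A (a * b) x) \<and>
     (\<forall>x\<in>asp A. ascal A 1 x = x) \<and>
     (\<forall>x\<in>asp A. \<forall>y\<in>asp A. \<forall>z\<in>asp A.
        amul A (x + y) z = amul A x z + amul A y z \<and>
        amul A z (x + y) = amul A z x + amul A z y) \<and>
     (\<forall>a. \<forall>x\<in>asp A. \<forall>y\<in>asp A.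
        amul A (ascal A a x) y = ascal A a (amul A x y) \<and>
        amul A x (ascal A a y) = ascal A a (amul A x y))"

definition alg_subspace :: "('a::ab_group_add, 'f::field, 'i, 'z) galg_scheme \<Rightarrow> 'a set \<Rightarrow> bool" where
  "alg_subspace A V \<longleftrightarrow> V \<subseteq> asp A \<and> 0 \<in> V \<and>
     (\<forall>x\<in>V. \<forall>y\<in>V. x + y \<in> V) \<and> (\<forall>a. \<forall>x\<in>V. ascal A a x \<in> V)"

definition alg_span :: "('a::ab_group_add, 'f::field, 'i, 'z) galg_scheme \<Rightarrow> 'a set \<Rightarrow> 'a set" where
  "alg_span A S = \<Inter> {V. alg_subspace A V \<and> S \<subseteq> V}"

definition alg_square :: "('a::ab_group_add, 'f::field, 'i, 'z) galg_scheme \<Rightarrow> 'a set" where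
  "alg_square A = alg_span A {amul A x y | x y. x \<in> asp A \<and> y \<in> asp A}"

definition alg_ideal :: "('a::ab_group_add, 'f::field, 'i, 'z) galg_scheme \<Rightarrow> 'a set \<Rightarrow> bool" where
  "alg_ideal A I \<longleftrightarrow> alg_subspace A I \<and>
     (\<forall>x\<in>asp A. \<forall>y\<in>I. amul A x y \<in> I \<and> amul A y x \<in> I)"

definition simple_alg :: "('a::ab_group_add, 'f::field, 'i, 'z) galg_scheme \<Rightarrow> bool" where
  "simple_alg A \<longleftrightarrow> is_algebra A \<and> asp A \<noteq> {0} \<and> alg_square A = asp A \<and>
     (\<forall>I. alg_ideal A I \<longrightarrow> I = {0} \<or> I = asp A)"

text \<open>Elements of the centroid are represented by functions that vanish outside the carrier.\<close>
definition centroid :: "('a::ab_group_add, 'f::field, 'i, 'z) galg_scheme \<Rightarrow> ('a \<Rightarrow> 'a) set" where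
  "centroid A = {c. (\<forall>x\<in>asp A. c x \<in> asp A) \<and> (\<forall>x. x \<notin> asp A \<longrightarrow> c x = 0) \<and>
      (\<forall>x\<in>asp A. \<forall>y\<in>asp A. c (x + y) = c x + c y) \<and>
      (\<forall>a. \<forall>x\<in>asp A. c (ascal A a x) = ascal A a (c x)) \<and>
      (\<forall>x\<in>asp A. \<forall>y\<in>asp A. c (amul A x y) = amul A (c x) y \<and> c (amul A x y) = amul A x (c y))}"

definition scalar_maps :: "('a::ab_group_add, 'f::field, 'i, 'z) galg_scheme \<Rightarrow> ('a \<Rightarrow> 'a) set" where
  "scalar_maps A = {(\<lambda>x. if x \<in> asp A then ascal A a x else 0) | a. True}"

definition central_alg :: "('a::ab_group_add, 'f::field, 'i, 'z) galg_scheme \<Rightarrow> bool" where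
  "central_alg A \<longleftrightarrow> centroid A = scalar_maps A"

definition is_decomp :: "('i, 'm) monoid_scheme \<Rightarrow> ('a::ab_group_add, 'f::field, 'i, 'z) galg_scheme
    \<Rightarrow> 'a \<Rightarrow> ('i \<Rightarrow> 'a) \<Rightarrow> bool" where
  "is_decomp \<Gamma> A x c \<longleftrightarrow>
     finite {g \<in> carrier \<Gamma>. c g \<noteq> 0} \<and>
     (\<forall>g. g \<notin> carrier \<Gamma> \<longrightarrow> c g = 0) \<and>
     (\<forall>g\<in>carrier \<Gamma>. c g \<in> acomp A g) \<and>
     x = (\<Sum>g\<in>{g \<in> carrier \<Gamma>. c g \<noteq> 0}. c g)"

definition graded :: "('i, 'm) monoid_scheme \<Rightarrow> ('a::ab_group_add, 'f::field, 'i, 'z) galg_scheme \<Rightarrow> bool" where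
  "graded \<Gamma> A \<longleftrightarrow> group \<Gamma> \<and> is_algebra A \<and>
     (\<forall>g\<in>carrier \<Gamma>. alg_subspace A (acomp A g)) \<and>
     (\<forall>x\<in>asp A. \<exists>!c. is_decomp \<Gamma> A x c) \<and>
     (\<forall>g\<in>carrier \<Gamma>. \<forall>h\<in>carrier \<Gamma>. \<forall>x\<in>acomp A g. \<forall>y\<in>acomp A h.
        amul A x y \<in> acomp A (g \<otimes>\<^bsub>\<Gamma>\<^esub> h))"

definition hcomp :: "('i, 'm) monoid_scheme \<Rightarrow> ('a::ab_group_add, 'f::field, 'i, 'z) galg_scheme
    \<Rightarrow> 'a \<Rightarrow> 'i \<Rightarrow> 'a" where
  "hcomp \<Gamma> A x = (THE c. is_decomp \<Gamma> A x c)"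

definition gsupp :: "('i, 'm) monoid_scheme \<Rightarrow> ('a::ab_group_add, 'f::field, 'i, 'z) galg_scheme
    \<Rightarrow> 'a \<Rightarrow> 'i set" where
  "gsupp \<Gamma> A x = {g \<in> carrier \<Gamma>. hcomp \<Gamma> A x g \<noteq> 0}"

definition graded_ideal :: "('i, 'm) monoid_scheme \<Rightarrow> ('a::ab_group_add, 'f::field, 'i, 'z) galg_scheme
    \<Rightarrow> 'a set \<Rightarrow> bool" where
  "graded_ideal \<Gamma> A I \<longleftrightarrow> alg_ideal A I \<and> (\<forall>x\<in>I. \<forall>g\<in>carrier \<Gamma>. hcomp \<Gamma> A x g \<in> I)"

definition graded_simple :: "('i, 'm) monoid_scheme \<Rightarrow> ('a::ab_group_add, 'f::field, 'i, 'z) galg_scheme \<Rightarrow> bool" where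
  "graded_simple \<Gamma> A \<longleftrightarrow> graded \<Gamma> A \<and> asp A \<noteq> {0} \<and> alg_square A = asp A \<and>
     (\<forall>I. graded_ideal \<Gamma> A I \<longrightarrow> I = {0} \<or> I = asp A)"

definition centroid_comp :: "('i, 'm) monoid_scheme \<Rightarrow> ('a::ab_group_add, 'f::field, 'i, 'z) galg_scheme
    \<Rightarrow> 'i \<Rightarrow> ('a \<Rightarrow> 'a) set" where
  "centroid_comp \<Gamma> A g = {c \<in> centroid A.
      \<forall>g'\<in>carrier \<Gamma>. \<forall>x\<in>acomp A g'. c x \<in> acomp A (g \<otimes>\<^bsub>\<Gamma>\<^esub> g')}"

definition graded_central :: "('i, 'm) monoid_scheme \<Rightarrow> ('a::ab_group_add, 'f::field, 'i, 'z) galg_scheme \<Rightarrow> bool" where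
  "graded_central \<Gamma> A \<longleftrightarrow> centroid_comp \<Gamma> A \<one>\<^bsub>\<Gamma>\<^esub> = scalar_maps A"

definition graded_central_simple :: "('i, 'm) monoid_scheme \<Rightarrow> ('a::ab_group_add, 'f::field, 'i, 'z) galg_scheme \<Rightarrow> bool" where
  "graded_central_simple \<Gamma> A \<longleftrightarrow> graded_simple \<Gamma> A \<and> graded_central \<Gamma> A"

definition centroid_alg :: "('i, 'm) monoid_scheme \<Rightarrow> ('a::ab_group_add, 'f::field, 'i, 'z) galg_scheme
    \<Rightarrow> ('a \<Rightarrow> 'a, 'f, 'i) galg" where
  "centroid_alg \<Gamma> A = \<lparr>asp = centroid A, ascal = (\<lambda>a c x. ascal A a (c x)),
     amul = (\<lambda>c d. c \<circ> d), acomp = centroid_comp \<Gamma> A\<rparr>"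

definition graded_iso :: "('i, 'm) monoid_scheme \<Rightarrow> ('a::ab_group_add, 'f::field, 'i, 'z) galg_scheme
    \<Rightarrow> ('b::ab_group_add, 'f, 'i, 'y) galg_scheme \<Rightarrow> bool" where
  "graded_iso \<Gamma> A B \<longleftrightarrow> (\<exists>\<phi>. bij_betw \<phi> (asp A) (asp B) \<and>
     (\<forall>x\<in>asp A. \<forall>y\<in>asp A. \<phi> (x + y) = \<phi> x + \<phi> y) \<and>
     (\<forall>a. \<forall>x\<in>asp A. \<phi> (ascal A a x) = ascal B a (\<phi> x)) \<and>
     (\<forall>x\<in>asp A. \<forall>y\<in>asp A. \<phi> (amul A x y) = amul B (\<phi> x) (\<phi> y)) \<and>
     (\<forall>g\<in>carrier \<Gamma>. \<phi> ` acomp A g = acomp B g))"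

definition Z2sym :: "('i, 'm) monoid_scheme \<Rightarrow> ('i \<Rightarrow> 'i \<Rightarrow> 'f::field) \<Rightarrow> bool" where
  "Z2sym \<Gamma> \<tau> \<longleftrightarrow>
     (\<forall>a\<in>carrier \<Gamma>. \<forall>b\<in>carrier \<Gamma>. \<tau> a b \<noteq> 0 \<and> \<tau> a b = \<tau> b a) \<and>
     (\<forall>a1\<in>carrier \<Gamma>. \<forall>a2\<in>carrier \<Gamma>. \<forall>a3\<in>carrier \<Gamma>.
        \<tau> a1 a2 * \<tau> (a1 \<otimes>\<^bsub>\<Gamma>\<^esub> a2) a3 = \<tau> a1 (a2 \<otimes>\<^bsub>\<Gamma>\<^esub> a3) * \<tau> a2 a3)"

text \<open>Equality of classes \<open>[\<tau>1] = [\<sigma>][\<tau>2]\<close> in \<open>H\<^sup>2\<^sub>s\<^sub>y\<^sub>m(\<Gamma>,\<bbbF>\<^sup>\<times>)\<close>: the quotient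
\<open>\<tau>1 / (\<sigma> \<tau>2)\<close> is a coboundary \<open>d\<gamma>\<close> with \<open>\<gamma> : \<Gamma> \<rightarrow> \<bbbF>\<^sup>\<times>\<close>.\<close>
definition cohom_eq_prod :: "('i, 'm) monoid_scheme \<Rightarrow> ('i \<Rightarrow> 'i \<Rightarrow> 'f::field)
    \<Rightarrow> ('i \<Rightarrow> 'i \<Rightarrow> 'f) \<Rightarrow> ('i \<Rightarrow> 'i \<Rightarrow> 'f) \<Rightarrow> bool" where
  "cohom_eq_prod \<Gamma> \<tau>1 \<sigma> \<tau>2 \<longleftrightarrow> (\<exists>\<gamma>. (\<forall>a\<in>carrier \<Gamma>. \<gamma> a \<noteq> 0) \<and>
     (\<forall>a\<in>carrier \<Gamma>. \<forall>b\<in>carrier \<Gamma>.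
        \<tau>1 a b = \<sigma> a b * \<tau>2 a b * (\<gamma> a * \<gamma> b / \<gamma> (a \<otimes>\<^bsub>\<Gamma>\<^esub> b))))"

text \<open>The \<open>\<tau>\<close>-twist: \<open>x * y = \<tau>(g1,g2) xy\<close> on homogeneous elements, extended bilinearly.\<close>
definition twist :: "('i, 'm) monoid_scheme \<Rightarrow> ('a::ab_group_add, 'f::field, 'i, 'z) galg_scheme
    \<Rightarrow> ('i \<Rightarrow> 'i \<Rightarrow> 'f) \<Rightarrow> ('a, 'f, 'i, 'z) galg_scheme" where
  "twist \<Gamma> A \<tau> = A\<lparr>amul := (\<lambda>x y. \<Sum>g\<in>gsupp \<Gamma> A x. \<Sum>h\<in>gsupp \<Gamma> A y.
      ascal A (\<tau> g h) (amul A (hcomp \<Gamma> A x g) (hcomp \<Gamma> A y h)))\<rparr>"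

definition group_alg :: "('g, 'm) monoid_scheme \<Rightarrow> 'g set \<Rightarrow> ('g \<Rightarrow> 'f::field, 'f, 'g) galg" where
  "group_alg G H = \<lparr>
     asp = {x. finite {g. x g \<noteq> 0} \<and> (\<forall>g. x g \<noteq> 0 \<longrightarrow> g \<in> H)},
     ascal = (\<lambda>a x g. a * x g),
     amul = (\<lambda>x y g. \<Sum>(g1, g2)\<in>{(g1, g2). x g1 \<noteq> 0 \<and> y g2 \<noteq> 0 \<and> g1 \<otimes>\<^bsub>G\<^esub> g2 = g}. x g1 * y g2),
     acomp = (\<lambda>g. {x. finite {g. x g \<noteq> 0} \<and> (\<forall>g. x g \<noteq> 0 \<longrightarrow> g \<in> H) \<and>
                      (\<forall>g'. g' \<noteq> g \<longrightarrow> x g' = 0)})\<rparr>"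

definition can_proj :: "('g, 'm) monoid_scheme \<Rightarrow> 'g set \<Rightarrow> 'g \<Rightarrow> 'g set" where
  "can_proj G H g = H #>\<^bsub>G\<^esub> g"

text \<open>Loop algebra \<open>L\<^sub>\<pi>(A) = \<Oplus>\<^sub>g A\<^sub>\<pi>\<^sub>(\<^sub>g\<^sub>) \<otimes> g \<subseteq> A \<otimes> \<bbbF>G\<close>, with \<open>A \<otimes> \<bbbF>G\<close> represented as
finitely supported functions \<open>G \<rightarrow> A\<close> (x corresponds to \<open>\<Sum>\<^sub>g x(g) \<otimes> g\<close>).\<close>
definition loop_alg :: "('g, 'm) monoid_scheme \<Rightarrow> 'g set
    \<Rightarrow> ('a::ab_group_add, 'f::field, 'g set, 'z) galg_scheme \<Rightarrow> ('g \<Rightarrow> 'a, 'f, 'g) galg" where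
  "loop_alg G H A = \<lparr>
     asp = {x. finite {g. x g \<noteq> 0} \<and> (\<forall>g. x g \<noteq> 0 \<longrightarrow> g \<in> carrier G) \<and>
               (\<forall>g\<in>carrier G. x g \<in> acomp A (can_proj G H g))},
     ascal = (\<lambda>a x g. ascal A a (x g)),
     amul = (\<lambda>x y g. \<Sum>(g1, g2)\<in>{(g1, g2). x g1 \<noteq> 0 \<and> y g2 \<noteq> 0 \<and> g1 \<otimes>\<^bsub>G\<^esub> g2 = g}.
                        amul A (x g1) (y g2)),
     acomp = (\<lambda>g. {x. finite {g. x g \<noteq> 0} \<and> (\<forall>g. x g \<noteq> 0 \<longrightarrow> g \<in> carrier G) \<and>
               (\<forall>g\<in>carrier G. x g \<in> acomp A (can_proj G H g)) \<and>
               (\<forall>g'. g' \<noteq> g \<longrightarrow> x g' = 0)})\<rparr>"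

definition twisted_loop_alg :: "('g, 'm) monoid_scheme \<Rightarrow> 'g set
    \<Rightarrow> ('a::ab_group_add, 'f::field, 'g set, 'z) galg_scheme \<Rightarrow> ('g \<Rightarrow> 'g \<Rightarrow> 'f)
    \<Rightarrow> ('g \<Rightarrow> 'a, 'f, 'g) galg" where
  "twisted_loop_alg G H A \<tau> = twist G (loop_alg G H A) \<tau>"

end

theory Submission
  imports Defs
begin

text \<open>The centroid of a loop algebra \<open>L\<close> over a central simple algebra \<open>A\<close> is spanned by the shifts by
elements of \<open>H\<close>, because a homogeneous centroid element of degree \<open>k\<close> acts on the component of degree
\<open>g\<close> through a map that depends only on the coset of \<open>g\<close> (as \<open>A = A\<^sup>2\<close>) and therefore defines
an element of the centroid of \<open>A\<close>. So \<open>H\<close> is recovered as the support of the centroid, and an isomorphism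
of loop algebras multiplies the shifts by scalars, which trivialize \<open>\<tau>1 / \<tau>2\<close> on \<open>H\<close> and make it
descend to \<open>G / H\<close> up to a coboundary.

Conversely, the nonzero homogeneous centroid elements of a graded-central-simple \<open>B\<close> are invertible, with
support a subgroup \<open>H\<close>, and multiply by a symmetric cocycle on \<open>H\<close>. This cocycle extends to \<open>G\<close>
(Zorn's lemma, adjoining one element at a time). Identifying the components of \<open>B\<close> within each coset of
\<open>H\<close> by means of the centroid yields \<open>A\<close>. Its centroid is \<open>F\<close>, and a graded-simple algebra with
ungraded centroid \<open>F\<close> is simple: if an element of a proper nonzero ideal with minimal support had two
components of different degrees, the correspondence between them would define a centroid element of
nontrivial degree.\<close>

subsection \<open>Graded spaces and graded algebras\<close>

text \<open>For a nonassociative algebra without unit the centroid acts only from outside, as maps;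
  A = A^2 makes these maps commute. The cocycle is unavoidable because the homogeneous centroid
  elements of B need not multiply like the elements of H: choosing one in each degree of H amounts
  to an abelian extension of H by F^x, which may fail to split. It extends to G because Ext(G, F^x)
  maps onto Ext(H, F^x), the integers having global dimension one. Untwisting B by the extended
  cocycle turns its centroid into the plain group algebra FH, and A is the specialization of B along
  the augmentation of FH. The specialization is not formed as a quotient: it is realized on coset
  representatives, at the price of a product that must be transported back from B. All maps,
  products and ideals are handled as families indexed by degrees, so that objects graded by G and by
  G/H can be compared one component at a time.\<close>

locale graded_space =
  fixes \<Gamma> :: "('i, 'm) monoid_scheme" (structure)
    and A :: "('a::ab_group_add, 'f::field, 'i) galg"
  assumes zero_mem [simp]: "0 \<in> asp A"
    and add_mem: "\<lbrakk>x \<in> asp A; y \<in> asp A\<rbrakk> \<Longrightarrow> x + y \<in> asp A"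
    and scal_mem: "x \<in> asp A \<Longrightarrow> ascal A a x \<in> asp A"
    and scal_add_right: "\<lbrakk>x \<in> asp A; y \<in> asp A\<rbrakk> \<Longrightarrow> ascal A a (x + y) = ascal A a x + ascal A a y"
    and scal_add_left: "x \<in> asp A \<Longrightarrow> ascal A (a + b) x = ascal A a x + ascal A b x"
    and scal_scal: "x \<in> asp A \<Longrightarrow> ascal A a (ascal A b x) = ascal A (a * b) x"
    and scal_one: "x \<in> asp A \<Longrightarrow> ascal A 1 x = x"
    and comp_subspace: "g \<in> carrier \<Gamma> \<Longrightarrow> alg_subspace A (acomp A g)"
    and ex1_decomp: "x \<in> asp A \<Longrightarrow> \<exists>!c. is_decomp \<Gamma> A x c"

text \<open>Kept apart from \<open>graded_space\<close> because twists, loop algebras and the base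
  algebra are shown to be graded spaces before anything is known of their products; the product then
  comes from \<open>graded_algebra_from_family\<close>.\<close>

locale graded_algebra = graded_space \<Gamma> A + group \<Gamma>
  for \<Gamma> :: "('i, 'm) monoid_scheme" (structure)
    and A :: "('a::ab_group_add, 'f::field, 'i) galg" +
  assumes mul_mem: "\<lbrakk>x \<in> asp A; y \<in> asp A\<rbrakk> \<Longrightarrow> amul A x y \<in> asp A"
    and mul_add_left: "\<lbrakk>x \<in> asp A; y \<in> asp A; z \<in> asp A\<rbrakk> \<Longrightarrow> amul A (x + y) z = amul A x z + amul A y z"
    and mul_add_right: "\<lbrakk>x \<in> asp A; y \<in> asp A; z \<in> asp A\<rbrakk> \<Longrightarrow> amul A z (x + y) = amul A z x + amul A z y"
    and mul_scal_left: "\<lbrakk>x \<in> asp A; y \<in> asp A\<rbrakk> \<Longrightarrow> amul A (ascal A a x) y = ascal A a (amul A x y)"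
    and mul_scal_right: "\<lbrakk>x \<in> asp A; y \<in> asp A\<rbrakk> \<Longrightarrow> amul A x (ascal A a y) = ascal A a (amul A x y)"
    and mul_comp: "\<lbrakk>g \<in> carrier \<Gamma>; h \<in> carrier \<Gamma>; x \<in> acomp A g; y \<in> acomp A h\<rbrakk>
           \<Longrightarrow> amul A x y \<in> acomp A (g \<otimes> h)"

lemma graded_iff_graded_algebra: "graded \<Gamma> A \<longleftrightarrow> graded_algebra \<Gamma> A"
proof
  assume "graded \<Gamma> A"
  then show "graded_algebra \<Gamma> A"
    unfolding graded_def is_algebra_def graded_algebra_def graded_space_def graded_algebra_axioms_def
    by (intro conjI allI impI) (simp_all)
next
  assume "graded_algebra \<Gamma> A"
  then show "graded \<Gamma> A"
    unfolding graded_def is_algebra_def graded_algebra_def graded_space_def graded_algebra_axioms_def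
    by (intro conjI allI ballI) (simp_all)
qed

section \<open>Linear maps and products prescribed on homogeneous components\<close>

definition gext :: "('i, 'm) monoid_scheme \<Rightarrow> ('a::ab_group_add, 'f::field, 'i) galg
    \<Rightarrow> ('i \<Rightarrow> 'a \<Rightarrow> 'b::ab_group_add) \<Rightarrow> 'a \<Rightarrow> 'b" where
  "gext \<Gamma> A f x = (\<Sum>g\<in>gsupp \<Gamma> A x. f g (hcomp \<Gamma> A x g))"

definition additive_family :: "('i, 'm) monoid_scheme \<Rightarrow> ('a::ab_group_add, 'f::field, 'i) galg
    \<Rightarrow> ('i \<Rightarrow> 'a \<Rightarrow> 'b::ab_group_add) \<Rightarrow> bool" where
  "additive_family \<Gamma> A f \<longleftrightarrow>
     (\<forall>g\<in>carrier \<Gamma>. \<forall>u\<in>acomp A g. \<forall>v\<in>acomp A g. f g (u + v) = f g u + f g v)"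

context graded_space
begin

lemma comp_mem: "\<lbrakk>g \<in> carrier \<Gamma>; x \<in> acomp A g\<rbrakk> \<Longrightarrow> x \<in> asp A"
  using comp_subspace[of g] unfolding alg_subspace_def by auto

lemma comp_zero: "g \<in> carrier \<Gamma> \<Longrightarrow> 0 \<in> acomp A g"
  using comp_subspace[of g] unfolding alg_subspace_def by auto

lemma comp_add: "\<lbrakk>g \<in> carrier \<Gamma>; x \<in> acomp A g; y \<in> acomp A g\<rbrakk> \<Longrightarrow> x + y \<in> acomp A g"
  using comp_subspace[of g] unfolding alg_subspace_def by auto

lemma comp_scal: "\<lbrakk>g \<in> carrier \<Gamma>; x \<in> acomp A g\<rbrakk> \<Longrightarrow> ascal A a x \<in> acomp A g"
  using comp_subspace[of g] unfolding alg_subspace_def by auto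

lemma scal_zero_right [simp]: "ascal A a 0 = 0"
  using scal_add_right[of 0 0 a] by simp

lemma scal_zero_left [simp]: "x \<in> asp A \<Longrightarrow> ascal A 0 x = 0"
  using scal_add_left[of x 0 0] by simp

lemma scal_minus_one: assumes "x \<in> asp A" shows "ascal A (- 1) x = - x"
proof -
  have "ascal A (-1) x + ascal A 1 x = 0"
    using scal_add_left[OF assms, of "-1" 1] assms by simp
  then show ?thesis using assms by (simp add: scal_one eq_neg_iff_add_eq_0)
qed

lemma minus_mem: "x \<in> asp A \<Longrightarrow> - x \<in> asp A"
  using scal_minus_one scal_mem by metis

lemma diff_mem: "\<lbrakk>x \<in> asp A; y \<in> asp A\<rbrakk> \<Longrightarrow> x - y \<in> asp A"
  using add_mem[of x "- y"] minus_mem by simp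

lemma scal_cancel: assumes "x \<in> asp A" "a \<noteq> 0" "ascal A a x = 0" shows "x = 0"
proof -
  have "ascal A (inverse a) (ascal A a x) = x"
    using assms(1,2) scal_scal[of x "inverse a" a] by (simp add: scal_one)
  then show ?thesis using assms by simp
qed

lemma scal_eq_scal_iff: assumes "x \<in> asp A" "x \<noteq> 0"
  shows "ascal A a x = ascal A b x \<longleftrightarrow> a = b"
proof
  assume e: "ascal A a x = ascal A b x"
  have "ascal A (a - b) x + ascal A b x = ascal A a x"
    using scal_add_left[OF assms(1), of "a - b" b] by simp
  then have "ascal A (a - b) x = 0" using e by simp
  then show "a = b" using scal_cancel assms by force
qed simp

lemma sum_mem: "(\<And>i. i \<in> S \<Longrightarrow> f i \<in> asp A) \<Longrightarrow> sum f S \<in> asp A"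
  by (induction S rule: infinite_finite_induct) (auto intro: add_mem)

lemma scal_sum: "(\<And>i. i \<in> S \<Longrightarrow> f i \<in> asp A) \<Longrightarrow> ascal A a (sum f S) = (\<Sum>i\<in>S. ascal A a (f i))"
  by (induction S rule: infinite_finite_induct) (auto simp: scal_add_right sum_mem)

lemma is_decomp_hcomp: "x \<in> asp A \<Longrightarrow> is_decomp \<Gamma> A x (hcomp \<Gamma> A x)"
  unfolding hcomp_def by (rule theI'[OF ex1_decomp])

lemma is_decomp_mem: "is_decomp \<Gamma> A x c \<Longrightarrow> x \<in> asp A"
  unfolding is_decomp_def using comp_mem by (auto intro!: sum_mem)

lemma hcomp_eqI: "is_decomp \<Gamma> A x c \<Longrightarrow> hcomp \<Gamma> A x = c"
  using is_decomp_hcomp ex1_decomp is_decomp_mem by metis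

lemma hcomp_comp: "\<lbrakk>x \<in> asp A; g \<in> carrier \<Gamma>\<rbrakk> \<Longrightarrow> hcomp \<Gamma> A x g \<in> acomp A g"
  using is_decomp_hcomp[of x] unfolding is_decomp_def by auto

lemma hcomp_outside: "\<lbrakk>x \<in> asp A; g \<notin> carrier \<Gamma>\<rbrakk> \<Longrightarrow> hcomp \<Gamma> A x g = 0"
  using is_decomp_hcomp[of x] unfolding is_decomp_def by auto

lemma hcomp_mem: "x \<in> asp A \<Longrightarrow> hcomp \<Gamma> A x g \<in> asp A"
  using hcomp_comp hcomp_outside comp_mem by (cases "g \<in> carrier \<Gamma>") auto

lemma finite_gsupp: "x \<in> asp A \<Longrightarrow> finite (gsupp \<Gamma> A x)"
  using is_decomp_hcomp[of x] unfolding is_decomp_def gsupp_def by auto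

lemma gsupp_carrier: "gsupp \<Gamma> A x \<subseteq> carrier \<Gamma>"
  unfolding gsupp_def by auto

lemma sum_hcomp: "x \<in> asp A \<Longrightarrow> (\<Sum>g\<in>gsupp \<Gamma> A x. hcomp \<Gamma> A x g) = x"
  using is_decomp_hcomp[of x] unfolding is_decomp_def gsupp_def by auto

lemma sum_hcomp_superset:
  assumes "x \<in> asp A" "finite S" "gsupp \<Gamma> A x \<subseteq> S" "S \<subseteq> carrier \<Gamma>"
  shows "(\<Sum>g\<in>S. hcomp \<Gamma> A x g) = x"
proof -
  have "(\<Sum>g\<in>gsupp \<Gamma> A x. hcomp \<Gamma> A x g) = (\<Sum>g\<in>S. hcomp \<Gamma> A x g)"
    by (rule sum.mono_neutral_left) (use assms in \<open>auto simp: gsupp_def\<close>)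
  then show ?thesis using sum_hcomp assms by simp
qed

text \<open>S may be larger than the support of c. For a sum of two elements this is essential,
  since components can cancel.\<close>

lemma is_decompI:
  assumes "finite S" "S \<subseteq> carrier \<Gamma>" "\<And>g. g \<in> S \<Longrightarrow> c g \<in> acomp A g" "\<And>g. g \<notin> S \<Longrightarrow> c g = 0"
    and "x = (\<Sum>g\<in>S. c g)"
  shows "is_decomp \<Gamma> A x c"
proof -
  have sub: "{g \<in> carrier \<Gamma>. c g \<noteq> 0} \<subseteq> S" using assms(4) by auto
  have "(\<Sum>g\<in>{g \<in> carrier \<Gamma>. c g \<noteq> 0}. c g) = (\<Sum>g\<in>S. c g)"
    by (rule sum.mono_neutral_left) (use assms sub in auto)
  then show ?thesis unfolding is_decomp_def
    using sub assms(1,2,4,5) finite_subset[OF sub] assms(3) comp_zero by fastforce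
qed

lemma hcomp_add: assumes "x \<in> asp A" "y \<in> asp A"
  shows "hcomp \<Gamma> A (x + y) g = hcomp \<Gamma> A x g + hcomp \<Gamma> A y g"
proof -
  let ?S = "gsupp \<Gamma> A x \<union> gsupp \<Gamma> A y"
  have fin: "finite ?S" using assms finite_gsupp by auto
  have "is_decomp \<Gamma> A (x + y) (\<lambda>g. hcomp \<Gamma> A x g + hcomp \<Gamma> A y g)"
  proof (rule is_decompI[of ?S])
    have "(\<Sum>g\<in>?S. hcomp \<Gamma> A x g) = x" "(\<Sum>g\<in>?S. hcomp \<Gamma> A y g) = y"
      using sum_hcomp_superset assms fin gsupp_carrier by auto
    then show "x + y = (\<Sum>g\<in>?S. hcomp \<Gamma> A x g + hcomp \<Gamma> A y g)" by (simp add: sum.distrib)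
  qed (use assms fin gsupp_carrier in \<open>auto simp: gsupp_def hcomp_comp hcomp_outside comp_add\<close>)
  then show ?thesis using hcomp_eqI by auto
qed

lemma hcomp_scal: assumes "x \<in> asp A"
  shows "hcomp \<Gamma> A (ascal A a x) g = ascal A a (hcomp \<Gamma> A x g)"
proof -
  have "is_decomp \<Gamma> A (ascal A a x) (\<lambda>g. ascal A a (hcomp \<Gamma> A x g))"
  proof (rule is_decompI[of "gsupp \<Gamma> A x"])
    show "ascal A a x = (\<Sum>g\<in>gsupp \<Gamma> A x. ascal A a (hcomp \<Gamma> A x g))"
      using scal_sum[of "gsupp \<Gamma> A x" "hcomp \<Gamma> A x" a] sum_hcomp assms hcomp_mem by simp
  qed (use assms finite_gsupp gsupp_carrier in \<open>auto simp: gsupp_def hcomp_comp hcomp_outside comp_scal\<close>)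
  then show ?thesis using hcomp_eqI by auto
qed

lemma hcomp_zero [simp]: "hcomp \<Gamma> A 0 g = 0"
  using hcomp_add[of 0 0 g] by simp

lemma hcomp_minus: "x \<in> asp A \<Longrightarrow> hcomp \<Gamma> A (- x) g = - hcomp \<Gamma> A x g"
  using hcomp_scal[of x "-1" g] hcomp_mem by (simp add: scal_minus_one)

lemma hcomp_diff: "\<lbrakk>x \<in> asp A; y \<in> asp A\<rbrakk> \<Longrightarrow> hcomp \<Gamma> A (x - y) g = hcomp \<Gamma> A x g - hcomp \<Gamma> A y g"
  using hcomp_add[of x "- y" g] minus_mem hcomp_minus by simp

lemma hcomp_sum: "(\<And>i. i \<in> S \<Longrightarrow> f i \<in> asp A) \<Longrightarrow> hcomp \<Gamma> A (sum f S) g = (\<Sum>i\<in>S. hcomp \<Gamma> A (f i) g)"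
  by (induction S rule: infinite_finite_induct) (auto simp: hcomp_add sum_mem)

lemma hcomp_homogeneous: assumes "g \<in> carrier \<Gamma>" "x \<in> acomp A g"
  shows "hcomp \<Gamma> A x h = (if h = g then x else 0)"
proof -
  have "is_decomp \<Gamma> A x (\<lambda>h. if h = g then x else 0)"
    by (rule is_decompI[of "{g}"]) (use assms in auto)
  then show ?thesis using hcomp_eqI by auto
qed

lemma comp_inter: "\<lbrakk>g \<in> carrier \<Gamma>; h \<in> carrier \<Gamma>; g \<noteq> h; x \<in> acomp A g; x \<in> acomp A h\<rbrakk> \<Longrightarrow> x = 0"
  using hcomp_homogeneous[of g x g] hcomp_homogeneous[of h x g] by auto

lemma eq_if_hcomp_eq: assumes "x \<in> asp A" "y \<in> asp A"
    "\<And>g. g \<in> carrier \<Gamma> \<Longrightarrow> hcomp \<Gamma> A x g = hcomp \<Gamma> A y g"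
  shows "x = y"
proof -
  have "hcomp \<Gamma> A x = hcomp \<Gamma> A y" using assms hcomp_outside by (metis ext)
  then show ?thesis using sum_hcomp assms unfolding gsupp_def by metis
qed

lemma homogeneous_induct [consumes 1, case_names zero homogeneous add]:
  assumes "x \<in> asp A" "P 0"
    and "\<And>g x. \<lbrakk>g \<in> carrier \<Gamma>; x \<in> acomp A g\<rbrakk> \<Longrightarrow> P x"
    and "\<And>x y. \<lbrakk>x \<in> asp A; y \<in> asp A; P x; P y\<rbrakk> \<Longrightarrow> P (x + y)"
  shows "P x"
proof -
  have "P (sum (hcomp \<Gamma> A x) S)" if "finite S" "S \<subseteq> carrier \<Gamma>" for S
    using that
  proof (induction S rule: finite_induct)
    case (insert g S)
    have "P (hcomp \<Gamma> A x g + sum (hcomp \<Gamma> A x) S)"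
      by (rule assms(4)) (use insert assms hcomp_mem hcomp_comp in \<open>auto intro!: sum_mem\<close>)
    then show ?case using insert by simp
  qed (simp add: assms)
  then show ?thesis
    using sum_hcomp[OF assms(1)] finite_gsupp[OF assms(1)] gsupp_carrier by metis
qed

lemma additive_family_zero:
  assumes "additive_family \<Gamma> A f" "g \<in> carrier \<Gamma>" shows "f g 0 = 0"
  using assms comp_zero[OF assms(2)] unfolding additive_family_def
  by (metis add_0 add_cancel_right_right)

text \<open>The extra terms are \<open>f g 0 = 0\<close>. The freedom matters because x, y and x + y
  have different supports, and their images can only be compared over a common index set.\<close>

lemma gext_superset:
  assumes "additive_family \<Gamma> A f" "x \<in> asp A" "finite S" "gsupp \<Gamma> A x \<subseteq> S" "S \<subseteq> carrier \<Gamma>"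
  shows "gext \<Gamma> A f x = (\<Sum>g\<in>S. f g (hcomp \<Gamma> A x g))"
  unfolding gext_def
  by (rule sum.mono_neutral_left)
     (use assms additive_family_zero[OF assms(1)] in \<open>auto simp: gsupp_def\<close>)

lemma gext_add:
  assumes "additive_family \<Gamma> A f" "x \<in> asp A" "y \<in> asp A"
  shows "gext \<Gamma> A f (x + y) = gext \<Gamma> A f x + gext \<Gamma> A f y"
proof -
  let ?S = "gsupp \<Gamma> A x \<union> gsupp \<Gamma> A y \<union> gsupp \<Gamma> A (x + y)"
  have fin: "finite ?S" "?S \<subseteq> carrier \<Gamma>" using assms finite_gsupp add_mem gsupp_carrier by blast+
  have "f g (hcomp \<Gamma> A (x + y) g) = f g (hcomp \<Gamma> A x g) + f g (hcomp \<Gamma> A y g)" if "g \<in> ?S" for g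
  proof -
    have "g \<in> carrier \<Gamma>" using fin that by blast
    then show ?thesis
      using assms hcomp_comp unfolding additive_family_def by (simp add: hcomp_add)
  qed
  then have "(\<Sum>g\<in>?S. f g (hcomp \<Gamma> A (x + y) g)) = (\<Sum>g\<in>?S. f g (hcomp \<Gamma> A x g)) + (\<Sum>g\<in>?S. f g (hcomp \<Gamma> A y g))"
    by (simp add: sum.distrib)
  moreover have "gext \<Gamma> A f z = (\<Sum>g\<in>?S. f g (hcomp \<Gamma> A z g))" if "z \<in> {x, y, x + y}" for z
    by (rule gext_superset) (use fin assms add_mem that in auto)
  ultimately show ?thesis by simp
qed

lemma gext_homogeneous:
  assumes "additive_family \<Gamma> A f" "g \<in> carrier \<Gamma>" "x \<in> acomp A g"
  shows "gext \<Gamma> A f x = f g x"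
proof -
  have "gsupp \<Gamma> A x \<subseteq> {g}" using assms by (auto simp: hcomp_homogeneous gsupp_def)
  then show ?thesis
    using gext_superset[of f x "{g}"] assms by (simp add: comp_mem hcomp_homogeneous)
qed

lemma gext_scal:
  assumes "x \<in> asp A" "additive_family \<Gamma> A f" "graded_space \<Delta> B"
    and "\<And>g u. \<lbrakk>g \<in> carrier \<Gamma>; u \<in> acomp A g\<rbrakk> \<Longrightarrow> f g u \<in> asp B"
    and "\<And>g u. \<lbrakk>g \<in> carrier \<Gamma>; u \<in> acomp A g\<rbrakk> \<Longrightarrow> f g (ascal A a u) = ascal B a (f g u)"
  shows "gext \<Gamma> A f (ascal A a x) = ascal B a (gext \<Gamma> A f x)"
proof -
  interpret B: graded_space \<Delta> B by fact
  let ?S = "gsupp \<Gamma> A x"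
  have S: "finite ?S" "?S \<subseteq> carrier \<Gamma>" "gsupp \<Gamma> A (ascal A a x) \<subseteq> ?S"
    using finite_gsupp assms gsupp_carrier by (auto simp: gsupp_def hcomp_scal)
  have "gext \<Gamma> A f (ascal A a x) = (\<Sum>g\<in>?S. f g (hcomp \<Gamma> A (ascal A a x) g))"
    using S assms by (intro gext_superset) (auto intro: scal_mem)
  also have "\<dots> = (\<Sum>g\<in>?S. ascal B a (f g (hcomp \<Gamma> A x g)))"
    using S assms hcomp_comp by (intro sum.cong) (auto simp: hcomp_scal)
  also have "\<dots> = ascal B a (gext \<Gamma> A f x)" unfolding gext_def
    using S assms hcomp_comp by (intro B.scal_sum[symmetric]) auto
  finally show ?thesis .
qed

lemma gext_mem:
  assumes "x \<in> asp A" "graded_space \<Delta> B"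
    and "\<And>g u. \<lbrakk>g \<in> carrier \<Gamma>; u \<in> acomp A g\<rbrakk> \<Longrightarrow> f g u \<in> asp B"
  shows "gext \<Gamma> A f x \<in> asp B"
  unfolding gext_def
  by (rule graded_space.sum_mem[OF assms(2)])
     (use assms gsupp_carrier hcomp_comp in \<open>auto simp: subset_iff\<close>)

text \<open>Bilinear products on pairs of components glue by two applications of
  \<open>gext\<close>, in the right argument for a fixed homogeneous left factor, then in the left
  argument. The double sum in \<open>amul_eq\<close> is the form in which \<open>twist\<close> is
  defined and to which the convolution of a loop algebra is brought later.\<close>

lemma graded_algebra_from_family:
  fixes m :: "'i \<Rightarrow> 'i \<Rightarrow> 'a \<Rightarrow> 'a \<Rightarrow> 'a"
  assumes "group \<Gamma>"
    and m_comp: "\<And>g h u v. \<lbrakk>g \<in> carrier \<Gamma>; h \<in> carrier \<Gamma>; u \<in> acomp A g; v \<in> acomp A h\<rbrakk>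
        \<Longrightarrow> m g h u v \<in> acomp A (g \<otimes> h)"
    and m_add_left: "\<And>g h u v w. \<lbrakk>g \<in> carrier \<Gamma>; h \<in> carrier \<Gamma>; u \<in> acomp A g; v \<in> acomp A g; w \<in> acomp A h\<rbrakk>
        \<Longrightarrow> m g h (u + v) w = m g h u w + m g h v w"
    and m_add_right: "\<And>g h u v w. \<lbrakk>g \<in> carrier \<Gamma>; h \<in> carrier \<Gamma>; u \<in> acomp A g; v \<in> acomp A h; w \<in> acomp A h\<rbrakk>
        \<Longrightarrow> m g h u (v + w) = m g h u v + m g h u w"
    and m_scal_left: "\<And>g h u v a. \<lbrakk>g \<in> carrier \<Gamma>; h \<in> carrier \<Gamma>; u \<in> acomp A g; v \<in> acomp A h\<rbrakk>
        \<Longrightarrow> m g h (ascal A a u) v = ascal A a (m g h u v)"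
    and m_scal_right: "\<And>g h u v a. \<lbrakk>g \<in> carrier \<Gamma>; h \<in> carrier \<Gamma>; u \<in> acomp A g; v \<in> acomp A h\<rbrakk>
        \<Longrightarrow> m g h u (ascal A a v) = ascal A a (m g h u v)"
    and amul_eq: "\<And>x y. \<lbrakk>x \<in> asp A; y \<in> asp A\<rbrakk> \<Longrightarrow>
          amul A x y = (\<Sum>g\<in>gsupp \<Gamma> A x. \<Sum>h\<in>gsupp \<Gamma> A y. m g h (hcomp \<Gamma> A x g) (hcomp \<Gamma> A y h))"
  shows "graded_algebra \<Gamma> A"
    and "\<lbrakk>g \<in> carrier \<Gamma>; h \<in> carrier \<Gamma>; u \<in> acomp A g; v \<in> acomp A h\<rbrakk> \<Longrightarrow> amul A u v = m g h u v"
proof -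
  interpret group \<Gamma> by fact
  have gs: "graded_space \<Gamma> A" by unfold_locales
  let ?r = "\<lambda>g u. gext \<Gamma> A (\<lambda>h. m g h u)"
  have fam_r: "additive_family \<Gamma> A (\<lambda>h. m g h u)" if "g \<in> carrier \<Gamma>" "u \<in> acomp A g" for g u
    unfolding additive_family_def using that m_add_right by auto
  have r_mem: "?r g u y \<in> asp A" if "g \<in> carrier \<Gamma>" "u \<in> acomp A g" "y \<in> asp A" for g u y
    by (rule gext_mem[OF that(3) gs]) (use that m_comp comp_mem in \<open>meson m_closed\<close>)
  have eq: "amul A x y = gext \<Gamma> A (\<lambda>g u. ?r g u y) x" if "x \<in> asp A" "y \<in> asp A" for x y
    using amul_eq[OF that] unfolding gext_def .
  have fam_l: "additive_family \<Gamma> A (\<lambda>g u. ?r g u y)" if "y \<in> asp A" for y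
    unfolding additive_family_def
  proof (intro ballI)
    fix g u v assume *: "g \<in> carrier \<Gamma>" "u \<in> acomp A g" "v \<in> acomp A g"
    show "?r g (u + v) y = ?r g u y + ?r g v y"
      unfolding gext_def sum.distrib[symmetric]
      by (rule sum.cong) (use * that hcomp_comp gsupp_carrier m_add_left in \<open>auto simp: subset_iff\<close>)
  qed
  have r_scal: "?r g (ascal A a u) y = ascal A a (?r g u y)"
    if "y \<in> asp A" "g \<in> carrier \<Gamma>" "u \<in> acomp A g" for a g u y
  proof -
    have "?r g (ascal A a u) y = (\<Sum>h\<in>gsupp \<Gamma> A y. ascal A a (m g h u (hcomp \<Gamma> A y h)))"
      unfolding gext_def
      by (rule sum.cong) (use that hcomp_comp gsupp_carrier m_scal_left in \<open>auto simp: subset_iff\<close>)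
    also have "\<dots> = ascal A a (?r g u y)" unfolding gext_def
      by (rule scal_sum[symmetric])
         (use that hcomp_comp gsupp_carrier m_comp comp_mem in \<open>metis m_closed subset_iff\<close>)
    finally show ?thesis .
  qed
  have r_add: "?r g u (x + y) = ?r g u x + ?r g u y"
    if "x \<in> asp A" "y \<in> asp A" "g \<in> carrier \<Gamma>" "u \<in> acomp A g" for g u x y
    using gext_add[OF fam_r] that by blast
  have r_scal': "?r g u (ascal A a y) = ascal A a (?r g u y)"
    if "y \<in> asp A" "g \<in> carrier \<Gamma>" "u \<in> acomp A g" for a g u y
  proof (rule gext_scal[OF that(1) fam_r gs])
    fix h v assume "h \<in> carrier \<Gamma>" "v \<in> acomp A h"
    then show "m g h u v \<in> asp A" using m_comp that comp_mem by (meson m_closed)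
  qed (use that m_scal_right in auto)
  show hom: "amul A u v = m g h u v"
    if "g \<in> carrier \<Gamma>" "h \<in> carrier \<Gamma>" "u \<in> acomp A g" "v \<in> acomp A h" for g h u v
    using that comp_mem by (simp add: eq gext_homogeneous[OF fam_l] gext_homogeneous[OF fam_r])
  show "graded_algebra \<Gamma> A"
  proof unfold_locales
    fix x y assume xy: "x \<in> asp A" "y \<in> asp A"
    show "amul A x y \<in> asp A"
      unfolding eq[OF xy] by (rule gext_mem[OF xy(1) gs]) (use r_mem xy in auto)
    fix a
    show "amul A (ascal A a x) y = ascal A a (amul A x y)"
      using xy by (simp add: eq scal_mem) (rule gext_scal[OF xy(1) fam_l gs]; use r_mem r_scal in auto)
    have "amul A x (ascal A a y) = (\<Sum>g\<in>gsupp \<Gamma> A x. ascal A a (?r g (hcomp \<Gamma> A x g) y))"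
      using xy unfolding eq[OF xy(1) scal_mem[OF xy(2)]] gext_def[of _ _ _ x]
      by (intro sum.cong) (use hcomp_comp gsupp_carrier r_scal' in \<open>auto simp: subset_iff\<close>)
    also have "\<dots> = ascal A a (amul A x y)" unfolding eq[OF xy] gext_def[of _ _ _ x]
      by (rule scal_sum[symmetric]) (use xy r_mem hcomp_comp gsupp_carrier in \<open>auto simp: subset_iff\<close>)
    finally show "amul A x (ascal A a y) = ascal A a (amul A x y)" .
    fix z assume z: "z \<in> asp A"
    show "amul A (x + y) z = amul A x z + amul A y z"
      using xy z add_mem gext_add[OF fam_l] by (simp add: eq)
    show "amul A z (x + y) = amul A z x + amul A z y"
      using xy z add_mem
      unfolding eq[OF z xy(1)] eq[OF z xy(2)] eq[OF z add_mem[OF xy]] gext_def[of _ _ _ z] sum.distrib[symmetric]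
      by (intro sum.cong) (use hcomp_comp gsupp_carrier r_add in \<open>auto simp: subset_iff\<close>)
  next
    fix g h x y assume *: "g \<in> carrier \<Gamma>" "h \<in> carrier \<Gamma>" "x \<in> acomp A g" "y \<in> acomp A h"
    then show "amul A x y \<in> acomp A (g \<otimes> h)" using hom m_comp by auto
  qed
qed

end

subsection \<open>Graded ideals and graded isomorphisms\<close>

context graded_algebra
begin

lemma mul_zero_left [simp]: "x \<in> asp A \<Longrightarrow> amul A 0 x = 0"
  using mul_add_left[of 0 0 x] by simp

lemma mul_zero_right [simp]: "x \<in> asp A \<Longrightarrow> amul A x 0 = 0"
  using mul_add_right[of 0 0 x] by simp

lemma homogeneous_pair_induct [consumes 2, case_names homogeneous add_left add_right]:
  assumes "x \<in> asp A" "y \<in> asp A"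
    and "\<And>g h u v. \<lbrakk>g \<in> carrier \<Gamma>; h \<in> carrier \<Gamma>; u \<in> acomp A g; v \<in> acomp A h\<rbrakk> \<Longrightarrow> P u v"
    and "\<And>u v w. \<lbrakk>u \<in> asp A; v \<in> asp A; w \<in> asp A; P u w; P v w\<rbrakk> \<Longrightarrow> P (u + v) w"
    and "\<And>u v w. \<lbrakk>u \<in> asp A; v \<in> asp A; w \<in> asp A; P u v; P u w\<rbrakk> \<Longrightarrow> P u (v + w)"
  shows "P x y"
proof -
  have zero: "0 \<in> acomp A \<one>" using comp_zero by simp
  have hom: "P u w" if "g \<in> carrier \<Gamma>" "u \<in> acomp A g" "w \<in> asp A" for g u w
    using that(3)
  proof (induction w rule: homogeneous_induct)
    case zero then show ?case using assms(3)[of g \<one> u 0] that zero comp_zero by simp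
  next
    case (homogeneous h v) then show ?case using assms(3) that by blast
  next
    case (add v w) then show ?case using assms(5) comp_mem that by blast
  qed
  show ?thesis using assms(1)
  proof (induction x rule: homogeneous_induct)
    case zero then show ?case using hom[of \<one> 0 y] zero comp_zero assms by simp
  next
    case (homogeneous h v) then show ?case using hom assms by blast
  next
    case (add v w) then show ?case using assms by blast
  qed
qed

text \<open>Translation by h is injective on degrees, so multiplication by y never mixes two
  components of x.\<close>

lemma hcomp_mul:
  assumes "x \<in> asp A" "h \<in> carrier \<Gamma>" "y \<in> acomp A h" "g \<in> carrier \<Gamma>"
  shows "hcomp \<Gamma> A (amul A x y) (g \<otimes> h) = amul A (hcomp \<Gamma> A x g) y"
    and "hcomp \<Gamma> A (amul A y x) (h \<otimes> g) = amul A y (hcomp \<Gamma> A x g)"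
proof -
  have y: "y \<in> asp A" using assms comp_mem by blast
  show "hcomp \<Gamma> A (amul A x y) (g \<otimes> h) = amul A (hcomp \<Gamma> A x g) y"
    using assms(1)
  proof (induction x rule: homogeneous_induct)
    case zero then show ?case using y by simp
  next
    case (homogeneous k x)
    have "amul A x y \<in> acomp A (k \<otimes> h)" using homogeneous assms mul_comp by blast
    then show ?case using homogeneous assms y by (simp add: hcomp_homogeneous[of "k \<otimes> h"] hcomp_homogeneous[of k])
  next
    case (add u v) then show ?case using y by (simp add: mul_add_left hcomp_add mul_mem hcomp_mem)
  qed
  show "hcomp \<Gamma> A (amul A y x) (h \<otimes> g) = amul A y (hcomp \<Gamma> A x g)"
    using assms(1)
  proof (induction x rule: homogeneous_induct)
    case zero then show ?case using y by simp
  next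
    case (homogeneous k x)
    have "amul A y x \<in> acomp A (h \<otimes> k)" using homogeneous assms mul_comp by blast
    then show ?case using homogeneous assms y by (simp add: hcomp_homogeneous[of "h \<otimes> k"] hcomp_homogeneous[of k])
  next
    case (add u v) then show ?case using y by (simp add: mul_add_right hcomp_add mul_mem hcomp_mem)
  qed
qed

lemma alg_subspace_asp: "alg_subspace A (asp A)"
  unfolding alg_subspace_def by (auto intro: add_mem scal_mem)

lemma alg_square_subspace: "alg_subspace A (alg_square A)"
proof -
  have "alg_square A \<subseteq> asp A"
    unfolding alg_square_def alg_span_def using alg_subspace_asp mul_mem by (intro Inter_lower) auto
  then show ?thesis
    unfolding alg_subspace_def by (auto simp: alg_square_def alg_span_def alg_subspace_def)
qed

lemma alg_square_mul: "\<lbrakk>x \<in> asp A; y \<in> asp A\<rbrakk> \<Longrightarrow> amul A x y \<in> alg_square A"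
  unfolding alg_square_def alg_span_def by auto

text \<open>The elements satisfying P form a subspace. By bilinearity it contains every product as
  soon as it contains the products of homogeneous elements, hence it contains their span.\<close>

lemma square_induct [consumes 1, case_names zero mul add scal]:
  assumes "z \<in> alg_square A" "P 0"
    and "\<And>g h x y. \<lbrakk>g \<in> carrier \<Gamma>; h \<in> carrier \<Gamma>; x \<in> acomp A g; y \<in> acomp A h\<rbrakk> \<Longrightarrow> P (amul A x y)"
    and "\<And>x y. \<lbrakk>x \<in> asp A; y \<in> asp A; P x; P y\<rbrakk> \<Longrightarrow> P (x + y)"
    and "\<And>a x. \<lbrakk>x \<in> asp A; P x\<rbrakk> \<Longrightarrow> P (ascal A a x)"
  shows "P z"
proof -
  let ?V = "{z \<in> asp A. P z}"
  have "P (amul A x y)" if "x \<in> asp A" "y \<in> asp A" for x y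
    using that
  proof (induction x y rule: homogeneous_pair_induct)
    fix u v w assume "u \<in> asp A" "v \<in> asp A" "w \<in> asp A" "P (amul A u w)" "P (amul A v w)"
    then show "P (amul A (u + v) w)" using assms(4) by (simp add: mul_add_left mul_mem)
  next
    fix u v w assume "u \<in> asp A" "v \<in> asp A" "w \<in> asp A" "P (amul A u v)" "P (amul A u w)"
    then show "P (amul A u (v + w))" using assms(4) by (simp add: mul_add_right mul_mem)
  qed (rule assms(3))
  then have "{amul A x y | x y. x \<in> asp A \<and> y \<in> asp A} \<subseteq> ?V" using mul_mem by auto
  moreover have "alg_subspace A ?V"
    unfolding alg_subspace_def using assms(2,4,5) add_mem scal_mem by auto
  ultimately have "alg_square A \<subseteq> ?V" unfolding alg_square_def alg_span_def by (intro Inter_lower) auto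
  then show ?thesis using assms(1) by auto
qed

text \<open>Run \<open>square_induct\<close> on the predicate that the degree k part satisfies P: a
  product of homogeneous elements of another total degree has degree k part 0. A claim about one
  component thus reduces to products that land in it.\<close>

lemma square_comp_induct [consumes 3, case_names zero mul add scal]:
  assumes "alg_square A = asp A" "k \<in> carrier \<Gamma>" "z \<in> acomp A k" "P 0"
    and "\<And>g h x y. \<lbrakk>g \<in> carrier \<Gamma>; h \<in> carrier \<Gamma>; g \<otimes> h = k; x \<in> acomp A g; y \<in> acomp A h\<rbrakk> \<Longrightarrow> P (amul A x y)"
    and "\<And>x y. \<lbrakk>x \<in> acomp A k; y \<in> acomp A k; P x; P y\<rbrakk> \<Longrightarrow> P (x + y)"
    and "\<And>a x. \<lbrakk>x \<in> acomp A k; P x\<rbrakk> \<Longrightarrow> P (ascal A a x)"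
  shows "P z"
proof -
  have "z \<in> alg_square A" using assms comp_mem by simp
  then have "P (hcomp \<Gamma> A z k)"
  proof (induction z rule: square_induct)
    case (mul g h x y)
    then have "hcomp \<Gamma> A (amul A x y) k = (if k = g \<otimes> h then amul A x y else 0)"
      using hcomp_homogeneous mul_comp by (metis m_closed)
    then show ?case using assms mul by auto
  qed (use assms in \<open>auto simp: hcomp_add hcomp_scal hcomp_comp\<close>)
  then show ?thesis using assms by (simp add: hcomp_homogeneous)
qed

end

section \<open>Graded simplicity expressed in homogeneous components\<close>

definition ideal_family :: "('i, 'm) monoid_scheme \<Rightarrow> ('a::ab_group_add, 'f::field, 'i) galg
    \<Rightarrow> ('i \<Rightarrow> 'a set) \<Rightarrow> bool" where
  "ideal_family \<Gamma> A J \<longleftrightarrow>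
     (\<forall>g\<in>carrier \<Gamma>. J g \<subseteq> acomp A g \<and> 0 \<in> J g \<and> (\<forall>x\<in>J g. \<forall>y\<in>J g. x + y \<in> J g) \<and>
        (\<forall>a. \<forall>x\<in>J g. ascal A a x \<in> J g)) \<and>
     (\<forall>g\<in>carrier \<Gamma>. \<forall>h\<in>carrier \<Gamma>. \<forall>x\<in>acomp A g. \<forall>y\<in>J h.
        amul A x y \<in> J (g \<otimes>\<^bsub>\<Gamma>\<^esub> h) \<and> amul A y x \<in> J (h \<otimes>\<^bsub>\<Gamma>\<^esub> g))"

context graded_algebra
begin

text \<open>Stability under homogeneous factors spreads to arbitrary factors, and then to arbitrary
  elements of I, through their decompositions. Working with the family J in place of I allows ideals
  of an algebra graded by G/H and of its loop to be compared component by component.\<close>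

lemma ideal_family_graded_ideal:
  assumes "ideal_family \<Gamma> A J"
  defines "I \<equiv> {x \<in> asp A. \<forall>g\<in>carrier \<Gamma>. hcomp \<Gamma> A x g \<in> J g}"
  shows "graded_ideal \<Gamma> A I" and "g \<in> carrier \<Gamma> \<Longrightarrow> I \<inter> acomp A g = J g"
proof -
  have J: "J g \<subseteq> acomp A g" "0 \<in> J g" "\<And>x y. x \<in> J g \<Longrightarrow> y \<in> J g \<Longrightarrow> x + y \<in> J g"
      "\<And>a x. x \<in> J g \<Longrightarrow> ascal A a x \<in> J g" if "g \<in> carrier \<Gamma>" for g
    using assms(1) that unfolding ideal_family_def by blast+
  have JM: "amul A x y \<in> J (g \<otimes> h)" "amul A y x \<in> J (h \<otimes> g)"
    if "g \<in> carrier \<Gamma>" "h \<in> carrier \<Gamma>" "x \<in> acomp A g" "y \<in> J h" for g h x y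
    using assms(1) that unfolding ideal_family_def by blast+
  have JI: "x \<in> I" if "g \<in> carrier \<Gamma>" "x \<in> J g" for g x
    unfolding I_def using that J comp_mem by (auto simp: hcomp_homogeneous subset_iff)
  show *: "I \<inter> acomp A g = J g" if "g \<in> carrier \<Gamma>" for g
    using that JI J(1)[OF that] unfolding I_def by (auto simp: hcomp_homogeneous subset_iff)
  have IA: "I \<subseteq> asp A" unfolding I_def by auto
  have I0: "0 \<in> I" and Iadd: "\<And>x y. x \<in> I \<Longrightarrow> y \<in> I \<Longrightarrow> x + y \<in> I"
    and Iscal: "\<And>a x. x \<in> I \<Longrightarrow> ascal A a x \<in> I"
    unfolding I_def by (auto simp: J hcomp_add hcomp_scal add_mem scal_mem)
  have Ihom: "hcomp \<Gamma> A x g \<in> I" if "x \<in> I" "g \<in> carrier \<Gamma>" for x g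
    using that JI unfolding I_def by blast
  have mul1: "amul A x u \<in> I \<and> amul A u x \<in> I" if "x \<in> asp A" "h \<in> carrier \<Gamma>" "u \<in> J h" for x h u
    using that(1)
  proof (induction x rule: homogeneous_induct)
    case zero then show ?case using that I0 IA JI by (auto simp: subset_iff)
  next
    case (homogeneous g x) then show ?case using JM JI that by (meson m_closed)
  next
    case (add x y)
    moreover have "u \<in> asp A" using that IA JI by blast
    ultimately show ?case using Iadd by (simp add: mul_add_left mul_add_right)
  qed
  have mul: "amul A x y \<in> I \<and> amul A y x \<in> I" if x: "x \<in> asp A" and y: "y \<in> I" for x y
  proof -
    have "amul A x (sum (hcomp \<Gamma> A y) S) \<in> I \<and> amul A (sum (hcomp \<Gamma> A y) S) x \<in> I"
      if "finite S" "S \<subseteq> carrier \<Gamma>" for S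
      using that
    proof (induction S rule: finite_induct)
      case empty then show ?case using x I0 by simp
    next
      case (insert g S)
      have "hcomp \<Gamma> A y g \<in> J g" using insert y unfolding I_def by auto
      then have "amul A x (hcomp \<Gamma> A y g) \<in> I \<and> amul A (hcomp \<Gamma> A y g) x \<in> I"
        using mul1[OF x] insert by auto
      moreover have "hcomp \<Gamma> A y g \<in> asp A" "sum (hcomp \<Gamma> A y) S \<in> asp A"
        using y IA hcomp_mem by (auto intro!: sum_mem)
      ultimately show ?case using insert x Iadd by (simp add: mul_add_left mul_add_right)
    qed
    from this[of "gsupp \<Gamma> A y"] show ?thesis
      using sum_hcomp[of y] y IA finite_gsupp[of y] gsupp_carrier by auto
  qed
  show "graded_ideal \<Gamma> A I"
    unfolding graded_ideal_def alg_ideal_def alg_subspace_def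
    using IA I0 Iadd Iscal mul Ihom by auto
qed

lemma graded_ideal_ideal_family:
  assumes "graded_ideal \<Gamma> A I" shows "ideal_family \<Gamma> A (\<lambda>g. I \<inter> acomp A g)"
proof -
  have I: "I \<subseteq> asp A" "0 \<in> I" "\<And>x y. x \<in> I \<Longrightarrow> y \<in> I \<Longrightarrow> x + y \<in> I" "\<And>a x. x \<in> I \<Longrightarrow> ascal A a x \<in> I"
    "\<And>x y. x \<in> asp A \<Longrightarrow> y \<in> I \<Longrightarrow> amul A x y \<in> I \<and> amul A y x \<in> I"
    using assms unfolding graded_ideal_def alg_ideal_def alg_subspace_def by auto
  show ?thesis unfolding ideal_family_def
    using I comp_zero comp_add comp_scal mul_comp comp_mem by (intro conjI ballI allI) auto
qed

lemma asp_nontrivial_iff: "asp A \<noteq> {0} \<longleftrightarrow> (\<exists>g\<in>carrier \<Gamma>. \<exists>x\<in>acomp A g. x \<noteq> 0)"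
proof
  assume "asp A \<noteq> {0}"
  then obtain x where x: "x \<in> asp A" "x \<noteq> 0" using zero_mem by blast
  then obtain g where "g \<in> carrier \<Gamma>" "hcomp \<Gamma> A x g \<noteq> 0" using eq_if_hcomp_eq[of x 0] by auto
  then show "\<exists>g\<in>carrier \<Gamma>. \<exists>x\<in>acomp A g. x \<noteq> 0" using x hcomp_comp by blast
qed (use comp_mem in blast)

text \<open>Being a graded ideal, A^2 is 0 or everything once there are no proper graded ideals. The
  criterion below can therefore ask for one nonzero product of homogeneous elements in place of A^2
  = A.\<close>

lemma graded_square_ideal: "graded_ideal \<Gamma> A (alg_square A)"
proof -
  have sub: "alg_square A \<subseteq> asp A" using alg_square_subspace unfolding alg_subspace_def by auto
  have "hcomp \<Gamma> A x g \<in> alg_square A" if g: "g \<in> carrier \<Gamma>" and x: "x \<in> alg_square A" for g x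
    using x
  proof (induction x rule: square_induct)
    case (mul h k x y)
    then have "hcomp \<Gamma> A (amul A x y) g = (if g = h \<otimes> k then amul A x y else 0)"
      using hcomp_homogeneous mul_comp by (metis m_closed)
    then show ?case
      using mul alg_square_mul comp_mem alg_square_subspace unfolding alg_subspace_def by auto
  qed (use alg_square_subspace in \<open>auto simp: alg_subspace_def hcomp_add hcomp_scal\<close>)
  then show ?thesis
    unfolding graded_ideal_def alg_ideal_def using alg_square_subspace alg_square_mul sub by auto
qed

lemma graded_simple_iff_ideal_family:
  "graded_simple \<Gamma> A \<longleftrightarrow>
     (\<exists>g\<in>carrier \<Gamma>. \<exists>h\<in>carrier \<Gamma>. \<exists>x\<in>acomp A g. \<exists>y\<in>acomp A h. amul A x y \<noteq> 0) \<and>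
     (\<forall>J. ideal_family \<Gamma> A J \<longrightarrow> (\<forall>g\<in>carrier \<Gamma>. J g = {0}) \<or> (\<forall>g\<in>carrier \<Gamma>. J g = acomp A g))"
  (is "_ \<longleftrightarrow> ?M \<and> ?J")
proof
  assume s: "graded_simple \<Gamma> A"
  have sq: "alg_square A = asp A" "asp A \<noteq> {0}" using s unfolding graded_simple_def by auto
  have ?M
  proof (rule ccontr)
    assume n: "\<not> ?M"
    have "z = 0" if "z \<in> alg_square A" for z
      using that by (induction z rule: square_induct) (use n in auto)
    then show False using sq zero_mem by blast
  qed
  moreover have ?J
  proof (intro allI impI)
    fix J assume J: "ideal_family \<Gamma> A J"
    let ?I = "{x \<in> asp A. \<forall>g\<in>carrier \<Gamma>. hcomp \<Gamma> A x g \<in> J g}"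
    have "?I = {0} \<or> ?I = asp A"
      using s ideal_family_graded_ideal(1)[OF J] unfolding graded_simple_def by blast
    then show "(\<forall>g\<in>carrier \<Gamma>. J g = {0}) \<or> (\<forall>g\<in>carrier \<Gamma>. J g = acomp A g)"
    proof
      assume I: "?I = {0}"
      have "J g = {0}" if "g \<in> carrier \<Gamma>" for g
        using ideal_family_graded_ideal(2)[OF J that] comp_zero[OF that] unfolding I by auto
      then show ?thesis by blast
    next
      assume I: "?I = asp A"
      have "J g = acomp A g" if "g \<in> carrier \<Gamma>" for g
        using ideal_family_graded_ideal(2)[OF J that] comp_mem[OF that] unfolding I by auto
      then show ?thesis by blast
    qed
  qed
  ultimately show "?M \<and> ?J" ..
next
  assume MJ: "?M \<and> ?J"
  have gr: "graded \<Gamma> A" using graded_iff_graded_algebra graded_algebra_axioms by blast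
  have triv: "I = {0} \<or> I = asp A" if I: "graded_ideal \<Gamma> A I" for I
  proof -
    have IA: "I \<subseteq> asp A" "0 \<in> I" and hom: "\<And>x g. x \<in> I \<Longrightarrow> g \<in> carrier \<Gamma> \<Longrightarrow> hcomp \<Gamma> A x g \<in> I"
      and add: "\<And>x y. x \<in> I \<Longrightarrow> y \<in> I \<Longrightarrow> x + y \<in> I"
      using I unfolding graded_ideal_def alg_ideal_def alg_subspace_def by auto
    consider "\<forall>g\<in>carrier \<Gamma>. I \<inter> acomp A g = {0}" | "\<forall>g\<in>carrier \<Gamma>. I \<inter> acomp A g = acomp A g"
      using MJ graded_ideal_ideal_family[OF I] by blast
    then show ?thesis
    proof cases
      case 1
      have "x = 0" if x: "x \<in> I" for x
      proof (rule eq_if_hcomp_eq[of x 0])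
        fix g assume g: "g \<in> carrier \<Gamma>"
        then have "hcomp \<Gamma> A x g \<in> I \<inter> acomp A g" using hom hcomp_comp x IA by blast
        then show "hcomp \<Gamma> A x g = hcomp \<Gamma> A 0 g" using 1 g by simp
      qed (use x IA in auto)
      then show ?thesis using IA by blast
    next
      case 2
      have "x \<in> I" if "x \<in> asp A" for x
        using that by (induction x rule: homogeneous_induct) (use 2 IA add in auto)
      then show ?thesis using IA by blast
    qed
  qed
  obtain g h x y where "g \<in> carrier \<Gamma>" "h \<in> carrier \<Gamma>" "x \<in> acomp A g" "y \<in> acomp A h"
    and "amul A x y \<noteq> 0" using MJ by fast
  then have xy: "x \<in> asp A" "y \<in> asp A" "amul A x y \<noteq> 0" using comp_mem by auto
  then have "alg_square A \<noteq> {0}" using alg_square_mul by blast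
  then show "graded_simple \<Gamma> A"
    unfolding graded_simple_def using gr triv graded_square_ideal xy by auto
qed

end

text \<open>The glued map acts degree by degree (\<open>p_hcomp\<close>), so injectivity and
  surjectivity are inherited from the components, and multiplicativity from pairs of homogeneous
  elements.\<close>

lemma graded_iso_from_family:
  assumes "graded_algebra \<Gamma> A" "graded_algebra \<Gamma> B"
    and add: "additive_family \<Gamma> A f"
    and scal: "\<And>g u a. \<lbrakk>g \<in> carrier \<Gamma>; u \<in> acomp A g\<rbrakk> \<Longrightarrow> f g (ascal A a u) = ascal B a (f g u)"
    and bij: "\<And>g. g \<in> carrier \<Gamma> \<Longrightarrow> bij_betw (f g) (acomp A g) (acomp B g)"
    and mul: "\<And>g h u v. \<lbrakk>g \<in> carrier \<Gamma>; h \<in> carrier \<Gamma>; u \<in> acomp A g; v \<in> acomp A h\<rbrakk>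
               \<Longrightarrow> f (g \<otimes>\<^bsub>\<Gamma>\<^esub> h) (amul A u v) = amul B (f g u) (f h v)"
  shows "graded_iso \<Gamma> A B"
proof -
  interpret A: graded_algebra \<Gamma> A by fact
  interpret B: graded_algebra \<Gamma> B by fact
  let ?p = "gext \<Gamma> A f"
  have f_comp: "f g u \<in> acomp B g" if "g \<in> carrier \<Gamma>" "u \<in> acomp A g" for g u
    using bij that bij_betwE by blast
  have p_hom: "?p u = f g u" if "g \<in> carrier \<Gamma>" "u \<in> acomp A g" for g u
    using A.gext_homogeneous[OF add] that by blast
  have p_mem: "?p x \<in> asp B" if "x \<in> asp A" for x
    by (rule A.gext_mem[OF that B.graded_space_axioms]) (use f_comp B.comp_mem in blast)
  have p_add: "?p (x + y) = ?p x + ?p y" if "x \<in> asp A" "y \<in> asp A" for x y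
    using A.gext_add[OF add that] .
  have p_scal: "?p (ascal A a x) = ascal B a (?p x)" if "x \<in> asp A" for a x
    by (rule A.gext_scal[OF that add B.graded_space_axioms]) (use f_comp B.comp_mem scal in blast)+
  have p_hcomp: "hcomp \<Gamma> B (?p x) g = f g (hcomp \<Gamma> A x g)" if "x \<in> asp A" "g \<in> carrier \<Gamma>" for x g
    using that(1)
  proof (induction x rule: A.homogeneous_induct)
    case zero
    have "?p 0 = 0" using p_add[of 0 0] by simp
    then show ?case using A.additive_family_zero[OF add] that by simp
  next
    case (homogeneous h x)
    then show ?case using p_hom f_comp A.additive_family_zero[OF add] that
      by (simp add: A.hcomp_homogeneous[of h] B.hcomp_homogeneous[of h])
  next
    case (add x y)
    then show ?case using assms(3) that A.hcomp_comp
      by (simp add: p_add B.hcomp_add p_mem A.hcomp_add additive_family_def)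
  qed
  have "inj_on ?p (asp A)"
  proof (rule inj_onI)
    fix x y assume xy: "x \<in> asp A" "y \<in> asp A" "?p x = ?p y"
    show "x = y"
    proof (rule A.eq_if_hcomp_eq[OF xy(1,2)])
      fix g assume g: "g \<in> carrier \<Gamma>"
      then have "f g (hcomp \<Gamma> A x g) = f g (hcomp \<Gamma> A y g)" using p_hcomp xy by metis
      then show "hcomp \<Gamma> A x g = hcomp \<Gamma> A y g"
        using bij[OF g] A.hcomp_comp g xy unfolding bij_betw_def by (auto dest: inj_onD)
    qed
  qed
  moreover have "y \<in> ?p ` asp A" if "y \<in> asp B" for y
    using that
  proof (induction y rule: B.homogeneous_induct)
    case zero
    have "?p 0 = 0" using p_add[of 0 0] by simp
    then show ?case by (intro image_eqI[of _ _ 0]) simp_all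
  next
    case (homogeneous g y)
    have "f g ` acomp A g = acomp B g" using bij homogeneous(1) by (simp add: bij_betw_def)
    then obtain x where "x \<in> acomp A g" "f g x = y" using homogeneous(2) by (metis imageE)
    then have "x \<in> asp A" "?p x = y" using p_hom homogeneous A.comp_mem by auto
    then show ?case by (intro image_eqI[of _ _ x]) simp_all
  next
    case (add x y)
    then obtain u v where "u \<in> asp A" "v \<in> asp A" "x = ?p u" "y = ?p v" by (auto simp: image_iff)
    then show ?case using p_add[of u v] A.add_mem[of u v] by (intro image_eqI[of _ _ "u + v"]) simp_all
  qed
  ultimately have b: "bij_betw ?p (asp A) (asp B)" unfolding bij_betw_def using p_mem by blast
  have p_mul: "?p (amul A x y) = amul B (?p x) (?p y)" if "x \<in> asp A" "y \<in> asp A" for x y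
    using that
  proof (induction x y rule: A.homogeneous_pair_induct)
    fix g h u v assume *: "g \<in> carrier \<Gamma>" "h \<in> carrier \<Gamma>" "u \<in> acomp A g" "v \<in> acomp A h"
    show "?p (amul A u v) = amul B (?p u) (?p v)"
      using mul[OF *] p_hom[of g u] p_hom[of h v] p_hom[of "g \<otimes>\<^bsub>\<Gamma>\<^esub> h" "amul A u v"] A.mul_comp[OF *] *
      by simp
  next
    fix u v w assume "u \<in> asp A" "v \<in> asp A" "w \<in> asp A" "?p (amul A u w) = amul B (?p u) (?p w)"
      "?p (amul A v w) = amul B (?p v) (?p w)"
    then show "?p (amul A (u + v) w) = amul B (?p (u + v)) (?p w)"
      by (simp add: A.mul_add_left p_add A.mul_mem B.mul_add_left p_mem)
  next
    fix u v w assume "u \<in> asp A" "v \<in> asp A" "w \<in> asp A" "?p (amul A u v) = amul B (?p u) (?p v)"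
      "?p (amul A u w) = amul B (?p u) (?p w)"
    then show "?p (amul A u (v + w)) = amul B (?p u) (?p (v + w))"
      by (simp add: A.mul_add_right p_add A.mul_mem B.mul_add_right p_mem)
  qed
  have "?p ` acomp A g = acomp B g" if "g \<in> carrier \<Gamma>" for g
  proof -
    have "?p ` acomp A g = f g ` acomp A g" using p_hom that by (intro image_cong) auto
    then show ?thesis using bij[OF that] by (simp add: bij_betw_def)
  qed
  then show ?thesis unfolding graded_iso_def using b p_add p_scal p_mul by (intro exI[of _ ?p]) auto
qed

lemma graded_isoE:
  assumes "graded_iso \<Gamma> A B"
  obtains p where "bij_betw p (asp A) (asp B)"
    and "\<And>x y. \<lbrakk>x \<in> asp A; y \<in> asp A\<rbrakk> \<Longrightarrow> p (x + y) = p x + p y"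
    and "\<And>a x. x \<in> asp A \<Longrightarrow> p (ascal A a x) = ascal B a (p x)"
    and "\<And>x y. \<lbrakk>x \<in> asp A; y \<in> asp A\<rbrakk> \<Longrightarrow> p (amul A x y) = amul B (p x) (p y)"
    and "\<And>g. g \<in> carrier \<Gamma> \<Longrightarrow> p ` acomp A g = acomp B g"
proof -
  obtain p where p: "bij_betw p (asp A) (asp B)"
      "\<forall>x\<in>asp A. \<forall>y\<in>asp A. p (x + y) = p x + p y"
      "\<forall>a. \<forall>x\<in>asp A. p (ascal A a x) = ascal B a (p x)"
      "\<forall>x\<in>asp A. \<forall>y\<in>asp A. p (amul A x y) = amul B (p x) (p y)"
      "\<forall>g\<in>carrier \<Gamma>. p ` acomp A g = acomp B g"
    using assms unfolding graded_iso_def by (elim exE conjE)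
  show thesis by (rule that[OF p(1)]) (simp_all add: p)
qed

lemma graded_iso_sym:
  assumes "graded_algebra \<Gamma> A" "graded_iso \<Gamma> A B"
  shows "graded_iso \<Gamma> B A"
proof -
  interpret A: graded_algebra \<Gamma> A by fact
  obtain p where b: "bij_betw p (asp A) (asp B)"
    and add: "\<And>x y. x \<in> asp A \<Longrightarrow> y \<in> asp A \<Longrightarrow> p (x + y) = p x + p y"
    and scal: "\<And>a x. x \<in> asp A \<Longrightarrow> p (ascal A a x) = ascal B a (p x)"
    and mul: "\<And>x y. x \<in> asp A \<Longrightarrow> y \<in> asp A \<Longrightarrow> p (amul A x y) = amul B (p x) (p y)"
    and comp: "\<And>g. g \<in> carrier \<Gamma> \<Longrightarrow> p ` acomp A g = acomp B g"
    using assms(2) by (rule graded_isoE) (rule that; assumption)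
  define q where "q = the_inv_into (asp A) p"
  have qp: "q (p x) = x" if "x \<in> asp A" for x
    unfolding q_def using b that by (simp add: bij_betw_def the_inv_into_f_f)
  have B: "\<exists>x\<in>asp A. y = p x" if "y \<in> asp B" for y
    using b that unfolding bij_betw_def by auto
  have "bij_betw q (asp B) (asp A)" unfolding q_def using b by (rule bij_betw_the_inv_into)
  moreover have "q (x + y) = q x + q y" "q (amul B x y) = amul A (q x) (q y)"
    if "x \<in> asp B" "y \<in> asp B" for x y
    using B[OF that(1)] B[OF that(2)] by (auto simp: qp A.add_mem A.mul_mem add[symmetric] mul[symmetric])
  moreover have "q (ascal B a x) = ascal A a (q x)" if "x \<in> asp B" for a x
    using B[OF that(1)] by (auto simp: qp A.scal_mem scal[symmetric])
  moreover have "q ` acomp B g = acomp A g" if "g \<in> carrier \<Gamma>" for g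
    using comp[OF that, symmetric] qp A.comp_mem[OF that] by (force simp: image_iff)
  ultimately show ?thesis unfolding graded_iso_def by (intro exI[of _ q]) auto
qed

subsection \<open>The centroid of a graded algebra\<close>

lemma sum_fun_apply: "(\<Sum>i\<in>S. f i) x = (\<Sum>i\<in>S. f i x)"
  by (induction S rule: infinite_finite_induct) auto

text \<open>The total function that represents a centroid element: 0 off the carrier, as
  \<open>centroid\<close> requires, so that equal centroid elements are equal functions.\<close>

definition cext :: "('i, 'm) monoid_scheme \<Rightarrow> ('a::ab_group_add, 'f::field, 'i) galg
    \<Rightarrow> ('i \<Rightarrow> 'a \<Rightarrow> 'a) \<Rightarrow> 'a \<Rightarrow> 'a" where
  "cext \<Gamma> A d x = (if x \<in> asp A then gext \<Gamma> A d x else 0)"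

text \<open>The degree k component of c in the grading of the centroid: of c u, with u of degree g,
  only the part of degree k g is kept.\<close>

definition cproj :: "('i, 'm) monoid_scheme \<Rightarrow> ('a::ab_group_add, 'f::field, 'i) galg
    \<Rightarrow> 'i \<Rightarrow> ('a \<Rightarrow> 'a) \<Rightarrow> 'a \<Rightarrow> 'a" where
  "cproj \<Gamma> A k c = cext \<Gamma> A (\<lambda>g u. hcomp \<Gamma> A (c u) (k \<otimes>\<^bsub>\<Gamma>\<^esub> g))"

lemma centroidD:
  assumes "c \<in> centroid A"
  shows "x \<in> asp A \<Longrightarrow> c x \<in> asp A" "x \<notin> asp A \<Longrightarrow> c x = 0"
    "\<lbrakk>x \<in> asp A; y \<in> asp A\<rbrakk> \<Longrightarrow> c (x + y) = c x + c y"
    "x \<in> asp A \<Longrightarrow> c (ascal A a x) = ascal A a (c x)"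
    "\<lbrakk>x \<in> asp A; y \<in> asp A\<rbrakk> \<Longrightarrow> c (amul A x y) = amul A (c x) y"
    "\<lbrakk>x \<in> asp A; y \<in> asp A\<rbrakk> \<Longrightarrow> c (amul A x y) = amul A x (c y)"
  using assms unfolding centroid_def by blast+

lemma centroidI:
  assumes "\<And>x. x \<in> asp A \<Longrightarrow> c x \<in> asp A" "\<And>x. x \<notin> asp A \<Longrightarrow> c x = 0"
    "\<And>x y. \<lbrakk>x \<in> asp A; y \<in> asp A\<rbrakk> \<Longrightarrow> c (x + y) = c x + c y"
    "\<And>a x. x \<in> asp A \<Longrightarrow> c (ascal A a x) = ascal A a (c x)"
    "\<And>x y. \<lbrakk>x \<in> asp A; y \<in> asp A\<rbrakk> \<Longrightarrow> c (amul A x y) = amul A (c x) y"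
    "\<And>x y. \<lbrakk>x \<in> asp A; y \<in> asp A\<rbrakk> \<Longrightarrow> c (amul A x y) = amul A x (c y)"
  shows "c \<in> centroid A"
  using assms unfolding centroid_def by auto

lemma centroid_compD:
  assumes "c \<in> centroid_comp \<Gamma> A k"
  shows "c \<in> centroid A" "\<lbrakk>g \<in> carrier \<Gamma>; x \<in> acomp A g\<rbrakk> \<Longrightarrow> c x \<in> acomp A (k \<otimes>\<^bsub>\<Gamma>\<^esub> g)"
  using assms unfolding centroid_comp_def by auto

context graded_algebra
begin

lemma centroid_zero: "c \<in> centroid A \<Longrightarrow> c 0 = 0"
  using centroidD(3)[of c A 0 0] by simp

lemma centroid_ext:
  assumes "c \<in> centroid A" "d \<in> centroid A"
    and "\<And>g x. \<lbrakk>g \<in> carrier \<Gamma>; x \<in> acomp A g\<rbrakk> \<Longrightarrow> c x = d x"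
  shows "c = d"
proof
  fix x
  show "c x = d x"
  proof (cases "x \<in> asp A")
    case True
    then show ?thesis
      by (induction x rule: homogeneous_induct) (use assms in \<open>auto simp: centroid_zero centroidD\<close>)
  qed (use assms in \<open>auto simp: centroidD\<close>)
qed

lemma zero_centroid_comp: "k \<in> carrier \<Gamma> \<Longrightarrow> 0 \<in> centroid_comp \<Gamma> A k"
  unfolding centroid_comp_def centroid_def by (auto simp: comp_zero)

lemma zero_centroid: "0 \<in> centroid A"
  using centroid_compD(1)[OF zero_centroid_comp[OF one_closed]] .

text \<open>The common source of centroid elements: homogeneous projections, lifts to a loop,
  descents to a base, and the correspondence between two components of an ideal are all given by
  such a family \<open>d\<close>.\<close>

lemma cext_centroid_comp:
  assumes k: "k \<in> carrier \<Gamma>"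
    and add: "additive_family \<Gamma> A d"
    and comp: "\<And>g u. \<lbrakk>g \<in> carrier \<Gamma>; u \<in> acomp A g\<rbrakk> \<Longrightarrow> d g u \<in> acomp A (k \<otimes> g)"
    and scal: "\<And>g u a. \<lbrakk>g \<in> carrier \<Gamma>; u \<in> acomp A g\<rbrakk> \<Longrightarrow> d g (ascal A a u) = ascal A a (d g u)"
    and mul_left: "\<And>g h u v. \<lbrakk>g \<in> carrier \<Gamma>; h \<in> carrier \<Gamma>; u \<in> acomp A g; v \<in> acomp A h\<rbrakk>
        \<Longrightarrow> d (g \<otimes> h) (amul A u v) = amul A (d g u) v"
    and mul_right: "\<And>g h u v. \<lbrakk>g \<in> carrier \<Gamma>; h \<in> carrier \<Gamma>; u \<in> acomp A g; v \<in> acomp A h\<rbrakk>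
        \<Longrightarrow> d (g \<otimes> h) (amul A u v) = amul A u (d h v)"
  shows "cext \<Gamma> A d \<in> centroid_comp \<Gamma> A k"
    and "\<lbrakk>g \<in> carrier \<Gamma>; u \<in> acomp A g\<rbrakk> \<Longrightarrow> cext \<Gamma> A d u = d g u"
proof -
  let ?c = "cext \<Gamma> A d"
  have gs: "graded_space \<Gamma> A" by unfold_locales
  have d_mem: "d g u \<in> asp A" if "g \<in> carrier \<Gamma>" "u \<in> acomp A g" for g u
    using comp[OF that] comp_mem[of "k \<otimes> g"] k that by simp
  show hom: "?c u = d g u" if "g \<in> carrier \<Gamma>" "u \<in> acomp A g" for g u
    using gext_homogeneous[OF add that] comp_mem[OF that] by (simp add: cext_def)
  have mem: "?c x \<in> asp A" if "x \<in> asp A" for x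
    using gext_mem[OF that gs, of d] d_mem that by (simp add: cext_def)
  have c_add: "?c (x + y) = ?c x + ?c y" if "x \<in> asp A" "y \<in> asp A" for x y
    using gext_add[OF add that] that by (simp add: cext_def add_mem)
  have c_scal: "?c (ascal A a x) = ascal A a (?c x)" if "x \<in> asp A" for a x
    using gext_scal[OF that add gs d_mem scal] that by (simp add: cext_def scal_mem)
  have c_mul: "?c (amul A x y) = amul A (?c x) y \<and> ?c (amul A x y) = amul A x (?c y)"
    if "x \<in> asp A" "y \<in> asp A" for x y
    using that
  proof (induction x y rule: homogeneous_pair_induct)
    case (homogeneous g h u v)
    then have "amul A u v \<in> acomp A (g \<otimes> h)" using mul_comp by simp
    then show ?case using homogeneous mul_left mul_right hom by (metis m_closed)
  next
    case (add_left u v w)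
    then have "?c (amul A (u + v) w) = ?c (amul A u w) + ?c (amul A v w)"
      by (simp add: mul_add_left c_add mul_mem)
    with add_left show ?case
      by (metis c_add mem mul_add_left)
  next
    case (add_right u v w)
    then have "?c (amul A u (v + w)) = ?c (amul A u v) + ?c (amul A u w)"
      by (simp add: mul_add_right c_add mul_mem)
    with add_right show ?case
      by (metis c_add mem mul_add_right)
  qed
  have out: "?c x = 0" if "x \<notin> asp A" for x using that by (simp add: cext_def)
  have "?c \<in> centroid A"
    by (rule centroidI[OF mem out c_add c_scal conjunct1[OF c_mul] conjunct2[OF c_mul]])
  then show "?c \<in> centroid_comp \<Gamma> A k" unfolding centroid_comp_def using hom comp by auto
qed

lemma hcomp_centroid_comp:
  assumes "c \<in> centroid_comp \<Gamma> A k" "k \<in> carrier \<Gamma>" "g \<in> carrier \<Gamma>" "x \<in> asp A"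
  shows "hcomp \<Gamma> A (c x) (k \<otimes> g) = c (hcomp \<Gamma> A x g)"
  using assms(4)
proof (induction x rule: homogeneous_induct)
  case zero
  then show ?case using centroid_zero[OF centroid_compD(1)[OF assms(1)]] by simp
next
  case (homogeneous h x)
  then show ?case
    using centroid_compD[OF assms(1)] centroid_zero[OF centroid_compD(1)[OF assms(1)]] assms(2,3)
    by (simp add: hcomp_homogeneous[of h] hcomp_homogeneous[of "k \<otimes> h"])
next
  case (add x y)
  then show ?case
    using centroid_compD(1)[OF assms(1)] by (simp add: centroidD hcomp_add hcomp_mem)
qed

lemma centroid_add: "\<lbrakk>c \<in> centroid A; d \<in> centroid A\<rbrakk> \<Longrightarrow> c + d \<in> centroid A"
  using centroidD(5,6)[of c A] centroidD(5,6)[of d A]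
  by (intro centroidI)
     (auto simp: centroidD(1-4) add_mem scal_add_right scal_mem mul_add_left mul_add_right algebra_simps)

lemma centroid_scal:
  assumes c: "c \<in> centroid A" shows "(\<lambda>x. ascal A a (c x)) \<in> centroid A"
proof (rule centroidI)
  fix x y assume xy: "x \<in> asp A" "y \<in> asp A"
  show "ascal A a (c (amul A x y)) = amul A (ascal A a (c x)) y"
    using xy c centroidD(5)[OF c xy] by (simp add: mul_scal_left centroidD(1))
  show "ascal A a (c (amul A x y)) = amul A x (ascal A a (c y))"
    using xy c centroidD(6)[OF c xy] by (simp add: mul_scal_right centroidD(1))
qed (use c in \<open>auto simp: centroidD(1-4) scal_mem scal_add_right scal_scal mult.commute\<close>)

lemma centroid_compose:
  assumes c: "c \<in> centroid A" and d: "d \<in> centroid A" shows "c \<circ> d \<in> centroid A"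
proof (rule centroidI)
  fix x y assume xy: "x \<in> asp A" "y \<in> asp A"
  show "(c \<circ> d) (amul A x y) = amul A ((c \<circ> d) x) y"
    using xy d centroidD(5)[OF d xy] centroidD(5)[OF c, of "d x" y] by (simp add: centroidD(1))
  show "(c \<circ> d) (amul A x y) = amul A x ((c \<circ> d) y)"
    using xy d centroidD(6)[OF d xy] centroidD(6)[OF c, of x "d y"] by (simp add: centroidD(1))
qed (use c d in \<open>auto simp: centroidD(1-4) centroid_zero\<close>)

lemma centroid_comp_add: "\<lbrakk>k \<in> carrier \<Gamma>; c \<in> centroid_comp \<Gamma> A k; d \<in> centroid_comp \<Gamma> A k\<rbrakk> \<Longrightarrow> c + d \<in> centroid_comp \<Gamma> A k"
  unfolding centroid_comp_def by (auto simp: centroid_add comp_add)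

lemma centroid_comp_scal: "\<lbrakk>k \<in> carrier \<Gamma>; c \<in> centroid_comp \<Gamma> A k\<rbrakk> \<Longrightarrow> (\<lambda>x. ascal A a (c x)) \<in> centroid_comp \<Gamma> A k"
  unfolding centroid_comp_def by (auto simp: centroid_scal comp_scal)

lemma centroid_comp_compose:
  "\<lbrakk>g \<in> carrier \<Gamma>; h \<in> carrier \<Gamma>; c \<in> centroid_comp \<Gamma> A g; d \<in> centroid_comp \<Gamma> A h\<rbrakk>
     \<Longrightarrow> c \<circ> d \<in> centroid_comp \<Gamma> A (g \<otimes> h)"
  unfolding centroid_comp_def by (auto simp: centroid_compose m_assoc)

text \<open>On a product the two maps can be moved to different factors: both composites send x y to
  (c x) (d y). Since A is spanned by products, this suffices. It is the source of the symmetry of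
  the cocycle obtained from a centroid.\<close>

lemma centroid_commute:
  assumes "alg_square A = asp A" "c \<in> centroid A" "d \<in> centroid A" "x \<in> asp A"
  shows "c (d x) = d (c x)"
proof -
  have "x \<in> alg_square A" using assms by simp
  then show ?thesis
  proof (induction x rule: square_induct)
    case (mul g h x y)
    then have xy: "x \<in> asp A" "y \<in> asp A" using comp_mem by auto
    have "c (d (amul A x y)) = amul A (c x) (d y)"
      using centroidD(6)[OF assms(3) xy] centroidD(5)[OF assms(2), of x "d y"] xy assms by (simp add: centroidD)
    moreover have "d (c (amul A x y)) = amul A (c x) (d y)"
      using centroidD(5)[OF assms(2) xy] centroidD(6)[OF assms(3), of "c x" y] xy assms by (simp add: centroidD)
    ultimately show ?case by simp
  qed (use assms in \<open>simp_all add: centroidD centroid_zero\<close>)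
qed

lemma scalar_map_centroid_comp: "(\<lambda>x. if x \<in> asp A then ascal A a x else 0) \<in> centroid_comp \<Gamma> A \<one>"
proof -
  have "(\<lambda>x. if x \<in> asp A then ascal A a x else 0) \<in> centroid A"
    by (rule centroidI)
       (auto simp: scal_mem add_mem scal_add_right scal_scal mul_mem mul_scal_left mul_scal_right mult.commute)
  then show ?thesis unfolding centroid_comp_def using comp_mem by (auto simp: comp_scal)
qed

end

section \<open>Homogeneous centroid elements of a graded-simple algebra\<close>

locale graded_simple_algebra = graded_algebra \<Gamma> A + comm_group \<Gamma>
  for \<Gamma> :: "('i, 'm) monoid_scheme" (structure)
    and A :: "('a::ab_group_add, 'f::field, 'i) galg" +
  assumes gr_simple: "graded_simple \<Gamma> A"
begin

lemma square_eq: "alg_square A = asp A" and nontrivial: "asp A \<noteq> {0}"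
  using gr_simple unfolding graded_simple_def by auto

lemma ideal_family_trivial:
  assumes "ideal_family \<Gamma> A J"
  shows "(\<forall>g\<in>carrier \<Gamma>. J g = {0}) \<or> (\<forall>g\<in>carrier \<Gamma>. J g = acomp A g)"
  using assms gr_simple graded_simple_iff_ideal_family by auto

lemma ideal_family_full:
  assumes "ideal_family \<Gamma> A J" "g \<in> carrier \<Gamma>" "x \<in> J g" "x \<noteq> 0" "h \<in> carrier \<Gamma>"
  shows "J h = acomp A h"
  using ideal_family_trivial[OF assms(1)] assms by auto

lemma cproj_centroid_comp:
  assumes "c \<in> centroid A" "k \<in> carrier \<Gamma>"
  shows "cproj \<Gamma> A k c \<in> centroid_comp \<Gamma> A k"
    and "\<lbrakk>g \<in> carrier \<Gamma>; u \<in> acomp A g\<rbrakk> \<Longrightarrow> cproj \<Gamma> A k c u = hcomp \<Gamma> A (c u) (k \<otimes> g)"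
proof -
  let ?d = "\<lambda>g u. hcomp \<Gamma> A (c u) (k \<otimes> g)"
  have add: "additive_family \<Gamma> A ?d"
    unfolding additive_family_def using assms comp_mem by (auto simp: centroidD hcomp_add)
  have comp: "?d g u \<in> acomp A (k \<otimes> g)" if "g \<in> carrier \<Gamma>" "u \<in> acomp A g" for g u
    using that assms comp_mem[OF that] by (simp add: hcomp_comp centroidD)
  have scal: "?d g (ascal A a u) = ascal A a (?d g u)" if "g \<in> carrier \<Gamma>" "u \<in> acomp A g" for g u a
    using that assms comp_mem[OF that] by (simp add: hcomp_scal centroidD)
  have ml: "?d (g \<otimes> h) (amul A u v) = amul A (?d g u) v"
    if "g \<in> carrier \<Gamma>" "h \<in> carrier \<Gamma>" "u \<in> acomp A g" "v \<in> acomp A h" for g h u v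
  proof -
    have uv: "u \<in> asp A" "v \<in> asp A" using that comp_mem by auto
    have "?d (g \<otimes> h) (amul A u v) = hcomp \<Gamma> A (amul A (c u) v) ((k \<otimes> g) \<otimes> h)"
      using that assms centroidD(5)[OF assms(1) uv] by (simp add: m_assoc)
    then show ?thesis using hcomp_mul(1)[of "c u" h v "k \<otimes> g"] uv that assms by (simp add: centroidD)
  qed
  have mr: "?d (g \<otimes> h) (amul A u v) = amul A u (?d h v)"
    if "g \<in> carrier \<Gamma>" "h \<in> carrier \<Gamma>" "u \<in> acomp A g" "v \<in> acomp A h" for g h u v
  proof -
    have uv: "u \<in> asp A" "v \<in> asp A" using that comp_mem by auto
    \<comment> \<open>Commutativity of the grading group enters here: k multiplies the degree from
      the left, while c is moved past the left factor u.\<close>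
    have "?d (g \<otimes> h) (amul A u v) = hcomp \<Gamma> A (amul A u (c v)) (g \<otimes> (k \<otimes> h))"
      using that assms centroidD(6)[OF assms(1) uv] by (simp add: m_lcomm)
    then show ?thesis using hcomp_mul(2)[of "c v" g u "k \<otimes> h"] uv that assms by (simp add: centroidD)
  qed
  show "cproj \<Gamma> A k c \<in> centroid_comp \<Gamma> A k"
    unfolding cproj_def by (rule cext_centroid_comp(1)[OF assms(2) add comp scal ml mr])
  show "cproj \<Gamma> A k c u = ?d g u" if "g \<in> carrier \<Gamma>" "u \<in> acomp A g" for g u
    unfolding cproj_def by (rule cext_centroid_comp(2)[OF assms(2) add comp scal ml mr that])
qed

text \<open>Homogeneity of c makes its kernel a graded ideal, and c \<noteq> 0 keeps it from being
  everything.\<close>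

lemma centroid_comp_inj:
  assumes "c \<in> centroid_comp \<Gamma> A k" "k \<in> carrier \<Gamma>" "c \<noteq> 0" "x \<in> asp A" "c x = 0"
  shows "x = 0"
proof -
  have c: "c \<in> centroid A" using centroid_compD(1)[OF assms(1)] .
  define J where "J g = {u \<in> acomp A g. c u = 0}" for g
  have J: "ideal_family \<Gamma> A J"
    unfolding ideal_family_def J_def using c comp_mem
    by (auto simp: centroid_zero comp_zero comp_add comp_scal centroidD mul_comp)
       (metis c centroidD(5) centroidD(6) comp_mem mul_zero_left mul_zero_right)+
  have "\<not> (\<forall>g\<in>carrier \<Gamma>. J g = acomp A g)"
  proof
    assume a: "\<forall>g\<in>carrier \<Gamma>. J g = acomp A g"
    have "c = 0" by (intro centroid_ext[OF c zero_centroid]) (use a J_def in auto)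
    then show False using assms by simp
  qed
  then have z: "\<forall>g\<in>carrier \<Gamma>. J g = {0}" using ideal_family_trivial[OF J] by auto
  show ?thesis
  proof (rule eq_if_hcomp_eq[OF assms(4) zero_mem])
    fix g assume g: "g \<in> carrier \<Gamma>"
    have "c (hcomp \<Gamma> A x g) = 0" using hcomp_centroid_comp[OF assms(1,2) g assms(4)] assms(5) by simp
    then have "hcomp \<Gamma> A x g \<in> J g" unfolding J_def using hcomp_comp g assms by simp
    then show "hcomp \<Gamma> A x g = hcomp \<Gamma> A 0 g" using z g by simp
  qed
qed

text \<open>The image of c is a graded ideal too, its part of degree h coming from degree
  \<open>inv k \<otimes> h\<close>. It is nonzero by injectivity, hence everything: Schur's lemma
  for the centroid.\<close>

lemma centroid_comp_surj_comp:
  assumes "c \<in> centroid_comp \<Gamma> A k" "k \<in> carrier \<Gamma>" "c \<noteq> 0" "g \<in> carrier \<Gamma>"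
  shows "c ` acomp A g = acomp A (k \<otimes> g)"
proof -
  have c: "c \<in> centroid A" using centroid_compD(1)[OF assms(1)] .
  define J where "J h = c ` acomp A (inv k \<otimes> h)" for h
  have kk: "k \<otimes> (inv k \<otimes> h) = h" "inv k \<otimes> (k \<otimes> h) = h" if "h \<in> carrier \<Gamma>" for h
    using that assms(2) by (simp_all add: m_assoc[symmetric])
  have J: "ideal_family \<Gamma> A J" unfolding ideal_family_def
  proof (intro conjI ballI allI)
    fix g assume g: "g \<in> carrier \<Gamma>"
    have ig: "inv k \<otimes> g \<in> carrier \<Gamma>" using g assms by simp
    show "J g \<subseteq> acomp A g" unfolding J_def using centroid_compD(2)[OF assms(1) ig] kk[OF g] by auto
    show "0 \<in> J g" unfolding J_def using comp_zero[OF ig] centroid_zero[OF c] by (metis imageI)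
    fix x assume "x \<in> J g"
    then obtain u where u: "u \<in> acomp A (inv k \<otimes> g)" "x = c u" unfolding J_def by auto
    have um: "u \<in> asp A" using comp_mem[OF ig] u by simp
    show "ascal A a x \<in> J g" for a
      unfolding J_def u(2) centroidD(4)[OF c um, symmetric] using comp_scal[OF ig u(1)] by simp
    fix y assume "y \<in> J g"
    then obtain v where v: "v \<in> acomp A (inv k \<otimes> g)" "y = c v" unfolding J_def by auto
    have vm: "v \<in> asp A" using comp_mem[OF ig] v by simp
    show "x + y \<in> J g"
      unfolding J_def u(2) v(2) centroidD(3)[OF c um vm, symmetric] using comp_add[OF ig u(1) v(1)] by simp
  next
    fix g h x y assume gh: "g \<in> carrier \<Gamma>" "h \<in> carrier \<Gamma>" and x: "x \<in> acomp A g" and y: "y \<in> J h"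
    have ih: "inv k \<otimes> h \<in> carrier \<Gamma>" using gh assms by simp
    obtain u where u: "u \<in> acomp A (inv k \<otimes> h)" "y = c u" using y unfolding J_def by auto
    have um: "u \<in> asp A" using comp_mem[OF ih] u by simp
    have xm: "x \<in> asp A" using comp_mem gh x by simp
    have "amul A x u \<in> acomp A (inv k \<otimes> (g \<otimes> h))"
      using mul_comp[OF gh(1) ih x u(1)] gh assms by (simp add: m_lcomm)
    then show "amul A x y \<in> J (g \<otimes> h)"
      unfolding J_def u(2) centroidD(6)[OF c xm um, symmetric] by simp
    have "amul A u x \<in> acomp A (inv k \<otimes> (h \<otimes> g))"
      using mul_comp[OF ih gh(1) u(1) x] gh assms by (simp add: m_assoc)
    then show "amul A y x \<in> J (h \<otimes> g)"
      unfolding J_def u(2) centroidD(5)[OF c um xm, symmetric] by simp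
  qed
  obtain h u where hu: "h \<in> carrier \<Gamma>" "u \<in> acomp A h" "u \<noteq> 0" using nontrivial asp_nontrivial_iff by auto
  have "c u \<in> J (k \<otimes> h)" unfolding J_def using hu kk by simp
  moreover have "c u \<noteq> 0" using centroid_comp_inj[OF assms(1-3)] hu comp_mem by auto
  ultimately have "J (k \<otimes> g) = acomp A (k \<otimes> g)"
    using ideal_family_full[OF J, of "k \<otimes> h" "c u" "k \<otimes> g"] hu assms by simp
  then show ?thesis unfolding J_def using kk assms by simp
qed

lemma centroid_comp_bij:
  assumes "c \<in> centroid_comp \<Gamma> A k" "k \<in> carrier \<Gamma>" "c \<noteq> 0"
  shows "bij_betw c (asp A) (asp A)"
proof -
  have c: "c \<in> centroid A" using centroid_compD(1)[OF assms(1)] .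
  have "inj_on c (asp A)"
  proof (rule inj_onI)
    fix x y assume xy: "x \<in> asp A" "y \<in> asp A" "c x = c y"
    have "c (x - y) + c y = c x" using centroidD(3)[OF c, of "x - y" y] xy diff_mem by simp
    then have "c (x - y) = 0" using xy by simp
    then show "x = y" using centroid_comp_inj[OF assms, of "x - y"] xy diff_mem by simp
  qed
  moreover have "x \<in> c ` asp A" if "x \<in> asp A" for x
    using that
  proof (induction x rule: homogeneous_induct)
    case zero
    show ?case using centroid_zero[OF c] by (intro image_eqI[of _ _ 0]) auto
  next
    case (homogeneous g x)
    then have "x \<in> c ` acomp A (inv k \<otimes> g)"
      using centroid_comp_surj_comp[OF assms, of "inv k \<otimes> g"] assms by (simp add: m_assoc[symmetric])
    then obtain u where u: "u \<in> acomp A (inv k \<otimes> g)" "x = c u" by (rule imageE)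
    then have "u \<in> asp A" using homogeneous comp_mem[of "inv k \<otimes> g"] assms by simp
    then show ?case using u(2) by simp
  next
    case (add x y)
    then obtain u v where "u \<in> asp A" "v \<in> asp A" "x = c u" "y = c v" by (auto simp: image_iff)
    then show ?case using centroidD(3)[OF c, of u v] add_mem[of u v] by (intro image_eqI[of _ _ "u + v"]) auto
  qed
  ultimately show ?thesis unfolding bij_betw_def using centroidD(1)[OF c] by auto
qed

lemma centroid_comp_inverse:
  assumes "c \<in> centroid_comp \<Gamma> A k" "k \<in> carrier \<Gamma>" "c \<noteq> 0"
  obtains d where "d \<in> centroid_comp \<Gamma> A (inv k)"
    and "\<And>x. x \<in> asp A \<Longrightarrow> d (c x) = x" and "\<And>x. x \<in> asp A \<Longrightarrow> c (d x) = x"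
proof -
  have c: "c \<in> centroid A" using centroid_compD(1)[OF assms(1)] .
  have b: "bij_betw c (asp A) (asp A)" using centroid_comp_bij[OF assms] .
  define d where "d x = (if x \<in> asp A then the_inv_into (asp A) c x else 0)" for x
  have dc: "d (c x) = x" if "x \<in> asp A" for x
    unfolding d_def using b that centroidD(1)[OF c] by (simp add: bij_betw_def the_inv_into_f_f)
  have ex: "\<exists>y\<in>asp A. x = c y" if "x \<in> asp A" for x
    using b that unfolding bij_betw_def by auto
  have cd: "c (d x) = x" if "x \<in> asp A" for x using ex[OF that] dc by auto
  have "d \<in> centroid A"
  proof (rule centroidI)
    fix x assume x: "x \<in> asp A"
    then obtain u where u: "u \<in> asp A" "x = c u" using ex by auto
    show "d x \<in> asp A" using u dc by simp
    show "d (ascal A a x) = ascal A a (d x)" for a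
      unfolding u(2) centroidD(4)[OF c u(1), symmetric] by (simp add: dc u scal_mem)
    fix y assume y: "y \<in> asp A"
    then obtain v where v: "v \<in> asp A" "y = c v" using ex by auto
    show "d (x + y) = d x + d y"
      unfolding u(2) v(2) centroidD(3)[OF c u(1) v(1), symmetric] by (simp add: dc u v add_mem)
    show "d (amul A x y) = amul A (d x) y"
      unfolding u(2) centroidD(5)[OF c u(1) y, symmetric] by (simp add: dc u y mul_mem)
    show "d (amul A x y) = amul A x (d y)"
      unfolding v(2) centroidD(6)[OF c x v(1), symmetric] by (simp add: dc v x mul_mem)
  qed (simp add: d_def)
  moreover have "d x \<in> acomp A (inv k \<otimes> g)" if g: "g \<in> carrier \<Gamma>" and x: "x \<in> acomp A g" for g x
  proof -
    have "c ` acomp A (inv k \<otimes> g) = acomp A g"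
      using centroid_comp_surj_comp[OF assms, of "inv k \<otimes> g"] assms g by (simp add: m_assoc[symmetric])
    then obtain u where "u \<in> acomp A (inv k \<otimes> g)" "x = c u" using x by auto
    then show ?thesis using dc[of u] comp_mem[of "inv k \<otimes> g" u] g assms by simp
  qed
  ultimately have "d \<in> centroid_comp \<Gamma> A (inv k)" unfolding centroid_comp_def by simp
  then show thesis using that dc cd by simp
qed

text \<open>Each nonzero homogeneous part of c is injective, so it shows up at any fixed nonzero u
  of degree h: the part of degree k puts a nonzero term of degree k h into c u. As c u has finite
  support, only finitely many k occur.\<close>

lemma cproj_finite:
  assumes c: "c \<in> centroid A"
  shows "finite {k \<in> carrier \<Gamma>. cproj \<Gamma> A k c \<noteq> 0}"
proof -
  obtain h u where hu: "h \<in> carrier \<Gamma>" "u \<in> acomp A h" "u \<noteq> 0" using nontrivial asp_nontrivial_iff by auto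
  have um: "u \<in> asp A" using hu comp_mem by simp
  have "{k \<in> carrier \<Gamma>. cproj \<Gamma> A k c \<noteq> 0} \<subseteq> (\<lambda>g. g \<otimes> inv h) ` gsupp \<Gamma> A (c u)"
  proof
    fix k assume "k \<in> {k \<in> carrier \<Gamma>. cproj \<Gamma> A k c \<noteq> 0}"
    then have k: "k \<in> carrier \<Gamma>" "cproj \<Gamma> A k c \<noteq> 0" by auto
    have "cproj \<Gamma> A k c u \<noteq> 0"
      using centroid_comp_inj[OF cproj_centroid_comp(1)[OF c k(1)] k um] hu by auto
    then have "k \<otimes> h \<in> gsupp \<Gamma> A (c u)"
      using cproj_centroid_comp(2)[OF c k(1) hu(1,2)] k hu unfolding gsupp_def by simp
    moreover have "k = (k \<otimes> h) \<otimes> inv h" using k hu by (simp add: m_assoc)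
    ultimately show "k \<in> (\<lambda>g. g \<otimes> inv h) ` gsupp \<Gamma> A (c u)" by (rule rev_image_eqI)
  qed
  then show ?thesis using finite_subset finite_gsupp[OF centroidD(1)[OF c um]] by blast
qed

lemma cproj_sum:
  assumes c: "c \<in> centroid A"
  shows "c = (\<Sum>k | k \<in> carrier \<Gamma> \<and> cproj \<Gamma> A k c \<noteq> 0. cproj \<Gamma> A k c)" (is "c = sum ?p ?S")
proof (rule centroid_ext[OF c])
  have fin: "finite ?S" using cproj_finite[OF c] .
  have "sum ?p T \<in> centroid A" if "finite T" "T \<subseteq> carrier \<Gamma>" for T
    using that
  proof (induction T rule: finite_induct)
    case empty
    then show ?case using zero_centroid by (simp only: sum.empty)
  next
    case (insert k T)
    have "cproj \<Gamma> A k c + sum ?p T \<in> centroid A"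
      by (rule centroid_add) (use insert centroid_compD(1)[OF cproj_centroid_comp(1)[OF c]] in auto)
    then show ?case unfolding sum.insert[OF insert(1,2)] .
  qed
  then show "sum ?p ?S \<in> centroid A" using fin by auto
  fix g u assume g: "g \<in> carrier \<Gamma>" and u: "u \<in> acomp A g"
  have um: "u \<in> asp A" and cu: "c u \<in> asp A" using comp_mem g u centroidD(1)[OF c] by auto
  have "(sum ?p ?S) u = (\<Sum>k\<in>?S. hcomp \<Gamma> A (c u) (k \<otimes> g))"
    unfolding sum_fun_apply using cproj_centroid_comp(2)[OF c _ g u] by (intro sum.cong) auto
  also have "\<dots> = (\<Sum>h\<in>(\<lambda>k. k \<otimes> g) ` ?S. hcomp \<Gamma> A (c u) h)"
    by (subst sum.reindex) (use g in \<open>auto intro!: inj_onI\<close>)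
  also have "\<dots> = c u"
  proof (rule sum_hcomp_superset[OF cu])
    show "gsupp \<Gamma> A (c u) \<subseteq> (\<lambda>k. k \<otimes> g) ` ?S"
    proof
      fix h assume "h \<in> gsupp \<Gamma> A (c u)"
      then have h: "h \<in> carrier \<Gamma>" "hcomp \<Gamma> A (c u) h \<noteq> 0" unfolding gsupp_def by auto
      have e: "h = (h \<otimes> inv g) \<otimes> g" using h g by (simp add: m_assoc)
      have "cproj \<Gamma> A (h \<otimes> inv g) c u \<noteq> 0"
        using cproj_centroid_comp(2)[OF c _ g u, of "h \<otimes> inv g"] h g e by simp
      then have "cproj \<Gamma> A (h \<otimes> inv g) c \<noteq> 0" by auto
      then have "h \<otimes> inv g \<in> ?S" using h g by simp
      then show "h \<in> (\<lambda>k. k \<otimes> g) ` ?S" using e by (rule rev_image_eqI)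
    qed
  qed (use fin g in auto)
  finally show "c u = (sum ?p ?S) u" by simp
qed

text \<open>Uniqueness of the decomposition is seen by evaluating at u of degree g: the summand of
  degree l contributes to c u in degree l g only, so different summands do not interfere.\<close>

lemma graded_algebra_centroid: "graded_algebra \<Gamma> (centroid_alg \<Gamma> A)"
proof unfold_locales
  fix c assume "c \<in> asp (centroid_alg \<Gamma> A)"
  then have c: "c \<in> centroid A" by (simp add: centroid_alg_def)
  show "\<exists>!e. is_decomp \<Gamma> (centroid_alg \<Gamma> A) c e"
  proof (rule ex1I[of _ "\<lambda>k. if k \<in> carrier \<Gamma> then cproj \<Gamma> A k c else 0"])
    have S: "{g \<in> carrier \<Gamma>. (if g \<in> carrier \<Gamma> then cproj \<Gamma> A g c else 0) \<noteq> 0} =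
      {k \<in> carrier \<Gamma>. cproj \<Gamma> A k c \<noteq> 0}" by auto
    show "is_decomp \<Gamma> (centroid_alg \<Gamma> A) c (\<lambda>k. if k \<in> carrier \<Gamma> then cproj \<Gamma> A k c else 0)"
      unfolding is_decomp_def S
      using cproj_finite[OF c] cproj_centroid_comp(1)[OF c] cproj_sum[OF c]
      by (simp add: centroid_alg_def)
    fix e assume e: "is_decomp \<Gamma> (centroid_alg \<Gamma> A) c e"
    let ?S = "{g \<in> carrier \<Gamma>. e g \<noteq> 0}"
    have fin: "finite ?S" and out: "\<And>k. k \<notin> carrier \<Gamma> \<Longrightarrow> e k = 0" and ec: "\<And>k. k \<in> carrier \<Gamma> \<Longrightarrow> e k \<in> centroid_comp \<Gamma> A k"
      and s: "c = (\<Sum>k\<in>?S. e k)"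
      using e unfolding is_decomp_def by (auto simp: centroid_alg_def)
    have "e k = cproj \<Gamma> A k c" if k: "k \<in> carrier \<Gamma>" for k
    proof (rule centroid_ext)
      show "e k \<in> centroid A" using centroid_compD(1)[OF ec[OF k]] .
      show "cproj \<Gamma> A k c \<in> centroid A" using centroid_compD(1)[OF cproj_centroid_comp(1)[OF c k]] .
      fix g u assume g: "g \<in> carrier \<Gamma>" and u: "u \<in> acomp A g"
      have eu: "e l u \<in> acomp A (l \<otimes> g)" if "l \<in> carrier \<Gamma>" for l
        using centroid_compD(2)[OF ec[OF that] g u] .
      have "cproj \<Gamma> A k c u = hcomp \<Gamma> A (\<Sum>l\<in>?S. e l u) (k \<otimes> g)"
        using cproj_centroid_comp(2)[OF c k g u] unfolding s sum_fun_apply by simp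
      also have "\<dots> = (\<Sum>l\<in>?S. hcomp \<Gamma> A (e l u) (k \<otimes> g))"
        by (rule hcomp_sum) (use eu comp_mem g in \<open>metis (no_types, lifting) m_closed mem_Collect_eq\<close>)
      also have "\<dots> = (\<Sum>l\<in>?S. if l = k then e k u else 0)"
        by (rule sum.cong) (use eu g k in \<open>auto simp: hcomp_homogeneous[OF _ eu]\<close>)
      also have "\<dots> = e k u" using fin k by (auto simp: sum.delta)
      finally show "e k u = cproj \<Gamma> A k c u" by simp
    qed
    then show "e = (\<lambda>k. if k \<in> carrier \<Gamma> then cproj \<Gamma> A k c else 0)" using out by auto
  qed
next
  fix g assume g: "g \<in> carrier \<Gamma>"
  show "alg_subspace (centroid_alg \<Gamma> A) (acomp (centroid_alg \<Gamma> A) g)"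
    unfolding alg_subspace_def using g zero_centroid_comp centroid_comp_add centroid_comp_scal
    by (auto simp: centroid_alg_def dest: centroid_compD(1))
next
  show "0 \<in> asp (centroid_alg \<Gamma> A)"
    using zero_centroid by (simp add: centroid_alg_def)
next
  fix c assume "c \<in> asp (centroid_alg \<Gamma> A)"
  then have c: "c \<in> centroid A" by (simp add: centroid_alg_def)
  have cx: "c x \<in> asp A" for x using centroidD(1,2)[OF c, of x] by (cases "x \<in> asp A") auto
  show "ascal (centroid_alg \<Gamma> A) a c \<in> asp (centroid_alg \<Gamma> A)" for a
    using centroid_scal[OF c] by (simp add: centroid_alg_def)
  show "ascal (centroid_alg \<Gamma> A) (a + b) c = ascal (centroid_alg \<Gamma> A) a c + ascal (centroid_alg \<Gamma> A) b c" for a b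
    using scal_add_left[OF cx] by (auto simp: centroid_alg_def)
  show "ascal (centroid_alg \<Gamma> A) a (ascal (centroid_alg \<Gamma> A) b c) = ascal (centroid_alg \<Gamma> A) (a * b) c" for a b
    using scal_scal[OF cx] by (auto simp: centroid_alg_def)
  show "ascal (centroid_alg \<Gamma> A) 1 c = c"
    using scal_one[OF cx] by (auto simp: centroid_alg_def)
  fix d assume "d \<in> asp (centroid_alg \<Gamma> A)"
  then have d: "d \<in> centroid A" by (simp add: centroid_alg_def)
  have dx: "d x \<in> asp A" for x using centroidD(1,2)[OF d, of x] by (cases "x \<in> asp A") auto
  show "c + d \<in> asp (centroid_alg \<Gamma> A)" using centroid_add[OF c d] by (simp add: centroid_alg_def)
  show "ascal (centroid_alg \<Gamma> A) a (c + d) = ascal (centroid_alg \<Gamma> A) a c + ascal (centroid_alg \<Gamma> A) a d" for a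
    using scal_add_right[OF cx dx] by (auto simp: centroid_alg_def)
  show "amul (centroid_alg \<Gamma> A) c d \<in> asp (centroid_alg \<Gamma> A)"
    using centroid_compose[OF c d] by (simp add: centroid_alg_def)
  show "amul (centroid_alg \<Gamma> A) (ascal (centroid_alg \<Gamma> A) a c) d = ascal (centroid_alg \<Gamma> A) a (amul (centroid_alg \<Gamma> A) c d)" for a
    by (auto simp: centroid_alg_def)
  show "amul (centroid_alg \<Gamma> A) c (ascal (centroid_alg \<Gamma> A) a d) = ascal (centroid_alg \<Gamma> A) a (amul (centroid_alg \<Gamma> A) c d)" for a
    using centroidD(4)[OF c dx] by (auto simp: centroid_alg_def)
  fix e assume "e \<in> asp (centroid_alg \<Gamma> A)"
  then have e: "e \<in> centroid A" by (simp add: centroid_alg_def)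
  show "amul (centroid_alg \<Gamma> A) (c + d) e = amul (centroid_alg \<Gamma> A) c e + amul (centroid_alg \<Gamma> A) d e"
    by (auto simp: centroid_alg_def)
  show "amul (centroid_alg \<Gamma> A) e (c + d) = amul (centroid_alg \<Gamma> A) e c + amul (centroid_alg \<Gamma> A) e d"
    using centroidD(3)[OF e cx dx] by (auto simp: centroid_alg_def)
next
  fix g h c d assume "g \<in> carrier \<Gamma>" "h \<in> carrier \<Gamma>" "c \<in> acomp (centroid_alg \<Gamma> A) g" "d \<in> acomp (centroid_alg \<Gamma> A) h"
  then show "amul (centroid_alg \<Gamma> A) c d \<in> acomp (centroid_alg \<Gamma> A) (g \<otimes> h)"
    using centroid_comp_compose by (simp add: centroid_alg_def)
qed

end

subsection \<open>From graded simplicity to simplicity\<close>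

context graded_simple_algebra
begin

text \<open>Every centroid element is the sum of its homogeneous parts, and by assumption only the
  part in the identity degree survives.\<close>

lemma central_alg_if_centroid_trivial:
  assumes "\<And>k. \<lbrakk>k \<in> carrier \<Gamma>; k \<noteq> \<one>\<rbrakk> \<Longrightarrow> centroid_comp \<Gamma> A k \<subseteq> {0}"
    and "centroid_comp \<Gamma> A \<one> \<subseteq> scalar_maps A"
  shows "central_alg A"
  unfolding central_alg_def
proof
  show "scalar_maps A \<subseteq> centroid A"
  proof
    fix c assume "c \<in> scalar_maps A"
    then obtain a where "c = (\<lambda>x. if x \<in> asp A then ascal A a x else 0)"
      unfolding scalar_maps_def by auto
    then show "c \<in> centroid A" using centroid_compD(1)[OF scalar_map_centroid_comp[of a]] by (simp only:)
  qed
  show "centroid A \<subseteq> scalar_maps A"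
  proof
    fix c assume c: "c \<in> centroid A"
    have "{k. k \<in> carrier \<Gamma> \<and> cproj \<Gamma> A k c \<noteq> 0} \<subseteq> {\<one>}"
      using assms(1) cproj_centroid_comp(1)[OF c] by fastforce
    then have "{k. k \<in> carrier \<Gamma> \<and> cproj \<Gamma> A k c \<noteq> 0} = {} \<or>
        {k. k \<in> carrier \<Gamma> \<and> cproj \<Gamma> A k c \<noteq> 0} = {\<one>}" by (rule subset_singletonD)
    then have "c = 0 \<or> c = cproj \<Gamma> A \<one> c"
    proof
      assume e: "{k. k \<in> carrier \<Gamma> \<and> cproj \<Gamma> A k c \<noteq> 0} = {}"
      show ?thesis using cproj_sum[OF c] unfolding e sum.empty by (rule disjI1)
    next
      assume e: "{k. k \<in> carrier \<Gamma> \<and> cproj \<Gamma> A k c \<noteq> 0} = {\<one>}"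
      have "c = (\<Sum>k\<in>{\<one>}. cproj \<Gamma> A k c)" using cproj_sum[OF c] unfolding e .
      then show ?thesis by simp
    qed
    then have "c \<in> centroid_comp \<Gamma> A \<one>"
    proof
      assume "c = 0" then show ?thesis using zero_centroid_comp[OF one_closed] by (simp only:)
    next
      assume e: "c = cproj \<Gamma> A \<one> c"
      show ?thesis by (subst e) (rule cproj_centroid_comp(1)[OF c one_closed])
    qed
    then show "c \<in> scalar_maps A" using assms(2) by auto
  qed
qed

text \<open>The degree pattern of a shortest element of I can be translated over the whole grading
  by multiplying with homogeneous elements. Shortness leaves the translates so little freedom that
  they form graphs of linear maps between components, and these maps are compatible with
  multiplication.\<close>

lemma simple_alg_if_centroid_trivial:
  assumes triv: "\<And>k. \<lbrakk>k \<in> carrier \<Gamma>; k \<noteq> \<one>\<rbrakk> \<Longrightarrow> centroid_comp \<Gamma> A k \<subseteq> {0}"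
  shows "simple_alg A"
proof -
  have "I = asp A" if I: "alg_ideal A I" and I_ne: "I \<noteq> {0}" for I
  proof -
    have IA: "I \<subseteq> asp A" and I0: "0 \<in> I" and Iadd: "\<And>x y. x \<in> I \<Longrightarrow> y \<in> I \<Longrightarrow> x + y \<in> I"
      and Iscal: "\<And>a x. x \<in> I \<Longrightarrow> ascal A a x \<in> I"
      and Imul: "\<And>x y. x \<in> asp A \<Longrightarrow> y \<in> I \<Longrightarrow> amul A x y \<in> I" "\<And>x y. x \<in> asp A \<Longrightarrow> y \<in> I \<Longrightarrow> amul A y x \<in> I"
      using I unfolding alg_ideal_def alg_subspace_def by auto
    obtain x where xI: "x \<in> I" and x0: "x \<noteq> 0"
      and min: "\<And>y. \<lbrakk>y \<in> I; y \<noteq> 0\<rbrakk> \<Longrightarrow> card (gsupp \<Gamma> A x) \<le> card (gsupp \<Gamma> A y)"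
    proof -
      obtain z where "z \<in> I \<and> z \<noteq> 0" using I0 I_ne by auto
      from ex_has_least_nat[of "\<lambda>z. z \<in> I \<and> z \<noteq> 0", OF this, of "\<lambda>y. card (gsupp \<Gamma> A y)"]
      show thesis using that by auto
    qed
    have xm: "x \<in> asp A" using xI IA by auto
    define S where "S = gsupp \<Gamma> A x"
    have S: "finite S" "S \<subseteq> carrier \<Gamma>" unfolding S_def using finite_gsupp[OF xm] gsupp_carrier by auto
    \<comment> \<open>Elements of I supported in the translate t S of the support of x.
      Multiplication by an element of degree h takes \<open>V t\<close> into
      \<open>V (h \<otimes> t)\<close>.\<close>
    define V where "V t = {y \<in> I. \<forall>s\<in>carrier \<Gamma>. s \<notin> S \<longrightarrow> hcomp \<Gamma> A y (t \<otimes> s) = 0}" for t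
    have Vm: "y \<in> asp A" if "y \<in> V t" for y t using that IA unfolding V_def by auto
    have V0: "0 \<in> V t" for t unfolding V_def using I0 by simp
    have Vadd: "y + z \<in> V t" if "y \<in> V t" "z \<in> V t" for y z t
      using that Vm[OF that(1)] Vm[OF that(2)] Iadd unfolding V_def by (simp add: hcomp_add)
    have Vscal: "ascal A a y \<in> V t" if "y \<in> V t" for y t a
      using that Vm[OF that(1)] Iscal unfolding V_def by (simp add: hcomp_scal)
    have Vmul: "amul A z y \<in> V (h \<otimes> t)" "amul A y z \<in> V (h \<otimes> t)"
      if y: "y \<in> V t" and t: "t \<in> carrier \<Gamma>" and h: "h \<in> carrier \<Gamma>" and z: "z \<in> acomp A h" for y z t h
    proof -
      have zm: "z \<in> asp A" using comp_mem[OF h z] .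
      have yI: "y \<in> I" using y unfolding V_def by auto
      have y0: "hcomp \<Gamma> A y (t \<otimes> s) = 0" if "s \<in> carrier \<Gamma>" "s \<notin> S" for s
        using y that unfolding V_def by auto
      have "hcomp \<Gamma> A (amul A z y) ((h \<otimes> t) \<otimes> s) = 0" if "s \<in> carrier \<Gamma>" "s \<notin> S" for s
        using hcomp_mul(2)[OF Vm[OF y] h z, of "t \<otimes> s"] y0[OF that] that t h zm by (simp add: m_assoc)
      then show "amul A z y \<in> V (h \<otimes> t)" unfolding V_def using Imul(1)[OF zm yI] by auto
      have "hcomp \<Gamma> A (amul A y z) ((h \<otimes> t) \<otimes> s) = 0" if "s \<in> carrier \<Gamma>" "s \<notin> S" for s
        using hcomp_mul(1)[OF Vm[OF y] h z, of "t \<otimes> s"] y0[OF that] that t h zm by (simp add: m_ac)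
      then show "amul A y z \<in> V (h \<otimes> t)" unfolding V_def using Imul(2)[OF zm yI] by auto
    qed
    \<comment> \<open>Minimality of S: giving up one of the possible degrees forces y = 0. Hence an
      element of \<open>V t\<close> is determined by any single one of its components at the places
      of t S.\<close>
    have Vzero: "y = 0" if y: "y \<in> V t" and t: "t \<in> carrier \<Gamma>" and a: "a \<in> S" and z: "hcomp \<Gamma> A y (t \<otimes> a) = 0" for y t a
    proof (rule ccontr)
      assume y0: "y \<noteq> 0"
      have "gsupp \<Gamma> A y \<subseteq> (\<lambda>s. t \<otimes> s) ` (S - {a})"
      proof
        fix g assume "g \<in> gsupp \<Gamma> A y"
        then have g: "g \<in> carrier \<Gamma>" "hcomp \<Gamma> A y g \<noteq> 0" unfolding gsupp_def by auto
        have e: "g = t \<otimes> (inv t \<otimes> g)" using g t by (simp add: m_assoc[symmetric])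
        then have "inv t \<otimes> g \<in> S" using y g t unfolding V_def by fastforce
        moreover have "inv t \<otimes> g \<noteq> a" using e z g by auto
        ultimately show "g \<in> (\<lambda>s. t \<otimes> s) ` (S - {a})" using e by blast
      qed
      then have "card (gsupp \<Gamma> A y) \<le> card (S - {a})"
        using S by (meson card_image_le card_mono finite_Diff finite_imageI order_trans)
      also have "\<dots> < card S" by (rule card_Diff1_less[OF S(1) a])
      finally show False using min[of y] y y0 unfolding V_def S_def by auto
    qed
    have x1: "x \<in> V \<one>" unfolding V_def S_def gsupp_def using xI by auto
    obtain a where a: "a \<in> S" using x0 sum_hcomp[OF xm] unfolding S_def[symmetric] by (metis equals0I sum.empty)
    have ac: "a \<in> carrier \<Gamma>" using a S by auto
    have xa: "hcomp \<Gamma> A x a \<noteq> 0" using a unfolding S_def gsupp_def by auto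
    \<comment> \<open>Components at the place a of the translates; in the translate by g a^(-1) this
      place has degree g. They form a graded ideal containing the nonzero component of x at a, hence
      fill every component of A.\<close>
    define W where "W g = (\<lambda>y. hcomp \<Gamma> A y g) ` V (g \<otimes> inv a)" for g
    have "ideal_family \<Gamma> A W" unfolding ideal_family_def
    proof (intro conjI ballI allI)
      fix g assume g: "g \<in> carrier \<Gamma>"
      show "W g \<subseteq> acomp A g" unfolding W_def using hcomp_comp[OF _ g] Vm by auto
      show "0 \<in> W g" unfolding W_def using V0 by (intro image_eqI[of _ _ 0]) auto
      fix u assume "u \<in> W g"
      then obtain y where y: "y \<in> V (g \<otimes> inv a)" "u = hcomp \<Gamma> A y g" unfolding W_def by auto
      show "ascal A b u \<in> W g" for b
        unfolding W_def y(2) using Vscal[OF y(1)] Vm[OF y(1)]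
        by (intro image_eqI[of _ _ "ascal A b y"]) (auto simp: hcomp_scal)
      fix v assume "v \<in> W g"
      then obtain z where z: "z \<in> V (g \<otimes> inv a)" "v = hcomp \<Gamma> A z g" unfolding W_def by auto
      show "u + v \<in> W g"
        unfolding W_def y(2) z(2) using Vadd[OF y(1) z(1)] Vm[OF y(1)] Vm[OF z(1)]
        by (intro image_eqI[of _ _ "y + z"]) (auto simp: hcomp_add)
    next
      fix h g z u assume h: "h \<in> carrier \<Gamma>" and g: "g \<in> carrier \<Gamma>" and z: "z \<in> acomp A h" and "u \<in> W g"
      then obtain y where y: "y \<in> V (g \<otimes> inv a)" "u = hcomp \<Gamma> A y g" unfolding W_def by auto
      have c: "g \<otimes> inv a \<in> carrier \<Gamma>" using g ac by simp
      show "amul A z u \<in> W (h \<otimes> g)"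
        unfolding W_def y(2) using Vmul(1)[OF y(1) c h z] hcomp_mul(2)[OF Vm[OF y(1)] h z g] g h ac
        by (intro image_eqI[of _ _ "amul A z y"]) (auto simp: m_assoc)
      show "amul A u z \<in> W (g \<otimes> h)"
        unfolding W_def y(2) using Vmul(2)[OF y(1) c h z] hcomp_mul(1)[OF Vm[OF y(1)] h z g] g h ac
        by (intro image_eqI[of _ _ "amul A y z"]) (auto simp: m_ac)
    qed
    moreover have "hcomp \<Gamma> A x a \<in> W a" unfolding W_def using x1 ac by simp
    ultimately have W: "W g = acomp A g" if "g \<in> carrier \<Gamma>" for g
      using ideal_family_full ac xa that by auto
    have W_ex: "\<exists>y. y \<in> V (g \<otimes> inv a) \<and> hcomp \<Gamma> A y g = u" if "g \<in> carrier \<Gamma>" "u \<in> acomp A g" for g u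
    proof -
      have "u \<in> W g" using W that by simp
      then show ?thesis unfolding W_def by auto
    qed
    show ?thesis
    proof (cases "S = {a}")
      case True
      \<comment> \<open>When x is homogeneous, the element of I found over u has no further
        component and so equals u.\<close>
      have "u \<in> I" if "u \<in> asp A" for u
        using that
      proof (induction u rule: homogeneous_induct)
        case (homogeneous g u)
        obtain y where y: "y \<in> V (g \<otimes> inv a)" "hcomp \<Gamma> A y g = u" using W_ex[OF homogeneous] by auto
        have "hcomp \<Gamma> A y h = hcomp \<Gamma> A u h" if h: "h \<in> carrier \<Gamma>" for h
        proof (cases "h = g")
          case False
          have e: "(g \<otimes> inv a) \<otimes> (inv (g \<otimes> inv a) \<otimes> h) = h"
            using homogeneous ac h m_assoc[of "g \<otimes> inv a" "inv (g \<otimes> inv a)" h] by simp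
          have "inv (g \<otimes> inv a) \<otimes> h \<noteq> a"
          proof
            assume "inv (g \<otimes> inv a) \<otimes> h = a"
            then have "h = (g \<otimes> inv a) \<otimes> a" using e by simp
            then show False using False homogeneous ac by (simp add: m_assoc)
          qed
          then have "hcomp \<Gamma> A y ((g \<otimes> inv a) \<otimes> (inv (g \<otimes> inv a) \<otimes> h)) = 0"
            using y(1) True homogeneous ac h unfolding V_def by auto
          then show ?thesis using False homogeneous e by (simp add: hcomp_homogeneous[of g])
        qed (use y homogeneous in \<open>simp add: hcomp_homogeneous[of g]\<close>)
        then have "y = u" by (rule eq_if_hcomp_eq[OF Vm[OF y(1)] comp_mem[OF homogeneous]])
        then show ?case using y(1) unfolding V_def by auto
      qed (use I0 Iadd in auto)
      then show ?thesis using IA by auto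
    next
      case False
      then obtain b where b: "b \<in> S" "b \<noteq> a" using a by auto
      have bc: "b \<in> carrier \<Gamma>" using b S by auto
      have xb: "hcomp \<Gamma> A x b \<noteq> 0" using b unfolding S_def gsupp_def by auto
      let ?k = "b \<otimes> inv a"
      \<comment> \<open>The element over u is unique by \<open>Vzero\<close>; this turns the choice
        into a map that is linear and compatible with products.\<close>
      define Y where "Y g u = (SOME y. y \<in> V (g \<otimes> inv a) \<and> hcomp \<Gamma> A y g = u)" for g u
      have Y: "Y g u \<in> V (g \<otimes> inv a)" "hcomp \<Gamma> A (Y g u) g = u" if "g \<in> carrier \<Gamma>" "u \<in> acomp A g" for g u
        using someI_ex[OF W_ex[OF that]] unfolding Y_def by auto
      have Y_eq: "Y g (hcomp \<Gamma> A y g) = y" if g: "g \<in> carrier \<Gamma>" and y: "y \<in> V (g \<otimes> inv a)" for g y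
      proof -
        let ?u = "hcomp \<Gamma> A y g"
        have u: "?u \<in> acomp A g" using hcomp_comp Vm[OF y] g by auto
        note Yu = Y[OF g u]
        have "y + ascal A (-1) (Y g ?u) \<in> V (g \<otimes> inv a)" using Vadd[OF y Vscal[OF Yu(1)]] .
        then have d: "y - Y g ?u \<in> V (g \<otimes> inv a)" using scal_minus_one[OF Vm[OF Yu(1)]] by simp
        have "(g \<otimes> inv a) \<otimes> a = g" using g ac by (simp add: m_assoc)
        then have "hcomp \<Gamma> A (y - Y g ?u) ((g \<otimes> inv a) \<otimes> a) = 0"
          using hcomp_diff[OF Vm[OF y] Vm[OF Yu(1)]] Yu(2) by simp
        then have "y - Y g ?u = 0" using Vzero[OF d _ a] g ac by simp
        then show ?thesis by simp
      qed
      \<comment> \<open>Reads off the component at the place b from the one at the place a. Degrees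
        move by b a^(-1), which is not the identity.\<close>
      define d where "d g u = hcomp \<Gamma> A (Y g u) (?k \<otimes> g)" for g u
      have d_add: "additive_family \<Gamma> A d" unfolding additive_family_def
      proof (intro ballI)
        fix g u v assume g: "g \<in> carrier \<Gamma>" and u: "u \<in> acomp A g" and v: "v \<in> acomp A g"
        have "Y g u + Y g v = Y g (u + v)"
          using Y_eq[OF g Vadd[OF Y(1)[OF g u] Y(1)[OF g v]]] Y(2)[OF g u] Y(2)[OF g v]
            hcomp_add[OF Vm[OF Y(1)[OF g u]] Vm[OF Y(1)[OF g v]]] by simp
        then show "d g (u + v) = d g u + d g v"
          unfolding d_def using hcomp_add[OF Vm[OF Y(1)[OF g u]] Vm[OF Y(1)[OF g v]]] by metis
      qed
      have d_comp: "d g u \<in> acomp A (?k \<otimes> g)" if "g \<in> carrier \<Gamma>" "u \<in> acomp A g" for g u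
        unfolding d_def using hcomp_comp[OF Vm[OF Y(1)[OF that]]] that ac bc by simp
      have d_scal: "d g (ascal A r u) = ascal A r (d g u)" if g: "g \<in> carrier \<Gamma>" and u: "u \<in> acomp A g" for g u r
      proof -
        have "ascal A r (Y g u) = Y g (ascal A r u)"
          using Y_eq[OF g Vscal[OF Y(1)[OF g u]]] Y(2)[OF g u] hcomp_scal[OF Vm[OF Y(1)[OF g u]]] by simp
        then show ?thesis unfolding d_def using hcomp_scal[OF Vm[OF Y(1)[OF g u]]] by metis
      qed
      have d_left: "d (g \<otimes> h) (amul A u v) = amul A (d g u) v"
        if g: "g \<in> carrier \<Gamma>" and h: "h \<in> carrier \<Gamma>" and u: "u \<in> acomp A g" and v: "v \<in> acomp A h" for g h u v
      proof -
        have e: "h \<otimes> (g \<otimes> inv a) = (g \<otimes> h) \<otimes> inv a" using g h ac by (simp add: m_ac)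
        have "amul A (Y g u) v \<in> V ((g \<otimes> h) \<otimes> inv a)"
          using Vmul(2)[OF Y(1)[OF g u] _ h v] g ac unfolding e by simp
        then have "amul A (Y g u) v = Y (g \<otimes> h) (amul A u v)"
          using Y_eq[of "g \<otimes> h" "amul A (Y g u) v"] hcomp_mul(1)[OF Vm[OF Y(1)[OF g u]] h v g] Y(2)[OF g u] g h by simp
        moreover have "hcomp \<Gamma> A (amul A (Y g u) v) ((?k \<otimes> g) \<otimes> h) = amul A (d g u) v"
          unfolding d_def using hcomp_mul(1)[OF Vm[OF Y(1)[OF g u]] h v, of "?k \<otimes> g"] g ac bc by simp
        ultimately show ?thesis unfolding d_def[of "g \<otimes> h"] using g h ac bc by (simp add: m_assoc)
      qed
      have d_right: "d (g \<otimes> h) (amul A u v) = amul A u (d h v)"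
        if g: "g \<in> carrier \<Gamma>" and h: "h \<in> carrier \<Gamma>" and u: "u \<in> acomp A g" and v: "v \<in> acomp A h" for g h u v
      proof -
        have e: "g \<otimes> (h \<otimes> inv a) = (g \<otimes> h) \<otimes> inv a" using g h ac by (simp add: m_ac)
        have "amul A u (Y h v) \<in> V ((g \<otimes> h) \<otimes> inv a)"
          using Vmul(1)[OF Y(1)[OF h v] _ g u] h ac unfolding e by simp
        then have "amul A u (Y h v) = Y (g \<otimes> h) (amul A u v)"
          using Y_eq[of "g \<otimes> h" "amul A u (Y h v)"] hcomp_mul(2)[OF Vm[OF Y(1)[OF h v]] g u h] Y(2)[OF h v] g h by simp
        moreover have "hcomp \<Gamma> A (amul A u (Y h v)) (g \<otimes> (?k \<otimes> h)) = amul A u (d h v)"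
          unfolding d_def using hcomp_mul(2)[OF Vm[OF Y(1)[OF h v]] g u, of "?k \<otimes> h"] h ac bc by simp
        moreover have "g \<otimes> (?k \<otimes> h) = ?k \<otimes> (g \<otimes> h)" using g h ac bc by (simp add: m_lcomm)
        ultimately show ?thesis unfolding d_def[of "g \<otimes> h"] by simp
      qed
      have kc: "?k \<in> carrier \<Gamma>" using ac bc by simp
      have "?k \<noteq> \<one>"
      proof
        assume "?k = \<one>"
        then have "b = a" using ac bc by (metis inv_equality inv_inv inv_closed)
        then show False using b by simp
      qed
      \<comment> \<open>The assumption kills this map, although it sends the component of x at a to
        the nonzero component of x at b.\<close>
      then have "cext \<Gamma> A d = 0"
        using triv[OF kc] cext_centroid_comp(1)[OF kc d_add d_comp d_scal d_left d_right] by auto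
      then have "d a (hcomp \<Gamma> A x a) = 0"
        using cext_centroid_comp(2)[OF kc d_add d_comp d_scal d_left d_right ac hcomp_comp[OF xm ac]] by simp
      moreover have "Y a (hcomp \<Gamma> A x a) = x" using Y_eq[OF ac, of x] x1 ac by simp
      moreover have "?k \<otimes> a = b" using ac bc by (simp add: m_assoc)
      ultimately show ?thesis using xb unfolding d_def by simp
    qed
  qed
  moreover have "is_algebra A"
    using graded_algebra_axioms unfolding graded_iff_graded_algebra[symmetric] graded_def by simp
  ultimately show ?thesis unfolding simple_alg_def using nontrivial square_eq by auto
qed

end

subsection \<open>Loop algebras up to isomorphism\<close>

lemma Z2symD:
  assumes "Z2sym G \<tau>"
  shows "\<lbrakk>a \<in> carrier G; b \<in> carrier G\<rbrakk> \<Longrightarrow> \<tau> a b \<noteq> 0"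
    and "\<lbrakk>a \<in> carrier G; b \<in> carrier G\<rbrakk> \<Longrightarrow> \<tau> a b = \<tau> b a"
    and "\<lbrakk>a \<in> carrier G; b \<in> carrier G; c \<in> carrier G\<rbrakk>
      \<Longrightarrow> \<tau> a b * \<tau> (a \<otimes>\<^bsub>G\<^esub> b) c = \<tau> a (b \<otimes>\<^bsub>G\<^esub> c) * \<tau> b c"
  using assms unfolding Z2sym_def by blast+

text \<open>Both sides equal \<tau>(a,b) \<tau>(ab,c), by the cocycle identity and its symmetry in a
  and b. It takes the place of the cocycle identity whenever a centroid element is moved past a left
  factor.\<close>

lemma Z2sym_swap:
  assumes "comm_group G" "Z2sym G \<tau>" "a \<in> carrier G" "b \<in> carrier G" "c \<in> carrier G"
  shows "\<tau> a (b \<otimes>\<^bsub>G\<^esub> c) * \<tau> b c = \<tau> b (a \<otimes>\<^bsub>G\<^esub> c) * \<tau> a c"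
proof -
  interpret comm_group G by fact
  show ?thesis
    using Z2symD(3)[OF assms(2), of a b c] Z2symD(3)[OF assms(2), of b a c] Z2symD(2)[OF assms(2), of a b]
      assms m_comm[of a b] by simp
qed

text \<open>The cocycle identity at (1, 1, g), with \<tau>(1,g) cancelled. Cocycles are not
  normalized, so the constant \<tau>(1,1) has to be carried along wherever the identity degree
  acts.\<close>

lemma Z2sym_one:
  assumes "comm_group G" "Z2sym G \<tau>" "g \<in> carrier G"
  shows "\<tau> \<one>\<^bsub>G\<^esub> g = \<tau> \<one>\<^bsub>G\<^esub> \<one>\<^bsub>G\<^esub>"
proof -
  interpret comm_group G by fact
  show ?thesis
    using Z2symD(3)[OF assms(2), of "\<one>\<^bsub>G\<^esub>" "\<one>\<^bsub>G\<^esub>" g] Z2symD(1)[OF assms(2), of "\<one>\<^bsub>G\<^esub>" g] assms(3) by simp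
qed

text \<open>A twisted loop algebra enters only through this interface: a graded algebra \<open>L\<close> whose components
are identified with those of \<open>A\<close> through maps \<open>\<iota> g\<close> in such a way that the product becomes
\<open>\<tau>\<close>-twisted; the twisted loop algebra has \<open>\<iota> g u = u \<otimes> g\<close>.\<close>

locale loop_like =
  G: comm_group G + \<Gamma>: comm_group \<Gamma> + A: graded_algebra \<Gamma> A + L: graded_algebra G L
  for G :: "('g, 'm) monoid_scheme" and \<Gamma> :: "('i, 'n) monoid_scheme"
    and A :: "('a::ab_group_add, 'f::field, 'i) galg" and L :: "('l::ab_group_add, 'f, 'g) galg" +
  fixes \<pi> :: "'g \<Rightarrow> 'i" and \<tau> :: "'g \<Rightarrow> 'g \<Rightarrow> 'f" and \<iota> :: "'g \<Rightarrow> 'a \<Rightarrow> 'l"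
  assumes \<pi>_mult: "\<lbrakk>g \<in> carrier G; h \<in> carrier G\<rbrakk> \<Longrightarrow> \<pi> (g \<otimes>\<^bsub>G\<^esub> h) = \<pi> g \<otimes>\<^bsub>\<Gamma>\<^esub> \<pi> h"
    and \<pi>_surj: "\<pi> ` carrier G = carrier \<Gamma>"
    and \<tau>: "Z2sym G \<tau>"
    and \<iota>_bij: "g \<in> carrier G \<Longrightarrow> bij_betw (\<iota> g) (acomp A (\<pi> g)) (acomp L g)"
    and \<iota>_add: "\<lbrakk>g \<in> carrier G; u \<in> acomp A (\<pi> g); v \<in> acomp A (\<pi> g)\<rbrakk> \<Longrightarrow> \<iota> g (u + v) = \<iota> g u + \<iota> g v"
    and \<iota>_scal: "\<lbrakk>g \<in> carrier G; u \<in> acomp A (\<pi> g)\<rbrakk> \<Longrightarrow> \<iota> g (ascal A r u) = ascal L r (\<iota> g u)"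
    and \<iota>_mul: "\<lbrakk>g \<in> carrier G; h \<in> carrier G; u \<in> acomp A (\<pi> g); v \<in> acomp A (\<pi> h)\<rbrakk>
        \<Longrightarrow> amul L (\<iota> g u) (\<iota> h v) = ascal L (\<tau> g h) (\<iota> (g \<otimes>\<^bsub>G\<^esub> h) (amul A u v))"
begin

lemma \<pi>_closed [simp]: "g \<in> carrier G \<Longrightarrow> \<pi> g \<in> carrier \<Gamma>"
  using \<pi>_surj by auto

lemma \<pi>_lift: "a \<in> carrier \<Gamma> \<Longrightarrow> \<exists>g\<in>carrier G. \<pi> g = a"
  unfolding \<pi>_surj[symmetric] by auto

lemma \<pi>_group_hom: "group_hom G \<Gamma> \<pi>"
  by unfold_locales (auto simp: hom_def \<pi>_mult)

lemma \<pi>_one [simp]: "\<pi> \<one>\<^bsub>G\<^esub> = \<one>\<^bsub>\<Gamma>\<^esub>"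
  using group_hom.hom_one[OF \<pi>_group_hom] .

lemma \<pi>_inv: "g \<in> carrier G \<Longrightarrow> \<pi> (inv\<^bsub>G\<^esub> g) = inv\<^bsub>\<Gamma>\<^esub> \<pi> g"
  using group_hom.hom_inv[OF \<pi>_group_hom] .

lemma \<iota>_mem: "\<lbrakk>g \<in> carrier G; u \<in> acomp A (\<pi> g)\<rbrakk> \<Longrightarrow> \<iota> g u \<in> acomp L g"
  using \<iota>_bij bij_betwE by blast

lemma \<iota>_mem_asp: "\<lbrakk>g \<in> carrier G; u \<in> acomp A (\<pi> g)\<rbrakk> \<Longrightarrow> \<iota> g u \<in> asp L"
  using L.comp_mem[OF _ \<iota>_mem] by simp

lemma \<iota>_inj: "\<lbrakk>g \<in> carrier G; u \<in> acomp A (\<pi> g); v \<in> acomp A (\<pi> g)\<rbrakk> \<Longrightarrow> \<iota> g u = \<iota> g v \<longleftrightarrow> u = v"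
  using \<iota>_bij[of g] by (auto simp: bij_betw_def inj_on_def)

lemma \<iota>_surj: "\<lbrakk>g \<in> carrier G; x \<in> acomp L g\<rbrakk> \<Longrightarrow> \<exists>u\<in>acomp A (\<pi> g). x = \<iota> g u"
  using \<iota>_bij[of g] by (auto simp: bij_betw_def)

lemma \<iota>_zero: "g \<in> carrier G \<Longrightarrow> \<iota> g 0 = 0"
  using \<iota>_add[of g 0 0] A.comp_zero[of "\<pi> g"] by simp

lemma \<iota>_eq_zero: "\<lbrakk>g \<in> carrier G; u \<in> acomp A (\<pi> g)\<rbrakk> \<Longrightarrow> \<iota> g u = 0 \<longleftrightarrow> u = 0"
  using \<iota>_inj[of g u 0] \<iota>_zero A.comp_zero[of "\<pi> g"] by simp

lemma A_mul_comp: "\<lbrakk>g \<in> carrier G; h \<in> carrier G; u \<in> acomp A (\<pi> g); v \<in> acomp A (\<pi> h)\<rbrakk>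
    \<Longrightarrow> amul A u v \<in> acomp A (\<pi> (g \<otimes>\<^bsub>G\<^esub> h))"
  using A.mul_comp[of "\<pi> g" "\<pi> h"] \<pi>_mult by simp

lemma \<tau>_nz: "\<lbrakk>g \<in> carrier G; h \<in> carrier G\<rbrakk> \<Longrightarrow> \<tau> g h \<noteq> 0"
  using Z2symD(1)[OF \<tau>] .

lemma \<iota>_mul': "\<lbrakk>g \<in> carrier G; h \<in> carrier G; u \<in> acomp A (\<pi> g); v \<in> acomp A (\<pi> h)\<rbrakk>
    \<Longrightarrow> \<iota> (g \<otimes>\<^bsub>G\<^esub> h) (amul A u v) = ascal L (inverse (\<tau> g h)) (amul L (\<iota> g u) (\<iota> h v))"
  using \<iota>_mem_asp[OF _ A_mul_comp] \<tau>_nz by (simp add: \<iota>_mul L.scal_scal L.scal_one)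

lemma mul_eq_zero_iff:
  assumes "g \<in> carrier G" "h \<in> carrier G" "u \<in> acomp A (\<pi> g)" "v \<in> acomp A (\<pi> h)"
  shows "amul L (\<iota> g u) (\<iota> h v) = 0 \<longleftrightarrow> amul A u v = 0"
proof -
  have gh: "g \<otimes>\<^bsub>G\<^esub> h \<in> carrier G" using assms by simp
  note uv = A_mul_comp[OF assms]
  show ?thesis
    using \<iota>_eq_zero[OF gh uv] L.scal_cancel[OF \<iota>_mem_asp[OF gh uv] \<tau>_nz[OF assms(1,2)]] \<iota>_mul[OF assms]
    by auto
qed

section \<open>Graded simplicity of the base and of the loop\<close>

lemma graded_simple_base_imp_loop:
  assumes "graded_simple \<Gamma> A" shows "graded_simple G L"
proof -
  interpret A: graded_simple_algebra \<Gamma> A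
    by (intro graded_simple_algebra.intro graded_simple_algebra_axioms.intro A.graded_algebra_axioms
        \<Gamma>.comm_group_axioms assms)
  obtain a b u v where uv: "a \<in> carrier \<Gamma>" "b \<in> carrier \<Gamma>" "u \<in> acomp A a" "v \<in> acomp A b" "amul A u v \<noteq> 0"
    using assms A.graded_simple_iff_ideal_family by auto
  show ?thesis unfolding L.graded_simple_iff_ideal_family
  proof (intro conjI allI impI)
    obtain g h where "g \<in> carrier G" "h \<in> carrier G" "\<pi> g = a" "\<pi> h = b" using uv \<pi>_lift by metis
    then show "\<exists>g\<in>carrier G. \<exists>h\<in>carrier G. \<exists>x\<in>acomp L g. \<exists>y\<in>acomp L h. amul L x y \<noteq> 0"
      using uv mul_eq_zero_iff[of g h u v] \<iota>_mem by metis
  next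
    fix J assume J: "ideal_family G L J"
    have J1: "J g \<subseteq> acomp L g" "0 \<in> J g" "\<And>x y. \<lbrakk>x \<in> J g; y \<in> J g\<rbrakk> \<Longrightarrow> x + y \<in> J g"
      "\<And>r x. x \<in> J g \<Longrightarrow> ascal L r x \<in> J g" if "g \<in> carrier G" for g
      using J that unfolding ideal_family_def by auto
    have J2: "amul L x y \<in> J (g \<otimes>\<^bsub>G\<^esub> h)" "amul L y x \<in> J (h \<otimes>\<^bsub>G\<^esub> g)"
      if "g \<in> carrier G" "h \<in> carrier G" "x \<in> acomp L g" "y \<in> J h" for g h x y
      using J that unfolding ideal_family_def by auto
    \<comment> \<open>An ideal of L may contain the copy of u in some degrees over a and not in
      others. Asking for all of them makes this an ideal family of the base.\<close>
    define J' where "J' a = {u \<in> acomp A a. \<forall>g\<in>carrier G. \<pi> g = a \<longrightarrow> \<iota> g u \<in> J g}" for a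
    \<comment> \<open>Assumption \<open>vJ\<close> wants, for each degree k over the product, just
      one factorization of k whose second factor carries a copy of v in J. It thus covers both v in
      J' and v with a single copy in J.\<close>
    have J'_mul: "amul A u v \<in> J' (a \<otimes>\<^bsub>\<Gamma>\<^esub> b) \<and> amul A v u \<in> J' (b \<otimes>\<^bsub>\<Gamma>\<^esub> a)"
      if a: "a \<in> carrier \<Gamma>" and b: "b \<in> carrier \<Gamma>" and u: "u \<in> acomp A a" and v: "v \<in> acomp A b"
        and vJ: "\<And>k. \<lbrakk>k \<in> carrier G; \<pi> k = a \<otimes>\<^bsub>\<Gamma>\<^esub> b\<rbrakk> \<Longrightarrow> \<exists>g\<in>carrier G. \<exists>h\<in>carrier G. g \<otimes>\<^bsub>G\<^esub> h = k \<and> \<pi> g = a \<and> \<pi> h = b \<and> \<iota> h v \<in> J h"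
      for a b u v
    proof -
      have "\<iota> k (amul A u v) \<in> J k \<and> \<iota> k (amul A v u) \<in> J k" if k: "k \<in> carrier G" "\<pi> k = a \<otimes>\<^bsub>\<Gamma>\<^esub> b" for k
      proof -
        obtain g h where gh: "g \<in> carrier G" "h \<in> carrier G" "g \<otimes>\<^bsub>G\<^esub> h = k" "\<pi> g = a" "\<pi> h = b" "\<iota> h v \<in> J h"
          using vJ[OF k] by auto
        have hg: "h \<otimes>\<^bsub>G\<^esub> g = k" using gh G.m_comm by simp
        have "\<iota> g u \<in> acomp L g" using \<iota>_mem gh u by simp
        then show ?thesis
          using \<iota>_mul'[of g h u v] \<iota>_mul'[of h g v u] gh hg u v J1(4)[of k] J2[of g h "\<iota> g u" "\<iota> h v"] k by simp
      qed
      then show ?thesis unfolding J'_def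
        using A.mul_comp[OF a b u v] A.mul_comp[OF b a v u] \<Gamma>.m_comm[OF a b] by simp
    qed
    have J': "ideal_family \<Gamma> A J'" unfolding ideal_family_def
    proof (intro conjI ballI allI)
      fix a assume a: "a \<in> carrier \<Gamma>"
      show "J' a \<subseteq> acomp A a" unfolding J'_def by auto
      show "0 \<in> J' a" unfolding J'_def using a A.comp_zero \<iota>_zero J1(2) by auto
      fix u assume u: "u \<in> J' a"
      then show "ascal A r u \<in> J' a" for r unfolding J'_def using a J1(4) A.comp_scal \<iota>_scal by auto
      fix v assume "v \<in> J' a"
      then show "u + v \<in> J' a" using u unfolding J'_def using a J1(3) A.comp_add \<iota>_add by auto
    next
      fix a b u v assume a: "a \<in> carrier \<Gamma>" and b: "b \<in> carrier \<Gamma>" and u: "u \<in> acomp A a" and v: "v \<in> J' b"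
      have lift: "\<exists>g\<in>carrier G. \<exists>h\<in>carrier G. g \<otimes>\<^bsub>G\<^esub> h = k \<and> \<pi> g = a \<and> \<pi> h = b \<and> \<iota> h v \<in> J h"
        if k: "k \<in> carrier G" "\<pi> k = a \<otimes>\<^bsub>\<Gamma>\<^esub> b" for k
      proof -
        obtain g where g: "g \<in> carrier G" "\<pi> g = a" using \<pi>_lift a by auto
        let ?h = "inv\<^bsub>G\<^esub> g \<otimes>\<^bsub>G\<^esub> k"
        have "g \<otimes>\<^bsub>G\<^esub> ?h = k" using g k by (simp add: G.m_assoc[symmetric])
        moreover have "\<pi> ?h = b" using g k a b by (simp add: \<pi>_mult \<pi>_inv \<Gamma>.m_assoc[symmetric])
        moreover have "\<iota> ?h v \<in> J ?h" using v \<open>\<pi> ?h = b\<close> g k unfolding J'_def by simp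
        ultimately show ?thesis using g k by (intro bexI[of _ g] bexI[of _ ?h]) simp_all
      qed
      have va: "v \<in> acomp A b" using v unfolding J'_def by auto
      show "amul A u v \<in> J' (a \<otimes>\<^bsub>\<Gamma>\<^esub> b)" "amul A v u \<in> J' (b \<otimes>\<^bsub>\<Gamma>\<^esub> a)"
        using J'_mul[OF a b u va lift] by auto
    qed
    show "(\<forall>g\<in>carrier G. J g = {0}) \<or> (\<forall>g\<in>carrier G. J g = acomp L g)"
      using A.ideal_family_trivial[OF J']
    proof
      assume full: "\<forall>a\<in>carrier \<Gamma>. J' a = acomp A a"
      have "x \<in> J g" if g: "g \<in> carrier G" and x: "x \<in> acomp L g" for g x
      proof -
        obtain u where u: "u \<in> acomp A (\<pi> g)" "x = \<iota> g u" using \<iota>_surj[OF g x] by auto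
        then have "u \<in> J' (\<pi> g)" using full g by simp
        then show ?thesis unfolding J'_def using g u by auto
      qed
      then show ?thesis using J1(1) by blast
    next
      assume z: "\<forall>a\<in>carrier \<Gamma>. J' a = {0}"
      \<comment> \<open>The two-sided annihilator of A. If J' vanishes, any v with a copy in J has
        all its products in J', so it lies in N; and N is a graded ideal which is not everything,
        because some product in A is nonzero.\<close>
      define N where "N a = {u \<in> acomp A a. \<forall>b\<in>carrier \<Gamma>. \<forall>v\<in>acomp A b. amul A u v = 0 \<and> amul A v u = 0}" for a
      have N: "ideal_family \<Gamma> A N" unfolding ideal_family_def
      proof (intro conjI ballI allI)
        fix a assume a: "a \<in> carrier \<Gamma>"
        show "N a \<subseteq> acomp A a" unfolding N_def by auto
        show "0 \<in> N a" unfolding N_def using a A.comp_zero A.comp_mem by auto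
        fix u assume u: "u \<in> N a"
        then show "ascal A r u \<in> N a" for r
          unfolding N_def using a A.comp_scal A.comp_mem by (auto simp: A.mul_scal_left A.mul_scal_right)
        fix v assume "v \<in> N a"
        then show "u + v \<in> N a"
          using u unfolding N_def using a A.comp_add A.comp_mem by (auto simp: A.mul_add_left A.mul_add_right)
      next
        fix a b u v assume ab: "a \<in> carrier \<Gamma>" "b \<in> carrier \<Gamma>" "u \<in> acomp A a" "v \<in> N b"
        then have "amul A u v = 0" "amul A v u = 0" unfolding N_def by auto
        moreover have "0 \<in> N c" if "c \<in> carrier \<Gamma>" for c
          unfolding N_def using that A.comp_zero A.comp_mem by auto
        ultimately show "amul A u v \<in> N (a \<otimes>\<^bsub>\<Gamma>\<^esub> b)" "amul A v u \<in> N (b \<otimes>\<^bsub>\<Gamma>\<^esub> a)" using ab by auto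
      qed
      have "N a \<noteq> acomp A a" using uv unfolding N_def by auto
      then have N0: "\<forall>a\<in>carrier \<Gamma>. N a = {0}" using A.ideal_family_trivial[OF N] uv by auto
      have "x = 0" if g: "g \<in> carrier G" and x: "x \<in> J g" for g x
      proof -
        obtain v where v: "v \<in> acomp A (\<pi> g)" "x = \<iota> g v" using \<iota>_surj[OF g] x J1(1)[OF g] by auto
        have "amul A v u = 0 \<and> amul A u v = 0" if b: "b \<in> carrier \<Gamma>" and u: "u \<in> acomp A b" for b u
        proof -
          have lift: "\<exists>h\<in>carrier G. \<exists>h'\<in>carrier G. h \<otimes>\<^bsub>G\<^esub> h' = k \<and> \<pi> h = b \<and> \<pi> h' = \<pi> g \<and> \<iota> h' v \<in> J h'"
            if k: "k \<in> carrier G" "\<pi> k = b \<otimes>\<^bsub>\<Gamma>\<^esub> \<pi> g" for k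
          proof (intro bexI conjI)
            show "(k \<otimes>\<^bsub>G\<^esub> inv\<^bsub>G\<^esub> g) \<otimes>\<^bsub>G\<^esub> g = k" using k g by (simp add: G.m_assoc)
            show "\<pi> (k \<otimes>\<^bsub>G\<^esub> inv\<^bsub>G\<^esub> g) = b" using k g b by (simp add: \<pi>_mult \<pi>_inv \<Gamma>.m_assoc)
          qed (use k g x v in auto)
          have "amul A u v \<in> J' (b \<otimes>\<^bsub>\<Gamma>\<^esub> \<pi> g) \<and> amul A v u \<in> J' (\<pi> g \<otimes>\<^bsub>\<Gamma>\<^esub> b)"
            by (rule J'_mul[OF b \<pi>_closed[OF g] u v(1) lift])
          then show ?thesis using z g b by simp
        qed
        then have "v \<in> N (\<pi> g)" unfolding N_def using v by auto
        then show ?thesis using N0 g v \<iota>_zero by simp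
      qed
      then show ?thesis using J1(2) by blast
    qed
  qed
qed

text \<open>A graded ideal of the base gives one of the loop by taking all copies of its components,
  and surjectivity of \<pi> recovers the former from the latter.\<close>

lemma graded_simple_loop_imp_base:
  assumes "graded_simple G L" shows "graded_simple \<Gamma> A"
  unfolding A.graded_simple_iff_ideal_family
proof (intro conjI allI impI)
  obtain g h x y where xy: "g \<in> carrier G" "h \<in> carrier G" "x \<in> acomp L g" "y \<in> acomp L h" "amul L x y \<noteq> 0"
    using assms L.graded_simple_iff_ideal_family by auto
  obtain u v where "u \<in> acomp A (\<pi> g)" "v \<in> acomp A (\<pi> h)" "x = \<iota> g u" "y = \<iota> h v"
    using \<iota>_surj xy by metis
  then show "\<exists>a\<in>carrier \<Gamma>. \<exists>b\<in>carrier \<Gamma>. \<exists>u\<in>acomp A a. \<exists>v\<in>acomp A b. amul A u v \<noteq> 0"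
    using xy mul_eq_zero_iff[of g h u v] by (metis \<pi>_closed)
next
  fix J assume J: "ideal_family \<Gamma> A J"
  have J1: "J a \<subseteq> acomp A a" "0 \<in> J a" "\<And>x y. \<lbrakk>x \<in> J a; y \<in> J a\<rbrakk> \<Longrightarrow> x + y \<in> J a"
    "\<And>r x. x \<in> J a \<Longrightarrow> ascal A r x \<in> J a" if "a \<in> carrier \<Gamma>" for a
    using J that unfolding ideal_family_def by auto
  have J2: "amul A x y \<in> J (a \<otimes>\<^bsub>\<Gamma>\<^esub> b)" "amul A y x \<in> J (b \<otimes>\<^bsub>\<Gamma>\<^esub> a)"
    if "a \<in> carrier \<Gamma>" "b \<in> carrier \<Gamma>" "x \<in> acomp A a" "y \<in> J b" for a b x y
    using J that unfolding ideal_family_def by auto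
  have Jc: "u \<in> acomp A (\<pi> g)" if "g \<in> carrier G" "u \<in> J (\<pi> g)" for g u using J1(1) that \<pi>_closed by blast
  have "ideal_family G L (\<lambda>g. \<iota> g ` J (\<pi> g))" unfolding ideal_family_def
  proof (intro conjI ballI allI)
    fix g assume g: "g \<in> carrier G"
    show "\<iota> g ` J (\<pi> g) \<subseteq> acomp L g" using \<iota>_mem[OF g] Jc[OF g] by auto
    show "0 \<in> \<iota> g ` J (\<pi> g)" using \<iota>_zero g J1(2) by (intro image_eqI[of _ _ 0]) simp_all
    fix x assume "x \<in> \<iota> g ` J (\<pi> g)"
    then obtain u where u: "u \<in> J (\<pi> g)" "x = \<iota> g u" by auto
    show "ascal L r x \<in> \<iota> g ` J (\<pi> g)" for r
      unfolding u(2) \<iota>_scal[OF g Jc[OF g u(1)], symmetric] using J1(4) u g by simp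
    fix y assume "y \<in> \<iota> g ` J (\<pi> g)"
    then obtain v where v: "v \<in> J (\<pi> g)" "y = \<iota> g v" by auto
    show "x + y \<in> \<iota> g ` J (\<pi> g)"
      unfolding u(2) v(2) \<iota>_add[OF g Jc[OF g u(1)] Jc[OF g v(1)], symmetric] using J1(3) u v g by simp
  next
    fix g h x y assume gh: "g \<in> carrier G" "h \<in> carrier G" and x: "x \<in> acomp L g" and "y \<in> \<iota> h ` J (\<pi> h)"
    then obtain v where v: "v \<in> J (\<pi> h)" "y = \<iota> h v" by auto
    obtain u where u: "u \<in> acomp A (\<pi> g)" "x = \<iota> g u" using \<iota>_surj gh x by auto
    have vc: "v \<in> acomp A (\<pi> h)" using Jc gh v by simp
    have "amul L x y = \<iota> (g \<otimes>\<^bsub>G\<^esub> h) (ascal A (\<tau> g h) (amul A u v))"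
      using \<iota>_mul[OF gh u(1) vc] \<iota>_scal[OF _ A_mul_comp[OF gh u(1) vc]] gh u v by simp
    moreover have "ascal A (\<tau> g h) (amul A u v) \<in> J (\<pi> (g \<otimes>\<^bsub>G\<^esub> h))"
      using J2(1)[OF _ _ u(1) v(1)] J1(4) gh by (simp add: \<pi>_mult)
    ultimately show "amul L x y \<in> \<iota> (g \<otimes>\<^bsub>G\<^esub> h) ` J (\<pi> (g \<otimes>\<^bsub>G\<^esub> h))" by simp
    have "amul L y x = \<iota> (h \<otimes>\<^bsub>G\<^esub> g) (ascal A (\<tau> h g) (amul A v u))"
      using \<iota>_mul[OF gh(2,1) vc u(1)] \<iota>_scal[OF _ A_mul_comp[OF gh(2,1) vc u(1)]] gh u v by simp
    moreover have "ascal A (\<tau> h g) (amul A v u) \<in> J (\<pi> (h \<otimes>\<^bsub>G\<^esub> g))"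
      using J2(2)[OF _ _ u(1) v(1)] J1(4) gh by (simp add: \<pi>_mult)
    ultimately show "amul L y x \<in> \<iota> (h \<otimes>\<^bsub>G\<^esub> g) ` J (\<pi> (h \<otimes>\<^bsub>G\<^esub> g))" by simp
  qed
  then have "(\<forall>g\<in>carrier G. \<iota> g ` J (\<pi> g) = {0}) \<or> (\<forall>g\<in>carrier G. \<iota> g ` J (\<pi> g) = acomp L g)"
    using assms L.graded_simple_iff_ideal_family by auto
  then show "(\<forall>a\<in>carrier \<Gamma>. J a = {0}) \<or> (\<forall>a\<in>carrier \<Gamma>. J a = acomp A a)"
  proof
    assume z: "\<forall>g\<in>carrier G. \<iota> g ` J (\<pi> g) = {0}"
    have "u = 0" if a: "a \<in> carrier \<Gamma>" and u: "u \<in> J a" for a u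
    proof -
      obtain g where g: "g \<in> carrier G" "\<pi> g = a" using \<pi>_lift a by auto
      then have "\<iota> g u = 0" using z u by auto
      then show ?thesis using \<iota>_eq_zero[OF g(1) Jc[OF g(1)], of u] g u by simp
    qed
    then show ?thesis using J1(2) by blast
  next
    assume f: "\<forall>g\<in>carrier G. \<iota> g ` J (\<pi> g) = acomp L g"
    have "u \<in> J a" if a: "a \<in> carrier \<Gamma>" and u: "u \<in> acomp A a" for a u
    proof -
      obtain g where g: "g \<in> carrier G" "\<pi> g = a" using \<pi>_lift a by auto
      have "\<iota> g u \<in> \<iota> g ` J (\<pi> g)"
        unfolding f[rule_format, OF g(1)] by (rule \<iota>_mem[OF g(1)]) (use g u in simp)
      then obtain v where "v \<in> J (\<pi> g)" "\<iota> g u = \<iota> g v" by auto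
      then show ?thesis using \<iota>_inj[OF g(1) _ Jc[OF g(1)], of u v] g u by simp
    qed
    then show ?thesis using J1(1) by blast
  qed
qed

section \<open>Transport of centroid elements between base and loop\<close>

abbreviation "jinv g \<equiv> the_inv_into (acomp A (\<pi> g)) (\<iota> g)"

lemma jinv_\<iota>: "\<lbrakk>g \<in> carrier G; u \<in> acomp A (\<pi> g)\<rbrakk> \<Longrightarrow> jinv g (\<iota> g u) = u"
  using \<iota>_bij[of g] by (simp add: bij_betw_def the_inv_into_f_f)

lemma jinv_mem: "\<lbrakk>g \<in> carrier G; x \<in> acomp L g\<rbrakk> \<Longrightarrow> jinv g x \<in> acomp A (\<pi> g)"
  using \<iota>_surj[of g x] jinv_\<iota> by auto

lemma \<iota>_jinv: "\<lbrakk>g \<in> carrier G; x \<in> acomp L g\<rbrakk> \<Longrightarrow> \<iota> g (jinv g x) = x"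
  using \<iota>_surj[of g x] jinv_\<iota> by auto

text \<open>The scalar \<tau>(k,g) makes the lift compatible with the twisted product: the cocycle
  identity for (k, g, h) gives the rule for the left factor, \<open>Z2sym_swap\<close> the one for
  the right factor.\<close>

lemma centroid_lift:
  assumes k: "k \<in> carrier G" and D: "D \<in> centroid_comp \<Gamma> A (\<pi> k)"
  obtains c where "c \<in> centroid_comp G L k"
    and "\<And>g u. \<lbrakk>g \<in> carrier G; u \<in> acomp A (\<pi> g)\<rbrakk> \<Longrightarrow> c (\<iota> g u) = ascal L (\<tau> k g) (\<iota> (k \<otimes>\<^bsub>G\<^esub> g) (D u))"
proof -
  define d where "d g x = ascal L (\<tau> k g) (\<iota> (k \<otimes>\<^bsub>G\<^esub> g) (D (jinv g x)))" for g x
  note Dc = centroid_compD(1)[OF D]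
  have D_comp: "D u \<in> acomp A (\<pi> (k \<otimes>\<^bsub>G\<^esub> g))" if "g \<in> carrier G" "u \<in> acomp A (\<pi> g)" for g u
    using centroid_compD(2)[OF D, of "\<pi> g" u] that k by (simp add: \<pi>_mult)
  have d_\<iota>: "d g (\<iota> g u) = ascal L (\<tau> k g) (\<iota> (k \<otimes>\<^bsub>G\<^esub> g) (D u))" if "g \<in> carrier G" "u \<in> acomp A (\<pi> g)" for g u
    unfolding d_def using that by (simp add: jinv_\<iota>)
  have add: "additive_family G L d" unfolding additive_family_def
  proof (intro ballI)
    fix g x y assume g: "g \<in> carrier G" and "x \<in> acomp L g" "y \<in> acomp L g"
    then obtain u v where u: "u \<in> acomp A (\<pi> g)" "x = \<iota> g u" and v: "v \<in> acomp A (\<pi> g)" "y = \<iota> g v"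
      using \<iota>_surj by metis
    have uv: "u + v \<in> acomp A (\<pi> g)" "u \<in> asp A" "v \<in> asp A"
      using u v g A.comp_add[of "\<pi> g"] A.comp_mem[of "\<pi> g"] by auto
    have kg: "k \<otimes>\<^bsub>G\<^esub> g \<in> carrier G" using k g by simp
    have "d g (x + y) = ascal L (\<tau> k g) (\<iota> (k \<otimes>\<^bsub>G\<^esub> g) (D u) + \<iota> (k \<otimes>\<^bsub>G\<^esub> g) (D v))"
      using d_\<iota>[OF g uv(1)] \<iota>_add[OF g u(1) v(1)] u v centroidD(3)[OF Dc uv(2,3)]
        \<iota>_add[OF kg D_comp[OF g u(1)] D_comp[OF g v(1)]] by simp
    then show "d g (x + y) = d g x + d g y"
      using d_\<iota>[OF g u(1)] d_\<iota>[OF g v(1)] u v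
        L.scal_add_right[OF \<iota>_mem_asp[OF kg D_comp[OF g u(1)]] \<iota>_mem_asp[OF kg D_comp[OF g v(1)]]] by simp
  qed
  have comp: "d g x \<in> acomp L (k \<otimes>\<^bsub>G\<^esub> g)" if g: "g \<in> carrier G" and x: "x \<in> acomp L g" for g x
    unfolding d_def using L.comp_scal[OF _ \<iota>_mem[OF _ D_comp[OF g jinv_mem[OF g x]]]] g k by simp
  have scal: "d g (ascal L r x) = ascal L r (d g x)" if g: "g \<in> carrier G" and x: "x \<in> acomp L g" for g x r
  proof -
    obtain u where u: "u \<in> acomp A (\<pi> g)" "x = \<iota> g u" using \<iota>_surj[OF g x] by auto
    have um: "u \<in> asp A" using A.comp_mem[of "\<pi> g" u] u g by simp
    have kg: "k \<otimes>\<^bsub>G\<^esub> g \<in> carrier G" using k g by simp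
    have "d g (ascal L r x) = ascal L (\<tau> k g) (ascal L r (\<iota> (k \<otimes>\<^bsub>G\<^esub> g) (D u)))"
      using u \<iota>_scal[OF g u(1), symmetric] d_\<iota>[OF g A.comp_scal[OF _ u(1)]] g centroidD(4)[OF Dc um]
        \<iota>_scal[OF kg D_comp[OF g u(1)]] by simp
    then show ?thesis using d_\<iota>[OF g u(1)] u(2) \<iota>_mem_asp[OF kg D_comp[OF g u(1)]]
      by (simp add: L.scal_scal mult.commute)
  qed
  have mul: "d (g \<otimes>\<^bsub>G\<^esub> h) (amul L x y) = amul L (d g x) y \<and> d (g \<otimes>\<^bsub>G\<^esub> h) (amul L x y) = amul L x (d h y)"
    if g: "g \<in> carrier G" and h: "h \<in> carrier G" and x: "x \<in> acomp L g" and y: "y \<in> acomp L h" for g h x y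
  proof -
    obtain u where u: "u \<in> acomp A (\<pi> g)" "x = \<iota> g u" using \<iota>_surj[OF g x] by auto
    obtain v where v: "v \<in> acomp A (\<pi> h)" "y = \<iota> h v" using \<iota>_surj[OF h y] by auto
    have um: "u \<in> asp A" "v \<in> asp A" using A.comp_mem[of "\<pi> g"] A.comp_mem[of "\<pi> h"] u v g h by auto
    have kg: "k \<otimes>\<^bsub>G\<^esub> g \<in> carrier G" and kh: "k \<otimes>\<^bsub>G\<^esub> h \<in> carrier G" and gh: "g \<otimes>\<^bsub>G\<^esub> h \<in> carrier G"
      using k g h by auto
    note uv = A_mul_comp[OF g h u(1) v(1)]
    let ?w = "\<iota> (k \<otimes>\<^bsub>G\<^esub> (g \<otimes>\<^bsub>G\<^esub> h)) (D (amul A u v))"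
    have w: "?w \<in> asp L" using \<iota>_mem_asp[OF _ D_comp[OF gh uv]] k gh by simp
    have xs: "x \<in> asp L" "y \<in> asp L" using L.comp_mem g h x y by auto
    have l: "d (g \<otimes>\<^bsub>G\<^esub> h) (amul L x y) = ascal L (\<tau> g h * \<tau> k (g \<otimes>\<^bsub>G\<^esub> h)) ?w"
      using u v \<iota>_mul[OF g h u(1) v(1)] scal[OF gh \<iota>_mem[OF gh uv]] d_\<iota>[OF gh uv] w by (simp add: L.scal_scal)
    have "amul L (d g x) y = ascal L (\<tau> k g) (amul L (\<iota> (k \<otimes>\<^bsub>G\<^esub> g) (D u)) (\<iota> h v))"
      using d_\<iota>[OF g u(1)] u(2) v(2) L.mul_scal_left[OF \<iota>_mem_asp[OF kg D_comp[OF g u(1)]] xs(2)] by simp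
    also have "\<dots> = ascal L (\<tau> k g * \<tau> (k \<otimes>\<^bsub>G\<^esub> g) h) ?w"
      using \<iota>_mul[OF kg h D_comp[OF g u(1)] v(1)] centroidD(5)[OF Dc um] w k g h
      by (simp add: L.scal_scal G.m_assoc)
    finally have r1: "amul L (d g x) y = ascal L (\<tau> k g * \<tau> (k \<otimes>\<^bsub>G\<^esub> g) h) ?w" .
    have "amul L x (d h y) = ascal L (\<tau> k h) (amul L (\<iota> g u) (\<iota> (k \<otimes>\<^bsub>G\<^esub> h) (D v)))"
      using d_\<iota>[OF h v(1)] u(2) v(2) L.mul_scal_right[OF xs(1) \<iota>_mem_asp[OF kh D_comp[OF h v(1)]]] by simp
    also have "\<dots> = ascal L (\<tau> k h * \<tau> g (k \<otimes>\<^bsub>G\<^esub> h)) ?w"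
      using \<iota>_mul[OF g kh u(1) D_comp[OF h v(1)]] centroidD(6)[OF Dc um] w G.m_lcomm[OF g k h]
      by (simp add: L.scal_scal)
    finally have r2: "amul L x (d h y) = ascal L (\<tau> k h * \<tau> g (k \<otimes>\<^bsub>G\<^esub> h)) ?w" .
    show ?thesis unfolding l r1 r2
      using Z2symD(3)[OF \<tau> k g h] Z2sym_swap[OF G.comm_group_axioms \<tau> k g h] by (simp add: mult.commute)
  qed
  note c = L.cext_centroid_comp[OF k add comp scal conjunct1[OF mul] conjunct2[OF mul]]
  show thesis by (rule that[OF c(1)]) (use c(2) d_\<iota> \<iota>_mem in auto)
qed

text \<open>Dividing by \<tau>(k,g) and undoing \<iota> reverses the lift, but yields one map
  \<open>d g\<close> for every g in G. Once it is known to depend on the coset of g only, values at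
  representatives give a centroid element of the base.\<close>

lemma centroid_descend:
  assumes A: "graded_simple \<Gamma> A" and k: "k \<in> carrier G" and c: "c \<in> centroid_comp G L k"
  obtains D where "D \<in> centroid_comp \<Gamma> A (\<pi> k)"
    and "\<And>g u. \<lbrakk>g \<in> carrier G; u \<in> acomp A (\<pi> g)\<rbrakk> \<Longrightarrow> c (\<iota> g u) = ascal L (\<tau> k g) (\<iota> (k \<otimes>\<^bsub>G\<^esub> g) (D u))"
proof -
  note cc = centroid_compD(1)[OF c]
  have sq: "alg_square A = asp A" using A unfolding graded_simple_def by simp
  define d where "d g u = jinv (k \<otimes>\<^bsub>G\<^esub> g) (ascal L (inverse (\<tau> k g)) (c (\<iota> g u)))" for g u
  have c_comp: "c (\<iota> g u) \<in> acomp L (k \<otimes>\<^bsub>G\<^esub> g)" if "g \<in> carrier G" "u \<in> acomp A (\<pi> g)" for g u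
    using centroid_compD(2)[OF c that(1) \<iota>_mem[OF that]] .
  have d_comp: "d g u \<in> acomp A (\<pi> (k \<otimes>\<^bsub>G\<^esub> g))" if "g \<in> carrier G" "u \<in> acomp A (\<pi> g)" for g u
    unfolding d_def using jinv_mem[OF _ L.comp_scal[OF _ c_comp[OF that]]] that k by simp
  have c_eq: "c (\<iota> g u) = ascal L (\<tau> k g) (\<iota> (k \<otimes>\<^bsub>G\<^esub> g) (d g u))" if "g \<in> carrier G" "u \<in> acomp A (\<pi> g)" for g u
    unfolding d_def using \<iota>_jinv[OF _ L.comp_scal[OF _ c_comp[OF that]]] that k \<tau>_nz[OF k that(1)]
      L.comp_mem[OF _ c_comp[OF that]] by (simp add: L.scal_scal L.scal_one)
  \<comment> \<open>Injectivity of \<iota> and \<tau>(k,g) \<noteq> 0 make \<open>d g u\<close> the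
    only solution of this equation, so every property of d is checked by applying c inside
    L.\<close>
  have d_unique: "d g u = v" if "g \<in> carrier G" "u \<in> acomp A (\<pi> g)" "v \<in> acomp A (\<pi> (k \<otimes>\<^bsub>G\<^esub> g))"
    "c (\<iota> g u) = ascal L (\<tau> k g) (\<iota> (k \<otimes>\<^bsub>G\<^esub> g) v)" for g u v
  proof -
    have kg: "k \<otimes>\<^bsub>G\<^esub> g \<in> carrier G" using k that by simp
    have "ascal L (inverse (\<tau> k g)) (ascal L (\<tau> k g) (\<iota> (k \<otimes>\<^bsub>G\<^esub> g) v)) = \<iota> (k \<otimes>\<^bsub>G\<^esub> g) v"
      using \<iota>_mem_asp[OF kg that(3)] \<tau>_nz[OF k that(1)] by (simp add: L.scal_scal L.scal_one)
    then show ?thesis unfolding d_def using that jinv_\<iota>[OF kg that(3)] by simp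
  qed
  have d_add: "d g (u + v) = d g u + d g v" if g: "g \<in> carrier G" and u: "u \<in> acomp A (\<pi> g)" and v: "v \<in> acomp A (\<pi> g)" for g u v
  proof (rule d_unique[OF g])
    have kg: "k \<otimes>\<^bsub>G\<^esub> g \<in> carrier G" using k g by simp
    show "u + v \<in> acomp A (\<pi> g)" "d g u + d g v \<in> acomp A (\<pi> (k \<otimes>\<^bsub>G\<^esub> g))"
      using A.comp_add u v g d_comp kg by auto
    show "c (\<iota> g (u + v)) = ascal L (\<tau> k g) (\<iota> (k \<otimes>\<^bsub>G\<^esub> g) (d g u + d g v))"
      using \<iota>_add[OF g u v] centroidD(3)[OF cc \<iota>_mem_asp[OF g u] \<iota>_mem_asp[OF g v]] c_eq[OF g u] c_eq[OF g v]
        \<iota>_add[OF kg d_comp[OF g u] d_comp[OF g v]]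
        L.scal_add_right[OF \<iota>_mem_asp[OF kg d_comp[OF g u]] \<iota>_mem_asp[OF kg d_comp[OF g v]]] by simp
  qed
  have d_scal: "d g (ascal A r u) = ascal A r (d g u)" if g: "g \<in> carrier G" and u: "u \<in> acomp A (\<pi> g)" for g u r
  proof (rule d_unique[OF g])
    have kg: "k \<otimes>\<^bsub>G\<^esub> g \<in> carrier G" using k g by simp
    show "ascal A r u \<in> acomp A (\<pi> g)" "ascal A r (d g u) \<in> acomp A (\<pi> (k \<otimes>\<^bsub>G\<^esub> g))"
      using A.comp_scal u g d_comp kg by auto
    show "c (\<iota> g (ascal A r u)) = ascal L (\<tau> k g) (\<iota> (k \<otimes>\<^bsub>G\<^esub> g) (ascal A r (d g u)))"
      using \<iota>_scal[OF g u] centroidD(4)[OF cc \<iota>_mem_asp[OF g u]] c_eq[OF g u]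
        \<iota>_scal[OF kg d_comp[OF g u]] \<iota>_mem_asp[OF kg d_comp[OF g u]] by (simp add: L.scal_scal mult.commute)
  qed
  have d_mul: "d (g \<otimes>\<^bsub>G\<^esub> h) (amul A u v) = amul A (d g u) v \<and> d (g \<otimes>\<^bsub>G\<^esub> h) (amul A u v) = amul A u (d h v)"
    if g: "g \<in> carrier G" and h: "h \<in> carrier G" and u: "u \<in> acomp A (\<pi> g)" and v: "v \<in> acomp A (\<pi> h)" for g h u v
  proof -
    have kg: "k \<otimes>\<^bsub>G\<^esub> g \<in> carrier G" and kh: "k \<otimes>\<^bsub>G\<^esub> h \<in> carrier G" and gh: "g \<otimes>\<^bsub>G\<^esub> h \<in> carrier G"
      using k g h by auto
    have kgh: "k \<otimes>\<^bsub>G\<^esub> g \<otimes>\<^bsub>G\<^esub> h = k \<otimes>\<^bsub>G\<^esub> (g \<otimes>\<^bsub>G\<^esub> h)" "g \<otimes>\<^bsub>G\<^esub> (k \<otimes>\<^bsub>G\<^esub> h) = k \<otimes>\<^bsub>G\<^esub> (g \<otimes>\<^bsub>G\<^esub> h)"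
      using k g h by (simp_all add: G.m_assoc G.m_lcomm)
    note uv = A_mul_comp[OF g h u v]
    note m1 = A_mul_comp[OF kg h d_comp[OF g u] v, unfolded kgh]
    note m2 = A_mul_comp[OF g kh u d_comp[OF h v], unfolded kgh]
    have kghc: "k \<otimes>\<^bsub>G\<^esub> (g \<otimes>\<^bsub>G\<^esub> h) \<in> carrier G" using k gh by simp
    have ce: "c (\<iota> (g \<otimes>\<^bsub>G\<^esub> h) (amul A u v)) = ascal L (inverse (\<tau> g h)) (c (amul L (\<iota> g u) (\<iota> h v)))"
      using \<iota>_mul'[OF g h u v] centroidD(4)[OF cc L.mul_mem[OF \<iota>_mem_asp[OF g u] \<iota>_mem_asp[OF h v]]] by simp
    have "d (g \<otimes>\<^bsub>G\<^esub> h) (amul A u v) = amul A (d g u) v"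
    proof (rule d_unique[OF gh uv m1])
      have "c (amul L (\<iota> g u) (\<iota> h v)) = amul L (c (\<iota> g u)) (\<iota> h v)"
        using centroidD(5)[OF cc \<iota>_mem_asp[OF g u] \<iota>_mem_asp[OF h v]] .
      also have "\<dots> = ascal L (\<tau> k g * \<tau> (k \<otimes>\<^bsub>G\<^esub> g) h) (\<iota> (k \<otimes>\<^bsub>G\<^esub> (g \<otimes>\<^bsub>G\<^esub> h)) (amul A (d g u) v))"
        using c_eq[OF g u] L.mul_scal_left[OF \<iota>_mem_asp[OF kg d_comp[OF g u]] \<iota>_mem_asp[OF h v]]
          \<iota>_mul[OF kg h d_comp[OF g u] v] \<iota>_mem_asp[OF kghc m1] kgh by (simp add: L.scal_scal)
      also have "\<tau> k g * \<tau> (k \<otimes>\<^bsub>G\<^esub> g) h = \<tau> g h * \<tau> k (g \<otimes>\<^bsub>G\<^esub> h)"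
        using Z2symD(3)[OF \<tau> k g h] by (simp add: mult.commute)
      finally show "c (\<iota> (g \<otimes>\<^bsub>G\<^esub> h) (amul A u v)) =
          ascal L (\<tau> k (g \<otimes>\<^bsub>G\<^esub> h)) (\<iota> (k \<otimes>\<^bsub>G\<^esub> (g \<otimes>\<^bsub>G\<^esub> h)) (amul A (d g u) v))"
        unfolding ce using \<iota>_mem_asp[OF kghc m1] \<tau>_nz[OF g h] by (simp add: L.scal_scal mult.assoc[symmetric])
    qed
    moreover have "d (g \<otimes>\<^bsub>G\<^esub> h) (amul A u v) = amul A u (d h v)"
    proof (rule d_unique[OF gh uv m2])
      have "c (amul L (\<iota> g u) (\<iota> h v)) = amul L (\<iota> g u) (c (\<iota> h v))"
        using centroidD(6)[OF cc \<iota>_mem_asp[OF g u] \<iota>_mem_asp[OF h v]] .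
      also have "\<dots> = ascal L (\<tau> k h * \<tau> g (k \<otimes>\<^bsub>G\<^esub> h)) (\<iota> (k \<otimes>\<^bsub>G\<^esub> (g \<otimes>\<^bsub>G\<^esub> h)) (amul A u (d h v)))"
        using c_eq[OF h v] L.mul_scal_right[OF \<iota>_mem_asp[OF g u] \<iota>_mem_asp[OF kh d_comp[OF h v]]]
          \<iota>_mul[OF g kh u d_comp[OF h v]] \<iota>_mem_asp[OF kghc m2] kgh by (simp add: L.scal_scal)
      also have "\<tau> k h * \<tau> g (k \<otimes>\<^bsub>G\<^esub> h) = \<tau> g h * \<tau> k (g \<otimes>\<^bsub>G\<^esub> h)"
        using Z2sym_swap[OF G.comm_group_axioms \<tau> k g h] by (simp add: mult.commute)
      finally show "c (\<iota> (g \<otimes>\<^bsub>G\<^esub> h) (amul A u v)) =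
          ascal L (\<tau> k (g \<otimes>\<^bsub>G\<^esub> h)) (\<iota> (k \<otimes>\<^bsub>G\<^esub> (g \<otimes>\<^bsub>G\<^esub> h)) (amul A u (d h v)))"
        unfolding ce using \<iota>_mem_asp[OF kghc m2] \<tau>_nz[OF g h] by (simp add: L.scal_scal mult.assoc[symmetric])
    qed
    ultimately show ?thesis ..
  qed
  \<comment> \<open>On a product \<open>x y\<close> the value \<open>x d(y)\<close> sees only the degree of \<open>y\<close>, so \<open>d g\<close> depends only
    on \<open>\<pi> g\<close>.\<close>
  have d_eq: "d g u = d g' u" if g: "g \<in> carrier G" "g' \<in> carrier G" "\<pi> g = \<pi> g'" and u: "u \<in> acomp A (\<pi> g)" for g g' u
    using sq \<pi>_closed[OF g(1)] u
  proof (induction u rule: A.square_comp_induct)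
    case zero
    show ?case using d_add[of g 0 0] d_add[of g' 0 0] g A.comp_zero[of "\<pi> g"] by simp
  next
    case (mul a b x y)
    obtain h where h: "h \<in> carrier G" "\<pi> h = b" using \<pi>_lift mul by auto
    have r: "d l (amul A x y) = amul A x (d h y)" if l: "l \<in> carrier G" "\<pi> l = \<pi> g" for l
    proof -
      let ?l = "l \<otimes>\<^bsub>G\<^esub> inv\<^bsub>G\<^esub> h"
      have "?l \<otimes>\<^bsub>G\<^esub> h = l" using l h by (simp add: G.m_assoc)
      moreover have "\<pi> ?l = a \<otimes>\<^bsub>\<Gamma>\<^esub> b \<otimes>\<^bsub>\<Gamma>\<^esub> inv\<^bsub>\<Gamma>\<^esub> b"
        using l h by (simp add: \<pi>_mult \<pi>_inv mul(3))
      then have "\<pi> ?l = a" using mul(1,2) by (simp add: \<Gamma>.m_assoc)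
      ultimately show ?thesis using conjunct2[OF d_mul[of ?l h x y]] l h mul by simp
    qed
    show ?case using r[of g] r[of g'] g by simp
  next
    case (add x y)
    then show ?case using d_add g by simp
  next
    case (scal r x)
    then show ?case using d_scal g by simp
  qed
  define s where "s a = (SOME g. g \<in> carrier G \<and> \<pi> g = a)" for a
  have s: "s a \<in> carrier G \<and> \<pi> (s a) = a" if "a \<in> carrier \<Gamma>" for a
    unfolding s_def by (rule someI_ex) (use \<pi>_lift[OF that] in auto)
  define e where "e a = d (s a)" for a
  have e_eq: "e (\<pi> g) u = d g u" if "g \<in> carrier G" "u \<in> acomp A (\<pi> g)" for g u
    unfolding e_def using d_eq[of "s (\<pi> g)" g u] s[of "\<pi> g"] that by simp
  have e_add: "additive_family \<Gamma> A e" unfolding additive_family_def e_def using d_add s by simp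
  have e_comp: "e a u \<in> acomp A (\<pi> k \<otimes>\<^bsub>\<Gamma>\<^esub> a)" if "a \<in> carrier \<Gamma>" "u \<in> acomp A a" for a u
    unfolding e_def using d_comp[of "s a" u] s[OF that(1)] that k by (simp add: \<pi>_mult)
  have e_scal: "e a (ascal A r u) = ascal A r (e a u)" if "a \<in> carrier \<Gamma>" "u \<in> acomp A a" for a u r
    unfolding e_def using d_scal[of "s a" u] s[OF that(1)] that by simp
  have e_mul: "e (a \<otimes>\<^bsub>\<Gamma>\<^esub> b) (amul A u v) = amul A (e a u) v \<and> e (a \<otimes>\<^bsub>\<Gamma>\<^esub> b) (amul A u v) = amul A u (e b v)"
    if ab: "a \<in> carrier \<Gamma>" "b \<in> carrier \<Gamma>" and uv: "u \<in> acomp A a" "v \<in> acomp A b" for a b u v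
  proof -
    have "e (a \<otimes>\<^bsub>\<Gamma>\<^esub> b) (amul A u v) = d (s a \<otimes>\<^bsub>G\<^esub> s b) (amul A u v)"
      using e_eq[of "s a \<otimes>\<^bsub>G\<^esub> s b" "amul A u v"] s[OF ab(1)] s[OF ab(2)] A.mul_comp[OF ab uv] by (simp add: \<pi>_mult)
    then show ?thesis unfolding e_def using d_mul[of "s a" "s b" u v] s[OF ab(1)] s[OF ab(2)] uv by metis
  qed
  have D1: "cext \<Gamma> A e \<in> centroid_comp \<Gamma> A (\<pi> k)"
    by (rule A.cext_centroid_comp(1)[OF \<pi>_closed[OF k] e_add e_comp e_scal conjunct1[OF e_mul] conjunct2[OF e_mul]])
  have D2: "cext \<Gamma> A e u = e a u" if "a \<in> carrier \<Gamma>" "u \<in> acomp A a" for a u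
    by (rule A.cext_centroid_comp(2)[OF \<pi>_closed[OF k] e_add e_comp e_scal conjunct1[OF e_mul] conjunct2[OF e_mul] that])
  show thesis
  proof (rule that[OF D1])
    fix g u assume g: "g \<in> carrier G" and u: "u \<in> acomp A (\<pi> g)"
    show "c (\<iota> g u) = ascal L (\<tau> k g) (\<iota> (k \<otimes>\<^bsub>G\<^esub> g) (cext \<Gamma> A e u))"
      using c_eq[OF g u] D2[OF \<pi>_closed[OF g] u] e_eq[OF g u] by simp
  qed
qed

lemma centroid_eqI:
  assumes "c \<in> centroid L" "d \<in> centroid L"
    and "\<And>g u. \<lbrakk>g \<in> carrier G; u \<in> acomp A (\<pi> g)\<rbrakk> \<Longrightarrow> c (\<iota> g u) = d (\<iota> g u)"
  shows "c = d"
proof (rule L.centroid_ext[OF assms(1,2)])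
  fix g x assume "g \<in> carrier G" "x \<in> acomp L g"
  then show "c x = d x" using \<iota>_surj[of g x] assms(3) by auto
qed

lemma \<tau>_one: "g \<in> carrier G \<Longrightarrow> \<tau> \<one>\<^bsub>G\<^esub> g = \<tau> \<one>\<^bsub>G\<^esub> \<one>\<^bsub>G\<^esub>"
  by (rule Z2sym_one[OF G.comm_group_axioms \<tau>])

end

section \<open>The centroid of a loop over a central base\<close>

locale central_loop_like = loop_like G \<Gamma> A L \<pi> \<tau> \<iota>
  for G :: "('g, 'm) monoid_scheme" and \<Gamma> :: "('i, 'n) monoid_scheme"
    and A :: "('a::ab_group_add, 'f::field, 'i) galg" and L :: "('l::ab_group_add, 'f, 'g) galg"
    and \<pi> \<tau> \<iota> +
  assumes A_simple: "graded_simple \<Gamma> A" and A_central: "central_alg A"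
begin

abbreviation "ker \<equiv> {k \<in> carrier G. \<pi> k = \<one>\<^bsub>\<Gamma>\<^esub>}"

text \<open>The lift of the identity of A. In the twisted loop algebra it acts like multiplication
  by 1 \<otimes> k, sending u \<otimes> g to \<tau>(k,g) u \<otimes> kg; for k in the kernel of
  \<pi>, the components over g and kg are the same.\<close>

definition shift :: "'g \<Rightarrow> 'l \<Rightarrow> 'l" where
  "shift k = (SOME c. c \<in> centroid_comp G L k \<and>
     (\<forall>g\<in>carrier G. \<forall>u\<in>acomp A (\<pi> g). c (\<iota> g u) = ascal L (\<tau> k g) (\<iota> (k \<otimes>\<^bsub>G\<^esub> g) u)))"

lemma
  assumes "k \<in> ker"
  shows shift_centroid_comp: "shift k \<in> centroid_comp G L k"
    and shift_\<iota>: "\<And>g u. \<lbrakk>g \<in> carrier G; u \<in> acomp A (\<pi> g)\<rbrakk>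
       \<Longrightarrow> shift k (\<iota> g u) = ascal L (\<tau> k g) (\<iota> (k \<otimes>\<^bsub>G\<^esub> g) u)"
proof -
  \<comment> \<open>The identity in the form demanded of centroid elements, 0 off the carrier. Its
    degree is the identity, which is \<pi> k for k in the kernel.\<close>
  let ?D = "\<lambda>x. if x \<in> asp A then ascal A 1 x else 0"
  have "?D \<in> centroid_comp \<Gamma> A (\<pi> k)" using A.scalar_map_centroid_comp[of 1] assms by simp
  then obtain c where c: "c \<in> centroid_comp G L k"
    "\<And>g u. \<lbrakk>g \<in> carrier G; u \<in> acomp A (\<pi> g)\<rbrakk> \<Longrightarrow> c (\<iota> g u) = ascal L (\<tau> k g) (\<iota> (k \<otimes>\<^bsub>G\<^esub> g) (?D u))"
    using centroid_lift[of k ?D] assms by auto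
  have Du: "?D u = u" if "g \<in> carrier G" "u \<in> acomp A (\<pi> g)" for g u
    using A.comp_mem[of "\<pi> g" u] that A.scal_one by simp
  define P where "P c \<longleftrightarrow> c \<in> centroid_comp G L k \<and>
     (\<forall>g\<in>carrier G. \<forall>u\<in>acomp A (\<pi> g). c (\<iota> g u) = ascal L (\<tau> k g) (\<iota> (k \<otimes>\<^bsub>G\<^esub> g) u))" for c
  have "P c" unfolding P_def by (intro conjI ballI c(1)) (simp only: c(2) Du)
  then have "P (shift k)" unfolding shift_def P_def[symmetric] by (rule someI[of P])
  then have s: "shift k \<in> centroid_comp G L k \<and>
     (\<forall>g\<in>carrier G. \<forall>u\<in>acomp A (\<pi> g). shift k (\<iota> g u) = ascal L (\<tau> k g) (\<iota> (k \<otimes>\<^bsub>G\<^esub> g) u))"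
    unfolding P_def .
  show "shift k \<in> centroid_comp G L k" using s ..
  show "shift k (\<iota> g u) = ascal L (\<tau> k g) (\<iota> (k \<otimes>\<^bsub>G\<^esub> g) u)"
    if "g \<in> carrier G" "u \<in> acomp A (\<pi> g)" for g u using s that by simp
qed

lemma loop_simple: "graded_simple G L"
  using graded_simple_base_imp_loop A_simple .

sublocale L: graded_simple_algebra G L
  by (intro graded_simple_algebra.intro graded_simple_algebra_axioms.intro L.graded_algebra_axioms
      G.comm_group_axioms loop_simple)

lemma shift_nonzero:
  assumes "k \<in> ker" obtains x where "x \<in> asp L" "shift k x \<noteq> 0"
proof -
  obtain a u where a: "a \<in> carrier \<Gamma>" "u \<in> acomp A a" "u \<noteq> 0"
    using A_simple A.asp_nontrivial_iff unfolding graded_simple_def by auto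
  obtain g where g: "g \<in> carrier G" "\<pi> g = a" using \<pi>_lift a by auto
  have kg: "k \<otimes>\<^bsub>G\<^esub> g \<in> carrier G" "\<pi> (k \<otimes>\<^bsub>G\<^esub> g) = a" using assms g a by (simp_all add: \<pi>_mult)
  have u: "u \<in> acomp A (\<pi> (k \<otimes>\<^bsub>G\<^esub> g))" using a kg by simp
  have "shift k (\<iota> g u) \<noteq> 0"
    using shift_\<iota>[OF assms, of g u] L.scal_cancel[OF \<iota>_mem_asp[OF kg(1) u], of "\<tau> k g"] \<tau>_nz[of k g]
      \<iota>_eq_zero[OF kg(1) u] a g assms by auto
  then show thesis using that[of "\<iota> g u"] \<iota>_mem_asp[of g u] g a by simp
qed

text \<open>The descended map is a scalar by centrality of the base. A scalar preserves degrees,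
  whereas a map of degree \<pi> k moves them; unless \<pi> k is the identity, its values lie in two
  different components and vanish.\<close>

lemma centroid_comp_scalar:
  assumes k: "k \<in> carrier G" and c: "c \<in> centroid_comp G L k"
  shows "k \<in> ker \<Longrightarrow> \<exists>r. c = (\<lambda>x. ascal L r (shift k x))"
    and "k \<notin> ker \<Longrightarrow> c = 0"
proof -
  obtain D where D: "D \<in> centroid_comp \<Gamma> A (\<pi> k)"
    and cD: "\<And>g u. \<lbrakk>g \<in> carrier G; u \<in> acomp A (\<pi> g)\<rbrakk> \<Longrightarrow> c (\<iota> g u) = ascal L (\<tau> k g) (\<iota> (k \<otimes>\<^bsub>G\<^esub> g) (D u))"
    using centroid_descend[OF A_simple k c] by metis
  have "D \<in> scalar_maps A" using centroid_compD(1)[OF D] A_central unfolding central_alg_def by simp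
  then obtain r where r: "D = (\<lambda>x. if x \<in> asp A then ascal A r x else 0)" unfolding scalar_maps_def by auto
  have Du: "D u = ascal A r u" if "g \<in> carrier G" "u \<in> acomp A (\<pi> g)" for g u
    unfolding r using A.comp_mem[of "\<pi> g" u] that by simp
  show "\<exists>r. c = (\<lambda>x. ascal L r (shift k x))" if ker: "k \<in> ker"
  proof (intro exI, rule centroid_eqI)
    show "c \<in> centroid L" "(\<lambda>x. ascal L r (shift k x)) \<in> centroid L"
      using centroid_compD(1)[OF c] L.centroid_scal[OF centroid_compD(1)[OF shift_centroid_comp[OF ker]]] by auto
    fix g u assume g: "g \<in> carrier G" and u: "u \<in> acomp A (\<pi> g)"
    have kg: "k \<otimes>\<^bsub>G\<^esub> g \<in> carrier G" "u \<in> acomp A (\<pi> (k \<otimes>\<^bsub>G\<^esub> g))" using ker g u by (simp_all add: \<pi>_mult)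
    show "c (\<iota> g u) = ascal L r (shift k (\<iota> g u))"
      using cD[OF g u] Du[OF g u] \<iota>_scal[OF kg] shift_\<iota>[OF ker g u] \<iota>_mem_asp[OF kg]
      by (simp add: L.scal_scal mult.commute)
  qed
  show "c = 0" if ker: "k \<notin> ker"
  proof (rule centroid_eqI)
    show "c \<in> centroid L" "0 \<in> centroid L" using centroid_compD(1)[OF c] L.zero_centroid by auto
    fix g u assume g: "g \<in> carrier G" and u: "u \<in> acomp A (\<pi> g)"
    have "D u \<in> acomp A (\<pi> g)" using Du[OF g u] A.comp_scal[OF _ u] g by simp
    moreover have "D u \<in> acomp A (\<pi> k \<otimes>\<^bsub>\<Gamma>\<^esub> \<pi> g)" using centroid_compD(2)[OF D _ u] g by simp
    moreover have "\<pi> g \<noteq> \<pi> k \<otimes>\<^bsub>\<Gamma>\<^esub> \<pi> g"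
    proof
      assume "\<pi> g = \<pi> k \<otimes>\<^bsub>\<Gamma>\<^esub> \<pi> g"
      then have "\<pi> k = \<one>\<^bsub>\<Gamma>\<^esub>" using g k by (metis \<Gamma>.l_cancel_one \<Gamma>.m_comm \<pi>_closed)
      then show False using ker k by simp
    qed
    ultimately have "D u = 0" using A.comp_inter[of "\<pi> g" "\<pi> k \<otimes>\<^bsub>\<Gamma>\<^esub> \<pi> g" "D u"] g k by simp
    then show "c (\<iota> g u) = 0 (\<iota> g u)" using cD[OF g u] \<iota>_zero[of "k \<otimes>\<^bsub>G\<^esub> g"] k g by simp
  qed
qed

lemma ker_mult: "\<lbrakk>h \<in> ker; k \<in> ker\<rbrakk> \<Longrightarrow> h \<otimes>\<^bsub>G\<^esub> k \<in> ker"
  by (simp add: \<pi>_mult)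

text \<open>At u \<otimes> g the scalars are \<tau>(k,g) \<tau>(h,kg) and \<tau>(h,k) \<tau>(hk,g),
  which the cocycle identity equates. The shifts thus multiply like the standard basis of the
  twisted group algebra of the kernel.\<close>

lemma shift_mult:
  assumes h: "h \<in> ker" and k: "k \<in> ker"
  shows "shift h \<circ> shift k = (\<lambda>x. ascal L (\<tau> h k) (shift (h \<otimes>\<^bsub>G\<^esub> k) x))"
proof (rule centroid_eqI)
  note sh = centroid_compD(1)[OF shift_centroid_comp[OF h]]
  show "shift h \<circ> shift k \<in> centroid L"
    by (rule L.centroid_compose[OF sh centroid_compD(1)[OF shift_centroid_comp[OF k]]])
  show "(\<lambda>x. ascal L (\<tau> h k) (shift (h \<otimes>\<^bsub>G\<^esub> k) x)) \<in> centroid L"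
    by (rule L.centroid_scal[OF centroid_compD(1)[OF shift_centroid_comp[OF ker_mult[OF h k]]]])
  fix g u assume g: "g \<in> carrier G" and u: "u \<in> acomp A (\<pi> g)"
  have kg: "k \<otimes>\<^bsub>G\<^esub> g \<in> carrier G" "u \<in> acomp A (\<pi> (k \<otimes>\<^bsub>G\<^esub> g))" using k g u by (simp_all add: \<pi>_mult)
  have hkg: "h \<otimes>\<^bsub>G\<^esub> (k \<otimes>\<^bsub>G\<^esub> g) \<in> carrier G" "u \<in> acomp A (\<pi> (h \<otimes>\<^bsub>G\<^esub> (k \<otimes>\<^bsub>G\<^esub> g)))" using h k g u by (simp_all add: \<pi>_mult)
  show "(shift h \<circ> shift k) (\<iota> g u) = ascal L (\<tau> h k) (shift (h \<otimes>\<^bsub>G\<^esub> k) (\<iota> g u))"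
    using shift_\<iota>[OF k g u] shift_\<iota>[OF h kg] shift_\<iota>[OF ker_mult[OF h k] g u]
      centroidD(4)[OF sh \<iota>_mem_asp[OF kg]] \<iota>_mem_asp[OF hkg] Z2symD(3)[OF \<tau>, of h k g] h k g
    by (simp add: L.scal_scal G.m_assoc mult.commute)
qed

lemma graded_central_simple_loop: "graded_central_simple G L"
  unfolding graded_central_simple_def graded_central_def
proof (intro conjI loop_simple subset_antisym subsetI)
  fix c assume "c \<in> scalar_maps L"
  then obtain r where "c = (\<lambda>x. if x \<in> asp L then ascal L r x else 0)" unfolding scalar_maps_def by auto
  then show "c \<in> centroid_comp G L \<one>\<^bsub>G\<^esub>" using L.scalar_map_centroid_comp[of r] by simp
next
  fix c assume c: "c \<in> centroid_comp G L \<one>\<^bsub>G\<^esub>"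
  have one: "\<one>\<^bsub>G\<^esub> \<in> ker" by simp
  obtain r where r: "c = (\<lambda>x. ascal L r (shift \<one>\<^bsub>G\<^esub> x))" using centroid_comp_scalar(1)[OF _ c] by auto
  \<comment> \<open>The shift in the identity degree is not the identity map but the scalar
    \<tau>(1,1), as \<tau>(1,g) = \<tau>(1,1).\<close>
  let ?d = "\<lambda>x. if x \<in> asp L then ascal L (r * \<tau> \<one>\<^bsub>G\<^esub> \<one>\<^bsub>G\<^esub>) x else 0"
  have "c = ?d"
  proof (rule centroid_eqI[OF centroid_compD(1)[OF c] centroid_compD(1)[OF L.scalar_map_centroid_comp]])
    fix g u assume g: "g \<in> carrier G" and u: "u \<in> acomp A (\<pi> g)"
    show "c (\<iota> g u) = ?d (\<iota> g u)"
      unfolding r using shift_\<iota>[OF one g u] g \<tau>_one[OF g] \<iota>_mem_asp[OF g u] by (simp add: L.scal_scal)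
  qed
  then show "c \<in> scalar_maps L" unfolding scalar_maps_def by blast
qed

end

subsection \<open>Twists and concrete loop algebras\<close>

lemma hcomp_amul_update [simp]: "hcomp \<Gamma> (A\<lparr>amul := m\<rparr>) = hcomp \<Gamma> A"
  by (simp add: hcomp_def is_decomp_def fun_eq_iff)

lemma gsupp_amul_update [simp]: "gsupp \<Gamma> (A\<lparr>amul := m\<rparr>) = gsupp \<Gamma> A"
  by (simp add: gsupp_def fun_eq_iff)

lemma graded_space_amul_update: "graded_space \<Gamma> A \<Longrightarrow> graded_space \<Gamma> (A\<lparr>amul := m\<rparr>)"
  unfolding graded_space_def by (simp add: alg_subspace_def is_decomp_def)

lemma twist_simps [simp]:
  "asp (twist \<Gamma> A \<tau>) = asp A" "ascal (twist \<Gamma> A \<tau>) = ascal A" "acomp (twist \<Gamma> A \<tau>) = acomp A"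
  "hcomp \<Gamma> (twist \<Gamma> A \<tau>) = hcomp \<Gamma> A" "gsupp \<Gamma> (twist \<Gamma> A \<tau>) = gsupp \<Gamma> A"
  by (simp_all add: twist_def)

text \<open>Multiplying the product of the components g and h by a constant keeps it bilinear, so
  \<open>graded_algebra_from_family\<close> applies; on homogeneous factors the double sum in
  \<open>twist\<close> collapses to one term.\<close>

lemma
  assumes "graded_algebra \<Gamma> A"
  shows graded_algebra_twist: "graded_algebra \<Gamma> (twist \<Gamma> A \<tau>)"
    and twist_mul: "\<lbrakk>g \<in> carrier \<Gamma>; h \<in> carrier \<Gamma>; u \<in> acomp A g; v \<in> acomp A h\<rbrakk>
      \<Longrightarrow> amul (twist \<Gamma> A \<tau>) u v = ascal A (\<tau> g h) (amul A u v)"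
proof -
  interpret A: graded_algebra \<Gamma> A by fact
  interpret T: graded_space \<Gamma> "twist \<Gamma> A \<tau>"
    unfolding twist_def by (rule graded_space_amul_update) (rule A.graded_space_axioms)
  let ?m = "\<lambda>g h u v. ascal A (\<tau> g h) (amul A u v)"
  have *: "graded_algebra \<Gamma> (twist \<Gamma> A \<tau>) \<and> (\<forall>g h u v. g \<in> carrier \<Gamma> \<longrightarrow> h \<in> carrier \<Gamma> \<longrightarrow> u \<in> acomp A g \<longrightarrow> v \<in> acomp A h
      \<longrightarrow> amul (twist \<Gamma> A \<tau>) u v = ?m g h u v)"
  proof (intro conjI allI impI)
    have mem: "u \<in> asp A" if "g \<in> carrier \<Gamma>" "u \<in> acomp A g" for g u using A.comp_mem that by simp
    note facts = A.is_group A.mul_comp A.comp_scal A.mul_add_left A.mul_add_right A.mul_scal_left A.mul_scal_right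
      A.scal_add_right A.scal_scal A.mul_mem
    have 1: "?m g h u v \<in> acomp (twist \<Gamma> A \<tau>) (g \<otimes>\<^bsub>\<Gamma>\<^esub> h)"
      if "g \<in> carrier \<Gamma>" "h \<in> carrier \<Gamma>" "u \<in> acomp (twist \<Gamma> A \<tau>) g" "v \<in> acomp (twist \<Gamma> A \<tau>) h" for g h u v
      using that A.mul_comp[of g h u v] A.comp_scal[of "g \<otimes>\<^bsub>\<Gamma>\<^esub> h"] by simp
    have 2: "?m g h (u + v) w = ?m g h u w + ?m g h v w"
      if "g \<in> carrier \<Gamma>" "h \<in> carrier \<Gamma>" "u \<in> acomp (twist \<Gamma> A \<tau>) g" "v \<in> acomp (twist \<Gamma> A \<tau>) g" "w \<in> acomp (twist \<Gamma> A \<tau>) h" for g h u v w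
      using that mem[of g u] mem[of g v] mem[of h w] by (simp add: facts)
    have 3: "?m g h u (v + w) = ?m g h u v + ?m g h u w"
      if "g \<in> carrier \<Gamma>" "h \<in> carrier \<Gamma>" "u \<in> acomp (twist \<Gamma> A \<tau>) g" "v \<in> acomp (twist \<Gamma> A \<tau>) h" "w \<in> acomp (twist \<Gamma> A \<tau>) h" for g h u v w
      using that mem[of g u] mem[of h v] mem[of h w] by (simp add: facts)
    have 4: "?m g h (ascal (twist \<Gamma> A \<tau>) a u) v = ascal (twist \<Gamma> A \<tau>) a (?m g h u v)"
      and 5: "?m g h u (ascal (twist \<Gamma> A \<tau>) a v) = ascal (twist \<Gamma> A \<tau>) a (?m g h u v)"
      if "g \<in> carrier \<Gamma>" "h \<in> carrier \<Gamma>" "u \<in> acomp (twist \<Gamma> A \<tau>) g" "v \<in> acomp (twist \<Gamma> A \<tau>) h" for g h u v a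
      using that mem[of g u] mem[of h v] by (simp_all add: facts mult.commute)
    have 6: "amul (twist \<Gamma> A \<tau>) x y = (\<Sum>g\<in>gsupp \<Gamma> (twist \<Gamma> A \<tau>) x. \<Sum>h\<in>gsupp \<Gamma> (twist \<Gamma> A \<tau>) y.
        ?m g h (hcomp \<Gamma> (twist \<Gamma> A \<tau>) x g) (hcomp \<Gamma> (twist \<Gamma> A \<tau>) y h))" for x y
      by (simp only: twist_simps) (simp add: twist_def)
    show "graded_algebra \<Gamma> (twist \<Gamma> A \<tau>)"
      by (rule T.graded_algebra_from_family(1)[where m = ?m, OF A.is_group 1 2 3 4 5 6])
    fix g h u v assume "g \<in> carrier \<Gamma>" "h \<in> carrier \<Gamma>" "u \<in> acomp A g" "v \<in> acomp A h"
    then show "amul (twist \<Gamma> A \<tau>) u v = ?m g h u v"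
      by (intro T.graded_algebra_from_family(2)[where m = ?m, OF A.is_group 1 2 3 4 5 6]) simp_all
  qed
  show "graded_algebra \<Gamma> (twist \<Gamma> A \<tau>)" using * ..
  show "amul (twist \<Gamma> A \<tau>) u v = ?m g h u v"
    if "g \<in> carrier \<Gamma>" "h \<in> carrier \<Gamma>" "u \<in> acomp A g" "v \<in> acomp A h" for g h u v using * that by simp
qed

locale quotient_graded = G: comm_group G + A: graded_algebra "G Mod H" A
  for G :: "('g, 'm) monoid_scheme" and H :: "'g set"
    and A :: "('a::ab_group_add, 'f::field, 'g set) galg" +
  assumes sub: "subgroup H G"

lemma can_proj_mult:
  assumes "comm_group G" "subgroup H G" "g \<in> carrier G" "h \<in> carrier G"
  shows "can_proj G H (g \<otimes>\<^bsub>G\<^esub> h) = can_proj G H g \<otimes>\<^bsub>G Mod H\<^esub> can_proj G H h"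
proof -
  interpret comm_group G by fact
  interpret normal H G using subgroup_imp_normal[OF assms(2)] .
  show ?thesis using assms by (simp add: can_proj_def FactGroup_def rcos_sum)
qed

lemma can_proj_surj: "can_proj G H ` carrier G = carrier (G Mod H)"
  by (auto simp: can_proj_def FactGroup_def RCOSETS_def)

lemma comm_group_Mod:
  assumes "comm_group G" "subgroup H G"
  shows "comm_group (G Mod H)"
  using comm_group.abelian_FactGroup[OF assms] .

lemma one_Mod: "\<one>\<^bsub>G Mod H\<^esub> = H"
  by (simp add: FactGroup_def)

lemma can_proj_eq_iff:
  assumes "comm_group G" "subgroup H G" "g \<in> carrier G" "h \<in> carrier G"
  shows "can_proj G H g = can_proj G H h \<longleftrightarrow> g \<otimes>\<^bsub>G\<^esub> inv\<^bsub>G\<^esub> h \<in> H"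
proof -
  interpret comm_group G by fact
  interpret H: subgroup H G by fact
  show ?thesis
  proof
    assume "can_proj G H g = can_proj G H h"
    then have "g \<in> H #>\<^bsub>G\<^esub> h" unfolding can_proj_def using rcos_self[OF assms(3,2)] by simp
    then show "g \<otimes>\<^bsub>G\<^esub> inv\<^bsub>G\<^esub> h \<in> H" using H.rcos_module_imp[OF is_group assms(4)] by simp
  next
    assume "g \<otimes>\<^bsub>G\<^esub> inv\<^bsub>G\<^esub> h \<in> H"
    then have "g \<in> H #>\<^bsub>G\<^esub> h" using H.rcos_module_rev[OF is_group assms(4,3)] by simp
    then show "can_proj G H g = can_proj G H h"
      unfolding can_proj_def using repr_independence[OF _ assms(4,2)] by metis
  qed
qed

lemma can_proj_eq_subgroup_iff:
  assumes "comm_group G" "subgroup H G" "g \<in> carrier G"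
  shows "can_proj G H g = H \<longleftrightarrow> g \<in> H"
proof -
  interpret comm_group G by fact
  have "can_proj G H \<one>\<^bsub>G\<^esub> = H"
    unfolding can_proj_def using coset_mult_one[of H] subgroup.subset[OF assms(2)] by simp
  then show ?thesis using can_proj_eq_iff[OF assms, of "\<one>\<^bsub>G\<^esub>"] assms by simp
qed

text \<open>The element u \<otimes> g of A \<otimes> FG, tensors being represented by finitely
  supported functions.\<close>

definition sgl :: "'g \<Rightarrow> 'a \<Rightarrow> 'g \<Rightarrow> 'a::zero" where
  "sgl g u = (\<lambda>h. if h = g then u else 0)"

lemma sgl_same [simp]: "sgl g u g = u" and sgl_zero [simp]: "sgl g 0 = 0"
  by (auto simp: sgl_def fun_eq_iff)

lemma sgl_eq_zero [simp]: "sgl g u = 0 \<longleftrightarrow> u = 0"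
  by (metis sgl_same sgl_zero zero_fun_apply)

lemma loop_alg_simps:
  "x \<in> asp (loop_alg G H A) \<longleftrightarrow> finite {g. x g \<noteq> 0} \<and> (\<forall>g. x g \<noteq> 0 \<longrightarrow> g \<in> carrier G) \<and>
     (\<forall>g\<in>carrier G. x g \<in> acomp A (can_proj G H g))"
  "ascal (loop_alg G H A) a x = (\<lambda>g. ascal A a (x g))"
  "x \<in> acomp (loop_alg G H A) g \<longleftrightarrow> x \<in> asp (loop_alg G H A) \<and> (\<forall>h. h \<noteq> g \<longrightarrow> x h = 0)"
  by (auto simp: loop_alg_def)

section \<open>The concrete loop algebra as a graded algebra\<close>

context quotient_graded
begin

abbreviation "\<pi> \<equiv> can_proj G H"
abbreviation "\<LL> \<equiv> loop_alg G H A"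

lemma \<pi>_closed: "g \<in> carrier G \<Longrightarrow> \<pi> g \<in> carrier (G Mod H)"
  using can_proj_surj[of G H] by blast

lemma loop_value_mem:
  assumes "x \<in> asp \<LL>" shows "x g \<in> asp A"
proof (cases "x g = 0")
  case False
  then have "g \<in> carrier G" "x g \<in> acomp A (\<pi> g)" using assms by (auto simp: loop_alg_simps)
  then show ?thesis using A.comp_mem[OF \<pi>_closed] by simp
qed simp

lemma loop_acomp_iff: "g \<in> carrier G \<Longrightarrow> x \<in> acomp \<LL> g \<longleftrightarrow> (\<exists>u\<in>acomp A (\<pi> g). x = sgl g u)"
proof
  assume g: "g \<in> carrier G" and "x \<in> acomp \<LL> g"
  then have "x g \<in> acomp A (\<pi> g)" "x = sgl g (x g)"
    by (auto simp: loop_alg_simps sgl_def fun_eq_iff)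
  then show "\<exists>u\<in>acomp A (\<pi> g). x = sgl g u" by blast
next
  assume g: "g \<in> carrier G" and "\<exists>u\<in>acomp A (\<pi> g). x = sgl g u"
  then obtain u where u: "u \<in> acomp A (\<pi> g)" "x = sgl g u" by blast
  have "{h. sgl g u h \<noteq> 0} \<subseteq> {g}" by (auto simp: sgl_def)
  then have "finite {h. sgl g u h \<noteq> 0}" by (rule finite_subset) simp
  then show "x \<in> acomp \<LL> g" using u g A.comp_zero[OF \<pi>_closed]
    by (auto simp: loop_alg_simps sgl_def)
qed

lemma loop_is_decomp:
  assumes x: "x \<in> asp \<LL>" shows "is_decomp G \<LL> x (\<lambda>g. sgl g (x g))"
proof -
  have S: "{g \<in> carrier G. sgl g (x g) \<noteq> 0} = {g. x g \<noteq> 0}"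
    using x by (auto simp: loop_alg_simps sgl_def fun_eq_iff)
  have fin: "finite {g. x g \<noteq> 0}" using x by (simp add: loop_alg_simps)
  have "x k = (\<Sum>g | x g \<noteq> 0. sgl g (x g)) k" for k
    unfolding sum_fun_apply sgl_def using fin by (simp add: sum.delta')
  then have eq: "x = (\<Sum>g | x g \<noteq> 0. sgl g (x g))" by (rule ext)
  have out: "sgl g (x g) = 0" if "g \<notin> carrier G" for g
    using x that by (auto simp: loop_alg_simps)
  have comp: "sgl g (x g) \<in> acomp \<LL> g" if "g \<in> carrier G" for g
    unfolding loop_acomp_iff[OF that] using x that by (auto simp: loop_alg_simps)
  show ?thesis unfolding is_decomp_def S
    by (intro conjI allI impI ballI fin out comp eq)
qed

lemma graded_space_loop: "graded_space G \<LL>"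
proof
  fix x assume x: "x \<in> asp \<LL>"
  note xg = loop_value_mem[OF x]
  show "\<exists>!c. is_decomp G \<LL> x c"
  proof (rule ex1I[of "is_decomp G \<LL> x" "\<lambda>g. sgl g (x g)", OF loop_is_decomp[OF x]])
    fix c assume c: "is_decomp G \<LL> x c"
    let ?S = "{g \<in> carrier G. c g \<noteq> 0}"
    have fin: "finite ?S" and out: "\<And>g. g \<notin> carrier G \<Longrightarrow> c g = 0" and comp: "\<And>g. g \<in> carrier G \<Longrightarrow> c g \<in> acomp \<LL> g"
      and xs: "x = (\<Sum>g\<in>?S. c g)" using c unfolding is_decomp_def by auto
    have cz: "c g h = 0" if "h \<noteq> g" for g h
      using comp[of g] out[of g] that by (cases "g \<in> carrier G") (auto simp: loop_alg_simps)
    have "x k = c k k" for k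
    proof -
      have "x k = (\<Sum>g\<in>?S. c g k)" by (subst xs) (simp add: sum_fun_apply)
      also have "\<dots> = (\<Sum>g\<in>?S. if g = k then c k k else 0)" using cz by (intro sum.cong) auto
      also have "\<dots> = c k k" using fin out by (auto simp: sum.delta)
      finally show ?thesis .
    qed
    then show "c = (\<lambda>g. sgl g (x g))" using cz by (auto simp: sgl_def fun_eq_iff)
  qed
  show "ascal \<LL> a x \<in> asp \<LL>" for a
  proof -
    have "{g. ascal A a (x g) \<noteq> 0} \<subseteq> {g. x g \<noteq> 0}" by auto
    then have "finite {g. ascal A a (x g) \<noteq> 0}" using x finite_subset by (auto simp: loop_alg_simps)
    moreover have "g \<in> carrier G" if "ascal A a (x g) \<noteq> 0" for g
    proof -
      have "x g \<noteq> 0" using that by auto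
      then show ?thesis using x by (simp add: loop_alg_simps)
    qed
    ultimately show ?thesis using x A.comp_scal[OF \<pi>_closed] by (simp add: loop_alg_simps)
  qed
  show "ascal \<LL> (a + b) x = ascal \<LL> a x + ascal \<LL> b x" "ascal \<LL> a (ascal \<LL> b x) = ascal \<LL> (a * b) x"
    "ascal \<LL> 1 x = x" for a b
    using xg by (auto simp: loop_alg_simps fun_eq_iff A.scal_add_left A.scal_scal A.scal_one)
  fix y assume y: "y \<in> asp \<LL>"
  have "{g. x g + y g \<noteq> 0} \<subseteq> {g. x g \<noteq> 0} \<union> {g. y g \<noteq> 0}" by auto
  then have "finite {g. x g + y g \<noteq> 0}" using x y finite_subset by (auto simp: loop_alg_simps)
  moreover have "x g + y g = 0" if "g \<notin> carrier G" for g
  proof -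
    have "x g = 0" "y g = 0" using x y that by (auto simp: loop_alg_simps)
    then show ?thesis by simp
  qed
  ultimately show "x + y \<in> asp \<LL>" using x y A.comp_add[OF \<pi>_closed] by (auto simp: loop_alg_simps)
  show "ascal \<LL> a (x + y) = ascal \<LL> a x + ascal \<LL> a y" for a
    using xg loop_value_mem[OF y] by (auto simp: loop_alg_simps fun_eq_iff A.scal_add_right)
next
  show "0 \<in> asp \<LL>" using A.comp_zero[OF \<pi>_closed] by (auto simp: loop_alg_simps)
next
  fix g assume g: "g \<in> carrier G"
  have add: "sgl g u + sgl g v = sgl g (u + v)" and scal: "ascal \<LL> a (sgl g u) = sgl g (ascal A a u)" for u v a
    by (auto simp: sgl_def fun_eq_iff loop_alg_simps)
  show "alg_subspace \<LL> (acomp \<LL> g)" unfolding alg_subspace_def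
  proof (intro conjI ballI allI)
    show "acomp \<LL> g \<subseteq> asp \<LL>" by (auto simp: loop_alg_simps(3))
    show "0 \<in> acomp \<LL> g" unfolding loop_acomp_iff[OF g] using A.comp_zero[OF \<pi>_closed[OF g]] by (metis sgl_zero)
    fix x assume "x \<in> acomp \<LL> g"
    then obtain u where u: "u \<in> acomp A (\<pi> g)" "x = sgl g u" unfolding loop_acomp_iff[OF g] by auto
    show "ascal \<LL> a x \<in> acomp \<LL> g" for a
      unfolding loop_acomp_iff[OF g] u(2) scal using A.comp_scal[OF \<pi>_closed[OF g] u(1)] by auto
    fix y assume "y \<in> acomp \<LL> g"
    then obtain v where v: "v \<in> acomp A (\<pi> g)" "y = sgl g v" unfolding loop_acomp_iff[OF g] by auto
    show "x + y \<in> acomp \<LL> g"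
      unfolding loop_acomp_iff[OF g] u(2) v(2) add using A.comp_add[OF \<pi>_closed[OF g] u(1) v(1)] by auto
  qed
qed

lemma loop_hcomp: "x \<in> asp \<LL> \<Longrightarrow> hcomp G \<LL> x g = sgl g (x g)"
  using graded_space.hcomp_eqI[OF graded_space_loop loop_is_decomp] by simp

lemma loop_gsupp: "x \<in> asp \<LL> \<Longrightarrow> gsupp G \<LL> x = {g. x g \<noteq> 0}"
  unfolding gsupp_def by (auto simp: loop_hcomp loop_alg_simps)

lemma sgl_add: "sgl g (u + v) = sgl g u + sgl g (v :: 'a)"
  by (auto simp: sgl_def fun_eq_iff)

lemma sgl_scal: "ascal \<LL> a (sgl g u) = sgl g (ascal A a u)"
  by (auto simp: sgl_def fun_eq_iff loop_alg_simps)

lemma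
  shows graded_algebra_loop: "graded_algebra G \<LL>"
    and loop_mul: "\<lbrakk>g \<in> carrier G; h \<in> carrier G; u \<in> acomp A (\<pi> g); v \<in> acomp A (\<pi> h)\<rbrakk>
      \<Longrightarrow> amul \<LL> (sgl g u) (sgl h v) = sgl (g \<otimes>\<^bsub>G\<^esub> h) (amul A u v)"
proof -
  interpret L: graded_space G \<LL> by (rule graded_space_loop)
  define m where "m g h x y = sgl (g \<otimes>\<^bsub>G\<^esub> h) (amul A (x g) (y h))" for g h x y
  have val: "x g \<in> acomp A (\<pi> g)" "x g \<in> asp A" if "g \<in> carrier G" "x \<in> acomp \<LL> g" for x g
    using that A.comp_mem[OF \<pi>_closed[OF that(1)]] by (auto simp: loop_alg_simps)
  have 1: "m g h u v \<in> acomp \<LL> (g \<otimes>\<^bsub>G\<^esub> h)"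
    if "g \<in> carrier G" "h \<in> carrier G" "u \<in> acomp \<LL> g" "v \<in> acomp \<LL> h" for g h u v
    unfolding m_def using that A.mul_comp[OF \<pi>_closed[OF that(1)] \<pi>_closed[OF that(2)] val(1)[OF that(1,3)] val(1)[OF that(2,4)]]
    by (auto simp: loop_acomp_iff can_proj_mult[OF G.comm_group_axioms sub])
  have 2: "m g h (u + v) w = m g h u w + m g h v w"
    if "g \<in> carrier G" "h \<in> carrier G" "u \<in> acomp \<LL> g" "v \<in> acomp \<LL> g" "w \<in> acomp \<LL> h" for g h u v w
    unfolding m_def using val(2)[OF that(1,3)] val(2)[OF that(1,4)] val(2)[OF that(2,5)] by (simp add: A.mul_add_left sgl_add)
  have 3: "m g h u (v + w) = m g h u v + m g h u w"
    if "g \<in> carrier G" "h \<in> carrier G" "u \<in> acomp \<LL> g" "v \<in> acomp \<LL> h" "w \<in> acomp \<LL> h" for g h u v w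
    unfolding m_def using val(2)[OF that(1,3)] val(2)[OF that(2,4)] val(2)[OF that(2,5)] by (simp add: A.mul_add_right sgl_add)
  have 4: "m g h (ascal \<LL> a u) v = ascal \<LL> a (m g h u v)"
    and 5: "m g h u (ascal \<LL> a v) = ascal \<LL> a (m g h u v)"
    if "g \<in> carrier G" "h \<in> carrier G" "u \<in> acomp \<LL> g" "v \<in> acomp \<LL> h" for g h u v a
    unfolding m_def sgl_scal using val(2)[OF that(1,3)] val(2)[OF that(2,4)]
    by (simp_all add: A.mul_scal_left A.mul_scal_right loop_alg_simps)
  \<comment> \<open>The convolution at k runs over the pairs with product k. Over all pairs from the
    two supports it becomes a sum with the indicator of product k, and evaluating \<open>sgl\<close>
    at k supplies exactly this indicator.\<close>
  have 6: "amul \<LL> x y = (\<Sum>g\<in>gsupp G \<LL> x. \<Sum>h\<in>gsupp G \<LL> y. m g h (hcomp G \<LL> x g) (hcomp G \<LL> y h))"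
    if x: "x \<in> asp \<LL>" and y: "y \<in> asp \<LL>" for x y
  proof
    fix k
    let ?X = "{g. x g \<noteq> 0}" and ?Y = "{g. y g \<noteq> 0}"
    have fin: "finite ?X" "finite ?Y" using x y by (auto simp: loop_alg_simps)
    have "amul \<LL> x y k = (\<Sum>(g, h)\<in>{p \<in> ?X \<times> ?Y. fst p \<otimes>\<^bsub>G\<^esub> snd p = k}. amul A (x g) (y h))"
      unfolding loop_alg_def by (auto intro!: sum.cong)
    also have "\<dots> = (\<Sum>(g, h)\<in>?X \<times> ?Y. if g \<otimes>\<^bsub>G\<^esub> h = k then amul A (x g) (y h) else 0)"
      by (subst sum.inter_filter) (use fin in \<open>auto intro!: sum.cong\<close>)
    also have "\<dots> = (\<Sum>g\<in>?X. \<Sum>h\<in>?Y. if g \<otimes>\<^bsub>G\<^esub> h = k then amul A (x g) (y h) else 0)"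
      by (simp add: sum.cartesian_product)
    also have "\<dots> = (\<Sum>g\<in>?X. \<Sum>h\<in>?Y. m g h (hcomp G \<LL> x g) (hcomp G \<LL> y h) k)"
      by (intro sum.cong refl) (auto simp: loop_hcomp[OF x] loop_hcomp[OF y] m_def sgl_def)
    finally show "amul \<LL> x y k = (\<Sum>g\<in>gsupp G \<LL> x. \<Sum>h\<in>gsupp G \<LL> y. m g h (hcomp G \<LL> x g) (hcomp G \<LL> y h)) k"
      by (simp only: loop_gsupp[OF x] loop_gsupp[OF y] sum_fun_apply)
  qed
  show "graded_algebra G \<LL>"
    by (rule L.graded_algebra_from_family(1)[where m = m, OF G.is_group 1 2 3 4 5 6])
  show "amul \<LL> (sgl g u) (sgl h v) = sgl (g \<otimes>\<^bsub>G\<^esub> h) (amul A u v)"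
    if gh: "g \<in> carrier G" "h \<in> carrier G" "u \<in> acomp A (\<pi> g)" "v \<in> acomp A (\<pi> h)" for g h u v
  proof -
    have "sgl g u \<in> acomp \<LL> g" "sgl h v \<in> acomp \<LL> h" using gh loop_acomp_iff by auto
    then have "amul \<LL> (sgl g u) (sgl h v) = m g h (sgl g u) (sgl h v)"
      by (intro L.graded_algebra_from_family(2)[where m = m, OF G.is_group 1 2 3 4 5 6]) (use gh in simp_all)
    then show ?thesis by (simp add: m_def)
  qed
qed

lemma sgl_bij: "g \<in> carrier G \<Longrightarrow> bij_betw (sgl g) (acomp A (\<pi> g)) (acomp \<LL> g)"
  unfolding bij_betw_def by (auto simp: loop_acomp_iff inj_on_def) (metis sgl_same)

lemma loop_like_twisted_loop:
  assumes "Z2sym G \<tau>"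
  shows "loop_like G (G Mod H) A (twisted_loop_alg G H A \<tau>) \<pi> \<tau> sgl"
proof -
  interpret T: graded_algebra G "twisted_loop_alg G H A \<tau>"
    unfolding twisted_loop_alg_def by (rule graded_algebra_twist[OF graded_algebra_loop])
  interpret Q: comm_group "G Mod H" using comm_group_Mod[OF G.comm_group_axioms sub] .
  show ?thesis
  proof
    show "bij_betw (sgl g) (acomp A (\<pi> g)) (acomp (twisted_loop_alg G H A \<tau>) g)" if "g \<in> carrier G" for g
      using sgl_bij[OF that] by (simp add: twisted_loop_alg_def)
    show "amul (twisted_loop_alg G H A \<tau>) (sgl g u) (sgl h v)
        = ascal (twisted_loop_alg G H A \<tau>) (\<tau> g h) (sgl (g \<otimes>\<^bsub>G\<^esub> h) (amul A u v))"
      if "g \<in> carrier G" "h \<in> carrier G" "u \<in> acomp A (\<pi> g)" "v \<in> acomp A (\<pi> h)" for g h u v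
      using twist_mul[OF graded_algebra_loop, of g h "sgl g u" "sgl h v"] loop_mul[OF that] that loop_acomp_iff
      by (auto simp: twisted_loop_alg_def)
    show "\<pi> (g \<otimes>\<^bsub>G\<^esub> h) = \<pi> g \<otimes>\<^bsub>G Mod H\<^esub> \<pi> h" if "g \<in> carrier G" "h \<in> carrier G" for g h
      by (rule can_proj_mult[OF G.comm_group_axioms sub that])
    show "\<pi> ` carrier G = carrier (G Mod H)" by (rule can_proj_surj)
  qed (use assms sgl_scal in \<open>auto simp: sgl_add twisted_loop_alg_def\<close>)
qed

end

lemma simple_imp_graded_simple:
  assumes "graded \<Gamma> A" "simple_alg A" shows "graded_simple \<Gamma> A"
  using assms unfolding graded_simple_def simple_alg_def graded_ideal_def by auto

lemma ker_can_proj: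
  assumes "comm_group G" "subgroup H G"
  shows "{k \<in> carrier G. can_proj G H k = \<one>\<^bsub>G Mod H\<^esub>} = H"
  using can_proj_eq_subgroup_iff[OF assms] subgroup.subset[OF assms(2)] unfolding one_Mod by auto

lemma quotient_graded_intro:
  assumes "comm_group G" "subgroup H G" "graded (G Mod H) A"
  shows "quotient_graded G H A"
  using assms unfolding quotient_graded_def quotient_graded_axioms_def graded_iff_graded_algebra by simp

lemma central_loop_like_twisted_loop:
  assumes "comm_group G" "subgroup H G" "graded (G Mod H) A" "simple_alg A" "central_alg A" "Z2sym G \<tau>"
  shows "central_loop_like G (G Mod H) A (twisted_loop_alg G H A \<tau>) (can_proj G H) \<tau> sgl"
  using quotient_graded.loop_like_twisted_loop[OF quotient_graded_intro[OF assms(1-3)] assms(6)]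
    simple_imp_graded_simple[OF assms(3,4)] assms(5)
  unfolding central_loop_like_def central_loop_like_axioms_def by simp

section \<open>The centroid as a twisted group algebra\<close>

context central_loop_like
begin

text \<open>The isomorphism takes the basis element of degree g to \<open>shift g\<close>; by
  \<open>mul\<close> and \<open>shift_mult\<close> both bases multiply with the cocycle \<tau>. K is
  kept abstract because the group algebra is recognized as a graded algebra only through another
  description.\<close>

lemma graded_iso_centroid:
  fixes K :: "('g \<Rightarrow> 'f, 'f, 'g) galg"
  assumes K: "graded_algebra G K"
    and comp: "\<And>g. g \<in> carrier G \<Longrightarrow> acomp K g = (if g \<in> ker then range (sgl g) else {0})"
    and scal: "\<And>a g r. ascal K a (sgl g r) = sgl g (a * r)"
    and mul: "\<And>g h r s. \<lbrakk>g \<in> ker; h \<in> ker\<rbrakk> \<Longrightarrow> amul K (sgl g r) (sgl h s) = sgl (g \<otimes>\<^bsub>G\<^esub> h) (\<tau> g h * (r * s))"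
  shows "graded_iso G K (centroid_alg G L)"
proof -
  interpret K: graded_algebra G K by fact
  define f where "f g x = (if g \<in> ker then (\<lambda>y. ascal L (x g) (shift g y)) else 0)" for g and x :: "'g \<Rightarrow> 'f"
  have sh: "shift g \<in> centroid L" if "g \<in> ker" for g
    using centroid_compD(1)[OF shift_centroid_comp[OF that]] .
  have shm: "shift g y \<in> asp L" if "g \<in> ker" for g y
    using centroidD(1,2)[OF sh[OF that], of y] by (cases "y \<in> asp L") auto
  show ?thesis
  proof (rule graded_iso_from_family[OF K L.graded_algebra_centroid, where f = f])
    show "additive_family G K f"
      unfolding additive_family_def f_def using shm by (auto simp: fun_eq_iff L.scal_add_left)
    fix g assume g: "g \<in> carrier G"
    show "f g (ascal K a x) = ascal (centroid_alg G L) a (f g x)" if x: "x \<in> acomp K g" for x a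
    proof (cases "g \<in> ker")
      case True
      then obtain r where "x = sgl g r" using x comp[OF g] by auto
      then show ?thesis using True shm[OF True] scal
        by (simp add: f_def centroid_alg_def L.scal_scal)
    next
      case False
      then have "f g z = 0" for z by (simp only: f_def if_False)
      then show ?thesis by (simp add: centroid_alg_def fun_eq_iff)
    qed
    show "bij_betw (f g) (acomp K g) (acomp (centroid_alg G L) g)"
    proof (cases "g \<in> ker")
      case True
      obtain y where y: "y \<in> asp L" "shift g y \<noteq> 0" using shift_nonzero[OF True] .
      have fs: "f g (sgl g r) = (\<lambda>y. ascal L r (shift g y))" for r using True by (simp add: f_def)
      have "inj_on (f g) (range (sgl g))"
      proof (rule inj_onI)
        fix x x' assume "x \<in> range (sgl g)" "x' \<in> range (sgl g)" and e: "f g x = f g x'"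
        then obtain r r' where r: "x = sgl g r" "x' = sgl g r'" by auto
        have "ascal L r (shift g y) = ascal L r' (shift g y)" using e unfolding r fs by meson
        then show "x = x'" using L.scal_eq_scal_iff[OF shm[OF True] y(2)] r by simp
      qed
      moreover have "f g ` range (sgl g) = centroid_comp G L g"
      proof
        show "f g ` range (sgl g) \<subseteq> centroid_comp G L g"
          using L.centroid_comp_scal[OF g shift_centroid_comp[OF True]] by (auto simp: fs)
        show "centroid_comp G L g \<subseteq> f g ` range (sgl g)"
        proof
          fix c assume "c \<in> centroid_comp G L g"
          then obtain r where "c = (\<lambda>x. ascal L r (shift g x))" using centroid_comp_scalar(1)[OF g _ True] by auto
          then have "c = f g (sgl g r)" by (simp only: fs)
          then show "c \<in> f g ` range (sgl g)" by (simp only: imageI rangeI)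
        qed
      qed
      ultimately show ?thesis
        unfolding bij_betw_def comp[OF g] using True by (simp add: centroid_alg_def)
    next
      case False
      have "centroid_comp G L g = {0}"
        using centroid_comp_scalar(2)[OF g _ False] L.zero_centroid_comp[OF g] by blast
      moreover have "acomp K g = {0}" using comp[OF g] by (simp only: False if_False)
      moreover have "f g 0 = 0" by (simp only: f_def False if_False)
      ultimately show ?thesis by (simp add: bij_betw_def centroid_alg_def)
    qed
    fix h x y assume h: "h \<in> carrier G" and x: "x \<in> acomp K g" and y: "y \<in> acomp K h"
    show "f (g \<otimes>\<^bsub>G\<^esub> h) (amul K x y) = amul (centroid_alg G L) (f g x) (f h y)"
    proof (cases "g \<in> ker \<and> h \<in> ker")
      case True
      then have gk: "g \<in> ker" and hk: "h \<in> ker" by auto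
      obtain r s where rs: "x = sgl g r" "y = sgl h s" using gk hk x y comp[OF g] comp[OF h] by auto
      have "(f g x \<circ> f h y) z = f (g \<otimes>\<^bsub>G\<^esub> h) (amul K x y) z" for z
      proof -
        have "(f g x \<circ> f h y) z = ascal L r (ascal L s (shift g (shift h z)))"
          using centroidD(4)[OF sh[OF gk] shm[OF hk]] gk hk by (simp add: f_def rs)
        also have "\<dots> = ascal L r (ascal L s (ascal L (\<tau> g h) (shift (g \<otimes>\<^bsub>G\<^esub> h) z)))"
          using fun_cong[OF shift_mult[OF gk hk], of z] by simp
        also have "\<dots> = f (g \<otimes>\<^bsub>G\<^esub> h) (amul K x y) z"
          unfolding rs mul[OF gk hk] using ker_mult[OF gk hk] shm[OF ker_mult[OF gk hk]]
          by (simp add: f_def L.scal_scal mult_ac)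
        finally show ?thesis .
      qed
      then show ?thesis by (simp add: centroid_alg_def fun_eq_iff)
    next
      case False
      have Kz: "amul K x y = 0"
      proof -
        have "x = 0 \<or> y = 0" using False x y comp[OF g] comp[OF h] by (auto split: if_splits)
        then show ?thesis using K.comp_mem[OF g x] K.comp_mem[OF h y] by auto
      qed
      have 1: "f (g \<otimes>\<^bsub>G\<^esub> h) (amul K x y) = 0"
        unfolding Kz f_def using shm[of "g \<otimes>\<^bsub>G\<^esub> h"] by (auto simp: fun_eq_iff)
      have "f g x = 0 \<or> f h y = 0" using False by (auto simp: f_def)
      moreover have "f g x 0 = 0"
        using L.centroid_zero[OF sh, of g] by (simp add: f_def)
      ultimately have "f g x \<circ> f h y = 0" by (auto simp: fun_eq_iff)
      then show ?thesis unfolding 1 by (simp add: centroid_alg_def)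
    qed
  qed
qed

end

text \<open>The ground field placed in the identity coset of G/H. Its loop algebra is the group
  algebra of H with its G-grading, so facts about loop algebras and their twists apply to the group
  algebra.\<close>

definition field_alg :: "'g set \<Rightarrow> ('f::field, 'f, 'g set) galg" where
  "field_alg H = \<lparr>asp = UNIV, ascal = (*), amul = (*), acomp = (\<lambda>a. if a = H then UNIV else {0})\<rparr>"

lemma graded_field_alg:
  assumes "comm_group G" "subgroup H G"
  shows "graded (G Mod H) (field_alg H :: ('f::field, 'f, 'g set) galg)"
proof -
  interpret Q: comm_group "G Mod H" using comm_group_Mod[OF assms] .
  have H: "H \<in> carrier (G Mod H)" using Q.one_closed unfolding one_Mod .
  have ex1: "\<exists>!c. is_decomp (G Mod H) (field_alg H) x c" for x :: 'f
  proof (rule ex1I[of _ "\<lambda>a. if a = H then x else 0"])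
    have S: "{g \<in> carrier (G Mod H). (if g = H then x else 0) \<noteq> 0} = (if x = 0 then {} else {H})" using H by auto
    show "is_decomp (G Mod H) (field_alg H) x (\<lambda>a. if a = H then x else 0)"
      unfolding is_decomp_def S using H by (auto simp: field_alg_def)
    fix c assume c: "is_decomp (G Mod H) (field_alg H) x c"
    then have z: "c a = 0" if "a \<noteq> H" for a
    proof (cases "a \<in> carrier (G Mod H)")
      case True
      then have "c a \<in> acomp (field_alg H) a" using c unfolding is_decomp_def by blast
      then show ?thesis using that by (simp add: field_alg_def)
    next
      case False
      then show ?thesis using c unfolding is_decomp_def by blast
    qed
    have x: "x = (\<Sum>g\<in>{g \<in> carrier (G Mod H). c g \<noteq> 0}. c g)" using c unfolding is_decomp_def by (elim conjE)
    have "x = c H"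
    proof (cases "c H = 0")
      case True
      then have "c a = 0" for a using z by (cases "a = H") auto
      then show ?thesis using x by simp
    next
      case False
      then have "{g \<in> carrier (G Mod H). c g \<noteq> 0} = {H}" using z H by auto
      then show ?thesis using x by simp
    qed
    then show "c = (\<lambda>a. if a = H then x else 0)" using z by auto
  qed
  have HH: "H \<otimes>\<^bsub>G Mod H\<^esub> H = H" using Q.l_one[OF H] unfolding one_Mod .
  have mc: "amul (field_alg H) x y \<in> acomp (field_alg H) (g \<otimes>\<^bsub>G Mod H\<^esub> h)"
    if "g \<in> carrier (G Mod H)" "h \<in> carrier (G Mod H)" "x \<in> acomp (field_alg H) g" "y \<in> acomp (field_alg H) h" for g h and x y :: 'f
    using that HH by (cases "g = H"; cases "h = H") (simp_all add: field_alg_def)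
  show ?thesis unfolding graded_def
  proof (intro conjI ballI ex1 mc)
    show "group (G Mod H)" by (rule Q.is_group)
    show "is_algebra (field_alg H)" by (simp add: is_algebra_def field_alg_def algebra_simps)
    show "alg_subspace (field_alg H) (acomp (field_alg H) g)" for g
      by (simp add: alg_subspace_def field_alg_def)
  qed
qed

text \<open>The component of \<open>field_alg H\<close> over the coset of g is F or 0 according to
  whether g lies in H, so the condition on values in the loop algebra becomes the support condition
  of the group algebra.\<close>

lemma group_alg_eq_loop_alg:
  assumes "comm_group G" "subgroup H G"
  shows "group_alg G H = loop_alg G H (field_alg H :: ('f::field, 'f, 'g set) galg)"
proof -
  have *: "(\<forall>g. x g \<noteq> 0 \<longrightarrow> g \<in> H) \<longleftrightarrow> (\<forall>g. x g \<noteq> 0 \<longrightarrow> g \<in> carrier G) \<and>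
       (\<forall>g\<in>carrier G. x g \<in> acomp (field_alg H) (can_proj G H g))" for x :: "'g \<Rightarrow> 'f"
  proof -
    have "x g \<in> acomp (field_alg H) (can_proj G H g) \<longleftrightarrow> (x g \<noteq> 0 \<longrightarrow> g \<in> H)" if "g \<in> carrier G" for g
      using can_proj_eq_subgroup_iff[OF assms that] by (simp add: field_alg_def)
    then show ?thesis using subgroup.subset[OF assms(2)] by blast
  qed
  show ?thesis unfolding group_alg_def loop_alg_def * by (simp add: field_alg_def)
qed

lemma twisted_loop_central_simple:
  fixes A :: "('a::ab_group_add, 'f::field, 'g set) galg"
  assumes "comm_group G" "subgroup H G" "graded (G Mod H) A" "simple_alg A" "central_alg A" "Z2sym G \<tau>"
  shows "graded_central_simple G (twisted_loop_alg G H A \<tau>)"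
    and "graded_iso G (centroid_alg G (twisted_loop_alg G H A \<tau>))
        (twist G (group_alg G H :: ('g \<Rightarrow> 'f, 'f, 'g) galg)
           (\<lambda>a b. if a \<in> H \<and> b \<in> H then \<tau> a b else (1 :: 'f)))"
proof -
  interpret L: central_loop_like G "G Mod H" A "twisted_loop_alg G H A \<tau>" "can_proj G H" \<tau> sgl
    by (rule central_loop_like_twisted_loop) fact+
  show "graded_central_simple G (twisted_loop_alg G H A \<tau>)" by (rule L.graded_central_simple_loop)
  let ?F = "field_alg H :: ('f, 'f, 'g set) galg"
  let ?t = "\<lambda>a b. if a \<in> H \<and> b \<in> H then \<tau> a b else (1 :: 'f)"
  interpret F: quotient_graded G H ?F
    by (rule quotient_graded_intro[OF assms(1,2) graded_field_alg[OF assms(1,2)]])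
  have ker: "L.ker = H" using ker_can_proj[OF assms(1,2)] .
  have Hc: "H \<subseteq> carrier G" using subgroup.subset[OF assms(2)] .
  let ?K = "twist G (loop_alg G H ?F) ?t"
  have K: "graded_algebra G ?K" by (rule graded_algebra_twist[OF F.graded_algebra_loop])
  \<comment> \<open>Built in the direction in which the source has an explicit basis, and reversed
    at the end.\<close>
  have "graded_iso G ?K (centroid_alg G (twisted_loop_alg G H A \<tau>))"
  proof (rule L.graded_iso_centroid[OF K], unfold ker)
    fix g assume g: "g \<in> carrier G"
    have "acomp ?F (can_proj G H g) = (if g \<in> H then UNIV else {0})"
      using can_proj_eq_subgroup_iff[OF assms(1,2) g] by (simp add: field_alg_def)
    then show "acomp ?K g = (if g \<in> H then range (sgl g) else {0})"
      using F.loop_acomp_iff[OF g] by auto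
  next
    show "ascal ?K a (sgl g r) = sgl g (a * r)" for a g r
      by (simp add: F.sgl_scal) (simp add: field_alg_def)
  next
    fix g h r s assume g: "g \<in> H" and h: "h \<in> H"
    have gh: "g \<in> carrier G" "h \<in> carrier G" using g h Hc by auto
    have u: "u \<in> acomp ?F (can_proj G H g)" "u \<in> acomp ?F (can_proj G H h)" for u
      using can_proj_eq_subgroup_iff[OF assms(1,2)] gh g h by (auto simp: field_alg_def)
    have "amul ?K (sgl g r) (sgl h s) = ascal (loop_alg G H ?F) (\<tau> g h) (amul (loop_alg G H ?F) (sgl g r) (sgl h s))"
      using twist_mul[OF F.graded_algebra_loop gh, of "sgl g r" "sgl h s" ?t] u g h gh F.loop_acomp_iff by auto
    then show "amul ?K (sgl g r) (sgl h s) = sgl (g \<otimes>\<^bsub>G\<^esub> h) (\<tau> g h * (r * s))"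
      unfolding F.loop_mul[OF gh u] F.sgl_scal by (simp add: field_alg_def)
  qed
  then show "graded_iso G (centroid_alg G (twisted_loop_alg G H A \<tau>)) (twist G (group_alg G H) ?t)"
    unfolding group_alg_eq_loop_alg[OF assms(1,2)] by (rule graded_iso_sym[OF K])
qed

text \<open>Linear bijections of the base components may be followed by a nonzero factor \<gamma> g
  in each degree, and this is how a coboundary is absorbed. Assumption \<open>mul\<close> is the
  resulting multiplicativity with denominators cleared. The case \<gamma> = 1 serves to recognize a
  given algebra as a loop algebra.\<close>

lemma loop_iso_from_base:
  assumes "loop_like G \<Gamma> A1 L1 \<pi> \<tau>1 \<iota>1" "loop_like G \<Gamma> A2 L2 \<pi> \<tau>2 \<iota>2"
    and bij: "\<And>a. a \<in> carrier \<Gamma> \<Longrightarrow> bij_betw (\<psi> a) (acomp A1 a) (acomp A2 a)"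
    and add: "\<And>a u v. \<lbrakk>a \<in> carrier \<Gamma>; u \<in> acomp A1 a; v \<in> acomp A1 a\<rbrakk> \<Longrightarrow> \<psi> a (u + v) = \<psi> a u + \<psi> a v"
    and scal: "\<And>a u r. \<lbrakk>a \<in> carrier \<Gamma>; u \<in> acomp A1 a\<rbrakk> \<Longrightarrow> \<psi> a (ascal A1 r u) = ascal A2 r (\<psi> a u)"
    and \<gamma>: "\<And>g. g \<in> carrier G \<Longrightarrow> \<gamma> g \<noteq> 0"
    and mul: "\<And>g h u v. \<lbrakk>g \<in> carrier G; h \<in> carrier G; u \<in> acomp A1 (\<pi> g); v \<in> acomp A1 (\<pi> h)\<rbrakk> \<Longrightarrow>
       ascal A2 (\<tau>1 g h * \<gamma> (g \<otimes>\<^bsub>G\<^esub> h)) (\<psi> (\<pi> (g \<otimes>\<^bsub>G\<^esub> h)) (amul A1 u v))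
       = ascal A2 (\<gamma> g * \<gamma> h * \<tau>2 g h) (amul A2 (\<psi> (\<pi> g) u) (\<psi> (\<pi> h) v))"
  shows "graded_iso G L1 L2"
proof -
  interpret L1: loop_like G \<Gamma> A1 L1 \<pi> \<tau>1 \<iota>1 by fact
  interpret L2: loop_like G \<Gamma> A2 L2 \<pi> \<tau>2 \<iota>2 by fact
  define f where "f g x = \<iota>2 g (ascal A2 (\<gamma> g) (\<psi> (\<pi> g) (L1.jinv g x)))" for g x
  have \<psi>m: "\<psi> (\<pi> g) u \<in> acomp A2 (\<pi> g)" if "g \<in> carrier G" "u \<in> acomp A1 (\<pi> g)" for g u
    using bij_betwE[OF bij[of "\<pi> g"]] that by simp
  have \<psi>s: "ascal A2 r (\<psi> (\<pi> g) u) \<in> acomp A2 (\<pi> g)" if "g \<in> carrier G" "u \<in> acomp A1 (\<pi> g)" for g u r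
    using L2.A.comp_scal[OF _ \<psi>m[OF that]] that by simp
  have f\<iota>: "f g (\<iota>1 g u) = \<iota>2 g (ascal A2 (\<gamma> g) (\<psi> (\<pi> g) u))" if "g \<in> carrier G" "u \<in> acomp A1 (\<pi> g)" for g u
    unfolding f_def using L1.jinv_\<iota>[OF that] by simp
  show ?thesis
  proof (rule graded_iso_from_family[OF L1.L.graded_algebra_axioms L2.L.graded_algebra_axioms, where f = f])
    show "additive_family G L1 f" unfolding additive_family_def
    proof (intro ballI)
      fix g x y assume g: "g \<in> carrier G" and "x \<in> acomp L1 g" "y \<in> acomp L1 g"
      then obtain u v where u: "u \<in> acomp A1 (\<pi> g)" "x = \<iota>1 g u" and v: "v \<in> acomp A1 (\<pi> g)" "y = \<iota>1 g v"
        using L1.\<iota>_surj by metis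
      have pg: "\<pi> g \<in> carrier \<Gamma>" using g by simp
      show "f g (x + y) = f g x + f g y"
        using f\<iota>[OF g L1.A.comp_add[OF pg u(1) v(1)]] f\<iota>[OF g u(1)] f\<iota>[OF g v(1)] L1.\<iota>_add[OF g u(1) v(1)]
          add[OF pg u(1) v(1)] L2.A.scal_add_right[OF L2.A.comp_mem[OF pg \<psi>m[OF g u(1)]] L2.A.comp_mem[OF pg \<psi>m[OF g v(1)]]]
          L2.\<iota>_add[OF g \<psi>s[OF g u(1)] \<psi>s[OF g v(1)]] u(2) v(2) by simp
    qed
    fix g assume g: "g \<in> carrier G"
    have pg: "\<pi> g \<in> carrier \<Gamma>" using g by simp
    show "f g (ascal L1 a x) = ascal L2 a (f g x)" if x: "x \<in> acomp L1 g" for a x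
    proof -
      obtain u where u: "u \<in> acomp A1 (\<pi> g)" "x = \<iota>1 g u" using L1.\<iota>_surj[OF g x] by auto
      show ?thesis
        using f\<iota>[OF g L1.A.comp_scal[OF pg u(1)]] f\<iota>[OF g u(1)] L1.\<iota>_scal[OF g u(1)] scal[OF pg u(1)]
          L2.\<iota>_scal[OF g \<psi>s[OF g u(1)]] u(2) L2.A.comp_mem[OF pg \<psi>m[OF g u(1)]]
        by (simp add: L2.A.scal_scal mult.commute)
    qed
    show "bij_betw (f g) (acomp L1 g) (acomp L2 g)"
    proof -
      have "bij_betw (ascal A2 (\<gamma> g)) (acomp A2 (\<pi> g)) (acomp A2 (\<pi> g))"
        by (rule bij_betw_byWitness[where f' = "ascal A2 (inverse (\<gamma> g))"])
           (use \<gamma>[OF g] L2.A.comp_mem[OF pg] L2.A.comp_scal[OF pg] in \<open>auto simp: L2.A.scal_scal L2.A.scal_one\<close>)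
      then have "bij_betw (\<iota>2 g \<circ> (ascal A2 (\<gamma> g) \<circ> (\<psi> (\<pi> g) \<circ> L1.jinv g))) (acomp L1 g) (acomp L2 g)"
        using bij_betw_trans[OF bij_betw_trans[OF bij_betw_trans[OF bij_betw_the_inv_into[OF L1.\<iota>_bij[OF g]] bij[OF pg]]] L2.\<iota>_bij[OF g]]
        by (simp add: comp_assoc)
      then show ?thesis unfolding f_def comp_def .
    qed
    fix h x y assume h: "h \<in> carrier G" and x: "x \<in> acomp L1 g" and y: "y \<in> acomp L1 h"
    obtain u where u: "u \<in> acomp A1 (\<pi> g)" "x = \<iota>1 g u" using L1.\<iota>_surj[OF g x] by auto
    obtain v where v: "v \<in> acomp A1 (\<pi> h)" "y = \<iota>1 h v" using L1.\<iota>_surj[OF h y] by auto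
    have ph: "\<pi> h \<in> carrier \<Gamma>" and gh: "g \<otimes>\<^bsub>G\<^esub> h \<in> carrier G" using g h by auto
    have pgh: "\<pi> (g \<otimes>\<^bsub>G\<^esub> h) \<in> carrier \<Gamma>" using gh by simp
    note uv = L1.A_mul_comp[OF g h u(1) v(1)]
    note uvm = L2.A.comp_mem[OF pgh \<psi>m[OF gh uv]]
    have um: "\<psi> (\<pi> g) u \<in> asp A2" "\<psi> (\<pi> h) v \<in> asp A2"
      using L2.A.comp_mem[OF pg \<psi>m[OF g u(1)]] L2.A.comp_mem[OF ph \<psi>m[OF h v(1)]] by auto
    have e1: "f (g \<otimes>\<^bsub>G\<^esub> h) (amul L1 x y) = \<iota>2 (g \<otimes>\<^bsub>G\<^esub> h) (ascal A2 (\<tau>1 g h * \<gamma> (g \<otimes>\<^bsub>G\<^esub> h)) (\<psi> (\<pi> (g \<otimes>\<^bsub>G\<^esub> h)) (amul A1 u v)))"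
      using u(2) v(2) L1.\<iota>_mul[OF g h u(1) v(1)] L1.\<iota>_scal[OF gh uv, symmetric] f\<iota>[OF gh L1.A.comp_scal[OF pgh uv]]
        scal[OF pgh uv] uvm by (simp add: L2.A.scal_scal mult.commute)
    have "amul L2 (f g x) (f h y) = ascal L2 (\<tau>2 g h) (\<iota>2 (g \<otimes>\<^bsub>G\<^esub> h) (amul A2 (ascal A2 (\<gamma> g) (\<psi> (\<pi> g) u)) (ascal A2 (\<gamma> h) (\<psi> (\<pi> h) v))))"
      using f\<iota>[OF g u(1)] f\<iota>[OF h v(1)] u(2) v(2) L2.\<iota>_mul[OF g h \<psi>s[OF g u(1)] \<psi>s[OF h v(1)]] by simp
    also have "\<dots> = \<iota>2 (g \<otimes>\<^bsub>G\<^esub> h) (ascal A2 (\<tau>2 g h) (amul A2 (ascal A2 (\<gamma> g) (\<psi> (\<pi> g) u)) (ascal A2 (\<gamma> h) (\<psi> (\<pi> h) v))))"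
      by (rule L2.\<iota>_scal[OF gh L2.A_mul_comp[OF g h \<psi>s[OF g u(1)] \<psi>s[OF h v(1)]], symmetric])
    also have "\<dots> = \<iota>2 (g \<otimes>\<^bsub>G\<^esub> h) (ascal A2 (\<gamma> g * \<gamma> h * \<tau>2 g h) (amul A2 (\<psi> (\<pi> g) u) (\<psi> (\<pi> h) v)))"
      using um by (simp add: L2.A.mul_scal_left L2.A.mul_scal_right L2.A.scal_scal L2.A.mul_mem L2.A.scal_mem mult_ac)
    finally show "f (g \<otimes>\<^bsub>G\<^esub> h) (amul L1 x y) = amul L2 (f g x) (f h y)"
      using e1 mul[OF g h u(1) v(1)] by simp
  qed
qed

text \<open>Conjugation by p, with value 0 off the carrier of B; as p preserves degrees, the
  conjugate has the degree of c.\<close>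

lemma centroid_transport:
  assumes "graded_algebra \<Gamma> A" and k: "k \<in> carrier \<Gamma>" and c: "c \<in> centroid_comp \<Gamma> A k"
    and p: "bij_betw p (asp A) (asp B)"
      "\<And>x y. \<lbrakk>x \<in> asp A; y \<in> asp A\<rbrakk> \<Longrightarrow> p (x + y) = p x + p y"
      "\<And>a x. x \<in> asp A \<Longrightarrow> p (ascal A a x) = ascal B a (p x)"
      "\<And>x y. \<lbrakk>x \<in> asp A; y \<in> asp A\<rbrakk> \<Longrightarrow> p (amul A x y) = amul B (p x) (p y)"
      "\<And>g. g \<in> carrier \<Gamma> \<Longrightarrow> p ` acomp A g = acomp B g"
  obtains c' where "c' \<in> centroid_comp \<Gamma> B k" and "\<And>x. x \<in> asp A \<Longrightarrow> c' (p x) = p (c x)"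
proof -
  interpret A: graded_algebra \<Gamma> A by fact
  note cc = centroid_compD(1)[OF c]
  define c' where "c' y = (if y \<in> asp B then p (c (the_inv_into (asp A) p y)) else 0)" for y
  have pm: "p x \<in> asp B" if "x \<in> asp A" for x using p(1) that bij_betwE by blast
  have c'p: "c' (p x) = p (c x)" if "x \<in> asp A" for x
    unfolding c'_def using p(1) pm[OF that] that by (simp add: bij_betw_def the_inv_into_f_f)
  have ex: "\<exists>x\<in>asp A. y = p x" if "y \<in> asp B" for y using p(1) that by (auto simp: bij_betw_def)
  have "c' \<in> centroid B"
  proof (rule centroidI)
    fix x assume "x \<in> asp B"
    then obtain u where u: "u \<in> asp A" "x = p u" using ex by auto
    note cu = centroidD(1)[OF cc u(1)]
    show "c' x \<in> asp B" using c'p u pm cu by simp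
    show "c' (ascal B a x) = ascal B a (c' x)" for a
      using c'p[OF A.scal_mem[OF u(1)]] p(3) u centroidD(4)[OF cc u(1)] c'p[OF u(1)] cu by simp
    fix y assume "y \<in> asp B"
    then obtain v where v: "v \<in> asp A" "y = p v" using ex by auto
    note cv = centroidD(1)[OF cc v(1)]
    show "c' (x + y) = c' x + c' y"
      using c'p[OF A.add_mem[OF u(1) v(1)]] p(2) u v centroidD(3)[OF cc u(1) v(1)] c'p cu cv by simp
    show "c' (amul B x y) = amul B (c' x) y"
      using c'p[OF A.mul_mem[OF u(1) v(1)]] p(4)[OF u(1) v(1)] p(4)[OF cu v(1)] u v centroidD(5)[OF cc u(1) v(1)] c'p by simp
    show "c' (amul B x y) = amul B x (c' y)"
      using c'p[OF A.mul_mem[OF u(1) v(1)]] p(4)[OF u(1) v(1)] p(4)[OF u(1) cv] u v centroidD(6)[OF cc u(1) v(1)] c'p by simp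
  qed (simp add: c'_def)
  moreover have "c' x \<in> acomp B (k \<otimes>\<^bsub>\<Gamma>\<^esub> g)" if g: "g \<in> carrier \<Gamma>" and x: "x \<in> acomp B g" for g x
  proof -
    obtain u where u: "u \<in> acomp A g" "x = p u" using x p(5)[OF g] by auto
    have "p (c u) \<in> p ` acomp A (k \<otimes>\<^bsub>\<Gamma>\<^esub> g)" using centroid_compD(2)[OF c g u(1)] by simp
    then show ?thesis using p(5)[of "k \<otimes>\<^bsub>\<Gamma>\<^esub> g"] g k c'p[OF A.comp_mem[OF g u(1)]] u(2) by simp
  qed
  ultimately have "c' \<in> centroid_comp \<Gamma> B k" unfolding centroid_comp_def by simp
  then show thesis using that c'p by simp
qed

subsection \<open>Comparing two loop algebras\<close>

text \<open>If \<open>\<sigma>\<close> restricted to \<open>H\<close> is the coboundary of \<open>l\<close>, then \<open>l\<close> extends to \<open>\<gamma>\<close> on \<open>G\<close>, by an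
arbitrary choice on coset representatives, so that \<open>\<sigma>\<close> divided by the coboundary of \<open>\<gamma>\<close> is constant
on \<open>H \<times> G\<close>; the cocycle identity then makes it invariant under \<open>H\<close> in both arguments.\<close>

lemma cocycle_descent:
  fixes \<sigma> :: "'g \<Rightarrow> 'g \<Rightarrow> 'f::field"
  assumes G: "comm_group G" and H: "subgroup H G" and \<sigma>: "Z2sym G \<sigma>"
    and l0: "\<And>h. h \<in> H \<Longrightarrow> l h \<noteq> 0"
    and l: "\<And>h k. \<lbrakk>h \<in> H; k \<in> H\<rbrakk> \<Longrightarrow> \<sigma> h k * l (h \<otimes>\<^bsub>G\<^esub> k) = l h * l k"
  obtains \<gamma> \<mu> where "\<And>g. g \<in> carrier G \<Longrightarrow> \<gamma> g \<noteq> 0" and "Z2sym (G Mod H) \<mu>"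
    and "\<And>g h. \<lbrakk>g \<in> carrier G; h \<in> carrier G\<rbrakk> \<Longrightarrow>
      \<sigma> g h * \<gamma> (g \<otimes>\<^bsub>G\<^esub> h) = \<mu> (can_proj G H g) (can_proj G H h) * (\<gamma> g * \<gamma> h)"
    and "\<And>h g. \<lbrakk>h \<in> H; g \<in> carrier G\<rbrakk> \<Longrightarrow> \<gamma> (h \<otimes>\<^bsub>G\<^esub> g) * \<sigma> h g = l h * \<gamma> g"
proof -
  interpret comm_group G by fact
  interpret H: subgroup H G by fact
  let ?p = "can_proj G H"
  note eq_iff = can_proj_eq_iff[OF G H]
  note p_mult = can_proj_mult[OF G H]
  have Hc: "h \<in> carrier G" if "h \<in> H" for h using that by (rule H.mem_carrier)
  have p_H: "?p (h \<otimes>\<^bsub>G\<^esub> g) = ?p g" if "h \<in> H" "g \<in> carrier G" for h g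
    using eq_iff[of "h \<otimes>\<^bsub>G\<^esub> g" g] that Hc by (simp add: m_assoc)
  define s where "s a = (SOME g. g \<in> carrier G \<and> ?p g = a)" for a
  have s: "s a \<in> carrier G \<and> ?p (s a) = a" if "a \<in> carrier (G Mod H)" for a
  proof -
    have "\<exists>g. g \<in> carrier G \<and> ?p g = a" using that unfolding can_proj_surj[of G H, symmetric] by auto
    then show ?thesis unfolding s_def by (rule someI_ex)
  qed
  have pc: "?p g \<in> carrier (G Mod H)" if "g \<in> carrier G" for g using that unfolding can_proj_surj[of G H, symmetric] by (rule imageI)
  have sp: "s (?p g) \<in> carrier G" "?p (s (?p g)) = ?p g" if "g \<in> carrier G" for g using s[OF pc[OF that]] by auto
  \<comment> \<open>The H-part of g relative to its coset representative. Translating g by an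
    element of H changes this part alone.\<close>
  define t where "t g = g \<otimes>\<^bsub>G\<^esub> inv\<^bsub>G\<^esub> s (?p g)" for g
  have t: "t g \<in> H" "t g \<otimes>\<^bsub>G\<^esub> s (?p g) = g" if "g \<in> carrier G" for g
    using eq_iff[OF that sp(1)[OF that]] sp[OF that] that unfolding t_def by (auto simp: m_assoc)
  have t_mult: "t (h \<otimes>\<^bsub>G\<^esub> g) = h \<otimes>\<^bsub>G\<^esub> t g" if "h \<in> H" "g \<in> carrier G" for h g
    unfolding t_def p_H[OF that] using that Hc sp by (simp add: m_assoc)
  have \<sigma>0: "\<sigma> g h \<noteq> 0" if "g \<in> carrier G" "h \<in> carrier G" for g h using Z2symD(1)[OF \<sigma> that] .
  \<comment> \<open>The relation \<open>\<gamma>H\<close> at a representative forces this formula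
    once the value there is normalized to 1. The value is indeed 1, because the hypothesis on l
    gives l(1) = \<sigma>(1,1).\<close>
  define \<gamma> where "\<gamma> g = l (t g) / \<sigma> (t g) (s (?p g))" for g
  have \<gamma>0: "\<gamma> g \<noteq> 0" if "g \<in> carrier G" for g
    unfolding \<gamma>_def using l0 t(1)[OF that] \<sigma>0[OF Hc sp(1)] that by simp
  have \<gamma>H: "\<gamma> (h \<otimes>\<^bsub>G\<^esub> g) * \<sigma> h g = l h * \<gamma> g" if h: "h \<in> H" and g: "g \<in> carrier G" for h g
  proof -
    let ?k = "t g" and ?s = "s (?p g)"
    have k: "?k \<in> H" and sc: "?s \<in> carrier G" using t sp g by auto
    have hk: "h \<otimes>\<^bsub>G\<^esub> ?k \<in> H" using h k by simp
    have c: "\<sigma> h ?k * \<sigma> (h \<otimes>\<^bsub>G\<^esub> ?k) ?s = \<sigma> h g * \<sigma> ?k ?s"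
      using Z2symD(3)[OF \<sigma> Hc[OF h] Hc[OF k] sc] t(2)[OF g] by simp
    have nz: "\<sigma> (h \<otimes>\<^bsub>G\<^esub> ?k) ?s \<noteq> 0" "\<sigma> ?k ?s \<noteq> 0" "\<sigma> h ?k \<noteq> 0"
      using \<sigma>0 Hc[OF h] Hc[OF k] sc by auto
    have e: "\<gamma> (h \<otimes>\<^bsub>G\<^esub> g) = l (h \<otimes>\<^bsub>G\<^esub> ?k) / \<sigma> (h \<otimes>\<^bsub>G\<^esub> ?k) ?s"
      unfolding \<gamma>_def t_mult[OF h g] p_H[OF h g] ..
    have "l (h \<otimes>\<^bsub>G\<^esub> ?k) * \<sigma> h g * \<sigma> ?k ?s = l h * l ?k * \<sigma> (h \<otimes>\<^bsub>G\<^esub> ?k) ?s"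
      unfolding mult.assoc[of "l (h \<otimes>\<^bsub>G\<^esub> ?k)"] c[symmetric] l[OF h k, symmetric] by (simp only: mult_ac)
    then show ?thesis unfolding e \<gamma>_def[of g] using nz by (simp add: field_simps)
  qed
  define m where "m g h = \<sigma> g h * \<gamma> (g \<otimes>\<^bsub>G\<^esub> h) / (\<gamma> g * \<gamma> h)" for g h
  have m: "Z2sym G m" unfolding Z2sym_def
  proof (intro conjI ballI)
    fix a b assume ab: "a \<in> carrier G" "b \<in> carrier G"
    show "m a b \<noteq> 0" unfolding m_def using ab \<sigma>0 \<gamma>0 by simp
    show "m a b = m b a" unfolding m_def using Z2symD(2)[OF \<sigma> ab] m_comm[OF ab] by (simp add: mult.commute)
    fix c assume c: "c \<in> carrier G"
    have nz: "\<gamma> a \<noteq> 0" "\<gamma> b \<noteq> 0" "\<gamma> c \<noteq> 0" "\<gamma> (a \<otimes>\<^bsub>G\<^esub> b) \<noteq> 0" "\<gamma> (b \<otimes>\<^bsub>G\<^esub> c) \<noteq> 0" using ab c \<gamma>0 by auto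
    have "m a b * m (a \<otimes>\<^bsub>G\<^esub> b) c = (\<sigma> a b * \<sigma> (a \<otimes>\<^bsub>G\<^esub> b) c) * \<gamma> (a \<otimes>\<^bsub>G\<^esub> (b \<otimes>\<^bsub>G\<^esub> c)) / (\<gamma> a * \<gamma> b * \<gamma> c)"
      unfolding m_def using nz ab c by (simp add: m_assoc mult.assoc)
    also have "\<dots> = (\<sigma> a (b \<otimes>\<^bsub>G\<^esub> c) * \<sigma> b c) * \<gamma> (a \<otimes>\<^bsub>G\<^esub> (b \<otimes>\<^bsub>G\<^esub> c)) / (\<gamma> a * \<gamma> b * \<gamma> c)"
      using Z2symD(3)[OF \<sigma> ab c] by simp
    also have "\<dots> = m a (b \<otimes>\<^bsub>G\<^esub> c) * m b c"
      unfolding m_def using nz by (simp add: mult_ac)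
    finally show "m a b * m (a \<otimes>\<^bsub>G\<^esub> b) c = m a (b \<otimes>\<^bsub>G\<^esub> c) * m b c" .
  qed
  \<comment> \<open>By \<open>\<gamma>H\<close> the value is l h / \<gamma> h, and the same relation
    at the identity shows that this quotient does not depend on h.\<close>
  have mH: "m h g = \<sigma> \<one>\<^bsub>G\<^esub> \<one>\<^bsub>G\<^esub> / \<gamma> \<one>\<^bsub>G\<^esub>" if h: "h \<in> H" and g: "g \<in> carrier G" for h g
  proof -
    have "m h g = l h / \<gamma> h"
      unfolding m_def using \<gamma>H[OF h g] \<gamma>0[OF g] by (simp add: mult.commute)
    moreover have "\<gamma> h * \<sigma> \<one>\<^bsub>G\<^esub> \<one>\<^bsub>G\<^esub> = l h * \<gamma> \<one>\<^bsub>G\<^esub>"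
      using \<gamma>H[OF h one_closed] Z2symD(2)[OF \<sigma> Hc[OF h] one_closed] Z2sym_one[OF G \<sigma> Hc[OF h]] Hc[OF h] by simp
    ultimately show ?thesis
      using frac_eq_eq[OF \<gamma>0[OF Hc[OF h]] \<gamma>0[OF one_closed], of "l h" "\<sigma> \<one>\<^bsub>G\<^esub> \<one>\<^bsub>G\<^esub>"] by (simp add: mult.commute)
  qed
  \<comment> \<open>In the cocycle identity for (h, g, k) the factors m(h,g) and m(h,gk) are both
    that constant and cancel.\<close>
  have m_inv: "m (h \<otimes>\<^bsub>G\<^esub> g) k = m g k" if h: "h \<in> H" and g: "g \<in> carrier G" and k: "k \<in> carrier G" for h g k
    using Z2symD(3)[OF m Hc[OF h] g k] mH[OF h g] mH[OF h, of "g \<otimes>\<^bsub>G\<^esub> k"] g k Z2symD(1)[OF m Hc[OF h] g] by simp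
  have m_eq: "m g k = m g' k'" if c: "g \<in> carrier G" "k \<in> carrier G" "g' \<in> carrier G" "k' \<in> carrier G"
    and p: "?p g = ?p g'" "?p k = ?p k'" for g k g' k'
  proof -
    have "m g k = m g' k" if "g \<in> carrier G" "g' \<in> carrier G" "k \<in> carrier G" "?p g = ?p g'" for g g' k
      using m_inv[of "g \<otimes>\<^bsub>G\<^esub> inv\<^bsub>G\<^esub> g'" g' k] eq_iff[of g g'] that by (simp add: m_assoc)
    then show ?thesis using c p Z2symD(2)[OF m] by metis
  qed
  define \<mu> where "\<mu> a b = m (s a) (s b)" for a b
  have \<mu>p: "\<mu> (?p g) (?p h) = m g h" if "g \<in> carrier G" "h \<in> carrier G" for g h
    unfolding \<mu>_def by (rule m_eq) (use sp that in auto)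
  have "Z2sym (G Mod H) \<mu>" unfolding Z2sym_def
  proof (intro conjI ballI)
    fix a b assume "a \<in> carrier (G Mod H)" "b \<in> carrier (G Mod H)"
    then obtain g h where g: "g \<in> carrier G" "a = ?p g" and h: "h \<in> carrier G" "b = ?p h"
      unfolding can_proj_surj[of G H, symmetric] by auto
    show "\<mu> a b \<noteq> 0" "\<mu> a b = \<mu> b a" using Z2symD(1,2)[OF m g(1) h(1)] g h by (auto simp: \<mu>p)
    fix c assume "c \<in> carrier (G Mod H)"
    then obtain k where k: "k \<in> carrier G" "c = ?p k" unfolding can_proj_surj[of G H, symmetric] by auto
    show "\<mu> a b * \<mu> (a \<otimes>\<^bsub>G Mod H\<^esub> b) c = \<mu> a (b \<otimes>\<^bsub>G Mod H\<^esub> c) * \<mu> b c"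
      unfolding g(2) h(2) k(2) p_mult[OF g(1) h(1), symmetric] p_mult[OF h(1) k(1), symmetric]
        \<mu>p[OF g(1) h(1)] \<mu>p[OF m_closed[OF g(1) h(1)] k(1)] \<mu>p[OF g(1) m_closed[OF h(1) k(1)]] \<mu>p[OF h(1) k(1)]
      by (rule Z2symD(3)[OF m g(1) h(1) k(1)])
  qed
  moreover have "\<sigma> g h * \<gamma> (g \<otimes>\<^bsub>G\<^esub> h) = \<mu> (?p g) (?p h) * (\<gamma> g * \<gamma> h)" if "g \<in> carrier G" "h \<in> carrier G" for g h
    unfolding \<mu>p[OF that] m_def using \<gamma>0 that by simp
  ultimately show thesis using that[of \<gamma> \<mu>] \<gamma>0 \<gamma>H by metis
qed

text \<open>The degrees that carry a nonzero centroid element are an isomorphism invariant; for a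
  loop over a central base they form the kernel of \<pi>. Here a nonzero shift is transported to the
  second algebra.\<close>

lemma loop_iso_ker_subset:
  assumes "central_loop_like G \<Gamma>1 A1 L1 \<pi>1 \<tau>1 \<iota>1" "central_loop_like G \<Gamma>2 A2 L2 \<pi>2 \<tau>2 \<iota>2"
    and iso: "graded_iso G L1 L2"
  shows "{k \<in> carrier G. \<pi>1 k = \<one>\<^bsub>\<Gamma>1\<^esub>} \<subseteq> {k \<in> carrier G. \<pi>2 k = \<one>\<^bsub>\<Gamma>2\<^esub>}"
proof
  interpret L1: central_loop_like G \<Gamma>1 A1 L1 \<pi>1 \<tau>1 \<iota>1 by fact
  interpret L2: central_loop_like G \<Gamma>2 A2 L2 \<pi>2 \<tau>2 \<iota>2 by fact
  obtain p where p: "bij_betw p (asp L1) (asp L2)"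
      "\<And>x y. \<lbrakk>x \<in> asp L1; y \<in> asp L1\<rbrakk> \<Longrightarrow> p (x + y) = p x + p y"
      "\<And>a x. x \<in> asp L1 \<Longrightarrow> p (ascal L1 a x) = ascal L2 a (p x)"
      "\<And>x y. \<lbrakk>x \<in> asp L1; y \<in> asp L1\<rbrakk> \<Longrightarrow> p (amul L1 x y) = amul L2 (p x) (p y)"
      "\<And>g. g \<in> carrier G \<Longrightarrow> p ` acomp L1 g = acomp L2 g"
    using iso by (rule graded_isoE) (rule that; assumption)
  fix k assume k: "k \<in> L1.ker"
  then have kc: "k \<in> carrier G" by simp
  note sc = L1.shift_centroid_comp[OF k]
  obtain c where c: "c \<in> centroid_comp G L2 k" "\<And>x. x \<in> asp L1 \<Longrightarrow> c (p x) = p (L1.shift k x)"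
    using centroid_transport[OF L1.L.graded_algebra_axioms kc sc p] by blast
  obtain x where x: "x \<in> asp L1" "L1.shift k x \<noteq> 0" using L1.shift_nonzero[OF k] .
  have "p 0 = 0" using p(2)[of 0 0] by simp
  then have "p (L1.shift k x) \<noteq> 0"
    using inj_onD[OF bij_betw_imp_inj_on[OF p(1)], of "L1.shift k x" 0] x centroidD(1)[OF centroid_compD(1)[OF sc] x(1)] by auto
  then have "c \<noteq> 0" using c(2)[OF x(1)] by auto
  then show "k \<in> L2.ker" using L2.centroid_comp_scalar(2)[OF kc c(1)] by blast
qed

text \<open>In degree g the isomorphism is a map \<phi> g between base components. Within a coset of
  H these maps differ only by scalars, governed by l and the two cocycles; the \<gamma> extending l
  removes this variation, and what the correction does to the product is measured by \<mu>.\<close>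

lemma loop_iso_imp_base_iso:
  assumes G: "comm_group G" and H: "subgroup H G"
    and "central_loop_like G (G Mod H) A1 L1 (can_proj G H) \<tau>1 \<iota>1"
    and "central_loop_like G (G Mod H) A2 L2 (can_proj G H) \<tau>2 \<iota>2"
    and iso: "graded_iso G L1 L2"
  shows "\<exists>\<mu>. Z2sym (G Mod H) \<mu> \<and>
          cohom_eq_prod G \<tau>1 (\<lambda>a b. \<mu> (can_proj G H a) (can_proj G H b)) \<tau>2 \<and>
          graded_iso (G Mod H) (twist (G Mod H) A1 \<mu>) A2"
proof -
  let ?Q = "G Mod H" and ?p = "can_proj G H"
  interpret L1: central_loop_like G ?Q A1 L1 ?p \<tau>1 \<iota>1 by fact
  interpret L2: central_loop_like G ?Q A2 L2 ?p \<tau>2 \<iota>2 by fact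
  obtain p where p: "bij_betw p (asp L1) (asp L2)"
      "\<And>x y. \<lbrakk>x \<in> asp L1; y \<in> asp L1\<rbrakk> \<Longrightarrow> p (x + y) = p x + p y"
      "\<And>a x. x \<in> asp L1 \<Longrightarrow> p (ascal L1 a x) = ascal L2 a (p x)"
      "\<And>x y. \<lbrakk>x \<in> asp L1; y \<in> asp L1\<rbrakk> \<Longrightarrow> p (amul L1 x y) = amul L2 (p x) (p y)"
      "\<And>g. g \<in> carrier G \<Longrightarrow> p ` acomp L1 g = acomp L2 g"
    using iso by (rule graded_isoE) (rule that; assumption)
  have ker: "L1.ker = H" using ker_can_proj[OF G H] .
  have Hc: "h \<in> carrier G" if "h \<in> H" for h using that subgroup.mem_carrier[OF H] by simp
  have pm: "p x \<in> asp L2" if "x \<in> asp L1" for x using bij_betwE[OF p(1)] that by simp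
  have p0: "p 0 = 0" using p(2)[of 0 0] by simp
  have pz: "x = 0" if "x \<in> asp L1" "p x = 0" for x
    using inj_onD[OF bij_betw_imp_inj_on[OF p(1)], of x 0] that p0 by simp
  have sh1: "L1.shift h x \<in> asp L1" if "h \<in> H" "x \<in> asp L1" for h x
    using centroidD(1)[OF centroid_compD(1)[OF L1.shift_centroid_comp]] that ker by blast
  have sh2: "L2.shift h x \<in> asp L2" if "h \<in> H" "x \<in> asp L2" for h x
    using centroidD(1)[OF centroid_compD(1)[OF L2.shift_centroid_comp]] that ker by blast
  have "\<exists>r. \<forall>x\<in>asp L1. p (L1.shift h x) = ascal L2 r (L2.shift h (p x))" if h: "h \<in> H" for h
  proof -
    have hk: "h \<in> L1.ker" using h unfolding ker .
    obtain c where c: "c \<in> centroid_comp G L2 h" "\<And>x. x \<in> asp L1 \<Longrightarrow> c (p x) = p (L1.shift h x)"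
      using centroid_transport[OF L1.L.graded_algebra_axioms Hc[OF h] L1.shift_centroid_comp[OF hk] p] by blast
    obtain r where "c = (\<lambda>x. ascal L2 r (L2.shift h x))" using L2.centroid_comp_scalar(1)[OF Hc[OF h] c(1) hk] by blast
    then show ?thesis using c(2) by (intro exI[of _ r]) simp
  qed
  then obtain l where l: "\<And>h x. \<lbrakk>h \<in> H; x \<in> asp L1\<rbrakk> \<Longrightarrow> p (L1.shift h x) = ascal L2 (l h) (L2.shift h (p x))"
    by metis
  have l0: "l h \<noteq> 0" if h: "h \<in> H" for h
  proof
    assume z: "l h = 0"
    have hk: "h \<in> L1.ker" using h unfolding ker .
    obtain x where x: "x \<in> asp L1" "L1.shift h x \<noteq> 0" using L1.shift_nonzero[OF hk] .
    have "p (L1.shift h x) = 0" using l[OF h x(1)] z sh2[OF h pm[OF x(1)]] by simp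
    then show False using pz[OF sh1[OF h x(1)]] x by simp
  qed
  \<comment> \<open>The image under p of a composite of two shifts is computed twice, composing
    before and after p. This compares the two cocycles on H.\<close>
  have l_mult: "\<tau>1 h k * l (h \<otimes>\<^bsub>G\<^esub> k) = l h * l k * \<tau>2 h k" if h: "h \<in> H" and k: "k \<in> H" for h k
  proof -
    have hk: "h \<in> L1.ker" "k \<in> L1.ker" using h k unfolding ker by auto
    have hkH: "h \<otimes>\<^bsub>G\<^esub> k \<in> H" using subgroup.m_closed[OF H h k] .
    obtain y where y: "y \<in> asp L2" "L2.shift (h \<otimes>\<^bsub>G\<^esub> k) y \<noteq> 0" using L2.shift_nonzero[OF L1.ker_mult[OF hk]] .
    obtain x where x: "x \<in> asp L1" "y = p x" using y p(1) by (auto simp: bij_betw_def)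
    have "p (L1.shift h (L1.shift k x)) = ascal L2 (\<tau>1 h k * l (h \<otimes>\<^bsub>G\<^esub> k)) (L2.shift (h \<otimes>\<^bsub>G\<^esub> k) y)"
      using fun_cong[OF L1.shift_mult[OF hk], of x] p(3)[OF sh1[OF hkH x(1)]] l[OF hkH x(1)] x(2) sh2[OF hkH y(1)]
      by (simp add: L2.L.scal_scal)
    moreover have "p (L1.shift h (L1.shift k x)) = ascal L2 (l h * l k * \<tau>2 h k) (L2.shift (h \<otimes>\<^bsub>G\<^esub> k) y)"
      using l[OF h sh1[OF k x(1)]] l[OF k x(1)] x(2) sh2[OF hkH y(1)] fun_cong[OF L2.shift_mult[OF hk], of y]
        centroidD(4)[OF centroid_compD(1)[OF L2.shift_centroid_comp[OF hk(1)]] sh2[OF k y(1)]]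
      by (simp add: L2.L.scal_scal mult.assoc)
    ultimately show ?thesis using L2.L.scal_eq_scal_iff[OF sh2[OF hkH y(1)] y(2)] by simp
  qed
  \<comment> \<open>By \<open>l_mult\<close> this quotient restricted to H is the coboundary of l,
    which is the input of \<open>cocycle_descent\<close>.\<close>
  define \<sigma> where "\<sigma> g h = \<tau>1 g h / \<tau>2 g h" for g h
  have \<sigma>: "Z2sym G \<sigma>"
    unfolding Z2sym_def \<sigma>_def
  proof (intro conjI ballI)
    fix a b assume ab: "a \<in> carrier G" "b \<in> carrier G"
    show "\<tau>1 a b / \<tau>2 a b \<noteq> 0" using L1.\<tau>_nz[OF ab] L2.\<tau>_nz[OF ab] by simp
    show "\<tau>1 a b / \<tau>2 a b = \<tau>1 b a / \<tau>2 b a" using Z2symD(2)[OF L1.\<tau> ab] Z2symD(2)[OF L2.\<tau> ab] by simp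
    fix c assume c: "c \<in> carrier G"
    show "\<tau>1 a b / \<tau>2 a b * (\<tau>1 (a \<otimes>\<^bsub>G\<^esub> b) c / \<tau>2 (a \<otimes>\<^bsub>G\<^esub> b) c) = \<tau>1 a (b \<otimes>\<^bsub>G\<^esub> c) / \<tau>2 a (b \<otimes>\<^bsub>G\<^esub> c) * (\<tau>1 b c / \<tau>2 b c)"
      unfolding times_divide_times_eq Z2symD(3)[OF L1.\<tau> ab c] Z2symD(3)[OF L2.\<tau> ab c] ..
  qed
  have ls: "\<sigma> h k * l (h \<otimes>\<^bsub>G\<^esub> k) = l h * l k" if "h \<in> H" "k \<in> H" for h k
    unfolding \<sigma>_def using l_mult[OF that] L2.\<tau>_nz[OF Hc[OF that(1)] Hc[OF that(2)]] by (simp add: field_simps)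
  obtain \<gamma> \<mu> where \<gamma>0: "\<And>g. g \<in> carrier G \<Longrightarrow> \<gamma> g \<noteq> 0" and \<mu>: "Z2sym ?Q \<mu>"
    and \<mu>\<sigma>: "\<And>g h. \<lbrakk>g \<in> carrier G; h \<in> carrier G\<rbrakk> \<Longrightarrow> \<sigma> g h * \<gamma> (g \<otimes>\<^bsub>G\<^esub> h) = \<mu> (?p g) (?p h) * (\<gamma> g * \<gamma> h)"
    and \<gamma>H: "\<And>h g. \<lbrakk>h \<in> H; g \<in> carrier G\<rbrakk> \<Longrightarrow> \<gamma> (h \<otimes>\<^bsub>G\<^esub> g) * \<sigma> h g = l h * \<gamma> g"
    by (rule cocycle_descent[OF G H \<sigma>, of l]) ((rule l0 ls; assumption) | (rule that; assumption))+
  have "cohom_eq_prod G \<tau>1 (\<lambda>a b. \<mu> (?p a) (?p b)) \<tau>2"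
    unfolding cohom_eq_prod_def
  proof (intro exI[of _ \<gamma>] conjI ballI \<gamma>0)
    fix a b assume ab: "a \<in> carrier G" "b \<in> carrier G"
    have "\<gamma> (a \<otimes>\<^bsub>G\<^esub> b) \<noteq> 0" "\<tau>2 a b \<noteq> 0" using \<gamma>0 ab L2.\<tau>_nz by auto
    then show "\<tau>1 a b = \<mu> (?p a) (?p b) * \<tau>2 a b * (\<gamma> a * \<gamma> b / \<gamma> (a \<otimes>\<^bsub>G\<^esub> b))"
      using \<mu>\<sigma>[OF ab] unfolding \<sigma>_def by (simp add: field_simps)
  qed
  moreover have "graded_iso ?Q (twist ?Q A1 \<mu>) A2"
  proof -
    define \<phi> where "\<phi> g u = L2.jinv g (p (\<iota>1 g u))" for g u
    have p\<iota>: "p (\<iota>1 g u) \<in> acomp L2 g" if "g \<in> carrier G" "u \<in> acomp A1 (?p g)" for g u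
      using p(5)[OF that(1)] L1.\<iota>_mem[OF that] by blast
    have \<phi>_eq: "\<iota>2 g (\<phi> g u) = p (\<iota>1 g u)" if "g \<in> carrier G" "u \<in> acomp A1 (?p g)" for g u
      unfolding \<phi>_def using L2.\<iota>_jinv[OF that(1) p\<iota>[OF that]] .
    have \<phi>m: "\<phi> g u \<in> acomp A2 (?p g)" if "g \<in> carrier G" "u \<in> acomp A1 (?p g)" for g u
      unfolding \<phi>_def using L2.jinv_mem[OF that(1) p\<iota>[OF that]] .
    have \<phi>_bij: "bij_betw (\<phi> g) (acomp A1 (?p g)) (acomp A2 (?p g))" if g: "g \<in> carrier G" for g
    proof -
      have "inj_on p (acomp L1 g)"
        using bij_betw_imp_inj_on[OF p(1)] by (rule inj_on_subset) (use L1.L.comp_mem[OF g] in auto)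
      then have "bij_betw p (acomp L1 g) (acomp L2 g)" using p(5)[OF g] by (simp add: bij_betw_def)
      from bij_betw_trans[OF bij_betw_trans[OF L1.\<iota>_bij[OF g] this] bij_betw_the_inv_into[OF L2.\<iota>_bij[OF g]]]
      show ?thesis unfolding \<phi>_def comp_def .
    qed
    have \<phi>_add: "\<phi> g (u + v) = \<phi> g u + \<phi> g v" if g: "g \<in> carrier G" and u: "u \<in> acomp A1 (?p g)" and v: "v \<in> acomp A1 (?p g)" for g u v
    proof -
      have pg: "?p g \<in> carrier ?Q" using g by simp
      have "\<iota>2 g (\<phi> g (u + v)) = \<iota>2 g (\<phi> g u + \<phi> g v)"
        using \<phi>_eq[OF g L1.A.comp_add[OF pg u v]] L1.\<iota>_add[OF g u v] p(2)[OF L1.\<iota>_mem_asp[OF g u] L1.\<iota>_mem_asp[OF g v]]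
          L2.\<iota>_add[OF g \<phi>m[OF g u] \<phi>m[OF g v]] \<phi>_eq[OF g u] \<phi>_eq[OF g v] by simp
      then show ?thesis
        using L2.\<iota>_inj[OF g \<phi>m[OF g L1.A.comp_add[OF pg u v]] L2.A.comp_add[OF pg \<phi>m[OF g u] \<phi>m[OF g v]]] by simp
    qed
    have \<phi>_scal: "\<phi> g (ascal A1 r u) = ascal A2 r (\<phi> g u)" if g: "g \<in> carrier G" and u: "u \<in> acomp A1 (?p g)" for g u r
    proof -
      have pg: "?p g \<in> carrier ?Q" using g by simp
      have "\<iota>2 g (\<phi> g (ascal A1 r u)) = \<iota>2 g (ascal A2 r (\<phi> g u))"
        using \<phi>_eq[OF g L1.A.comp_scal[OF pg u]] L1.\<iota>_scal[OF g u] p(3)[OF L1.\<iota>_mem_asp[OF g u]]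
          L2.\<iota>_scal[OF g \<phi>m[OF g u]] \<phi>_eq[OF g u] by simp
      then show ?thesis
        using L2.\<iota>_inj[OF g \<phi>m[OF g L1.A.comp_scal[OF pg u]] L2.A.comp_scal[OF pg \<phi>m[OF g u]]] by simp
    qed
    \<comment> \<open>The correspondence of the shifts, read on homogeneous elements: it ties the
      map in degree hg to the map in degree g.\<close>
    have \<phi>_H: "ascal A2 (\<tau>1 h g) (\<phi> (h \<otimes>\<^bsub>G\<^esub> g) u) = ascal A2 (l h * \<tau>2 h g) (\<phi> g u)"
      if h: "h \<in> H" and g: "g \<in> carrier G" and u: "u \<in> acomp A1 (?p g)" for h g u
    proof -
      have hk: "h \<in> L1.ker" using h unfolding ker .
      have hg: "h \<otimes>\<^bsub>G\<^esub> g \<in> carrier G" using Hc[OF h] g by simp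
      have ph: "?p (h \<otimes>\<^bsub>G\<^esub> g) = ?p g" using can_proj_eq_iff[OF G H hg g] h g Hc[OF h] by (simp add: L1.G.m_assoc)
      have u': "u \<in> acomp A1 (?p (h \<otimes>\<^bsub>G\<^esub> g))" and f': "\<phi> g u \<in> acomp A2 (?p (h \<otimes>\<^bsub>G\<^esub> g))" using ph u \<phi>m[OF g u] by auto
      have phg: "?p (h \<otimes>\<^bsub>G\<^esub> g) \<in> carrier ?Q" using hg by simp
      have "p (L1.shift h (\<iota>1 g u)) = ascal L2 (\<tau>1 h g) (\<iota>2 (h \<otimes>\<^bsub>G\<^esub> g) (\<phi> (h \<otimes>\<^bsub>G\<^esub> g) u))"
        using L1.shift_\<iota>[OF hk g u] p(3)[OF L1.\<iota>_mem_asp[OF hg u']] \<phi>_eq[OF hg u'] by simp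
      moreover have "p (L1.shift h (\<iota>1 g u)) = ascal L2 (l h * \<tau>2 h g) (\<iota>2 (h \<otimes>\<^bsub>G\<^esub> g) (\<phi> g u))"
        using l[OF h L1.\<iota>_mem_asp[OF g u]] \<phi>_eq[OF g u] L2.shift_\<iota>[OF hk g \<phi>m[OF g u]] L2.\<iota>_mem_asp[OF hg f']
        by (simp add: L2.L.scal_scal)
      ultimately have "\<iota>2 (h \<otimes>\<^bsub>G\<^esub> g) (ascal A2 (\<tau>1 h g) (\<phi> (h \<otimes>\<^bsub>G\<^esub> g) u)) = \<iota>2 (h \<otimes>\<^bsub>G\<^esub> g) (ascal A2 (l h * \<tau>2 h g) (\<phi> g u))"
        using L2.\<iota>_scal[OF hg \<phi>m[OF hg u']] L2.\<iota>_scal[OF hg f'] by simp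
      then show ?thesis
        using L2.\<iota>_inj[OF hg L2.A.comp_scal[OF phg \<phi>m[OF hg u']] L2.A.comp_scal[OF phg f']] by simp
    qed
    \<comment> \<open>With this factor, \<open>\<gamma>H\<close> cancels the scalars in
      \<open>\<phi>_H\<close>, so that the map depends on the coset of g alone.\<close>
    define \<psi> where "\<psi> g u = ascal A2 (inverse (\<gamma> g)) (\<phi> g u)" for g u
    have \<psi>_H: "\<psi> (h \<otimes>\<^bsub>G\<^esub> g) u = \<psi> g u" if h: "h \<in> H" and g: "g \<in> carrier G" and u: "u \<in> acomp A1 (?p g)" for h g u
    proof -
      have hk: "h \<in> L1.ker" using h unfolding ker .
      have hg: "h \<otimes>\<^bsub>G\<^esub> g \<in> carrier G" using Hc[OF h] g by simp
      have ph: "?p (h \<otimes>\<^bsub>G\<^esub> g) = ?p g" using can_proj_eq_iff[OF G H hg g] h g Hc[OF h] by (simp add: L1.G.m_assoc)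
      have fm: "\<phi> (h \<otimes>\<^bsub>G\<^esub> g) u \<in> asp A2" "\<phi> g u \<in> asp A2"
        using L2.A.comp_mem[OF L2.\<pi>_closed[OF hg] \<phi>m[OF hg]] L2.A.comp_mem[OF L2.\<pi>_closed[OF g] \<phi>m[OF g u]] ph u by auto
      have nz: "\<tau>1 h g \<noteq> 0" "\<tau>2 h g \<noteq> 0" "\<gamma> g \<noteq> 0" "\<gamma> (h \<otimes>\<^bsub>G\<^esub> g) \<noteq> 0"
        using L1.\<tau>_nz L2.\<tau>_nz \<gamma>0 Hc[OF h] g hg by auto
      have "\<phi> (h \<otimes>\<^bsub>G\<^esub> g) u = ascal A2 (inverse (\<tau>1 h g)) (ascal A2 (\<tau>1 h g) (\<phi> (h \<otimes>\<^bsub>G\<^esub> g) u))"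
        using fm nz by (simp add: L2.A.scal_scal L2.A.scal_one)
      also have "\<dots> = ascal A2 (inverse (\<tau>1 h g) * (l h * \<tau>2 h g)) (\<phi> g u)"
        unfolding \<phi>_H[OF h g u] using fm by (simp add: L2.A.scal_scal)
      finally have "\<psi> (h \<otimes>\<^bsub>G\<^esub> g) u = ascal A2 (inverse (\<gamma> (h \<otimes>\<^bsub>G\<^esub> g)) * (inverse (\<tau>1 h g) * (l h * \<tau>2 h g))) (\<phi> g u)"
        unfolding \<psi>_def using fm by (simp add: L2.A.scal_scal)
      moreover have "inverse (\<gamma> (h \<otimes>\<^bsub>G\<^esub> g)) * (inverse (\<tau>1 h g) * (l h * \<tau>2 h g)) = inverse (\<gamma> g)"
        using \<gamma>H[OF h g] nz l0[OF h] unfolding \<sigma>_def by (simp add: field_simps)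
      ultimately show ?thesis unfolding \<psi>_def by simp
    qed
    have \<psi>_eq: "\<psi> g u = \<psi> g' u" if g: "g \<in> carrier G" "g' \<in> carrier G" "?p g = ?p g'" and u: "u \<in> acomp A1 (?p g)" for g g' u
    proof -
      have "g \<otimes>\<^bsub>G\<^esub> inv\<^bsub>G\<^esub> g' \<in> H" using can_proj_eq_iff[OF G H g(1,2)] g(3) by simp
      then show ?thesis using \<psi>_H[of "g \<otimes>\<^bsub>G\<^esub> inv\<^bsub>G\<^esub> g'" g' u] g u by (simp add: L1.G.m_assoc)
    qed
    have \<psi>_mul: "ascal A2 (\<mu> (?p g) (?p h)) (\<psi> (g \<otimes>\<^bsub>G\<^esub> h) (amul A1 u v)) = amul A2 (\<psi> g u) (\<psi> h v)"
      if g: "g \<in> carrier G" and h: "h \<in> carrier G" and u: "u \<in> acomp A1 (?p g)" and v: "v \<in> acomp A1 (?p h)" for g h u v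
    proof -
      have gh: "g \<otimes>\<^bsub>G\<^esub> h \<in> carrier G" using g h by simp
      note uv = L1.A_mul_comp[OF g h u v]
      note fuv = \<phi>m[OF gh uv]
      note ff = L2.A_mul_comp[OF g h \<phi>m[OF g u] \<phi>m[OF h v]]
      note Q = L2.\<pi>_closed[OF gh]
      have m: "\<phi> g u \<in> asp A2" "\<phi> h v \<in> asp A2" "\<phi> (g \<otimes>\<^bsub>G\<^esub> h) (amul A1 u v) \<in> asp A2"
        using L2.A.comp_mem[OF L2.\<pi>_closed[OF g] \<phi>m[OF g u]] L2.A.comp_mem[OF L2.\<pi>_closed[OF h] \<phi>m[OF h v]]
          L2.A.comp_mem[OF Q fuv] by auto
      have nz: "\<tau>1 g h \<noteq> 0" "\<tau>2 g h \<noteq> 0" "\<gamma> g \<noteq> 0" "\<gamma> h \<noteq> 0" "\<gamma> (g \<otimes>\<^bsub>G\<^esub> h) \<noteq> 0"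
        using L1.\<tau>_nz L2.\<tau>_nz \<gamma>0 g h gh by auto
      have "p (amul L1 (\<iota>1 g u) (\<iota>1 h v)) = ascal L2 (\<tau>1 g h) (\<iota>2 (g \<otimes>\<^bsub>G\<^esub> h) (\<phi> (g \<otimes>\<^bsub>G\<^esub> h) (amul A1 u v)))"
        using L1.\<iota>_mul[OF g h u v] p(3)[OF L1.\<iota>_mem_asp[OF gh uv]] \<phi>_eq[OF gh uv] by simp
      moreover have "p (amul L1 (\<iota>1 g u) (\<iota>1 h v)) = ascal L2 (\<tau>2 g h) (\<iota>2 (g \<otimes>\<^bsub>G\<^esub> h) (amul A2 (\<phi> g u) (\<phi> h v)))"
        using p(4)[OF L1.\<iota>_mem_asp[OF g u] L1.\<iota>_mem_asp[OF h v]] \<phi>_eq[OF g u] \<phi>_eq[OF h v]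
          L2.\<iota>_mul[OF g h \<phi>m[OF g u] \<phi>m[OF h v]] by simp
      ultimately have "\<iota>2 (g \<otimes>\<^bsub>G\<^esub> h) (ascal A2 (\<tau>1 g h) (\<phi> (g \<otimes>\<^bsub>G\<^esub> h) (amul A1 u v)))
          = \<iota>2 (g \<otimes>\<^bsub>G\<^esub> h) (ascal A2 (\<tau>2 g h) (amul A2 (\<phi> g u) (\<phi> h v)))"
        using L2.\<iota>_scal[OF gh fuv] L2.\<iota>_scal[OF gh ff] by simp
      then have e: "ascal A2 (\<tau>1 g h) (\<phi> (g \<otimes>\<^bsub>G\<^esub> h) (amul A1 u v)) = ascal A2 (\<tau>2 g h) (amul A2 (\<phi> g u) (\<phi> h v))"
        using L2.\<iota>_inj[OF gh L2.A.comp_scal[OF Q fuv] L2.A.comp_scal[OF Q ff]] by simp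
      \<comment> \<open>The relation \<open>\<mu>\<sigma>\<close> solved for the scalar that the
        rescaling by \<gamma> leaves in front of the product.\<close>
      have c: "\<mu> (?p g) (?p h) * inverse (\<gamma> (g \<otimes>\<^bsub>G\<^esub> h)) = inverse (\<gamma> g) * inverse (\<gamma> h) * inverse (\<tau>2 g h) * \<tau>1 g h"
        using \<mu>\<sigma>[OF g h] nz unfolding \<sigma>_def by (simp add: field_simps)
      have "ascal A2 (\<mu> (?p g) (?p h)) (\<psi> (g \<otimes>\<^bsub>G\<^esub> h) (amul A1 u v))
          = ascal A2 (inverse (\<gamma> g) * inverse (\<gamma> h) * inverse (\<tau>2 g h)) (ascal A2 (\<tau>1 g h) (\<phi> (g \<otimes>\<^bsub>G\<^esub> h) (amul A1 u v)))"
        unfolding \<psi>_def using m by (simp only: L2.A.scal_scal c)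
      also have "\<dots> = ascal A2 (inverse (\<gamma> g) * inverse (\<gamma> h)) (amul A2 (\<phi> g u) (\<phi> h v))"
        unfolding e using m nz by (simp add: L2.A.scal_scal L2.A.mul_mem mult.assoc)
      also have "\<dots> = amul A2 (\<psi> g u) (\<psi> h v)"
        unfolding \<psi>_def using m by (simp add: L2.A.mul_scal_left L2.A.mul_scal_right L2.A.scal_mem L2.A.scal_scal L2.A.mul_mem mult.commute)
      finally show ?thesis .
    qed
    define s where "s a = (SOME g. g \<in> carrier G \<and> ?p g = a)" for a
    have s: "s a \<in> carrier G" "?p (s a) = a" if "a \<in> carrier ?Q" for a
      using someI_ex[of "\<lambda>g. g \<in> carrier G \<and> ?p g = a"] L1.\<pi>_lift[OF that] unfolding s_def by blast+
    interpret T: graded_algebra ?Q "twist ?Q A1 \<mu>" by (rule graded_algebra_twist[OF L1.A.graded_algebra_axioms])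
    show ?thesis
    proof (rule graded_iso_from_family[OF T.graded_algebra_axioms L2.A.graded_algebra_axioms, where f = "\<lambda>a. \<psi> (s a)"], unfold twist_simps)
      show "additive_family ?Q (twist ?Q A1 \<mu>) (\<lambda>a. \<psi> (s a))"
        unfolding additive_family_def twist_simps
      proof (intro ballI)
        fix a u v assume a: "a \<in> carrier ?Q" and u: "u \<in> acomp A1 a" and v: "v \<in> acomp A1 a"
        have u': "u \<in> acomp A1 (?p (s a))" "v \<in> acomp A1 (?p (s a))" using s[OF a] u v by auto
        show "\<psi> (s a) (u + v) = \<psi> (s a) u + \<psi> (s a) v"
          unfolding \<psi>_def \<phi>_add[OF s(1)[OF a] u']
          by (rule L2.A.scal_add_right) (use L2.A.comp_mem[OF L2.\<pi>_closed[OF s(1)[OF a]] \<phi>m[OF s(1)[OF a]]] u' in auto)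
      qed
      fix a assume a: "a \<in> carrier ?Q"
      note sa = s[OF a]
      show "\<psi> (s a) (ascal A1 r u) = ascal A2 r (\<psi> (s a) u)" if "u \<in> acomp A1 a" for u r
      proof -
        have u': "u \<in> acomp A1 (?p (s a))" using sa that by simp
        show ?thesis unfolding \<psi>_def \<phi>_scal[OF sa(1) u']
          using L2.A.comp_mem[OF L2.\<pi>_closed[OF sa(1)] \<phi>m[OF sa(1) u']] by (simp add: L2.A.scal_scal mult.commute)
      qed
      show "bij_betw (\<psi> (s a)) (acomp A1 a) (acomp A2 a)"
      proof -
        have "bij_betw (ascal A2 (inverse (\<gamma> (s a)))) (acomp A2 a) (acomp A2 a)"
          by (rule bij_betw_byWitness[where f' = "ascal A2 (\<gamma> (s a))"])
             (use \<gamma>0[OF sa(1)] L2.A.comp_mem[OF a] L2.A.comp_scal[OF a] in \<open>auto simp: L2.A.scal_scal L2.A.scal_one\<close>)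
        moreover have "bij_betw (\<phi> (s a)) (acomp A1 a) (acomp A2 a)" using \<phi>_bij[OF sa(1)] sa(2) by simp
        ultimately have "bij_betw (ascal A2 (inverse (\<gamma> (s a))) \<circ> \<phi> (s a)) (acomp A1 a) (acomp A2 a)"
          by (rule bij_betw_trans[rotated])
        then show ?thesis unfolding \<psi>_def comp_def .
      qed
      fix b u v assume b: "b \<in> carrier ?Q" and u: "u \<in> acomp A1 a" and v: "v \<in> acomp A1 b"
      note sb = s[OF b]
      have u': "u \<in> acomp A1 (?p (s a))" and v': "v \<in> acomp A1 (?p (s b))" using sa sb u v by auto
      have ab: "a \<otimes>\<^bsub>?Q\<^esub> b \<in> carrier ?Q" using a b by (rule L1.\<Gamma>.m_closed)
      have pe: "?p (s (a \<otimes>\<^bsub>?Q\<^esub> b)) = ?p (s a \<otimes>\<^bsub>G\<^esub> s b)"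
        using s(2)[OF ab] L1.\<pi>_mult[OF sa(1) sb(1)] sa(2) sb(2) by simp
      have uv: "amul A1 u v \<in> acomp A1 (a \<otimes>\<^bsub>?Q\<^esub> b)" by (rule L1.A.mul_comp[OF a b u v])
      have uv': "amul A1 u v \<in> acomp A1 (?p (s (a \<otimes>\<^bsub>?Q\<^esub> b)))" using uv s(2)[OF ab] by simp
      have sab: "s a \<otimes>\<^bsub>G\<^esub> s b \<in> carrier G" using sa sb by simp
      have "\<psi> (s (a \<otimes>\<^bsub>?Q\<^esub> b)) (amul (twist ?Q A1 \<mu>) u v) = \<psi> (s (a \<otimes>\<^bsub>?Q\<^esub> b)) (ascal A1 (\<mu> a b) (amul A1 u v))"
        using twist_mul[OF L1.A.graded_algebra_axioms a b u v] by simp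
      also have "\<dots> = ascal A2 (\<mu> a b) (\<psi> (s (a \<otimes>\<^bsub>?Q\<^esub> b)) (amul A1 u v))"
        unfolding \<psi>_def \<phi>_scal[OF s(1)[OF ab] uv']
        using L2.A.comp_mem[OF L2.\<pi>_closed[OF s(1)[OF ab]] \<phi>m[OF s(1)[OF ab] uv']] by (simp add: L2.A.scal_scal mult.commute)
      also have "\<psi> (s (a \<otimes>\<^bsub>?Q\<^esub> b)) (amul A1 u v) = \<psi> (s a \<otimes>\<^bsub>G\<^esub> s b) (amul A1 u v)"
        by (rule \<psi>_eq[OF s(1)[OF ab] sab pe uv'])
      also have "ascal A2 (\<mu> a b) (\<psi> (s a \<otimes>\<^bsub>G\<^esub> s b) (amul A1 u v)) = amul A2 (\<psi> (s a) u) (\<psi> (s b) v)"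
        using \<psi>_mul[OF sa(1) sb(1) u' v'] unfolding sa(2) sb(2) .
      finally show "\<psi> (s (a \<otimes>\<^bsub>?Q\<^esub> b)) (amul (twist ?Q A1 \<mu>) u v) = amul A2 (\<psi> (s a) u) (\<psi> (s b) v)" .
    qed
  qed
  ultimately show ?thesis using \<mu> by blast
qed

text \<open>The same p serves in every degree, rescaled by the \<gamma> of the coboundary. The
  factor \<mu> in the cohomology relation matches the one that p picks up from the twisted product
  of A1.\<close>

lemma base_iso_imp_loop_iso:
  assumes "loop_like G \<Gamma> A1 L1 \<pi> \<tau>1 \<iota>1" "loop_like G \<Gamma> A2 L2 \<pi> \<tau>2 \<iota>2"
    and co: "cohom_eq_prod G \<tau>1 (\<lambda>a b. \<mu> (\<pi> a) (\<pi> b)) \<tau>2"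
    and iso: "graded_iso \<Gamma> (twist \<Gamma> A1 \<mu>) A2"
  shows "graded_iso G L1 L2"
proof -
  interpret L1: loop_like G \<Gamma> A1 L1 \<pi> \<tau>1 \<iota>1 by fact
  interpret L2: loop_like G \<Gamma> A2 L2 \<pi> \<tau>2 \<iota>2 by fact
  obtain \<gamma> where \<gamma>0: "\<forall>a\<in>carrier G. \<gamma> a \<noteq> 0"
    and \<gamma>: "\<forall>a\<in>carrier G. \<forall>b\<in>carrier G. \<tau>1 a b = \<mu> (\<pi> a) (\<pi> b) * \<tau>2 a b * (\<gamma> a * \<gamma> b / \<gamma> (a \<otimes>\<^bsub>G\<^esub> b))"
    using co unfolding cohom_eq_prod_def by (elim exE conjE)
  obtain p where p: "bij_betw p (asp (twist \<Gamma> A1 \<mu>)) (asp A2)"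
      "\<And>x y. \<lbrakk>x \<in> asp (twist \<Gamma> A1 \<mu>); y \<in> asp (twist \<Gamma> A1 \<mu>)\<rbrakk> \<Longrightarrow> p (x + y) = p x + p y"
      "\<And>a x. x \<in> asp (twist \<Gamma> A1 \<mu>) \<Longrightarrow> p (ascal (twist \<Gamma> A1 \<mu>) a x) = ascal A2 a (p x)"
      "\<And>x y. \<lbrakk>x \<in> asp (twist \<Gamma> A1 \<mu>); y \<in> asp (twist \<Gamma> A1 \<mu>)\<rbrakk> \<Longrightarrow> p (amul (twist \<Gamma> A1 \<mu>) x y) = amul A2 (p x) (p y)"
      "\<And>g. g \<in> carrier \<Gamma> \<Longrightarrow> p ` acomp (twist \<Gamma> A1 \<mu>) g = acomp A2 g"
    using iso by (rule graded_isoE) (rule that; assumption)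
  note p = p[unfolded twist_simps]
  show ?thesis
  proof (rule loop_iso_from_base[OF assms(1,2), where \<psi> = "\<lambda>a. p" and \<gamma> = \<gamma>])
    fix a assume a: "a \<in> carrier \<Gamma>"
    note mem = L1.A.comp_mem[OF a]
    have "inj_on p (acomp A1 a)" using bij_betw_imp_inj_on[OF p(1)] by (rule inj_on_subset) (use mem in auto)
    then show "bij_betw p (acomp A1 a) (acomp A2 a)" using p(5)[OF a] by (simp add: bij_betw_def)
    show "p (u + v) = p u + p v" if "u \<in> acomp A1 a" "v \<in> acomp A1 a" for u v
      using p(2) mem that by simp
    show "p (ascal A1 r u) = ascal A2 r (p u)" if "u \<in> acomp A1 a" for u r
      using p(3) mem that by simp
  next
    show "\<gamma> g \<noteq> 0" if "g \<in> carrier G" for g using \<gamma>0 that by simp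
  next
    fix g h u v assume g: "g \<in> carrier G" and h: "h \<in> carrier G" and u: "u \<in> acomp A1 (\<pi> g)" and v: "v \<in> acomp A1 (\<pi> h)"
    note pg = L1.\<pi>_closed[OF g] note ph = L1.\<pi>_closed[OF h]
    have m: "u \<in> asp A1" "v \<in> asp A1" "amul A1 u v \<in> asp A1"
      using L1.A.comp_mem[OF pg u] L1.A.comp_mem[OF ph v] L1.A.mul_mem by auto
    have pm: "p (amul A1 u v) \<in> asp A2" using bij_betwE[OF p(1)] m by simp
    have "amul A2 (p u) (p v) = p (ascal A1 (\<mu> (\<pi> g) (\<pi> h)) (amul A1 u v))"
      using p(4)[OF m(1,2)] twist_mul[OF L1.A.graded_algebra_axioms pg ph u v] by simp
    also have "\<dots> = ascal A2 (\<mu> (\<pi> g) (\<pi> h)) (p (amul A1 u v))" using p(3)[OF m(3)] .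
    finally have e: "amul A2 (p u) (p v) = ascal A2 (\<mu> (\<pi> g) (\<pi> h)) (p (amul A1 u v))" .
    have "\<tau>1 g h * \<gamma> (g \<otimes>\<^bsub>G\<^esub> h) = \<gamma> g * \<gamma> h * \<tau>2 g h * \<mu> (\<pi> g) (\<pi> h)"
      using \<gamma>[rule_format, OF g h] \<gamma>0 g h by simp
    then show "ascal A2 (\<tau>1 g h * \<gamma> (g \<otimes>\<^bsub>G\<^esub> h)) (p (amul A1 u v)) = ascal A2 (\<gamma> g * \<gamma> h * \<tau>2 g h) (amul A2 (p u) (p v))"
      unfolding e using pm by (simp add: L2.A.scal_scal)
  qed
qed

subsection \<open>Extending symmetric cocycles\<close>

text \<open>Restricting the carrier leaves the values outside K x K free, so different functions can
  represent the same cocycle on K.\<close>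

abbreviation Z2sym_on :: "('g, 'm) monoid_scheme \<Rightarrow> 'g set \<Rightarrow> ('g \<Rightarrow> 'g \<Rightarrow> 'f::field) \<Rightarrow> bool" where
  "Z2sym_on G K \<tau> \<equiv> Z2sym (G\<lparr>carrier := K\<rparr>) \<tau>"

text \<open>The exponents i with g^i in K form a subgroup of the integers, hence the multiples of
  some n; n = 0 covers the case in which only the zeroth power lies in K.\<close>

lemma int_pow_mem_iff_dvd:
  assumes "group G" "subgroup K G" "g \<in> carrier G"
  obtains n :: nat where "\<And>i :: int. g [^]\<^bsub>G\<^esub> i \<in> K \<longleftrightarrow> int n dvd i"
proof -
  interpret group G by fact
  interpret K: subgroup K G by fact
  have neg: "g [^]\<^bsub>G\<^esub> (- i) \<in> K" if "g [^]\<^bsub>G\<^esub> i \<in> K" for i :: int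
    using that assms(3) by (simp add: int_pow_neg)
  show thesis
  proof (cases "\<exists>i::nat. i > 0 \<and> g [^]\<^bsub>G\<^esub> int i \<in> K")
    case False
    have "g [^]\<^bsub>G\<^esub> i \<in> K \<longleftrightarrow> int 0 dvd i" for i :: int
    proof
      assume i: "g [^]\<^bsub>G\<^esub> i \<in> K"
      have "g [^]\<^bsub>G\<^esub> int (nat \<bar>i\<bar>) \<in> K" using i neg[OF i] by (cases "i \<ge> 0") auto
      moreover have "\<not> (nat \<bar>i\<bar> > 0 \<and> g [^]\<^bsub>G\<^esub> int (nat \<bar>i\<bar>) \<in> K)"
        using False unfolding not_ex by (rule spec)
      ultimately have "nat \<bar>i\<bar> = 0" by linarith
      then show "int 0 dvd i" by simp
    qed simp
    then show thesis using that by blast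
  next
    case True
    define n where "n = (LEAST i::nat. i > 0 \<and> g [^]\<^bsub>G\<^esub> int i \<in> K)"
    have n: "n > 0" "g [^]\<^bsub>G\<^esub> int n \<in> K" using LeastI_ex[OF True] unfolding n_def by auto
    have min: "n \<le> i" if "i > 0" "g [^]\<^bsub>G\<^esub> int i \<in> K" for i
      unfolding n_def by (rule Least_le) (use that in simp)
    have mult: "g [^]\<^bsub>G\<^esub> (int n * q) \<in> K" for q
    proof -
      have "(g [^]\<^bsub>G\<^esub> int n) [^]\<^bsub>G\<^esub> q \<in> K" 
        using group.int_pow_closed[OF K.subgroup_is_group[OF is_group], of "g [^]\<^bsub>G\<^esub> int n" q] n(2)
          int_pow_consistent[OF assms(2) n(2)] by simp
      then show ?thesis using assms(3) by (simp add: int_pow_pow)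
    qed
    have "g [^]\<^bsub>G\<^esub> i \<in> K \<longleftrightarrow> int n dvd i" for i :: int
    proof
      assume i: "g [^]\<^bsub>G\<^esub> i \<in> K"
      have "i mod int n = i + int n * (- (i div int n))" by (simp add: minus_div_mult_eq_mod[symmetric])
      then have "g [^]\<^bsub>G\<^esub> (i mod int n) = g [^]\<^bsub>G\<^esub> i \<otimes>\<^bsub>G\<^esub> g [^]\<^bsub>G\<^esub> (int n * (- (i div int n)))"
        using assms(3) by (simp only: int_pow_mult)
      then have "g [^]\<^bsub>G\<^esub> (i mod int n) \<in> K" using K.m_closed[OF i mult[of "- (i div int n)"]] by simp
      then have "g [^]\<^bsub>G\<^esub> int (nat (i mod int n)) \<in> K" using n by simp
      moreover have "nat (i mod int n) < n" using n by (simp add: nat_less_iff)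
      ultimately have "nat (i mod int n) = 0" using min[of "nat (i mod int n)"] by linarith
      moreover have "i mod int n \<ge> 0" using n by simp
      ultimately show "int n dvd i" by (simp add: dvd_eq_mod_eq_0)
    next
      assume "int n dvd i"
      then show "g [^]\<^bsub>G\<^esub> i \<in> K" using mult by (auto elim: dvdE)
    qed
    then show thesis using that by blast
  qed
qed

text \<open>The extension to the subgroup generated by \<open>K\<close> and \<open>g\<close> comes from adjoining to the extension of \<open>K\<close>
defined by \<open>\<tau>\<close> an element \<open>v\<close> over \<open>g\<close>, with \<open>v\<^sup>n\<close> equal to the chosen lift of \<open>k0 = g\<^sup>n\<close> when \<open>n\<close> is the
least positive exponent with \<open>g\<^sup>n \<in> K\<close>. Here \<open>n = 0\<close> if there is no such exponent; then
\<open>j mod 0 = j\<close> and \<open>j div 0 = 0\<close> give the right formulas.\<close>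

lemma cocycle_extend_step:
  fixes \<tau> :: "'g \<Rightarrow> 'g \<Rightarrow> 'f::field"
  assumes G: "comm_group G" and K: "subgroup K G" and g: "g \<in> carrier G" and \<tau>: "Z2sym_on G K \<tau>"
  obtains K' \<tau>' where "subgroup K' G" "K \<subseteq> K'" "g \<in> K'" "Z2sym_on G K' \<tau>'"
    "\<And>a b. \<lbrakk>a \<in> K; b \<in> K\<rbrakk> \<Longrightarrow> \<tau>' a b = \<tau> a b"
proof -
  interpret comm_group G by fact
  interpret K: subgroup K G by fact
  obtain n :: nat where n: "\<And>i :: int. g [^]\<^bsub>G\<^esub> i \<in> K \<longleftrightarrow> int n dvd i"
    using int_pow_mem_iff_dvd[OF is_group K g] by metis
  have Kc: "k \<in> carrier G" if "k \<in> K" for k using that by (rule K.mem_carrier)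
  have pc: "g [^]\<^bsub>G\<^esub> (i::int) \<in> carrier G" for i using g by simp
  have pm: "g [^]\<^bsub>G\<^esub> (i + j) = g [^]\<^bsub>G\<^esub> i \<otimes>\<^bsub>G\<^esub> g [^]\<^bsub>G\<^esub> j" for i j :: int using g by (rule int_pow_mult)
  define K' where "K' = {k \<otimes>\<^bsub>G\<^esub> g [^]\<^bsub>G\<^esub> i | k (i::int). k \<in> K}"
  have K'c: "x \<in> carrier G" if "x \<in> K'" for x using that Kc pc unfolding K'_def by auto
  have K'_iff: "x \<in> K' \<longleftrightarrow> x \<in> carrier G \<and> (\<exists>j::int. x \<otimes>\<^bsub>G\<^esub> g [^]\<^bsub>G\<^esub> (- j) \<in> K)" for x
  proof
    assume x: "x \<in> K'"
    then obtain k i where k: "k \<in> K" "x = k \<otimes>\<^bsub>G\<^esub> g [^]\<^bsub>G\<^esub> (i::int)" unfolding K'_def by auto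
    have "x \<otimes>\<^bsub>G\<^esub> g [^]\<^bsub>G\<^esub> (- i) = k" using k Kc[OF k(1)] pc pm[of i "- i"] by (simp add: m_assoc)
    then show "x \<in> carrier G \<and> (\<exists>j::int. x \<otimes>\<^bsub>G\<^esub> g [^]\<^bsub>G\<^esub> (- j) \<in> K)"
      using k(1) K'c[OF x] by (intro conjI exI[of _ i]) simp_all
  next
    assume "x \<in> carrier G \<and> (\<exists>j::int. x \<otimes>\<^bsub>G\<^esub> g [^]\<^bsub>G\<^esub> (- j) \<in> K)"
    then obtain j :: int where j: "x \<in> carrier G" "x \<otimes>\<^bsub>G\<^esub> g [^]\<^bsub>G\<^esub> (- j) \<in> K" by auto
    have "x = (x \<otimes>\<^bsub>G\<^esub> g [^]\<^bsub>G\<^esub> (- j)) \<otimes>\<^bsub>G\<^esub> g [^]\<^bsub>G\<^esub> j" using j pc pm[of "- j" j] by (simp add: m_assoc)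
    then show "x \<in> K'" unfolding K'_def using j(2) by blast
  qed
  have sub: "subgroup K' G"
  proof (rule subgroupI)
    show "K' \<subseteq> carrier G" using K'c by auto
    have "\<one>\<^bsub>G\<^esub> \<otimes>\<^bsub>G\<^esub> g [^]\<^bsub>G\<^esub> (0::int) \<in> K'" unfolding K'_def using K.one_closed by blast
    then show "K' \<noteq> {}" by blast
    fix x assume "x \<in> K'"
    then obtain k i where k: "k \<in> K" "x = k \<otimes>\<^bsub>G\<^esub> g [^]\<^bsub>G\<^esub> (i::int)" unfolding K'_def by auto
    have "inv\<^bsub>G\<^esub> x = inv\<^bsub>G\<^esub> k \<otimes>\<^bsub>G\<^esub> g [^]\<^bsub>G\<^esub> (- i)" using k Kc[OF k(1)] pc g by (simp add: inv_mult int_pow_neg)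
    then show "inv\<^bsub>G\<^esub> x \<in> K'" unfolding K'_def using K.m_inv_closed[OF k(1)] by blast
    fix y assume "y \<in> K'"
    then obtain l j where l: "l \<in> K" "y = l \<otimes>\<^bsub>G\<^esub> g [^]\<^bsub>G\<^esub> (j::int)" unfolding K'_def by auto
    have "x \<otimes>\<^bsub>G\<^esub> y = (k \<otimes>\<^bsub>G\<^esub> l) \<otimes>\<^bsub>G\<^esub> g [^]\<^bsub>G\<^esub> (i + j)" unfolding pm k l using Kc k l pc by (simp add: m_ac)
    then show "x \<otimes>\<^bsub>G\<^esub> y \<in> K'" unfolding K'_def using K.m_closed[OF k(1) l(1)] by blast
  qed
  have KK': "K \<subseteq> K'"
  proof
    fix k assume k: "k \<in> K"
    then have "k \<otimes>\<^bsub>G\<^esub> g [^]\<^bsub>G\<^esub> (- (0::int)) \<in> K" using Kc by simp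
    then show "k \<in> K'" unfolding K'_iff using Kc[OF k] by blast
  qed
  have gK': "g \<in> K'" unfolding K'_iff using g pm[of 1 "-1"] K.one_closed by (intro conjI exI[of _ 1]) (simp_all add: int_pow_1)
  \<comment> \<open>The exponent of g in x, reduced to the canonical residue modulo n. For n = 0
    nothing is reduced, and the exponent is unique.\<close>
  define ix where "ix x = (SOME j::int. x \<otimes>\<^bsub>G\<^esub> g [^]\<^bsub>G\<^esub> (- j) \<in> K) mod int n" for x
  have ix_eq: "j mod int n = ix x" if x: "x \<in> K'" and j: "x \<otimes>\<^bsub>G\<^esub> g [^]\<^bsub>G\<^esub> (- j) \<in> K" for x and j :: int
  proof -
    define j' where "j' = (SOME j::int. x \<otimes>\<^bsub>G\<^esub> g [^]\<^bsub>G\<^esub> (- j) \<in> K)"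
    have xc: "x \<in> carrier G" using K'c[OF x] .
    have j': "x \<otimes>\<^bsub>G\<^esub> g [^]\<^bsub>G\<^esub> (- j') \<in> K" unfolding j'_def using j by (rule someI)
    have canc: "x \<otimes>\<^bsub>G\<^esub> (inv\<^bsub>G\<^esub> x \<otimes>\<^bsub>G\<^esub> z) = z" if "z \<in> carrier G" for z using xc that by (simp add: m_assoc[symmetric])
    have "(x \<otimes>\<^bsub>G\<^esub> g [^]\<^bsub>G\<^esub> (- j)) \<otimes>\<^bsub>G\<^esub> inv\<^bsub>G\<^esub> (x \<otimes>\<^bsub>G\<^esub> g [^]\<^bsub>G\<^esub> (- j')) = g [^]\<^bsub>G\<^esub> (- j) \<otimes>\<^bsub>G\<^esub> g [^]\<^bsub>G\<^esub> j'"
      using xc pc g by (simp add: inv_mult int_pow_neg m_ac canc)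
    also have "\<dots> = g [^]\<^bsub>G\<^esub> (j' - j)" using pm[of "- j" j'] by simp
    finally have "g [^]\<^bsub>G\<^esub> (j' - j) \<in> K" using K.m_closed[OF j K.m_inv_closed[OF j']] by simp
    then have "int n dvd j' - j" using n by simp
    then show ?thesis unfolding ix_def j'_def[symmetric] by (simp add: mod_eq_dvd_iff dvd_diff_commute)
  qed
  have ix_mem: "x \<otimes>\<^bsub>G\<^esub> g [^]\<^bsub>G\<^esub> (- ix x) \<in> K" if x: "x \<in> K'" for x
  proof -
    obtain j :: int where j: "x \<otimes>\<^bsub>G\<^esub> g [^]\<^bsub>G\<^esub> (- j) \<in> K" using x unfolding K'_iff by auto
    have "- ix x = - j + int n * (j div int n)" unfolding ix_eq[OF x j, symmetric] by (simp add: minus_mult_div_eq_mod[symmetric])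
    then have "x \<otimes>\<^bsub>G\<^esub> g [^]\<^bsub>G\<^esub> (- ix x) = (x \<otimes>\<^bsub>G\<^esub> g [^]\<^bsub>G\<^esub> (- j)) \<otimes>\<^bsub>G\<^esub> g [^]\<^bsub>G\<^esub> (int n * (j div int n))"
      using K'c[OF x] pc by (simp only: pm m_assoc)
    moreover have "g [^]\<^bsub>G\<^esub> (int n * (j div int n)) \<in> K" using n by simp
    ultimately show ?thesis using K.m_closed[OF j] by simp
  qed
  have ix_mod: "ix x mod int n = ix x" for x unfolding ix_def by simp
  have ix_range: "0 \<le> ix x \<and> ix x < int n" if "n > 0" for x using that ix_mod[of x] by (metis of_nat_0_less_iff pos_mod_bound pos_mod_sign)
  have ix_K: "ix x = 0" if "x \<in> K" for x
    using ix_eq[of x 0] that KK' Kc by auto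
  \<comment> \<open>The K-part of x: the product of \<open>kx x\<close> and g to the power
    \<open>ix x\<close> is x.\<close>
  define kx where "kx x = x \<otimes>\<^bsub>G\<^esub> g [^]\<^bsub>G\<^esub> (- ix x)" for x
  define k0 where "k0 = g [^]\<^bsub>G\<^esub> int n"
  have k0: "k0 \<in> K" unfolding k0_def using n by simp
  have kxm: "kx x \<in> K" if "x \<in> K'" for x unfolding kx_def using ix_mem[OF that] .
  have kx_K: "kx x = x" if "x \<in> K" for x unfolding kx_def ix_K[OF that] using Kc[OF that] by simp
  \<comment> \<open>The carry in adding two residues: 0 or 1, and always 0 for n = 0. A carry turns
    g^n into the element k0 of K.\<close>
  define q where "q x y = (ix x + ix y) div int n" for x y
  have ix_mult: "ix (x \<otimes>\<^bsub>G\<^esub> y) = (ix x + ix y) mod int n" if x: "x \<in> K'" and y: "y \<in> K'" for x y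
  proof -
    have "(x \<otimes>\<^bsub>G\<^esub> y) \<otimes>\<^bsub>G\<^esub> g [^]\<^bsub>G\<^esub> (- (ix x + ix y)) = kx x \<otimes>\<^bsub>G\<^esub> kx y"
      unfolding kx_def minus_add_distrib pm using K'c[OF x] K'c[OF y] pc by (simp add: m_ac)
    then show ?thesis using ix_eq[OF subgroup.m_closed[OF sub x y], of "ix x + ix y"] K.m_closed[OF kxm[OF x] kxm[OF y]] by simp
  qed
  have ixq: "ix x + ix y = int n * q x y + ix (x \<otimes>\<^bsub>G\<^esub> y)" if x: "x \<in> K'" and y: "y \<in> K'" for x y
    unfolding ix_mult[OF x y] q_def by simp
  have q01: "q x y = 0 \<or> q x y = 1 \<and> n > 0" for x y
  proof (cases "n > 0")
    case True
    have "0 \<le> ix x + ix y" "ix x + ix y < 2 * int n" using ix_range[OF True, of x] ix_range[OF True, of y] by auto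
    moreover have "int n * q x y + (ix x + ix y) mod int n = ix x + ix y" "0 \<le> (ix x + ix y) mod int n"
      unfolding q_def using True by simp_all
    ultimately have "int n * q x y < int n * 2" by linarith
    then have "q x y < 2" using True by simp
    moreover have "0 \<le> q x y" unfolding q_def
      using True \<open>0 \<le> ix x + ix y\<close> by (simp add: pos_imp_zdiv_nonneg_iff)
    ultimately show ?thesis using True by linarith
  qed (simp add: q_def)
  have kx_mult: "kx (x \<otimes>\<^bsub>G\<^esub> y) = (if q x y = 0 then kx x \<otimes>\<^bsub>G\<^esub> kx y else kx x \<otimes>\<^bsub>G\<^esub> kx y \<otimes>\<^bsub>G\<^esub> k0)" if x: "x \<in> K'" and y: "y \<in> K'" for x y
  proof -
    have "- ix (x \<otimes>\<^bsub>G\<^esub> y) = - ix x + - ix y + int n * q x y" using ixq[OF x y] by simp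
    then have "kx (x \<otimes>\<^bsub>G\<^esub> y) = kx x \<otimes>\<^bsub>G\<^esub> kx y \<otimes>\<^bsub>G\<^esub> g [^]\<^bsub>G\<^esub> (int n * q x y)"
      unfolding kx_def using K'c[OF x] K'c[OF y] pc by (simp only: pm) (simp add: m_ac)
    then show ?thesis using q01[of x y] Kc[OF kxm[OF x]] Kc[OF kxm[OF y]] unfolding k0_def by auto
  qed
  \<comment> \<open>The total carry in adding three residues does not depend on the bracketing,
    because the sum and the final residue do not.\<close>
  have q_sum: "q x y + q (x \<otimes>\<^bsub>G\<^esub> y) z = q x (y \<otimes>\<^bsub>G\<^esub> z) + q y z" if x: "x \<in> K'" and y: "y \<in> K'" and z: "z \<in> K'" for x y z
  proof (cases "n > 0")
    case True
    have xy: "x \<otimes>\<^bsub>G\<^esub> y \<in> K'" and yz: "y \<otimes>\<^bsub>G\<^esub> z \<in> K'" using subgroup.m_closed[OF sub] x y z by auto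
    have "int n * (q x y + q (x \<otimes>\<^bsub>G\<^esub> y) z) = int n * (q x (y \<otimes>\<^bsub>G\<^esub> z) + q y z)"
      using ixq[OF x y] ixq[OF xy z] ixq[OF x yz] ixq[OF y z] m_assoc[OF K'c[OF x] K'c[OF y] K'c[OF z]]
      by (simp add: distrib_left)
    then show ?thesis using True by simp
  next
    case False
    then show ?thesis using q01 by (metis add_0)
  qed
  have t0: "\<tau> a b \<noteq> 0" and ts: "\<tau> a b = \<tau> b a" if "a \<in> K" "b \<in> K" for a b
    using Z2symD(1,2)[OF \<tau>, of a b] that by simp_all
  have tc: "\<tau> a b * \<tau> (a \<otimes>\<^bsub>G\<^esub> b) c = \<tau> a (b \<otimes>\<^bsub>G\<^esub> c) * \<tau> b c" if "a \<in> K" "b \<in> K" "c \<in> K" for a b c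
    using Z2symD(3)[OF \<tau>, of a b c] that by simp
  \<comment> \<open>The scalar produced by multiplying the lifts of x and y: \<tau> of the two
    K-parts, and after a carry one more value of \<tau> for absorbing k0.\<close>
  define \<tau>' where "\<tau>' x y = (if q x y = 0 then \<tau> (kx x) (kx y) else \<tau> (kx x) (kx y) * \<tau> (kx x \<otimes>\<^bsub>G\<^esub> kx y) k0)" for x y
  have "Z2sym_on G K' \<tau>'" unfolding Z2sym_def
  proof (intro conjI ballI)
    fix x y assume "x \<in> carrier (G\<lparr>carrier := K'\<rparr>)" "y \<in> carrier (G\<lparr>carrier := K'\<rparr>)"
    then have xy: "x \<in> K'" "y \<in> K'" by auto
    note k = kxm[OF xy(1)] kxm[OF xy(2)]
    show "\<tau>' x y \<noteq> 0" unfolding \<tau>'_def using t0 k k0 K.m_closed[OF k] by simp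
    have "q x y = q y x" unfolding q_def by (simp add: add.commute)
    then show "\<tau>' x y = \<tau>' y x" unfolding \<tau>'_def using ts[OF k] m_comm[OF Kc[OF k(1)] Kc[OF k(2)]] by simp
    fix z assume "z \<in> carrier (G\<lparr>carrier := K'\<rparr>)"
    then have z: "z \<in> K'" by simp
    let ?a = "kx x" and ?b = "kx y" and ?c = "kx z"
    have c: "?c \<in> K" using kxm[OF z] .
    note kc = Kc[OF k(1)] Kc[OF k(2)] Kc[OF c] Kc[OF k0]
    have m: "?a \<otimes>\<^bsub>G\<^esub> ?b \<in> K" "?b \<otimes>\<^bsub>G\<^esub> ?c \<in> K" "?a \<otimes>\<^bsub>G\<^esub> ?b \<otimes>\<^bsub>G\<^esub> ?c \<in> K" using k c by auto
    let ?w = "?a \<otimes>\<^bsub>G\<^esub> ?b \<otimes>\<^bsub>G\<^esub> ?c"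
    have w: "?a \<otimes>\<^bsub>G\<^esub> (?b \<otimes>\<^bsub>G\<^esub> ?c) = ?w" "?a \<otimes>\<^bsub>G\<^esub> ?b \<otimes>\<^bsub>G\<^esub> k0 \<otimes>\<^bsub>G\<^esub> ?c = ?w \<otimes>\<^bsub>G\<^esub> k0" "?a \<otimes>\<^bsub>G\<^esub> (?b \<otimes>\<^bsub>G\<^esub> ?c \<otimes>\<^bsub>G\<^esub> k0) = ?w \<otimes>\<^bsub>G\<^esub> k0"
      using kc by (simp_all add: m_ac)
    have abc: "\<tau> ?a ?b * \<tau> (?a \<otimes>\<^bsub>G\<^esub> ?b) ?c = \<tau> ?a (?b \<otimes>\<^bsub>G\<^esub> ?c) * \<tau> ?b ?c" using tc[OF k c] .
    \<comment> \<open>A carry made before ?c is multiplied in contributes the same factor,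
      \<open>\<tau> ?w k0\<close>, as one made afterwards.\<close>
    have L: "\<tau> (?a \<otimes>\<^bsub>G\<^esub> ?b) k0 * \<tau> (?a \<otimes>\<^bsub>G\<^esub> ?b \<otimes>\<^bsub>G\<^esub> k0) ?c = \<tau> (?a \<otimes>\<^bsub>G\<^esub> ?b) ?c * \<tau> ?w k0"
      using tc[OF m(1) k0 c] tc[OF m(1) c k0] m_comm[OF kc(3,4)] ts[OF k0 c] by simp
    have R: "\<tau> ?a (?b \<otimes>\<^bsub>G\<^esub> ?c \<otimes>\<^bsub>G\<^esub> k0) * \<tau> (?b \<otimes>\<^bsub>G\<^esub> ?c) k0 = \<tau> ?a (?b \<otimes>\<^bsub>G\<^esub> ?c) * \<tau> ?w k0"
      using tc[OF k(1) m(2) k0] w(1) by simp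
    \<comment> \<open>The contribution of the carries to either side of the cocycle identity. It
      depends only on their total number, which is at most two and by \<open>q_sum\<close> the same
      on both sides.\<close>
    define P where "P = (if q x y + q (x \<otimes>\<^bsub>G\<^esub> y) z = 0 then 1 else if q x y + q (x \<otimes>\<^bsub>G\<^esub> y) z = 1 then \<tau> ?w k0 else \<tau> ?w k0 * \<tau> (?w \<otimes>\<^bsub>G\<^esub> k0) k0)"
    have q1: "q x y = 0 \<or> q x y = 1" "q (x \<otimes>\<^bsub>G\<^esub> y) z = 0 \<or> q (x \<otimes>\<^bsub>G\<^esub> y) z = 1"
      "q x (y \<otimes>\<^bsub>G\<^esub> z) = 0 \<or> q x (y \<otimes>\<^bsub>G\<^esub> z) = 1" "q y z = 0 \<or> q y z = 1" using q01 by blast+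
    have "\<tau>' x y * \<tau>' (x \<otimes>\<^bsub>G\<^esub> y) z = \<tau> ?a ?b * \<tau> (?a \<otimes>\<^bsub>G\<^esub> ?b) ?c * P"
      using q1(1,2) L unfolding \<tau>'_def kx_mult[OF xy] P_def by (elim disjE) (simp_all add: w mult_ac)
    moreover have "\<tau>' x (y \<otimes>\<^bsub>G\<^esub> z) * \<tau>' y z = \<tau> ?a (?b \<otimes>\<^bsub>G\<^esub> ?c) * \<tau> ?b ?c * P"
      using q1(3,4) R unfolding \<tau>'_def kx_mult[OF xy(2) z] P_def q_sum[OF xy z] by (elim disjE) (simp_all add: w mult_ac)
    ultimately show "\<tau>' x y * \<tau>' (x \<otimes>\<^bsub>G\<lparr>carrier := K'\<rparr>\<^esub> y) z = \<tau>' x (y \<otimes>\<^bsub>G\<lparr>carrier := K'\<rparr>\<^esub> z) * \<tau>' y z"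
      using abc by simp
  qed
  moreover have "\<tau>' a b = \<tau> a b" if "a \<in> K" "b \<in> K" for a b
    unfolding \<tau>'_def kx_K[OF that(1)] kx_K[OF that(2)] q_def ix_K[OF that(1)] ix_K[OF that(2)] by simp
  ultimately show thesis using that[of K' \<tau>'] sub KK' gK' by blast
qed

text \<open>The surjectivity of restriction on symmetric cohomology, in the sharper form that the
  given values on H are kept and not just their class.\<close>

lemma cocycle_extend:
  fixes \<sigma> :: "'g \<Rightarrow> 'g \<Rightarrow> 'f::field"
  assumes G: "comm_group G" and H: "subgroup H G" and \<sigma>: "Z2sym_on G H \<sigma>"
  obtains \<tau> where "Z2sym G \<tau>" "\<And>a b. \<lbrakk>a \<in> H; b \<in> H\<rbrakk> \<Longrightarrow> \<tau> a b = \<sigma> a b"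
proof -
  interpret comm_group G by fact
  \<comment> \<open>Only the values on K x K are recorded. Inclusion of graphs then means extension
    of both the subgroup and the cocycle, and functions that differ outside K give the same element
    of the ordered set.\<close>
  define graph where "graph K \<tau> = {(a, b, \<tau> a b) | a b. a \<in> K \<and> b \<in> K}" for K :: "'g set" and \<tau> :: "'g \<Rightarrow> 'g \<Rightarrow> 'f"
  define ok where "ok K \<tau> \<longleftrightarrow> subgroup K G \<and> H \<subseteq> K \<and> Z2sym_on G K \<tau> \<and> (\<forall>a\<in>H. \<forall>b\<in>H. \<tau> a b = \<sigma> a b)"
    for K :: "'g set" and \<tau> :: "'g \<Rightarrow> 'g \<Rightarrow> 'f"
  define \<A> where "\<A> = {graph K \<tau> | K \<tau>. ok K \<tau>}"
  have sub_iff: "graph K \<tau> \<subseteq> graph K' \<tau>' \<longleftrightarrow> K \<subseteq> K' \<and> (\<forall>a\<in>K. \<forall>b\<in>K. \<tau>' a b = \<tau> a b)" for K \<tau> K' \<tau>'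
  proof
    assume s: "graph K \<tau> \<subseteq> graph K' \<tau>'"
    have "a \<in> K' \<and> \<tau>' a b = \<tau> a b" if "a \<in> K" "b \<in> K" for a b
    proof -
      have "(a, b, \<tau> a b) \<in> graph K \<tau>" unfolding graph_def using that by blast
      then have "(a, b, \<tau> a b) \<in> graph K' \<tau>'" using s by blast
      then show ?thesis unfolding graph_def by auto
    qed
    then show "K \<subseteq> K' \<and> (\<forall>a\<in>K. \<forall>b\<in>K. \<tau>' a b = \<tau> a b)" by blast
  next
    assume s: "K \<subseteq> K' \<and> (\<forall>a\<in>K. \<forall>b\<in>K. \<tau>' a b = \<tau> a b)"
    show "graph K \<tau> \<subseteq> graph K' \<tau>'"
    proof
      fix p assume "p \<in> graph K \<tau>"
      then obtain a b where p: "p = (a, b, \<tau> a b)" "a \<in> K" "b \<in> K" unfolding graph_def by blast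
      then have "p = (a, b, \<tau>' a b)" "a \<in> K'" "b \<in> K'" using s by auto
      then show "p \<in> graph K' \<tau>'" unfolding graph_def by blast
    qed
  qed
  have "\<exists>M\<in>\<A>. \<forall>X\<in>\<A>. M \<subseteq> X \<longrightarrow> X = M"
  proof (rule subset_Zorn)
    fix C assume C: "subset.chain \<A> C"
    show "\<exists>U\<in>\<A>. \<forall>X\<in>C. X \<subseteq> U"
    proof (cases "C = {}")
      case True
      have "ok H \<sigma>" unfolding ok_def using H \<sigma> by auto
      then show ?thesis using True unfolding \<A>_def by blast
    next
      case False
      define I where "I = {(K, \<tau>). ok K \<tau> \<and> graph K \<tau> \<in> C}"
      have CI: "\<exists>K \<tau>. X = graph K \<tau> \<and> (K, \<tau>) \<in> I" if "X \<in> C" for X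
        using that C unfolding I_def \<A>_def subset.chain_def by blast
      have lin: "graph K \<tau> \<subseteq> graph K' \<tau>' \<or> graph K' \<tau>' \<subseteq> graph K \<tau>" if "(K, \<tau>) \<in> I" "(K', \<tau>') \<in> I" for K \<tau> K' \<tau>'
        using that C unfolding I_def subset.chain_def by (auto simp: subset_chain_def)
      define U where "U = \<Union> (fst ` I)"
      \<comment> \<open>Members of the chain agree where both are defined, so any member whose
        subgroup contains a and b gives the same value.\<close>
      define t where "t a b = (SOME r. \<exists>K \<tau>. (K, \<tau>) \<in> I \<and> a \<in> K \<and> b \<in> K \<and> r = \<tau> a b)" for a b
      have t: "t a b = \<tau> a b" if i: "(K, \<tau>) \<in> I" and ab: "a \<in> K" "b \<in> K" for K \<tau> a b
      proof -
        have "\<exists>r. \<exists>K \<tau>. (K, \<tau>) \<in> I \<and> a \<in> K \<and> b \<in> K \<and> r = \<tau> a b" using i ab by blast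
        then have "\<exists>K \<tau>. (K, \<tau>) \<in> I \<and> a \<in> K \<and> b \<in> K \<and> t a b = \<tau> a b" unfolding t_def by (rule someI_ex)
        then obtain K' \<tau>' where i': "(K', \<tau>') \<in> I" and ab': "a \<in> K'" "b \<in> K'" "t a b = \<tau>' a b" by blast
        show ?thesis using lin[OF i i'] ab ab' unfolding sub_iff by auto
      qed
      have two: "\<exists>K \<tau>. (K, \<tau>) \<in> I \<and> a \<in> K \<and> b \<in> K" if a: "a \<in> U" and b: "b \<in> U" for a b
      proof -
        obtain K \<tau> where 1: "(K, \<tau>) \<in> I" "a \<in> K" using a unfolding U_def by force
        obtain K' \<tau>' where 2: "(K', \<tau>') \<in> I" "b \<in> K'" using b unfolding U_def by force
        show ?thesis using lin[OF 1(1) 2(1)] 1 2 unfolding sub_iff by blast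
      qed
      have IK: "subgroup K G" "H \<subseteq> K" "Z2sym_on G K \<tau>" "\<And>a b. a \<in> H \<Longrightarrow> b \<in> H \<Longrightarrow> \<tau> a b = \<sigma> a b" "K \<subseteq> U"
        if "(K, \<tau>) \<in> I" for K \<tau> using that unfolding I_def ok_def U_def by force+
      obtain K1 \<tau>1 where 1: "(K1, \<tau>1) \<in> I" using False CI by blast
      have U: "subgroup U G"
      proof (rule subgroupI)
        show "U \<subseteq> carrier G" using IK(1) subgroup.subset unfolding U_def by fastforce
        show "U \<noteq> {}" using subgroup.one_closed[OF IK(1)[OF 1]] IK(5)[OF 1] by blast
        fix a assume a: "a \<in> U"
        obtain K \<tau> where K: "(K, \<tau>) \<in> I" "a \<in> K" using two[OF a a] by blast
        show "inv\<^bsub>G\<^esub> a \<in> U" using subgroup.m_inv_closed[OF IK(1)[OF K(1)] K(2)] IK(5)[OF K(1)] by blast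
        fix b assume b: "b \<in> U"
        obtain K \<tau> where K: "(K, \<tau>) \<in> I" "a \<in> K" "b \<in> K" using two[OF a b] by blast
        show "a \<otimes>\<^bsub>G\<^esub> b \<in> U" using subgroup.m_closed[OF IK(1)[OF K(1)] K(2,3)] IK(5)[OF K(1)] by blast
      qed
      have "Z2sym_on G U t" unfolding Z2sym_def
      proof (intro conjI ballI)
        fix a b assume "a \<in> carrier (G\<lparr>carrier := U\<rparr>)" "b \<in> carrier (G\<lparr>carrier := U\<rparr>)"
        then have ab: "a \<in> U" "b \<in> U" by auto
        obtain K \<tau> where K: "(K, \<tau>) \<in> I" "a \<in> K" "b \<in> K" using two[OF ab] by blast
        show "t a b \<noteq> 0" "t a b = t b a" using t[OF K] t[OF K(1,3,2)] Z2symD(1,2)[OF IK(3)[OF K(1)], of a b] K by auto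
        fix c assume "c \<in> carrier (G\<lparr>carrier := U\<rparr>)"
        then have c: "c \<in> U" by simp
        obtain K' \<tau>' where K': "(K', \<tau>') \<in> I" "c \<in> K'" using two[OF c c] by blast
        have "\<exists>K \<tau>. (K, \<tau>) \<in> I \<and> a \<in> K \<and> b \<in> K \<and> c \<in> K"
          using lin[OF K(1) K'(1)] K K' unfolding sub_iff by blast
        then obtain K \<tau> where K: "(K, \<tau>) \<in> I" "a \<in> K" "b \<in> K" "c \<in> K" by blast
        note m = subgroup.m_closed[OF IK(1)[OF K(1)]]
        show "t a b * t (a \<otimes>\<^bsub>G\<lparr>carrier := U\<rparr>\<^esub> b) c = t a (b \<otimes>\<^bsub>G\<lparr>carrier := U\<rparr>\<^esub> c) * t b c"
          using Z2symD(3)[OF IK(3)[OF K(1)], of a b c] K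
          by (simp add: t[OF K(1)] m)
      qed
      then have "ok U t" unfolding ok_def using U IK(2,5)[OF 1] t[OF 1] IK(4)[OF 1] by (auto simp: subset_iff)
      moreover have "X \<subseteq> graph U t" if X: "X \<in> C" for X
      proof -
        obtain K \<tau> where K: "X = graph K \<tau>" "(K, \<tau>) \<in> I" using CI[OF X] by blast
        show ?thesis unfolding K(1) sub_iff using IK(5)[OF K(2)] t[OF K(2)] by blast
      qed
      ultimately show ?thesis unfolding \<A>_def by blast
    qed
  qed
  then obtain M where M: "M \<in> \<A>" "\<forall>X\<in>\<A>. M \<subseteq> X \<longrightarrow> X = M" ..
  obtain K \<tau> where ok: "ok K \<tau>" and MK: "M = graph K \<tau>" using M(1) unfolding \<A>_def by blast
  have max: "graph K' \<tau>' = graph K \<tau>" if "ok K' \<tau>'" "graph K \<tau> \<subseteq> graph K' \<tau>'" for K' \<tau>'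
  proof -
    have "graph K' \<tau>' \<in> \<A>" unfolding \<A>_def using that(1) by blast
    then show ?thesis using M(2) that(2) unfolding MK by simp
  qed
  have K: "subgroup K G" "H \<subseteq> K" "Z2sym_on G K \<tau>" "\<And>a b. \<lbrakk>a \<in> H; b \<in> H\<rbrakk> \<Longrightarrow> \<tau> a b = \<sigma> a b"
    using ok unfolding ok_def by auto
  have "g \<in> K" if g: "g \<in> carrier G" for g
  proof -
    obtain K' \<tau>' where K': "subgroup K' G" "K \<subseteq> K'" "g \<in> K'" "Z2sym_on G K' \<tau>'"
      "\<And>a b. \<lbrakk>a \<in> K; b \<in> K\<rbrakk> \<Longrightarrow> \<tau>' a b = \<tau> a b"
      by (rule cocycle_extend_step[OF G K(1) g K(3)]) (rule that; assumption)
    have "ok K' \<tau>'" unfolding ok_def using K' K(2,4) by (auto simp: subset_iff)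
    moreover have "graph K \<tau> \<subseteq> graph K' \<tau>'" unfolding sub_iff using K' by blast
    ultimately have "graph K' \<tau>' \<subseteq> graph K \<tau>" using max by blast
    then show ?thesis unfolding sub_iff using K'(3) by blast
  qed
  then have KG: "K = carrier G" using subgroup.subset[OF K(1)] by blast
  have "Z2sym G \<tau>" unfolding Z2sym_def
  proof (intro conjI ballI)
    fix a b assume ab: "a \<in> carrier G" "b \<in> carrier G"
    show "\<tau> a b \<noteq> 0" using Z2symD(1)[OF K(3), of a b] ab KG by simp
    show "\<tau> a b = \<tau> b a" using Z2symD(2)[OF K(3), of a b] ab KG by simp
    show "\<tau> a b * \<tau> (a \<otimes>\<^bsub>G\<^esub> b) c = \<tau> a (b \<otimes>\<^bsub>G\<^esub> c) * \<tau> b c" if "c \<in> carrier G" for c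
      using Z2symD(3)[OF K(3), of a b c] ab that KG by simp
  qed
  then show thesis using that K(4) by blast
qed

subsection \<open>Realizing graded-central-simple algebras as loop algebras\<close>

lemma fun_neq_zeroI: "f x \<noteq> 0 \<Longrightarrow> f \<noteq> 0"
  by auto

context graded_simple_algebra
begin

definition centroid_supp :: "'i set" where
  "centroid_supp = {h \<in> carrier \<Gamma>. \<exists>c\<in>centroid_comp \<Gamma> A h. c \<noteq> 0}"

lemma centroid_comp_nonzero_value:
  assumes "c \<in> centroid_comp \<Gamma> A k" "k \<in> carrier \<Gamma>" "c \<noteq> 0"
  obtains x where "x \<in> asp A" "c x \<noteq> 0"
proof -
  obtain x where x: "x \<in> asp A" "x \<noteq> 0" using nontrivial zero_mem by blast
  then have "c x \<noteq> 0" using centroid_comp_inj[OF assms] by auto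
  then show thesis using that x by blast
qed

lemma centroid_comp_compose_nonzero:
  assumes "c \<in> centroid_comp \<Gamma> A g" "d \<in> centroid_comp \<Gamma> A h" "g \<in> carrier \<Gamma>" "h \<in> carrier \<Gamma>" "c \<noteq> 0" "d \<noteq> 0"
  shows "c \<circ> d \<noteq> 0"
proof -
  obtain x where x: "x \<in> asp A" "d x \<noteq> 0" using centroid_comp_nonzero_value[OF assms(2,4,6)] .
  have "c (d x) \<noteq> 0" using centroid_comp_inj[OF assms(1,3,5) centroidD(1)[OF centroid_compD(1)[OF assms(2)] x(1)]] x by auto
  then show ?thesis using fun_neq_zeroI[of "c \<circ> d" x] by simp
qed

lemma subgroup_centroid_supp: "subgroup centroid_supp \<Gamma>"
proof (rule subgroupI)
  show "centroid_supp \<subseteq> carrier \<Gamma>" unfolding centroid_supp_def by auto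
  let ?c = "\<lambda>x. if x \<in> asp A then ascal A 1 x else 0"
  obtain x where x: "x \<in> asp A" "x \<noteq> 0" using nontrivial zero_mem by blast
  then have "?c x \<noteq> 0" by (simp add: scal_one)
  then have "?c \<noteq> 0" by (rule fun_neq_zeroI[of ?c x])
  then have "\<one> \<in> centroid_supp" unfolding centroid_supp_def using scalar_map_centroid_comp[of 1]
    by (intro CollectI conjI one_closed bexI)
  then show "centroid_supp \<noteq> {}" by blast
  fix g assume "g \<in> centroid_supp"
  then obtain c where g: "g \<in> carrier \<Gamma>" and c: "c \<in> centroid_comp \<Gamma> A g" "c \<noteq> 0" unfolding centroid_supp_def by blast
  obtain d where d: "d \<in> centroid_comp \<Gamma> A (inv g)" "\<And>x. x \<in> asp A \<Longrightarrow> d (c x) = x"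
    using centroid_comp_inverse[OF c(1) g c(2)] by blast
  have "d (c x) \<noteq> 0" using d(2)[OF x(1)] x(2) by simp
  then have "d \<noteq> 0" by (rule fun_neq_zeroI)
  then show "inv g \<in> centroid_supp" unfolding centroid_supp_def using d(1) g by blast
  fix h assume "h \<in> centroid_supp"
  then obtain e where h: "h \<in> carrier \<Gamma>" and e: "e \<in> centroid_comp \<Gamma> A h" "e \<noteq> 0" unfolding centroid_supp_def by blast
  show "g \<otimes> h \<in> centroid_supp" unfolding centroid_supp_def
    using centroid_comp_compose[OF g h c(1) e(1)] centroid_comp_compose_nonzero[OF c(1) e(1) g h c(2) e(2)] g h by blast
qed

text \<open>Composing c with the inverse of u gives an element of identity degree, which is a scalar
  by graded centrality.\<close>

lemma centroid_comp_one_dim: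
  assumes "graded_central \<Gamma> A" "h \<in> carrier \<Gamma>" "c \<in> centroid_comp \<Gamma> A h" "u \<in> centroid_comp \<Gamma> A h" "u \<noteq> 0"
  obtains r where "c = (\<lambda>x. ascal A r (u x))"
proof -
  note cc = centroid_compD(1)[OF assms(3)] and uc = centroid_compD(1)[OF assms(4)]
  obtain d where d: "d \<in> centroid_comp \<Gamma> A (inv h)" "\<And>x. x \<in> asp A \<Longrightarrow> d (u x) = x" "\<And>x. x \<in> asp A \<Longrightarrow> u (d x) = x"
    using centroid_comp_inverse[OF assms(4,2,5)] by blast
  have "d \<circ> c \<in> centroid_comp \<Gamma> A (inv h \<otimes> h)" by (rule centroid_comp_compose) (use d assms in auto)
  then have "d \<circ> c \<in> scalar_maps A" using assms(1,2) unfolding graded_central_def by simp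
  then obtain r where r: "d \<circ> c = (\<lambda>x. if x \<in> asp A then ascal A r x else 0)" unfolding scalar_maps_def by blast
  have "c x = ascal A r (u x)" for x
  proof (cases "x \<in> asp A")
    case True
    have "d (c x) = ascal A r x" using fun_cong[OF r, of x] True by simp
    then have "u (d (c x)) = ascal A r (u x)" using centroidD(4)[OF uc True] by simp
    then show ?thesis using d(3)[OF centroidD(1)[OF cc True]] by simp
  next
    case False
    then show ?thesis using centroidD(2)[OF cc] centroidD(2)[OF uc] by simp
  qed
  then show thesis using that by blast
qed

text \<open>One-dimensionality yields the structure constants \<sigma>. Their cocycle identity is
  the associativity of composing maps, and their symmetry is the commutativity of the centroid; both
  hold although A itself is nonassociative.\<close>

lemma centroid_basis:
  assumes "graded_central \<Gamma> A"
  obtains u \<sigma> where "\<And>h. h \<in> centroid_supp \<Longrightarrow> u h \<in> centroid_comp \<Gamma> A h \<and> u h \<noteq> 0"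
    and "Z2sym_on \<Gamma> centroid_supp \<sigma>"
    and "\<And>h k x. \<lbrakk>h \<in> centroid_supp; k \<in> centroid_supp; x \<in> asp A\<rbrakk>
      \<Longrightarrow> u h (u k x) = ascal A (\<sigma> h k) (u (h \<otimes> k) x)"
proof -
  let ?H = centroid_supp
  interpret H: subgroup ?H \<Gamma> by (rule subgroup_centroid_supp)
  define u where "u h = (SOME c. c \<in> centroid_comp \<Gamma> A h \<and> c \<noteq> 0)" for h
  have u: "u h \<in> centroid_comp \<Gamma> A h \<and> u h \<noteq> 0" if "h \<in> ?H" for h
  proof -
    have "\<exists>c. c \<in> centroid_comp \<Gamma> A h \<and> c \<noteq> 0" using that unfolding centroid_supp_def by blast
    then show ?thesis unfolding u_def by (rule someI_ex)
  qed
  have uc: "u h \<in> centroid A" if "h \<in> ?H" for h using centroid_compD(1)[of "u h" \<Gamma> A h] u[OF that] by simp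
  have um: "u h x \<in> asp A" if "h \<in> ?H" "x \<in> asp A" for h x using centroidD(1)[OF uc] that by blast
  have unz: "u h x \<noteq> 0" if "h \<in> ?H" "x \<in> asp A" "x \<noteq> 0" for h x
    using centroid_comp_inj[of "u h" h x] u[OF that(1)] that by auto
  have "\<exists>r. \<forall>x\<in>asp A. u h (u k x) = ascal A r (u (h \<otimes> k) x)" if "h \<in> ?H" "k \<in> ?H" for h k
  proof -
    have hk: "h \<in> carrier \<Gamma>" "k \<in> carrier \<Gamma>" "h \<otimes> k \<in> ?H" using that H.m_closed by auto
    have "u h \<circ> u k \<in> centroid_comp \<Gamma> A (h \<otimes> k)" by (rule centroid_comp_compose) (use u hk that in auto)
    then obtain r where "u h \<circ> u k = (\<lambda>x. ascal A r (u (h \<otimes> k) x))"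
      using centroid_comp_one_dim[OF assms, of "h \<otimes> k" "u h \<circ> u k" "u (h \<otimes> k)"] hk u[OF hk(3)] by auto
    then show ?thesis by (metis comp_apply)
  qed
  then obtain \<sigma> where \<sigma>: "\<And>h k x. \<lbrakk>h \<in> ?H; k \<in> ?H; x \<in> asp A\<rbrakk> \<Longrightarrow> u h (u k x) = ascal A (\<sigma> h k) (u (h \<otimes> k) x)"
    by metis
  obtain x where x: "x \<in> asp A" "x \<noteq> 0" using nontrivial zero_mem by blast
  have "Z2sym_on \<Gamma> ?H \<sigma>" unfolding Z2sym_def
  proof (intro conjI ballI)
    fix h k assume "h \<in> carrier (\<Gamma>\<lparr>carrier := ?H\<rparr>)" "k \<in> carrier (\<Gamma>\<lparr>carrier := ?H\<rparr>)"
    then have hk: "h \<in> ?H" "k \<in> ?H" by auto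
    have hkH: "h \<otimes> k \<in> ?H" using hk by simp
    show "\<sigma> h k \<noteq> 0"
    proof
      assume "\<sigma> h k = 0"
      then have "u h (u k x) = 0" using \<sigma>[OF hk x(1)] um[OF hkH x(1)] by simp
      then show False using unz[OF hk(1) um[OF hk(2) x(1)] unz[OF hk(2) x]] by simp
    qed
    have "ascal A (\<sigma> h k) (u (h \<otimes> k) x) = ascal A (\<sigma> k h) (u (h \<otimes> k) x)"
      using \<sigma>[OF hk x(1)] \<sigma>[OF hk(2,1) x(1)] centroid_commute[OF square_eq uc[OF hk(1)] uc[OF hk(2)] x(1)]
        m_comm[of h k] hk by simp
    then show "\<sigma> h k = \<sigma> k h" using scal_eq_scal_iff[OF um[OF hkH x(1)] unz[OF hkH x]] by simp
    fix l assume "l \<in> carrier (\<Gamma>\<lparr>carrier := ?H\<rparr>)"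
    then have l: "l \<in> ?H" by simp
    have klH: "k \<otimes> l \<in> ?H" and hklH: "h \<otimes> (k \<otimes> l) \<in> ?H" using hk l by auto
    have "u h (u k (u l x)) = ascal A (\<sigma> h k * \<sigma> (h \<otimes> k) l) (u (h \<otimes> (k \<otimes> l)) x)"
      using \<sigma>[OF hk um[OF l x(1)]] \<sigma>[OF hkH l x(1)] um[OF hklH x(1)] hk l by (simp add: scal_scal m_assoc)
    moreover have "u h (u k (u l x)) = ascal A (\<sigma> h (k \<otimes> l) * \<sigma> k l) (u (h \<otimes> (k \<otimes> l)) x)"
      using \<sigma>[OF hk(2) l x(1)] centroidD(4)[OF uc[OF hk(1)] um[OF klH x(1)]] \<sigma>[OF hk(1) klH x(1)] um[OF hklH x(1)]
      by (simp add: scal_scal mult.commute)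
    ultimately show "\<sigma> h k * \<sigma> (h \<otimes>\<^bsub>\<Gamma>\<lparr>carrier := ?H\<rparr>\<^esub> k) l = \<sigma> h (k \<otimes>\<^bsub>\<Gamma>\<lparr>carrier := ?H\<rparr>\<^esub> l) * \<sigma> k l"
      using scal_eq_scal_iff[OF um[OF hklH x(1)] unz[OF hklH x]] by simp
  qed
  then show thesis using that[of u \<sigma>] u \<sigma> by blast
qed

end

text \<open>The sum of the components of B in the degrees s a, regraded by Q. Only the space is
  treated: s is in general not multiplicative, so the sum need not be closed under the product of B
  and will receive another one.\<close>

lemma graded_space_section:
  fixes B :: "('b::ab_group_add, 'f::field, 'g) galg" and A :: "('b, 'f, 'i) galg"
  assumes "graded_space G B" and s: "\<And>a. a \<in> carrier Q \<Longrightarrow> s a \<in> carrier G" and inj: "inj_on s (carrier Q)"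
    and A: "asp A = {x \<in> asp B. \<forall>g\<in>carrier G. g \<notin> s ` carrier Q \<longrightarrow> hcomp G B x g = 0}"
      "ascal A = ascal B" "\<And>a. acomp A a = acomp B (s a)"
  shows "graded_space Q A"
proof -
  interpret B: graded_space G B by fact
  have As: "acomp B (s a) \<subseteq> asp A" if "a \<in> carrier Q" for a
  proof
    fix x assume x: "x \<in> acomp B (s a)"
    have "hcomp G B x g = 0" if "g \<in> carrier G" "g \<notin> s ` carrier Q" for g
      using B.hcomp_homogeneous[OF s[OF \<open>a \<in> carrier Q\<close>] x] that \<open>a \<in> carrier Q\<close> by auto
    then show "x \<in> asp A" unfolding A using B.comp_mem[OF s[OF that] x] by simp
  qed
  show ?thesis
  proof
    fix x assume xA: "x \<in> asp A"
    then have x: "x \<in> asp B" and x0: "\<And>g. \<lbrakk>g \<in> carrier G; g \<notin> s ` carrier Q\<rbrakk> \<Longrightarrow> hcomp G B x g = 0" unfolding A by auto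
    show "ascal A r x \<in> asp A" for r using x x0 unfolding A by (simp add: B.scal_mem B.hcomp_scal)
    show "ascal A (r + r') x = ascal A r x + ascal A r' x" "ascal A r (ascal A r' x) = ascal A (r * r') x" "ascal A 1 x = x" for r r'
      unfolding A using x by (simp_all add: B.scal_add_left B.scal_scal B.scal_one)
    show "\<exists>!c. is_decomp Q A x c"
    proof (rule ex1I)
      let ?c = "\<lambda>a. if a \<in> carrier Q then hcomp G B x (s a) else 0"
      let ?S = "{a \<in> carrier Q. hcomp G B x (s a) \<noteq> 0}"
      have S: "{a \<in> carrier Q. ?c a \<noteq> 0} = ?S" by auto
      have im: "s ` ?S = gsupp G B x" unfolding gsupp_def using x0 s by (auto simp: image_iff)
      have injS: "inj_on s ?S" by (rule inj_on_subset[OF inj]) auto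
      have fin: "finite ?S" using finite_imageD[of s ?S] injS im B.finite_gsupp[OF x] by simp
      have "(\<Sum>a\<in>?S. ?c a) = (\<Sum>a\<in>?S. hcomp G B x (s a))" by (rule sum.cong) auto
      also have "\<dots> = (\<Sum>g\<in>s ` ?S. hcomp G B x g)" using sum.reindex[OF injS, of "hcomp G B x"] by (simp add: comp_def)
      also have "\<dots> = x" unfolding im using B.sum_hcomp[OF x] .
      finally show "is_decomp Q A x ?c" unfolding is_decomp_def S
        using fin B.hcomp_comp[OF x] s by (simp add: A)
      fix c assume "is_decomp Q A x c"
      then have c: "finite {a \<in> carrier Q. c a \<noteq> 0}" "\<And>a. a \<notin> carrier Q \<Longrightarrow> c a = 0" "\<And>a. a \<in> carrier Q \<Longrightarrow> c a \<in> acomp B (s a)"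
        and xs: "x = (\<Sum>a\<in>{a \<in> carrier Q. c a \<noteq> 0}. c a)"
        unfolding is_decomp_def by (auto simp: A)
      let ?T = "{a \<in> carrier Q. c a \<noteq> 0}"
      have cm: "c a \<in> asp B" if "a \<in> ?T" for a using B.comp_mem[OF s c(3)] that by simp
      have "hcomp G B x (s b) = c b" if b: "b \<in> carrier Q" for b
      proof -
        have "hcomp G B x (s b) = (\<Sum>a\<in>?T. hcomp G B (c a) (s b))" by (subst xs) (rule B.hcomp_sum[OF cm])
        also have "\<dots> = (\<Sum>a\<in>?T. if a = b then c b else 0)"
        proof (rule sum.cong[OF refl])
          fix a assume "a \<in> ?T"
          then have a: "a \<in> carrier Q" by simp
          show "hcomp G B (c a) (s b) = (if a = b then c b else 0)"
            using B.hcomp_homogeneous[OF s[OF a] c(3)[OF a], of "s b"] inj_onD[OF inj _ b a] by auto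
        qed
        also have "\<dots> = c b" using c(1) b by (auto simp: sum.delta)
        finally show ?thesis .
      qed
      then show "c = ?c" using c(2) by auto
    qed
    fix y assume "y \<in> asp A"
    then have y: "y \<in> asp B" "\<And>g. \<lbrakk>g \<in> carrier G; g \<notin> s ` carrier Q\<rbrakk> \<Longrightarrow> hcomp G B y g = 0" unfolding A by auto
    show "x + y \<in> asp A" using x x0 y unfolding A by (simp add: B.add_mem B.hcomp_add)
    show "ascal A r (x + y) = ascal A r x + ascal A r y" for r unfolding A using x y by (simp add: B.scal_add_right)
  next
    show "0 \<in> asp A" unfolding A by simp
  next
    fix a assume a: "a \<in> carrier Q"
    show "alg_subspace A (acomp A a)"
      using B.comp_subspace[OF s[OF a]] As[OF a] unfolding alg_subspace_def A(2,3) by simp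
  qed
qed

text \<open>The base algebra is the sum of the components of \<open>B\<close> at coset representatives, the centroid
serving to identify the components within one coset.\<close>

lemma graded_central_simple_loop_like:
  fixes B :: "('b::ab_group_add, 'f::field, 'g) galg"
  assumes G: "comm_group G" and B: "graded_central_simple G B"
  obtains H and A :: "('b, 'f, 'g set) galg" and \<tau> \<theta> where "subgroup H G"
    and "loop_like G (G Mod H) A B (can_proj G H) \<tau> \<theta>"
    and "\<And>k. \<lbrakk>k \<in> carrier G; k \<notin> H\<rbrakk> \<Longrightarrow> centroid_comp G B k \<subseteq> {0}"
proof -
  have Bs: "graded_simple G B" and Bc: "graded_central G B" using B unfolding graded_central_simple_def by auto
  have Bg: "graded_algebra G B" using Bs unfolding graded_simple_def graded_iff_graded_algebra by simp
  interpret B: graded_simple_algebra G B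
    by (intro graded_simple_algebra.intro graded_simple_algebra_axioms.intro Bg G Bs)
  define H where "H = B.centroid_supp"
  have H: "subgroup H G" unfolding H_def by (rule B.subgroup_centroid_supp)
  interpret H: subgroup H G by fact
  let ?Q = "G Mod H" and ?p = "can_proj G H"
  interpret Q: comm_group ?Q by (rule comm_group_Mod[OF G H])
  have Hc: "h \<in> carrier G" if "h \<in> H" for h using that by (rule H.mem_carrier)
  obtain u \<sigma> where u: "\<And>h. h \<in> H \<Longrightarrow> u h \<in> centroid_comp G B h \<and> u h \<noteq> 0"
    and \<sigma>: "Z2sym_on G H \<sigma>"
    and u\<sigma>: "\<And>h k x. \<lbrakk>h \<in> H; k \<in> H; x \<in> asp B\<rbrakk> \<Longrightarrow> u h (u k x) = ascal B (\<sigma> h k) (u (h \<otimes>\<^bsub>G\<^esub> k) x)"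
    by (rule B.centroid_basis[OF Bc, folded H_def]) (rule that; assumption)
  \<comment> \<open>The identifications below evaluate the cocycle at an element of H and a
    representative that may lie outside H, where \<sigma> prescribes nothing.\<close>
  obtain \<tau> where \<tau>: "Z2sym G \<tau>" and \<tau>\<sigma>: "\<And>a b. \<lbrakk>a \<in> H; b \<in> H\<rbrakk> \<Longrightarrow> \<tau> a b = \<sigma> a b"
    by (rule cocycle_extend[OF G H \<sigma>]) (rule that; assumption)
  have uc: "u h \<in> centroid B" if "h \<in> H" for h using centroid_compD(1)[of "u h" G B h] u[OF that] by simp
  have \<tau>0: "\<tau> a b \<noteq> 0" if "a \<in> carrier G" "b \<in> carrier G" for a b using Z2symD(1)[OF \<tau> that] .
  define s where "s a = (SOME g. g \<in> carrier G \<and> ?p g = a)" for a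
  have s: "s a \<in> carrier G" "?p (s a) = a" if "a \<in> carrier ?Q" for a
  proof -
    have "\<exists>g. g \<in> carrier G \<and> ?p g = a" using that unfolding can_proj_surj[of G H, symmetric] by auto
    then have "s a \<in> carrier G \<and> ?p (s a) = a" unfolding s_def by (rule someI_ex)
    then show "s a \<in> carrier G" "?p (s a) = a" by auto
  qed
  have s_inj: "inj_on s (carrier ?Q)" by (rule inj_onI) (metis s(2))
  have pc: "?p g \<in> carrier ?Q" if "g \<in> carrier G" for g using that unfolding can_proj_surj[of G H, symmetric] by (rule imageI)
  have p_mult: "?p (g \<otimes>\<^bsub>G\<^esub> h) = ?p g \<otimes>\<^bsub>?Q\<^esub> ?p h" if "g \<in> carrier G" "h \<in> carrier G" for g h
    by (rule can_proj_mult[OF G H that])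
  have p_H: "?p (h \<otimes>\<^bsub>G\<^esub> g) = ?p g" if "h \<in> H" "g \<in> carrier G" for h g
    using can_proj_eq_iff[OF G H, of "h \<otimes>\<^bsub>G\<^esub> g" g] that Hc by (simp add: B.m_assoc)
  define r where "r g = s (?p g)" for g
  have rc: "r g \<in> carrier G" if "g \<in> carrier G" for g unfolding r_def using s(1)[OF pc[OF that]] .
  have r_H: "r (h \<otimes>\<^bsub>G\<^esub> g) = r g" if "h \<in> H" "g \<in> carrier G" for h g unfolding r_def p_H[OF that] ..
  have r_mult: "r (r g \<otimes>\<^bsub>G\<^esub> r h) = r (g \<otimes>\<^bsub>G\<^esub> h)" if "g \<in> carrier G" "h \<in> carrier G" for g h
  proof -
    have "?p (r g) = ?p g" "?p (r h) = ?p h" unfolding r_def using s(2) pc that by auto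
    then show ?thesis unfolding r_def[of "r g \<otimes>\<^bsub>G\<^esub> r h"] r_def[of "g \<otimes>\<^bsub>G\<^esub> h"] p_mult[OF that] p_mult[OF rc[OF that(1)] rc[OF that(2)]] by simp
  qed
  have rr: "r (r g) = r g" if "g \<in> carrier G" for g unfolding r_def using s(2)[OF pc[OF that]] by simp
  define t where "t g = g \<otimes>\<^bsub>G\<^esub> inv\<^bsub>G\<^esub> r g" for g
  have t: "t g \<in> H" "t g \<otimes>\<^bsub>G\<^esub> r g = g" if g: "g \<in> carrier G" for g
  proof -
    have "?p g = ?p (r g)" unfolding r_def using s(2)[OF pc[OF g]] by simp
    then show "t g \<in> H" unfolding t_def using can_proj_eq_iff[OF G H g rc[OF g]] by simp
    show "t g \<otimes>\<^bsub>G\<^esub> r g = g" unfolding t_def using g rc[OF g] by (simp add: B.m_assoc)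
  qed
  have t_H: "t (h \<otimes>\<^bsub>G\<^esub> g) = h \<otimes>\<^bsub>G\<^esub> t g" if "h \<in> H" "g \<in> carrier G" for h g
    unfolding t_def r_H[OF that] using that Hc rc by (simp add: B.m_assoc)
  \<comment> \<open>The copy of x in degree g is made by the centroid basis element of degree t g.
    The scalar is chosen so that the copies obey the rule of shifts in a twisted loop, which is
    \<open>u\<theta>\<close>.\<close>
  define \<theta> where "\<theta> g x = ascal B (inverse (\<tau> (t g) (r g))) (u (t g) x)" for g x
  have nz: "inverse (\<tau> (t g) (r g)) \<noteq> 0" if "g \<in> carrier G" for g using \<tau>0[OF Hc[OF t(1)[OF that]] rc[OF that]] by simp
  have \<theta>_bij: "bij_betw (\<theta> g) (acomp B (r g)) (acomp B g)" if g: "g \<in> carrier G" for g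
  proof -
    note ut = u[OF t(1)[OF g]]
    have "inj_on (u (t g)) (acomp B (r g))"
      by (rule inj_on_subset[OF bij_betw_imp_inj_on[OF B.centroid_comp_bij[OF conjunct1[OF ut] Hc[OF t(1)[OF g]] conjunct2[OF ut]]]])
         (use B.comp_mem[OF rc[OF g]] in auto)
    then have "bij_betw (u (t g)) (acomp B (r g)) (acomp B g)"
      using B.centroid_comp_surj_comp[OF conjunct1[OF ut] Hc[OF t(1)[OF g]] conjunct2[OF ut] rc[OF g]] t(2)[OF g]
      by (simp add: bij_betw_def)
    moreover have "bij_betw (ascal B (inverse (\<tau> (t g) (r g)))) (acomp B g) (acomp B g)"
      by (rule bij_betw_byWitness[where f' = "ascal B (\<tau> (t g) (r g))"])
         (use nz[OF g] B.comp_mem[OF g] B.comp_scal[OF g] in \<open>auto simp: B.scal_scal B.scal_one\<close>)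
    ultimately have "bij_betw (ascal B (inverse (\<tau> (t g) (r g))) \<circ> u (t g)) (acomp B (r g)) (acomp B g)"
      by (rule bij_betw_trans)
    then show ?thesis unfolding \<theta>_def comp_def .
  qed
  have \<theta>m: "\<theta> g x \<in> acomp B g" if "g \<in> carrier G" "x \<in> acomp B (r g)" for g x
    using bij_betwE[OF \<theta>_bij[OF that(1)]] that(2) by simp
  have \<theta>ms: "\<theta> g x \<in> asp B" if "g \<in> carrier G" "x \<in> acomp B (r g)" for g x
    using B.comp_mem[OF that(1) \<theta>m[OF that]] .
  have \<theta>_inj: "x = y" if "g \<in> carrier G" "x \<in> acomp B (r g)" "y \<in> acomp B (r g)" "\<theta> g x = \<theta> g y" for g x y
    using inj_onD[OF bij_betw_imp_inj_on[OF \<theta>_bij[OF that(1)]] that(4,2,3)] .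
  have \<theta>_add: "\<theta> g (x + y) = \<theta> g x + \<theta> g y" if "g \<in> carrier G" "x \<in> acomp B (r g)" "y \<in> acomp B (r g)" for g x y
    unfolding \<theta>_def using centroidD(1,3)[OF uc[OF t(1)[OF that(1)]]] B.comp_mem[OF rc[OF that(1)]] that by (simp add: B.scal_add_right)
  have \<theta>_scal: "\<theta> g (ascal B a x) = ascal B a (\<theta> g x)" if "g \<in> carrier G" "x \<in> acomp B (r g)" for g x a
    unfolding \<theta>_def using centroidD(1,4)[OF uc[OF t(1)[OF that(1)]]] B.comp_mem[OF rc[OF that(1)]] that by (simp add: B.scal_scal mult.commute)
  \<comment> \<open>The product rule of the basis combined with the cocycle identity for h, the
    H-part of g and its representative; this works because \<tau> agrees with \<sigma> on H.\<close>
  have u\<theta>: "u h (\<theta> g x) = ascal B (\<tau> h g) (\<theta> (h \<otimes>\<^bsub>G\<^esub> g) x)" if h: "h \<in> H" and g: "g \<in> carrier G" and x: "x \<in> acomp B (r g)" for h g x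
  proof -
    let ?k = "t g" and ?s = "r g"
    have k: "?k \<in> H" using t g by simp
    have hk: "h \<otimes>\<^bsub>G\<^esub> ?k \<in> H" using h k by simp
    have xm: "x \<in> asp B" using B.comp_mem[OF rc[OF g] x] .
    have c: "\<tau> h ?k * \<tau> (h \<otimes>\<^bsub>G\<^esub> ?k) ?s = \<tau> h g * \<tau> ?k ?s"
      using Z2symD(3)[OF \<tau> Hc[OF h] Hc[OF k] rc[OF g]] t(2)[OF g] by simp
    have n: "\<tau> ?k ?s \<noteq> 0" "\<tau> (h \<otimes>\<^bsub>G\<^esub> ?k) ?s \<noteq> 0" using \<tau>0 Hc[OF k] Hc[OF hk] rc[OF g] by auto
    have e: "inverse (\<tau> ?k ?s) * \<tau> h ?k = \<tau> h g * inverse (\<tau> (h \<otimes>\<^bsub>G\<^esub> ?k) ?s)"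
      using c n by (simp add: field_simps)
    have um: "u ?k x \<in> asp B" "u (h \<otimes>\<^bsub>G\<^esub> ?k) x \<in> asp B" using centroidD(1)[OF uc[OF k] xm] centroidD(1)[OF uc[OF hk] xm] .
    have "u h (\<theta> g x) = ascal B (inverse (\<tau> ?k ?s)) (ascal B (\<tau> h ?k) (u (h \<otimes>\<^bsub>G\<^esub> ?k) x))"
      unfolding \<theta>_def centroidD(4)[OF uc[OF h] um(1)] u\<sigma>[OF h k xm] \<tau>\<sigma>[OF h k] ..
    also have "\<dots> = ascal B (\<tau> h g * inverse (\<tau> (h \<otimes>\<^bsub>G\<^esub> ?k) ?s)) (u (h \<otimes>\<^bsub>G\<^esub> ?k) x)"
      unfolding B.scal_scal[OF um(2)] e ..
    also have "\<dots> = ascal B (\<tau> h g) (\<theta> (h \<otimes>\<^bsub>G\<^esub> g) x)"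
      unfolding \<theta>_def t_H[OF h g] r_H[OF h g] B.scal_scal[OF um(2)] ..
    finally show ?thesis .
  qed
  \<comment> \<open>The product on the base is dictated by the equation for products in
    \<open>loop_like\<close>, taken at the representatives: multiply the copies in B, go back by
    \<theta>, and divide by \<tau>.\<close>
  define m where "m a b x y = ascal B (inverse (\<tau> (s a) (s b)))
      (the_inv_into (acomp B (s (a \<otimes>\<^bsub>?Q\<^esub> b))) (\<theta> (s a \<otimes>\<^bsub>G\<^esub> s b)) (amul B (\<theta> (s a) x) (\<theta> (s b) y)))" for a b x y
  have rs: "r (s a) = s a" if "a \<in> carrier ?Q" for a unfolding r_def s(2)[OF that] ..
  have rss: "r (s a \<otimes>\<^bsub>G\<^esub> s b) = s (a \<otimes>\<^bsub>?Q\<^esub> b)" if "a \<in> carrier ?Q" "b \<in> carrier ?Q" for a b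
    unfolding r_def p_mult[OF s(1)[OF that(1)] s(1)[OF that(2)]] s(2)[OF that(1)] s(2)[OF that(2)] ..
  have m: "m a b x y \<in> acomp B (s (a \<otimes>\<^bsub>?Q\<^esub> b))"
      "amul B (\<theta> (s a) x) (\<theta> (s b) y) = ascal B (\<tau> (s a) (s b)) (\<theta> (s a \<otimes>\<^bsub>G\<^esub> s b) (m a b x y))"
    if a: "a \<in> carrier ?Q" and b: "b \<in> carrier ?Q" and x: "x \<in> acomp B (s a)" and y: "y \<in> acomp B (s b)" for a b x y
  proof -
    let ?g = "s a \<otimes>\<^bsub>G\<^esub> s b"
    let ?z = "amul B (\<theta> (s a) x) (\<theta> (s b) y)" and ?i = "the_inv_into (acomp B (s (a \<otimes>\<^bsub>?Q\<^esub> b))) (\<theta> ?g)"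
    have g: "?g \<in> carrier G" using s(1)[OF a] s(1)[OF b] by simp
    have z: "?z \<in> acomp B ?g" using B.mul_comp[OF s(1)[OF a] s(1)[OF b] \<theta>m \<theta>m] s(1)[OF a] s(1)[OF b] rs[OF a] rs[OF b] x y by simp
    note bj = \<theta>_bij[OF g, unfolded rss[OF a b]]
    have i: "?i ?z \<in> acomp B (s (a \<otimes>\<^bsub>?Q\<^esub> b))" using bij_betwE[OF bij_betw_the_inv_into[OF bj]] z by simp
    have \<theta>i: "\<theta> ?g (?i ?z) = ?z" using f_the_inv_into_f_bij_betw[OF bj] z by simp
    have sab: "s (a \<otimes>\<^bsub>?Q\<^esub> b) \<in> carrier G" by (rule s(1)[OF Q.m_closed[OF a b]])
    show "m a b x y \<in> acomp B (s (a \<otimes>\<^bsub>?Q\<^esub> b))" unfolding m_def by (rule B.comp_scal[OF sab i])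
    have i': "?i ?z \<in> acomp B (r ?g)" using i unfolding rss[OF a b] .
    show "?z = ascal B (\<tau> (s a) (s b)) (\<theta> ?g (m a b x y))"
      unfolding m_def \<theta>_scal[OF g i'] \<theta>i
      using B.comp_mem[OF g z] \<tau>0[OF s(1)[OF a] s(1)[OF b]] by (simp add: B.scal_scal B.scal_one)
  qed
  \<comment> \<open>With uniqueness, the bilinearity of m reduces to that of the product of
    B.\<close>
  have m_unique: "m a b x y = z"
    if a: "a \<in> carrier ?Q" and b: "b \<in> carrier ?Q" and x: "x \<in> acomp B (s a)" and y: "y \<in> acomp B (s b)"
      and z: "z \<in> acomp B (s (a \<otimes>\<^bsub>?Q\<^esub> b))"
      and e: "amul B (\<theta> (s a) x) (\<theta> (s b) y) = ascal B (\<tau> (s a) (s b)) (\<theta> (s a \<otimes>\<^bsub>G\<^esub> s b) z)" for a b x y z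
  proof -
    let ?g = "s a \<otimes>\<^bsub>G\<^esub> s b" and ?t = "\<tau> (s a) (s b)"
    have g: "?g \<in> carrier G" using s(1)[OF a] s(1)[OF b] by simp
    have t0: "?t \<noteq> 0" using \<tau>0[OF s(1)[OF a] s(1)[OF b]] .
    have z': "z \<in> acomp B (r ?g)" "m a b x y \<in> acomp B (r ?g)" unfolding rss[OF a b] using z m(1)[OF a b x y] by auto
    have "ascal B (inverse ?t) (ascal B ?t (\<theta> ?g (m a b x y))) = ascal B (inverse ?t) (ascal B ?t (\<theta> ?g z))"
      using e m(2)[OF a b x y] by simp
    then have "\<theta> ?g (m a b x y) = \<theta> ?g z" using t0 \<theta>ms[OF g z'(1)] \<theta>ms[OF g z'(2)] by (simp add: B.scal_scal B.scal_one)
    then show ?thesis by (rule \<theta>_inj[OF g z'(2,1)])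
  qed
  \<comment> \<open>The product given here is a placeholder. Decompositions do not depend on it, and
    it is replaced once \<open>hcomp\<close> and \<open>gsupp\<close> can be formed.\<close>
  define A0 :: "('b, 'f, 'g set) galg" where
    "A0 = \<lparr>asp = {x \<in> asp B. \<forall>g\<in>carrier G. g \<notin> s ` carrier ?Q \<longrightarrow> hcomp G B x g = 0}, ascal = ascal B,
      amul = amul B, acomp = (\<lambda>a. acomp B (s a))\<rparr>"
  define A where "A = A0\<lparr>amul := (\<lambda>x y. \<Sum>a\<in>gsupp ?Q A0 x. \<Sum>b\<in>gsupp ?Q A0 y. m a b (hcomp ?Q A0 x a) (hcomp ?Q A0 y b))\<rparr>"
  have A0: "graded_space ?Q A0"
    by (rule graded_space_section[OF B.graded_space_axioms s(1) s_inj]) (simp_all add: A0_def)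
  interpret A: graded_space ?Q A unfolding A_def by (rule graded_space_amul_update[OF A0])
  have Ac: "acomp A a = acomp B (s a)" and As: "ascal A = ascal B" for a by (simp_all add: A_def A0_def)
  have fam: "graded_algebra ?Q A \<and> (\<forall>a\<in>carrier ?Q. \<forall>b\<in>carrier ?Q. \<forall>x\<in>acomp A a. \<forall>y\<in>acomp A b. amul A x y = m a b x y)"
  proof -
    have 1: "m a b x y \<in> acomp A (a \<otimes>\<^bsub>?Q\<^esub> b)"
      if "a \<in> carrier ?Q" "b \<in> carrier ?Q" "x \<in> acomp A a" "y \<in> acomp A b" for a b x y
      using m(1) that unfolding Ac by simp
    have bil: "m a b (x + x') y = m a b x y + m a b x' y" "m a b x (y + y') = m a b x y + m a b x y'"
      "m a b (ascal A q x) y = ascal A q (m a b x y)" "m a b x (ascal A q y) = ascal A q (m a b x y)"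
      if a: "a \<in> carrier ?Q" and b: "b \<in> carrier ?Q" and "x \<in> acomp A a" "x' \<in> acomp A a" "y \<in> acomp A b" "y' \<in> acomp A b" for a b x x' y y' q
    proof -
      have X: "x \<in> acomp B (s a)" "x' \<in> acomp B (s a)" "y \<in> acomp B (s b)" "y' \<in> acomp B (s b)" using that unfolding Ac by auto
      have X': "x \<in> acomp B (r (s a))" "x' \<in> acomp B (r (s a))" "y \<in> acomp B (r (s b))" "y' \<in> acomp B (r (s b))" using X rs a b by auto
      note sa = s(1)[OF a] and sb = s(1)[OF b]
      have ab: "a \<otimes>\<^bsub>?Q\<^esub> b \<in> carrier ?Q" by (rule Q.m_closed[OF a b])
      note sab = s(1)[OF ab]
      have g: "s a \<otimes>\<^bsub>G\<^esub> s b \<in> carrier G" using sa sb by simp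
      note M1 = m(1)[OF a b] and M2 = m(2)[OF a b]
      have M1': "m a b x y \<in> acomp B (r (s a \<otimes>\<^bsub>G\<^esub> s b))" "m a b x' y \<in> acomp B (r (s a \<otimes>\<^bsub>G\<^esub> s b))" "m a b x y' \<in> acomp B (r (s a \<otimes>\<^bsub>G\<^esub> s b))"
        unfolding rss[OF a b] using M1 X by auto
      note T = \<theta>ms[OF sa X'(1)] \<theta>ms[OF sa X'(2)] \<theta>ms[OF sb X'(3)] \<theta>ms[OF sb X'(4)]
        \<theta>ms[OF g M1'(1)] \<theta>ms[OF g M1'(2)] \<theta>ms[OF g M1'(3)]
      show "m a b (x + x') y = m a b x y + m a b x' y"
        by (rule m_unique[OF a b B.comp_add[OF sa X(1,2)] X(3) B.comp_add[OF sab M1[OF X(1,3)] M1[OF X(2,3)]]])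
           (simp add: \<theta>_add[OF sa X'(1,2)] \<theta>_add[OF g M1'(1,2)] B.mul_add_left T B.scal_add_right M2[OF X(1,3)] M2[OF X(2,3)])
      show "m a b x (y + y') = m a b x y + m a b x y'"
        by (rule m_unique[OF a b X(1) B.comp_add[OF sb X(3,4)] B.comp_add[OF sab M1[OF X(1,3)] M1[OF X(1,4)]]])
           (simp add: \<theta>_add[OF sb X'(3,4)] \<theta>_add[OF g M1'(1,3)] B.mul_add_right T B.scal_add_right M2[OF X(1,3)] M2[OF X(1,4)])
      show "m a b (ascal A q x) y = ascal A q (m a b x y)" unfolding As
        by (rule m_unique[OF a b B.comp_scal[OF sa X(1)] X(3) B.comp_scal[OF sab M1[OF X(1,3)]]])
           (simp add: \<theta>_scal[OF sa X'(1)] \<theta>_scal[OF g M1'(1)] B.mul_scal_left T B.scal_scal mult.commute M2[OF X(1,3)])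
      show "m a b x (ascal A q y) = ascal A q (m a b x y)" unfolding As
        by (rule m_unique[OF a b X(1) B.comp_scal[OF sb X(3)] B.comp_scal[OF sab M1[OF X(1,3)]]])
           (simp add: \<theta>_scal[OF sb X'(3)] \<theta>_scal[OF g M1'(1)] B.mul_scal_right T B.scal_scal mult.commute M2[OF X(1,3)])
    qed
    have 2: "m a b (x + x') y = m a b x y + m a b x' y"
      if "a \<in> carrier ?Q" "b \<in> carrier ?Q" "x \<in> acomp A a" "x' \<in> acomp A a" "y \<in> acomp A b" for a b x x' y
      by (rule bil(1)[OF that that(5)])
    have 3: "m a b x (y + y') = m a b x y + m a b x y'"
      if "a \<in> carrier ?Q" "b \<in> carrier ?Q" "x \<in> acomp A a" "y \<in> acomp A b" "y' \<in> acomp A b" for a b x y y'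
      by (rule bil(2)[OF that(1-3,3-5)])
    have 4: "m a b (ascal A q x) y = ascal A q (m a b x y)" and 5: "m a b x (ascal A q y) = ascal A q (m a b x y)"
      if "a \<in> carrier ?Q" "b \<in> carrier ?Q" "x \<in> acomp A a" "y \<in> acomp A b" for a b x y q
      by (rule bil(3)[OF that(1-3,3,4,4)], rule bil(4)[OF that(1-3,3,4,4)])
    have 6: "amul A x y = (\<Sum>a\<in>gsupp ?Q A x. \<Sum>b\<in>gsupp ?Q A y. m a b (hcomp ?Q A x a) (hcomp ?Q A y b))" for x y
      by (simp add: A_def)
    show ?thesis
    proof (intro conjI ballI)
      show "graded_algebra ?Q A" by (rule A.graded_algebra_from_family(1)[where m = m, OF Q.is_group 1 2 3 4 5 6])
      fix a b x y assume "a \<in> carrier ?Q" "b \<in> carrier ?Q" "x \<in> acomp A a" "y \<in> acomp A b"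
      then show "amul A x y = m a b x y"
        by (intro A.graded_algebra_from_family(2)[where m = m, OF Q.is_group 1 2 3 4 5 6])
    qed
  qed
  interpret A: graded_algebra ?Q A using fam ..
  \<comment> \<open>The product equation holds at representatives by construction. In general
    degrees the H-parts are supplied by centroid elements, which can be pulled out of both factors
    of a product.\<close>
  have loop: "loop_like G ?Q A B ?p \<tau> \<theta>"
  proof
    fix g assume g: "g \<in> carrier G"
    have Acg: "acomp A (?p g) = acomp B (r g)" unfolding Ac r_def ..
    show "bij_betw (\<theta> g) (acomp A (?p g)) (acomp B g)" unfolding Acg by (rule \<theta>_bij[OF g])
    show "\<theta> g (x + y) = \<theta> g x + \<theta> g y" if "x \<in> acomp A (?p g)" "y \<in> acomp A (?p g)" for x y
      using \<theta>_add[OF g] that unfolding Acg by simp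
    show "\<theta> g (ascal A q x) = ascal B q (\<theta> g x)" if "x \<in> acomp A (?p g)" for x q
      using \<theta>_scal[OF g] that unfolding Acg As by simp
    fix h assume h: "h \<in> carrier G"
    show "?p (g \<otimes>\<^bsub>G\<^esub> h) = ?p g \<otimes>\<^bsub>?Q\<^esub> ?p h" by (rule p_mult[OF g h])
    fix x y assume x: "x \<in> acomp A (?p g)" and y: "y \<in> acomp A (?p h)"
    have Ach: "acomp A (?p h) = acomp B (r h)" unfolding Ac r_def ..
    let ?h = "t g" and ?k = "t h" and ?s = "r g" and ?s' = "r h"
    have T: "?h \<in> H" "?k \<in> H" using t(1) g h by auto
    note c = Hc[OF T(1)] Hc[OF T(2)] rc[OF g] rc[OF h]
    have x': "x \<in> acomp B (r ?s)" and y': "y \<in> acomp B (r ?s')" using x y rr g h unfolding Acg Ach by auto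
    define z where "z = amul A x y"
    have zm: "z = m (?p g) (?p h) x y" unfolding z_def using fam pc[OF g] pc[OF h] x y by blast
    have zM: "amul B (\<theta> ?s x) (\<theta> ?s' y) = ascal B (\<tau> ?s ?s') (\<theta> (?s \<otimes>\<^bsub>G\<^esub> ?s') z)"
      using m(2)[OF pc[OF g] pc[OF h], of x y] x y unfolding zm Ac r_def .
    have z1: "z \<in> acomp B (r (g \<otimes>\<^bsub>G\<^esub> h))"
      using m(1)[OF pc[OF g] pc[OF h], of x y] x y unfolding zm Ac r_def[of "g \<otimes>\<^bsub>G\<^esub> h"] p_mult[OF g h] .
    have z2: "z \<in> acomp B (r (?s \<otimes>\<^bsub>G\<^esub> ?s'))" using z1 unfolding r_mult[OF g h] .
    have ss: "?s \<otimes>\<^bsub>G\<^esub> ?s' \<in> carrier G" using c by simp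
    have z3: "z \<in> acomp B (r (?k \<otimes>\<^bsub>G\<^esub> (?s \<otimes>\<^bsub>G\<^esub> ?s')))" using z2 unfolding r_H[OF T(2) ss] .
    have kss: "?k \<otimes>\<^bsub>G\<^esub> (?s \<otimes>\<^bsub>G\<^esub> ?s') \<in> carrier G" using c ss by simp
    have gh: "?h \<otimes>\<^bsub>G\<^esub> (?k \<otimes>\<^bsub>G\<^esub> (?s \<otimes>\<^bsub>G\<^esub> ?s')) = g \<otimes>\<^bsub>G\<^esub> h"
    proof -
      have "?h \<otimes>\<^bsub>G\<^esub> (?k \<otimes>\<^bsub>G\<^esub> (?s \<otimes>\<^bsub>G\<^esub> ?s')) = (?h \<otimes>\<^bsub>G\<^esub> ?s) \<otimes>\<^bsub>G\<^esub> (?k \<otimes>\<^bsub>G\<^esub> ?s')"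
        using c by (simp add: B.m_ac)
      then show ?thesis using t(2) g h by simp
    qed
    have m1: "\<theta> ?s x \<in> asp B" "\<theta> ?s' y \<in> asp B" using \<theta>ms[OF rc[OF g] x'] \<theta>ms[OF rc[OF h] y'] .
    have m2: "\<theta> (?s \<otimes>\<^bsub>G\<^esub> ?s') z \<in> asp B" "\<theta> (?k \<otimes>\<^bsub>G\<^esub> (?s \<otimes>\<^bsub>G\<^esub> ?s')) z \<in> asp B" "\<theta> (g \<otimes>\<^bsub>G\<^esub> h) z \<in> asp B"
      using \<theta>ms[OF ss z2] \<theta>ms[OF kss z3] \<theta>ms[OF _ z1] g h by auto
    have e1: "u ?h (\<theta> ?s x) = ascal B (\<tau> ?h ?s) (\<theta> g x)" using u\<theta>[OF T(1) rc[OF g] x'] t(2)[OF g] by simp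
    have e2: "u ?k (\<theta> ?s' y) = ascal B (\<tau> ?k ?s') (\<theta> h y)" using u\<theta>[OF T(2) rc[OF h] y'] t(2)[OF h] by simp
    have m3: "\<theta> g x \<in> asp B" "\<theta> h y \<in> asp B" using \<theta>ms[OF g] \<theta>ms[OF h] x y unfolding Acg Ach by auto
    have um: "u ?k (\<theta> ?s' y) \<in> asp B" using centroidD(1)[OF uc[OF T(2)] m1(2)] .
    have l: "amul B (u ?h (\<theta> ?s x)) (u ?k (\<theta> ?s' y)) = ascal B (\<tau> ?h ?s * \<tau> ?k ?s') (amul B (\<theta> g x) (\<theta> h y))"
      unfolding e1 e2 using m3 by (simp add: B.mul_scal_left B.mul_scal_right B.scal_mem B.scal_scal B.mul_mem mult.commute)
    have "amul B (u ?h (\<theta> ?s x)) (u ?k (\<theta> ?s' y)) = u ?h (u ?k (amul B (\<theta> ?s x) (\<theta> ?s' y)))"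
      using centroidD(5)[OF uc[OF T(1)] m1(1) um] centroidD(6)[OF uc[OF T(2)] m1] by simp
    also have "\<dots> = ascal B (\<tau> ?s ?s' * \<tau> ?k (?s \<otimes>\<^bsub>G\<^esub> ?s') * \<tau> ?h (?k \<otimes>\<^bsub>G\<^esub> (?s \<otimes>\<^bsub>G\<^esub> ?s'))) (\<theta> (g \<otimes>\<^bsub>G\<^esub> h) z)"
      unfolding zM using centroidD(4)[OF uc[OF T(2)] m2(1)] centroidD(4)[OF uc[OF T(1)] m2(2)]
        u\<theta>[OF T(2) ss z2] u\<theta>[OF T(1) kss z3] m2 centroidD(4)[OF uc[OF T(1)] centroidD(1)[OF uc[OF T(2)] m2(1)]]
      by (simp add: gh B.scal_scal B.scal_mem centroidD(4)[OF uc[OF T(1)]] mult.assoc)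
    finally have f: "ascal B (\<tau> ?h ?s * \<tau> ?k ?s') (amul B (\<theta> g x) (\<theta> h y)) =
        ascal B (\<tau> ?s ?s' * \<tau> ?k (?s \<otimes>\<^bsub>G\<^esub> ?s') * \<tau> ?h (?k \<otimes>\<^bsub>G\<^esub> (?s \<otimes>\<^bsub>G\<^esub> ?s'))) (\<theta> (g \<otimes>\<^bsub>G\<^esub> h) z)" unfolding l .
    \<comment> \<open>Together with \<open>i2\<close> this rewrites the scalars collected in
      \<open>f\<close> until the factor called N below appears on both sides and can be
      cancelled.\<close>
    have i1: "\<tau> ?h ?s * \<tau> g h = \<tau> ?h (?k \<otimes>\<^bsub>G\<^esub> (?s \<otimes>\<^bsub>G\<^esub> ?s')) * \<tau> ?s h"
    proof -
      have "?s \<otimes>\<^bsub>G\<^esub> h = ?k \<otimes>\<^bsub>G\<^esub> (?s \<otimes>\<^bsub>G\<^esub> ?s')"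
        using t(2)[OF h] B.m_lcomm[OF c(3,2,4)] by simp
      then show ?thesis using Z2symD(3)[OF \<tau> c(1,3) h] t(2)[OF g] by simp
    qed
    have i2: "\<tau> ?s h * \<tau> ?k ?s' = \<tau> ?k (?s \<otimes>\<^bsub>G\<^esub> ?s') * \<tau> ?s ?s'"
      using Z2sym_swap[OF G \<tau> c(3,2,4)] t(2)[OF h] by simp
    have i: "\<tau> ?s ?s' * \<tau> ?k (?s \<otimes>\<^bsub>G\<^esub> ?s') * \<tau> ?h (?k \<otimes>\<^bsub>G\<^esub> (?s \<otimes>\<^bsub>G\<^esub> ?s')) = (\<tau> ?h ?s * \<tau> ?k ?s') * \<tau> g h"
    proof -
      have "(\<tau> ?h ?s * \<tau> ?k ?s') * \<tau> g h = (\<tau> ?h ?s * \<tau> g h) * \<tau> ?k ?s'" by (simp only: mult_ac)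
      also have "\<dots> = \<tau> ?h (?k \<otimes>\<^bsub>G\<^esub> (?s \<otimes>\<^bsub>G\<^esub> ?s')) * (\<tau> ?s h * \<tau> ?k ?s')" unfolding i1 by (simp only: mult_ac)
      finally show ?thesis unfolding i2 by (simp only: mult_ac)
    qed
    define N where "N = \<tau> ?h ?s * \<tau> ?k ?s'"
    have n0: "N \<noteq> 0" unfolding N_def using \<tau>0[OF c(1,3)] \<tau>0[OF c(2,4)] by simp
    have "ascal B N (amul B (\<theta> g x) (\<theta> h y)) = ascal B (N * \<tau> g h) (\<theta> (g \<otimes>\<^bsub>G\<^esub> h) z)"
      using f unfolding i N_def[symmetric] .
    then have "ascal B (inverse N) (ascal B N (amul B (\<theta> g x) (\<theta> h y))) = ascal B (inverse N) (ascal B (N * \<tau> g h) (\<theta> (g \<otimes>\<^bsub>G\<^esub> h) z))"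
      by simp
    then show "amul B (\<theta> g x) (\<theta> h y) = ascal B (\<tau> g h) (\<theta> (g \<otimes>\<^bsub>G\<^esub> h) (amul A x y))"
      using n0 B.mul_mem[OF m3] m2(3) unfolding z_def by (simp add: B.scal_scal B.scal_one mult.assoc[symmetric])
  qed (fact can_proj_surj \<tau>)+
  have "centroid_comp G B k \<subseteq> {0}" if "k \<in> carrier G" "k \<notin> H" for k
    using that unfolding H_def B.centroid_supp_def by blast
  then show thesis using that[OF H loop] by blast
qed

text \<open>Homogeneous centroid elements of A are tested by lifting them to B. Over a nontrivial
  coset the lift vanishes, as its degree lies outside H; over the trivial coset the lift is taken in
  the identity degree, where B has only scalars.\<close>

lemma graded_central_simple_is_twisted_loop:
  fixes B :: "('b::ab_group_add, 'f::field, 'g) galg"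
  assumes G: "comm_group G" and B: "graded_central_simple G B"
  shows "\<exists>H (A :: ('b, 'f, 'g set) galg) \<tau>.
         subgroup H G \<and> graded (G Mod H) A \<and> simple_alg A \<and> central_alg A \<and>
         Z2sym G \<tau> \<and> graded_iso G B (twisted_loop_alg G H A \<tau>)"
proof -
  obtain H and A :: "('b, 'f, 'g set) galg" and \<tau> \<theta> where H: "subgroup H G"
    and loop: "loop_like G (G Mod H) A B (can_proj G H) \<tau> \<theta>"
    and supp: "\<And>k. \<lbrakk>k \<in> carrier G; k \<notin> H\<rbrakk> \<Longrightarrow> centroid_comp G B k \<subseteq> {0}"
    by (rule graded_central_simple_loop_like[OF G B]) (rule that; assumption)
  let ?Q = "G Mod H" and ?p = "can_proj G H"
  interpret L: loop_like G ?Q A B ?p \<tau> \<theta> by (fact loop)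
  have Bs: "graded_simple G B" and Bc: "graded_central G B" using B unfolding graded_central_simple_def by auto
  interpret A: graded_simple_algebra ?Q A
    by (intro graded_simple_algebra.intro graded_simple_algebra_axioms.intro L.A.graded_algebra_axioms
        L.\<Gamma>.comm_group_axioms L.graded_simple_loop_imp_base[OF Bs])
  have triv: "centroid_comp ?Q A a \<subseteq> {0}" if a: "a \<in> carrier ?Q" "a \<noteq> \<one>\<^bsub>?Q\<^esub>" for a
  proof
    fix D assume D: "D \<in> centroid_comp ?Q A a"
    obtain k where k: "k \<in> carrier G" "?p k = a" using L.\<pi>_lift[OF a(1)] by blast
    have "k \<notin> H" using can_proj_eq_subgroup_iff[OF G H k(1)] a(2) k(2) unfolding one_Mod by blast
    obtain c where c: "c \<in> centroid_comp G B k"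
      "\<And>g u. \<lbrakk>g \<in> carrier G; u \<in> acomp A (?p g)\<rbrakk> \<Longrightarrow> c (\<theta> g u) = ascal B (\<tau> k g) (\<theta> (k \<otimes>\<^bsub>G\<^esub> g) (D u))"
      by (rule L.centroid_lift[OF k(1) D[folded k(2)]]) (rule that; assumption)
    have c0: "c = 0" using supp[OF k(1) \<open>k \<notin> H\<close>] c(1) by blast
    have "D = 0"
    proof (rule L.A.centroid_ext[OF centroid_compD(1)[OF D] L.A.zero_centroid])
      fix b u assume b: "b \<in> carrier ?Q" and u: "u \<in> acomp A b"
      obtain g where g: "g \<in> carrier G" "?p g = b" using L.\<pi>_lift[OF b] by blast
      have kg: "k \<otimes>\<^bsub>G\<^esub> g \<in> carrier G" using k g by simp
      have Du: "D u \<in> acomp A (?p (k \<otimes>\<^bsub>G\<^esub> g))" using centroid_compD(2)[OF D b u] L.\<pi>_mult[OF k(1) g(1)] k(2) g(2) by simp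
      have "ascal B (\<tau> k g) (\<theta> (k \<otimes>\<^bsub>G\<^esub> g) (D u)) = 0" using c(2)[OF g(1), of u] u g(2) c0 by simp
      then have "\<theta> (k \<otimes>\<^bsub>G\<^esub> g) (D u) = 0" by (rule L.L.scal_cancel[OF L.\<iota>_mem_asp[OF kg Du] L.\<tau>_nz[OF k(1) g(1)]])
      then show "D u = 0 u" using L.\<iota>_eq_zero[OF kg Du] by simp
    qed
    then show "D \<in> {0}" by simp
  qed
  have scalar: "centroid_comp ?Q A \<one>\<^bsub>?Q\<^esub> \<subseteq> scalar_maps A"
  proof
    fix D assume D: "D \<in> centroid_comp ?Q A \<one>\<^bsub>?Q\<^esub>"
    have D': "D \<in> centroid_comp ?Q A (?p \<one>\<^bsub>G\<^esub>)" using D L.\<pi>_one by simp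
    obtain c where c: "c \<in> centroid_comp G B \<one>\<^bsub>G\<^esub>"
      "\<And>g u. \<lbrakk>g \<in> carrier G; u \<in> acomp A (?p g)\<rbrakk> \<Longrightarrow> c (\<theta> g u) = ascal B (\<tau> \<one>\<^bsub>G\<^esub> g) (\<theta> (\<one>\<^bsub>G\<^esub> \<otimes>\<^bsub>G\<^esub> g) (D u))"
      by (rule L.centroid_lift[OF L.G.one_closed D']) (rule that; assumption)
    have "c \<in> scalar_maps B" using c(1) Bc unfolding graded_central_def by simp
    then obtain q where q: "c = (\<lambda>x. if x \<in> asp B then ascal B q x else 0)" unfolding scalar_maps_def by blast
    let ?t = "\<tau> \<one>\<^bsub>G\<^esub> \<one>\<^bsub>G\<^esub>"
    \<comment> \<open>The lift of D in the identity degree carries the factor \<tau>(1,1), which has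
      to be divided out of the scalar q.\<close>
    let ?d = "\<lambda>x. if x \<in> asp A then ascal A (inverse ?t * q) x else 0"
    have "D = ?d"
    proof (rule L.A.centroid_ext[OF centroid_compD(1)[OF D] centroid_compD(1)[OF L.A.scalar_map_centroid_comp]])
      fix b u assume b: "b \<in> carrier ?Q" and u: "u \<in> acomp A b"
      obtain g where g: "g \<in> carrier G" "?p g = b" using L.\<pi>_lift[OF b] by blast
      have ug: "u \<in> acomp A (?p g)" using u g(2) by simp
      have Du: "D u \<in> acomp A (?p g)" using centroid_compD(2)[OF D b u] unfolding L.\<Gamma>.l_one[OF b] g(2) .
      have Dm: "D u \<in> asp A" and um: "u \<in> asp A" using L.A.comp_mem[OF b] Du u g(2) by auto
      have t0: "?t \<noteq> 0" using L.\<tau>_nz[OF L.G.one_closed L.G.one_closed] .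
      have "ascal B q (\<theta> g u) = ascal B ?t (\<theta> g (D u))"
        using c(2)[OF g(1) ug] L.\<iota>_mem_asp[OF g(1) ug] L.\<tau>_one[OF g(1)] g(1) unfolding q by simp
      then have "\<theta> g (ascal A q u) = \<theta> g (ascal A ?t (D u))" using L.\<iota>_scal[OF g(1) ug] L.\<iota>_scal[OF g(1) Du] by simp
      then have "ascal A q u = ascal A ?t (D u)"
        using L.\<iota>_inj[OF g(1) L.A.comp_scal[OF L.\<pi>_closed[OF g(1)] ug] L.A.comp_scal[OF L.\<pi>_closed[OF g(1)] Du]] by simp
      then have "ascal A (inverse ?t) (ascal A q u) = ascal A (inverse ?t) (ascal A ?t (D u))" by simp
      then show "D u = ?d u" using t0 Dm um by (simp add: L.A.scal_scal L.A.scal_one)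
    qed
    then show "D \<in> scalar_maps A" unfolding scalar_maps_def by blast
  qed
  have "central_alg A" by (rule A.central_alg_if_centroid_trivial[OF triv scalar])
  moreover have "simple_alg A" by (rule A.simple_alg_if_centroid_trivial[OF triv])
  moreover have gA: "graded ?Q A" unfolding graded_iff_graded_algebra by (rule L.A.graded_algebra_axioms)
  \<comment> \<open>B and the twisted loop algebra are loops over the same A with the same \<tau>,
    so the identity of A with factor 1 in every degree does it.\<close>
  moreover have "graded_iso G B (twisted_loop_alg G H A \<tau>)"
    by (rule loop_iso_from_base[OF loop quotient_graded.loop_like_twisted_loop[OF quotient_graded_intro[OF G H gA] L.\<tau>],
          where \<psi> = "\<lambda>a u. u" and \<gamma> = "\<lambda>g. 1"]) (auto simp: bij_betw_def)
  ultimately show ?thesis using H L.\<tau> by blast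
qed

theorem theorem5p2:
  fixes G :: "'g monoid"
  assumes "comm_group G"
  shows
  "(\<forall>B :: ('b::ab_group_add, 'f::field, 'g) galg.
      graded_central_simple G B \<longrightarrow>
      (\<exists>H (A :: ('b, 'f, 'g set) galg) \<tau>.
         subgroup H G \<and> graded (G Mod H) A \<and> simple_alg A \<and> central_alg A \<and>
         Z2sym G \<tau> \<and> graded_iso G B (twisted_loop_alg G H A \<tau>)))
   \<and>
   (\<forall>H (A :: ('a::ab_group_add, 'f, 'g set) galg) \<tau>.
      subgroup H G \<and> graded (G Mod H) A \<and> simple_alg A \<and> central_alg A \<and> Z2sym G \<tau> \<longrightarrow>
      graded_central_simple G (twisted_loop_alg G H A \<tau>) \<and>
      graded_iso G (centroid_alg G (twisted_loop_alg G H A \<tau>))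
        (twist G (group_alg G H :: ('g \<Rightarrow> 'f, 'f, 'g) galg)
           (\<lambda>a b. if a \<in> H \<and> b \<in> H then \<tau> a b else 1)))
   \<and>
   (\<forall>H1 H2 (A1 :: ('a1::ab_group_add, 'f, 'g set) galg) (A2 :: ('a2::ab_group_add, 'f, 'g set) galg)
       \<tau>1 \<tau>2.
      subgroup H1 G \<and> graded (G Mod H1) A1 \<and> simple_alg A1 \<and> central_alg A1 \<and> Z2sym G \<tau>1 \<and>
      subgroup H2 G \<and> graded (G Mod H2) A2 \<and> simple_alg A2 \<and> central_alg A2 \<and> Z2sym G \<tau>2 \<longrightarrow>
      (graded_iso G (twisted_loop_alg G H1 A1 \<tau>1) (twisted_loop_alg G H2 A2 \<tau>2) \<longleftrightarrow>
       H1 = H2 \<and>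
       (\<exists>\<mu>. Z2sym (G Mod H1) \<mu> \<and>
          cohom_eq_prod G \<tau>1 (\<lambda>a b. \<mu> (can_proj G H1 a) (can_proj G H1 b)) \<tau>2 \<and>
          graded_iso (G Mod H1) (twist (G Mod H1) A1 \<mu>) A2)))"
proof (intro conjI allI impI; (elim conjE)?)
  fix B :: "('b, 'f, 'g) galg" assume "graded_central_simple G B"
  then show "\<exists>H (A :: ('b, 'f, 'g set) galg) \<tau>.
         subgroup H G \<and> graded (G Mod H) A \<and> simple_alg A \<and> central_alg A \<and>
         Z2sym G \<tau> \<and> graded_iso G B (twisted_loop_alg G H A \<tau>)"
    by (rule graded_central_simple_is_twisted_loop[OF assms])
next
  fix H and A :: "('a, 'f, 'g set) galg" and \<tau> :: "'g \<Rightarrow> 'g \<Rightarrow> 'f"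
  assume A: "subgroup H G" "graded (G Mod H) A" "simple_alg A" "central_alg A" "Z2sym G \<tau>"
  show "graded_central_simple G (twisted_loop_alg G H A \<tau>)"
    by (rule twisted_loop_central_simple(1)[OF assms A])
  show "graded_iso G (centroid_alg G (twisted_loop_alg G H A \<tau>))
        (twist G (group_alg G H :: ('g \<Rightarrow> 'f, 'f, 'g) galg)
           (\<lambda>a b. if a \<in> H \<and> b \<in> H then \<tau> a b else 1))"
    by (rule twisted_loop_central_simple(2)[OF assms A])
next
  fix H1 H2 and \<tau>1 \<tau>2 :: "'g \<Rightarrow> 'g \<Rightarrow> 'f" and A1 :: "('a1, 'f, 'g set) galg" and A2 :: "('a2, 'f, 'g set) galg"
  assume A1: "subgroup H1 G" "graded (G Mod H1) A1" "simple_alg A1" "central_alg A1" "Z2sym G \<tau>1"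
    and A2: "subgroup H2 G" "graded (G Mod H2) A2" "simple_alg A2" "central_alg A2" "Z2sym G \<tau>2"
  let ?L1 = "twisted_loop_alg G H1 A1 \<tau>1" and ?L2 = "twisted_loop_alg G H2 A2 \<tau>2"
  let ?R = "\<exists>\<mu>. Z2sym (G Mod H1) \<mu> \<and>
          cohom_eq_prod G \<tau>1 (\<lambda>a b. \<mu> (can_proj G H1 a) (can_proj G H1 b)) \<tau>2 \<and>
          graded_iso (G Mod H1) (twist (G Mod H1) A1 \<mu>) A2"
  note L1 = central_loop_like_twisted_loop[OF assms A1] and L2 = central_loop_like_twisted_loop[OF assms A2]
  note l1 = central_loop_like.axioms(1)[OF L1] and l2 = central_loop_like.axioms(1)[OF L2]
  have g1: "graded_algebra G ?L1" using l1 unfolding loop_like_def by blast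
  show "graded_iso G ?L1 ?L2 \<longleftrightarrow> H1 = H2 \<and> ?R"
  proof
    assume iso: "graded_iso G ?L1 ?L2"
    have "H1 \<subseteq> H2" using loop_iso_ker_subset[OF L1 L2 iso]
      unfolding ker_can_proj[OF assms A1(1)] ker_can_proj[OF assms A2(1)] .
    moreover have "H2 \<subseteq> H1" using loop_iso_ker_subset[OF L2 L1 graded_iso_sym[OF g1 iso]]
      unfolding ker_can_proj[OF assms A1(1)] ker_can_proj[OF assms A2(1)] .
    \<comment> \<open>From here on both base algebras are graded by the same quotient, which the
      comparison of their components presupposes.\<close>
    ultimately have e: "H1 = H2" by blast
    show "H1 = H2 \<and> ?R"
      using loop_iso_imp_base_iso[OF assms A1(1) L1 L2[folded e]] iso e by blast
  next
    assume r: "H1 = H2 \<and> ?R"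
    then obtain \<mu> where \<mu>: "cohom_eq_prod G \<tau>1 (\<lambda>a b. \<mu> (can_proj G H1 a) (can_proj G H1 b)) \<tau>2"
      "graded_iso (G Mod H1) (twist (G Mod H1) A1 \<mu>) A2" by blast
    have e: "H1 = H2" using r ..
    show "graded_iso G ?L1 ?L2" using base_iso_imp_loop_iso[OF l1 l2[folded e] \<mu>] unfolding e .
  qed
qed

end
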